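(* Let $E$ be a Banach space, $s\in\mathbb{R}$, $1<p<\infty$ and $1\leq q\leq\infty$. Then the following are equivalent: (i) each function $M:\mathbb{Z}^{n}\to\mathcal{L}(E)$ of bounded variation with respect to the coarse decomposition of $\mathbb{Z}^{n}$ is a Fourier multiplier on $B_{p,q}^{s}(\mathbb{T}^{n},E)$; (ii) $E$ is a UMD-space.
   Context: Throughout $n\in\mathbb{N}$ is fixed, Banach spaces have complex scalars, $\mathbb{N}_0=\mathbb{N}\cup\{0\}$, and $\delta_1,\dots,\delta_n$ is the standard basis of $\mathbb{R}^n$. **Periodic distributions.** $C^\infty(\mathbb{T}^n,E)$ is the Fréchet space of smooth $E$-valued functions on $\mathbb{R}^n$ that are $2\pi$-periodic in each component, with seminorms $q_k(\varphi)=\max_{|\alpha|\le k}\sup_{x\in[0,2\pi]^n}\|\partial^\alpha\varphi(x)\|$; $C^\infty(\mathbb{T}^n):=C^\infty(\mathbb{T}^n,\mathbb{C})$. $\mathcal{D}'(\mathbb{T}^n,E)$ is the space of continuous linear maps $C^\infty(\mathbb{T}^n)\to E$. Put $e_k(x):=e^{ik\cdot x}$ and, for $f\in\mathcal{D}'(\mathbb{T}^n,E)$, $\hat f(k):=f(e_{-k})$, $k\in\mathbb{Z}^n$. A function $g$ is identified with the distribution $\varphi\mapsto(2\pi)^{-n}\int_{[0,2\pi]^n}\varphi g\,dx$. $(e_k\otimes a)(x):=e_k(x)a$ for $a\in E$. $L^p(\mathbb{T}^n,E)$ is the Bochner space of periodic functions with $\|f\|_{L^p}=\big((2\pi)^{-n}\int_{[0,2\pi]^n}\|f(x)\|_E^p\,dx\big)^{1/p}$.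 **Besov spaces.** A resolution of unity is a sequence $(\phi_j)_{j\ge0}$ of Schwartz functions on $\mathbb{R}^n$ with: $\operatorname{supp}\phi_0\subset\Omega_0:=\{|x|\le2\}$, $\operatorname{supp}\phi_j\subset\Omega_j:=\{2^{j-1}\le|x|\le2^{j+1}\}$ for $j\ge1$; $\sum_{j\ge0}\phi_j=1$ on $\mathbb{R}^n$; and for each $\alpha\in\mathbb{N}_0^n$ there is $C_\alpha>0$ with $|\partial^\alpha\phi_j(\xi)|\le C_\alpha2^{-j|\alpha|}\chi_{\Omega_j}(\xi)$ for all $\xi,j$. Fix one. For $1\le p,q\le\infty$, $s\in\mathbb{R}$, $B^s_{p,q}(\mathbb{T}^n,E)$ is the Banach space of all $f\in\mathcal{D}'(\mathbb{T}^n,E)$ with $\|f\|_{B^s_{p,q}}:=\big(\sum_{j\ge0}2^{sjq}\|\sum_{k\in\mathbb{Z}^n}e_k\otimes\phi_j(k)\hat f(k)\|_{L^p(\mathbb{T}^n,E)}^q\big)^{1/q}<\infty$ (supremum over $j$ of $2^{sj}\|\cdot\|_{L^p}$ if $q=\infty$). Different choices of $(\phi_j)$ give equivalent norms. **Multipliers.** $M:\mathbb{Z}^n\to\mathcal{L}(E)$ is a Fourier multiplier on $B^s_{p,q}(\mathbb{T}^n,E)$ if for each $f\in B^s_{p,q}(\mathbb{T}^n,E)$ there is $g\in B^s_{p,q}(\mathbb{T}^n,E)$ with $\hat g(k)=M(k)\hat f(k)$ for all $k\in\mathbb{Z}^n$. A uniformly bounded $M:\mathbb{Z}^n\to\mathcal{L}(E)$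 is a discrete $L^p$-Fourier multiplier ($1\le p<\infty$) if there is $C>0$ with $\|\sum_ke_k\otimes M(k)\hat f(k)\|_{L^p(\mathbb{T}^n,E)}\le C\|f\|_{L^p(\mathbb{T}^n,E)}$ for all $E$-valued trigonometric polynomials $f$ (finite sums $\sum_ke_k\otimes x_k$, $x_k\in E$). **UMD.** $E$ is a UMD-space if $R:\mathbb{Z}^n\to\mathcal{L}(E)$, $R(k)=I_E$ if $k\ge0$ (i.e. $k_j\ge0$ for all $j$) and $R(k)=0$ otherwise, is a discrete $L^p$-Fourier multiplier for some (equivalently, for all) $p\in(1,\infty)$. **Bounded variation.** For $\alpha\le\beta$ in $\mathbb{Z}^n$ (componentwise) let $[\alpha,\beta]:=\{k\in\mathbb{Z}^n:\alpha\le k\le\beta\}$. For $G\subset\mathbb{Z}^n$ let $M_G(k):=M(k)$ if $k\in G$, $M_G(k):=0$ otherwise. Relative to $[\alpha,\beta]$ define the difference operators by $\Delta^{\delta_j}M_{[\alpha,\beta]}(x):=M_{[\alpha,\beta]}(x)-M_{[\alpha,\beta]}(x-\delta_j)$ if $x_j\ne\alpha_j$ and $:=0$ if $x_j=\alpha_j$ (the same formula is used when iterating), $\Delta^0$ the identity, and $\Delta^\gamma:=\Delta^{\gamma_1\delta_1}\cdots\Delta^{\gamma_n\delta_n}$ for $\gamma\in\{0,1\}^n$. For $\xi\in[\alpha,\beta]$ let $\gamma_\xi\in\{0,1\}^n$ have $j$-th entry $1$ if $\xi_j\ne\alpha_j$ and $0$ if $\xi_j=\alpha_j$. The variation is $\operatorname{Var}_{[\alpha,\beta]}M_{[\alpha,\beta]}:=\sum_{\xi\in[\alpha,\beta]}\|\Delta^{\gamma_\xi}M_{[\alpha,\beta]}(\xi)\|$.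 The coarse decomposition of $\mathbb{Z}^n$: $D_0:=\{0\}$ and, for $d=nr+l\in\mathbb{N}$ with $r\in\mathbb{N}_0$, $l\in\{1,\dots,n\}$, $D_d:=\{k\in\mathbb{Z}^n:|k_1|,\dots,|k_{l-1}|<2^{r+1},\ 2^r\le|k_l|<2^{r+1},\ |k_{l+1}|,\dots,|k_n|<2^r\}$, $D_{d^\pm}:=\{k\in D_d:\pm k_l>0\}$; each $D_{d^\pm}$ is of the form $[\alpha,\beta]$. Put $\operatorname{Var}_{D_d}M:=\operatorname{Var}_{D_{d^+}}M_{D_{d^+}}+\operatorname{Var}_{D_{d^-}}M_{D_{d^-}}$ for $d\in\mathbb{N}$, and $\operatorname{Var}_{D_0}M:=\operatorname{Var}_{D_0}M_{D_0}$. A uniformly bounded $M$ is of bounded variation with respect to the coarse decomposition if $\sup_{d\in\mathbb{N}_0}\operatorname{Var}_{D_d}M<\infty$. *)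

theory Defs
  imports "HOL-Analysis.Analysis"
begin

section \<open>Complex Banach spaces\<close>

class complex_banach = banach +
  fixes scaleC :: "complex \<Rightarrow> 'a \<Rightarrow> 'a"  (infixr \<open>*\<^sub>C\<close> 75)
  assumes scaleC_add_right: "c *\<^sub>C (x + y) = c *\<^sub>C x + c *\<^sub>C y"
    and scaleC_add_left: "(c + d) *\<^sub>C x = c *\<^sub>C x + d *\<^sub>C x"
    and scaleC_scaleC: "c *\<^sub>C (d *\<^sub>C x) = (c * d) *\<^sub>C x"
    and scaleC_of_real: "complex_of_real r *\<^sub>C x = r *\<^sub>R x"
    and norm_scaleC: "norm (c *\<^sub>C x) = cmod c * norm x"

instantiation complex :: complex_banach
begin
definition scaleC_complex :: "complex \<Rightarrow> complex \<Rightarrow> complex"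
  where "scaleC_complex c x = c * x"
instance
  by standard (simp_all add: scaleC_complex_def algebra_simps norm_mult scaleR_conv_of_real)
end

text \<open>The library type \<^typ>\<open>'e \<Rightarrow>\<^sub>L 'e\<close> consists of the bounded \<^emph>\<open>real\<close>-linear maps with the operator
  norm; \<open>L(E)\<close> is its closed subspace of complex-linear maps.\<close>

definition L_ops :: "('e::complex_banach \<Rightarrow>\<^sub>L 'e) set"
  where "L_ops = {A. \<forall>c x. blinfun_apply A (c *\<^sub>C x) = c *\<^sub>C blinfun_apply A x}"


section \<open>Coordinates and partial derivatives\<close>

text \<open>The index type \<open>'n\<close> has \<open>n\<close> elements, and its linear order is the order \<open>1 < \<dots> < n\<close> of the
  coordinates.\<close>

type_synonym 'n rvec = "(real, 'n) vec"
type_synonym 'n zvec = "(int, 'n) vec"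
type_synonym 'n mindex = "(nat, 'n) vec"

definition coords :: "'n::{finite,linorder} list"
  where "coords = sorted_list_of_set UNIV"

definition multi_compose ::
    "('n \<Rightarrow> 'f \<Rightarrow> 'f) \<Rightarrow> 'n::{finite,linorder} mindex \<Rightarrow> 'f \<Rightarrow> 'f"
  \<comment> \<open>\<open>T\<^sub>1\<^bsup>\<gamma>\<^sub>1\<^esup> \<dots> T\<^sub>n\<^bsup>\<gamma>\<^sub>n\<^esup> f\<close>\<close>
  where "multi_compose T \<gamma> f = foldr (\<lambda>j. T j ^^ (\<gamma> $ j)) coords f"

definition multi_abs :: "'n::finite mindex \<Rightarrow> nat"
  where "multi_abs \<alpha> = (\<Sum>i\<in>UNIV. \<alpha> $ i)"

definition partial :: "'n::finite \<Rightarrow> ('n rvec \<Rightarrow> 'a::real_normed_vector) \<Rightarrow> 'n rvec \<Rightarrow> 'a"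
  where "partial i f x = vector_derivative (\<lambda>t. f (x + t *\<^sub>R axis i 1)) (at 0)"

abbreviation mpartial ::
    "'n::{finite,linorder} mindex \<Rightarrow> ('n rvec \<Rightarrow> 'a::real_normed_vector) \<Rightarrow> 'n rvec \<Rightarrow> 'a"
  where "mpartial \<equiv> multi_compose partial"

text \<open>\<open>C\<^sup>\<infinity>\<close>: all iterated partial derivatives, in any order, exist and are continuous.\<close>

definition smooth :: "('n::finite rvec \<Rightarrow> 'a::real_normed_vector) \<Rightarrow> bool"
  where "smooth f \<longleftrightarrow> (\<forall>is. continuous_on UNIV (foldr partial is f) \<and>
    (\<forall>i x. (\<lambda>t. foldr partial is f (x + t *\<^sub>R axis i 1)) differentiable (at 0)))"


section \<open>Periodic distributions\<close>

abbreviation period_cube :: "('n::finite rvec) set"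
  where "period_cube \<equiv> cbox 0 (\<chi> i. 2 * pi)"

definition test_functions :: "('n::finite rvec \<Rightarrow> complex) set"
  where "test_functions = {\<phi>. smooth \<phi> \<and> (\<forall>i x. \<phi> (x + (2 * pi) *\<^sub>R axis i 1) = \<phi> x)}"

definition test_seminorm :: "nat \<Rightarrow> ('n::{finite,linorder} rvec \<Rightarrow> complex) \<Rightarrow> real"
  where "test_seminorm k \<phi> =
    Max ((\<lambda>\<alpha>. SUP x\<in>period_cube. norm (mpartial \<alpha> \<phi> x)) ` {\<alpha>. multi_abs \<alpha> \<le> k})"

text \<open>A distribution is a function on the set of test functions, hence extensional (equal to
  \<^term>\<open>undefined\<close>) outside that set. The seminorms increase with \<open>k\<close>, so their balls form
  neighbourhood bases.\<close>

definition distributions :: "(('n::{finite,linorder} rvec \<Rightarrow> complex) \<Rightarrow> 'e::complex_banach) set"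
  where "distributions = {f \<in> extensional test_functions.
    (\<forall>\<phi>\<in>test_functions. \<forall>\<psi>\<in>test_functions. f (\<lambda>x. \<phi> x + \<psi> x) = f \<phi> + f \<psi>) \<and>
    (\<forall>c. \<forall>\<phi>\<in>test_functions. f (\<lambda>x. c * \<phi> x) = c *\<^sub>C f \<phi>) \<and>
    (\<forall>\<phi>\<in>test_functions. \<forall>\<epsilon>>0. \<exists>k. \<exists>\<delta>>0. \<forall>\<psi>\<in>test_functions.
       test_seminorm k (\<lambda>x. \<psi> x - \<phi> x) < \<delta> \<longrightarrow> norm (f \<psi> - f \<phi>) < \<epsilon>)}"

definition real_vec :: "'n::finite zvec \<Rightarrow> 'n rvec"
  where "real_vec k = (\<chi> i. of_int (k $ i))"

definition char_fun :: "'n::finite zvec \<Rightarrow> 'n rvec \<Rightarrow> complex"  (\<open>\<e>\<close>)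
  where "\<e> k x = exp (\<i> * of_real (real_vec k \<bullet> x))"

definition fourier_coeff ::
    "(('n::finite rvec \<Rightarrow> complex) \<Rightarrow> 'e) \<Rightarrow> 'n zvec \<Rightarrow> 'e"
  where "fourier_coeff f k = f (\<e> (- k))"

text \<open>The distribution \<open>\<phi> \<mapsto> (2\<pi>)\<^sup>-\<^sup>n \<integral> \<phi> g\<close>. It is only used for continuous \<open>g\<close>, where the
  Henstock-Kurzweil integral agrees with the Bochner integral; the library's Bochner integral is
  restricted to second-countable spaces.\<close>

definition distribution_of ::
    "('n::{finite,linorder} rvec \<Rightarrow> 'e::complex_banach) \<Rightarrow> ('n rvec \<Rightarrow> complex) \<Rightarrow> 'e"
  where "distribution_of g =
    (\<lambda>\<phi>\<in>test_functions. (1 / (2 * pi) ^ CARD('n)) *\<^sub>R integral period_cube (\<lambda>x. \<phi> x *\<^sub>C g x))"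

definition Lp_norm :: "real \<Rightarrow> ('n::finite rvec \<Rightarrow> 'e::real_normed_vector) \<Rightarrow> real"
  where "Lp_norm p f =
    (1 / (2 * pi) ^ CARD('n) * (LINT x:period_cube|lborel. norm (f x) powr p)) powr (1 / p)"


section \<open>Besov spaces\<close>

definition schwartz :: "('n::{finite,linorder} rvec \<Rightarrow> complex) \<Rightarrow> bool"
  where "schwartz f \<longleftrightarrow> smooth f \<and>
    (\<forall>\<alpha> \<beta> :: 'n mindex. bounded (range (\<lambda>x. (\<Prod>i\<in>UNIV. (x $ i) ^ (\<beta> $ i)) *\<^sub>R mpartial \<alpha> f x)))"

definition dyadic_annulus :: "nat \<Rightarrow> ('n::finite rvec) set"
  where "dyadic_annulus j =
    (if j = 0 then {x. norm x \<le> 2} else {x. 2 ^ (j - 1) \<le> norm x \<and> norm x \<le> 2 ^ (j + 1)})"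

definition resolution_of_unity :: "(nat \<Rightarrow> 'n::{finite,linorder} rvec \<Rightarrow> complex) \<Rightarrow> bool"
  where "resolution_of_unity \<phi> \<longleftrightarrow>
    (\<forall>j. schwartz (\<phi> j)) \<and>
    (\<forall>j. closure {x. \<phi> j x \<noteq> 0} \<subseteq> dyadic_annulus j) \<and>
    (\<forall>x. (\<lambda>j. \<phi> j x) sums 1) \<and>
    (\<forall>\<alpha>. \<exists>C>0. \<forall>j \<xi>. norm (mpartial \<alpha> (\<phi> j) \<xi>) \<le>
       C * 2 powr (- real j * real (multi_abs \<alpha>)) * indicator (dyadic_annulus j) \<xi>)"

text \<open>The sum below is over a finite set, since \<open>\<phi>\<^sub>j\<close> has compact support.\<close>

definition dyadic_block ::
    "(nat \<Rightarrow> 'n::finite rvec \<Rightarrow> complex) \<Rightarrow> nat \<Rightarrow>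
     (('n rvec \<Rightarrow> complex) \<Rightarrow> 'e::complex_banach) \<Rightarrow> 'n rvec \<Rightarrow> 'e"
  where "dyadic_block \<phi> j f x =
    (\<Sum>k | \<phi> j (real_vec k) \<noteq> 0. \<e> k x *\<^sub>C (\<phi> j (real_vec k) *\<^sub>C fourier_coeff f k))"

definition besov_norm ::
    "(nat \<Rightarrow> 'n::finite rvec \<Rightarrow> complex) \<Rightarrow> real \<Rightarrow> real \<Rightarrow> ennreal \<Rightarrow>
     (('n rvec \<Rightarrow> complex) \<Rightarrow> 'e::complex_banach) \<Rightarrow> ennreal"
  where "besov_norm \<phi> s p q f =
    (if q = \<infinity> then (SUP j. ennreal (2 powr (s * real j) * Lp_norm p (dyadic_block \<phi> j f)))
     else let S = (\<Sum>j. ennreal (2 powr (s * real j * enn2real q)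
                                 * Lp_norm p (dyadic_block \<phi> j f) powr enn2real q))
          in if S = \<infinity> then \<infinity> else ennreal (enn2real S powr (1 / enn2real q)))"

definition besov_space ::
    "(nat \<Rightarrow> 'n::{finite,linorder} rvec \<Rightarrow> complex) \<Rightarrow> real \<Rightarrow> real \<Rightarrow> ennreal \<Rightarrow>
     (('n rvec \<Rightarrow> complex) \<Rightarrow> 'e::complex_banach) set"
  where "besov_space \<phi> s p q = {f \<in> distributions. besov_norm \<phi> s p q f < \<infinity>}"


section \<open>Multipliers and UMD spaces\<close>

definition besov_multiplier ::
    "(nat \<Rightarrow> 'n::{finite,linorder} rvec \<Rightarrow> complex) \<Rightarrow> real \<Rightarrow> real \<Rightarrow> ennreal \<Rightarrow>
     ('n zvec \<Rightarrow> 'e::complex_banach \<Rightarrow>\<^sub>L 'e) \<Rightarrow> bool"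
  where "besov_multiplier \<phi> s p q M \<longleftrightarrow>
    (\<forall>f\<in>besov_space \<phi> s p q. \<exists>g\<in>besov_space \<phi> s p q.
       \<forall>k. fourier_coeff g k = blinfun_apply (M k) (fourier_coeff f k))"

definition trig_polys :: "('n::finite rvec \<Rightarrow> 'e::complex_banach) set"
  where "trig_polys = {f. \<exists>K a. finite K \<and> f = (\<lambda>x. \<Sum>k\<in>K. \<e> k x *\<^sub>C a k)}"

definition discrete_Lp_multiplier ::
    "real \<Rightarrow> ('n::{finite,linorder} zvec \<Rightarrow> 'e::complex_banach \<Rightarrow>\<^sub>L 'e) \<Rightarrow> bool"
  where "discrete_Lp_multiplier p M \<longleftrightarrow> bounded (range M) \<and>
    (\<exists>C>0. \<forall>f\<in>trig_polys.
       let c = fourier_coeff (distribution_of f)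
       in Lp_norm p (\<lambda>x. \<Sum>k | c k \<noteq> 0. \<e> k x *\<^sub>C blinfun_apply (M k) (c k)) \<le> C * Lp_norm p f)"

definition riesz_projection :: "'n::finite zvec \<Rightarrow> 'e::complex_banach \<Rightarrow>\<^sub>L 'e"
  where "riesz_projection k = (if \<forall>j. 0 \<le> k $ j then id_blinfun else 0)"

text \<open>The index type is a parameter because the definition is in terms of multipliers on \<open>\<int>\<^sup>n\<close>.\<close>

definition UMD_space :: "'n::{finite,linorder} itself \<Rightarrow> 'e::complex_banach itself \<Rightarrow> bool"
  where "UMD_space _ _ \<longleftrightarrow>
    (\<exists>p>1. discrete_Lp_multiplier p (riesz_projection :: 'n zvec \<Rightarrow> 'e \<Rightarrow>\<^sub>L 'e))"


section \<open>Bounded variation with respect to the coarse decomposition\<close>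

text \<open>Intervals in \<^typ>\<open>'n zvec\<close> are taken with respect to the componentwise order of the library.\<close>

definition cut :: "'k set \<Rightarrow> ('k \<Rightarrow> 'b::zero) \<Rightarrow> 'k \<Rightarrow> 'b"
  where "cut G M k = (if k \<in> G then M k else 0)"

definition diff_op ::
    "'n::finite zvec \<Rightarrow> 'n \<Rightarrow> ('n zvec \<Rightarrow> 'b::ab_group_add) \<Rightarrow> 'n zvec \<Rightarrow> 'b"
  where "diff_op \<alpha> j N x = (if x $ j \<noteq> \<alpha> $ j then N x - N (x - axis j 1) else 0)"

definition variation ::
    "'n::{finite,linorder} zvec \<Rightarrow> 'n zvec \<Rightarrow> ('n zvec \<Rightarrow> 'b::real_normed_vector) \<Rightarrow> real"
  where "variation \<alpha> \<beta> N =
    (\<Sum>\<xi>\<in>{\<alpha>..\<beta>}.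
       norm (multi_compose (diff_op \<alpha>) (\<chi> j. if \<xi> $ j \<noteq> \<alpha> $ j then 1 else 0) N \<xi>))"

text \<open>The variation of \<open>M\<^sub>G\<close> over a set \<open>G\<close> of the form \<open>[\<alpha>, \<beta>]\<close>.\<close>

definition Var :: "('n::{finite,linorder} zvec) set \<Rightarrow> ('n zvec \<Rightarrow> 'b::real_normed_vector) \<Rightarrow> real"
  where "Var G M = (THE v. \<exists>\<alpha> \<beta>. \<alpha> \<le> \<beta> \<and> G = {\<alpha>..\<beta>} \<and> v = variation \<alpha> \<beta> (cut G M))"

lemma Var_atLeastAtMost:
  fixes \<alpha> \<beta> :: "'n::{finite,linorder} zvec"
  assumes "\<alpha> \<le> \<beta>"
  shows "Var {\<alpha>..\<beta>} M = variation \<alpha> \<beta> (cut {\<alpha>..\<beta>} M)"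
  unfolding Var_def using assms by (intro the_equality) (auto simp: Icc_eq_Icc)

text \<open>For \<open>d = n r + l\<close> with \<open>1 \<le> l \<le> n\<close>, \<open>level\<close> is \<open>r\<close> and \<open>direction\<close> is the \<open>l\<close>-th coordinate.\<close>

definition direction :: "nat \<Rightarrow> 'n::{finite,linorder}"
  where "direction d = coords ! ((d - 1) mod CARD('n))"

definition level :: "'n::finite itself \<Rightarrow> nat \<Rightarrow> nat"
  where "level _ d = (d - 1) div CARD('n)"

definition coarse :: "nat \<Rightarrow> ('n::{finite,linorder} zvec) set"
  where "coarse d = (if d = 0 then {0} else
    let l = direction d; r = level TYPE('n) d
    in {k. (\<forall>i<l. \<bar>k $ i\<bar> < 2 ^ (r + 1)) \<and> 2 ^ r \<le> \<bar>k $ l\<bar> \<and> \<bar>k $ l\<bar> < 2 ^ (r + 1) \<and>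
           (\<forall>i>l. \<bar>k $ i\<bar> < 2 ^ r)})"

definition coarse_pos :: "nat \<Rightarrow> ('n::{finite,linorder} zvec) set"
  where "coarse_pos d = {k \<in> coarse d. k $ direction d > 0}"

definition coarse_neg :: "nat \<Rightarrow> ('n::{finite,linorder} zvec) set"
  where "coarse_neg d = {k \<in> coarse d. k $ direction d < 0}"

lemma coarse_pos_interval:
  fixes d :: nat
  assumes "d > 0"
  shows "\<exists>\<alpha> \<beta> :: 'n::{finite,linorder} zvec. \<alpha> \<le> \<beta> \<and> coarse_pos d = {\<alpha>..\<beta>}"
proof -
  define l :: 'n where "l = direction d"
  define r where "r = level TYPE('n) d"
  define u where "u i = (if i \<le> l then 2 ^ (r + 1) else 2 ^ r) - (1::int)" for i
  define \<alpha> \<beta> :: "'n zvec" where "\<alpha> = (\<chi> i. if i = l then 2 ^ r else - u i)" and "\<beta> = (\<chi> i. u i)"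
  have pw: "(2::int) ^ r \<ge> 1" by simp
  then have pw': "1 < 2 * (2::int) ^ r" "1 < 4 * (2::int) ^ r" by linarith+
  have "\<alpha> \<le> \<beta>"
    using pw' by (auto simp: \<alpha>_def \<beta>_def u_def less_eq_vec_def)
  moreover have "k \<in> coarse_pos d \<longleftrightarrow> k \<in> {\<alpha>..\<beta>}" for k
  proof -
    define P where "P i \<longleftrightarrow> \<alpha> $ i \<le> k $ i \<and> k $ i \<le> \<beta> $ i" for i
    have P_less: "P i \<longleftrightarrow> \<bar>k $ i\<bar> < 2 ^ (r + 1)" if "i < l" for i
      using that unfolding P_def \<alpha>_def \<beta>_def u_def by auto
    have P_l: "P l \<longleftrightarrow> 2 ^ r \<le> \<bar>k $ l\<bar> \<and> \<bar>k $ l\<bar> < 2 ^ (r + 1) \<and> k $ l > 0"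
      using pw unfolding P_def \<alpha>_def \<beta>_def u_def by (simp add: abs_if) linarith
    have P_greater: "P i \<longleftrightarrow> \<bar>k $ i\<bar> < 2 ^ r" if "i > l" for i
      using that unfolding P_def \<alpha>_def \<beta>_def u_def by auto
    have "k \<in> coarse_pos d \<longleftrightarrow> (\<forall>i<l. P i) \<and> P l \<and> (\<forall>i>l. P i)"
      using assms unfolding coarse_pos_def coarse_def Let_def l_def[symmetric] r_def[symmetric]
      by (simp add: P_less P_l P_greater conj_ac)
    also have "\<dots> \<longleftrightarrow> (\<forall>i. P i)"
      using linorder_less_linear[of _ l] by blast
    finally show ?thesis by (simp add: P_def less_eq_vec_def all_conj_distrib)
  qed
  ultimately show ?thesis by blast
qed

lemma coarse_neg_interval:
  fixes d :: nat
  assumes "d > 0"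
  shows "\<exists>\<alpha> \<beta> :: 'n::{finite,linorder} zvec. \<alpha> \<le> \<beta> \<and> coarse_neg d = {\<alpha>..\<beta>}"
proof -
  obtain \<alpha> \<beta> :: "'n zvec" where ab: "\<alpha> \<le> \<beta>" "coarse_pos d = {\<alpha>..\<beta>}"
    using coarse_pos_interval[OF assms] by blast
  have "k \<in> coarse_neg d \<longleftrightarrow> - k \<in> coarse_pos d" for k :: "'n zvec"
    by (auto simp: coarse_neg_def coarse_pos_def coarse_def Let_def)
  moreover have "(- k \<in> {\<alpha>..\<beta>}) = (k \<in> {- \<beta>..- \<alpha>})" for k
  proof -
    have "(\<alpha> $ i \<le> - k $ i \<and> - k $ i \<le> \<beta> $ i) = (- \<beta> $ i \<le> k $ i \<and> k $ i \<le> - \<alpha> $ i)" for i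
      by linarith
    then show ?thesis
      unfolding atLeastAtMost_iff less_eq_vec_def vector_uminus_component by blast
  qed
  ultimately have "coarse_neg d = {- \<beta>..- \<alpha>}"
    unfolding ab(2) by blast
  moreover have "- \<beta> \<le> - \<alpha>" using ab(1) by (auto simp: less_eq_vec_def)
  ultimately show ?thesis by blast
qed

definition coarse_Var :: "nat \<Rightarrow> ('n::{finite,linorder} zvec \<Rightarrow> 'b::real_normed_vector) \<Rightarrow> real"
  where "coarse_Var d M =
    (if d = 0 then Var (coarse 0) M else Var (coarse_pos d) M + Var (coarse_neg d) M)"

definition bounded_coarse_variation ::
    "('n::{finite,linorder} zvec \<Rightarrow> 'b::real_normed_vector) \<Rightarrow> bool"
  where "bounded_coarse_variation M \<longleftrightarrow>
    bounded (range M) \<and> bdd_above (range (\<lambda>d. coarse_Var d M))"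

end

theory Submission
  imports Defs "HOL-Library.Real_Mod"
begin

text \<open>Suppose \<open>E\<close> is UMD. Transference by Fejer kernels turns the Riesz projection into a convolution
  operator on the cyclic group of order \<open>N\<close> which is bounded on one \<open>\<ell>\<^sup>p(E)\<close> uniformly in \<open>N\<close>. Its kernel
  satisfies Hoermander's condition, so Calderon-Zygmund extrapolation and duality give all exponents,
  and letting \<open>N \<rightarrow> \<infinity>\<close> bounds the half-space projections on \<open>L\<^sup>p(T\<^sup>n, E)\<close>. Summation by parts writes \<open>M\<close> on a
  coarse block as a combination of box projections with coefficients \<open>\<Delta>\<^bsup>\<gamma>\<^esup>M(\<xi>)\<close>, whose norms add up to the
  variation. Since a bounded number of coarse blocks meets each dyadic annulus, \<open>M\<close> acts boundedly on
  the dyadic pieces of \<open>f\<close>.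

  Conversely, consider the function of bounded variation which near \<open>2\<^bsup>r\<^esup> \<delta>\<^sub>1\<close> (\<open>r\<close> even) is the translate of the
  symbol \<open>R\<close> defining UMD. If \<open>R\<close> were unbounded on \<open>L\<^sup>p\<close>, there would be trigonometric polynomials \<open>h\<^sub>m\<close> with
  \<open>\<parallel>h\<^sub>m\<parallel> \<le> 2\<^bsup>-m\<^esup>\<close> and \<open>\<parallel>R h\<^sub>m\<parallel> \<ge> 2\<^bsup>m\<^esup>\<close>. Modulated to sparse dyadic points and rescaled by \<open>2\<^bsup>-sr\<^esup>\<close>, they
  add up to a Besov distribution whose image has unbounded dyadic blocks.\<close>

section \<open>Discrete Calderon-Zygmund operators\<close>

text \<open>Two obstacles shape the proof. The UMD property is given for a single exponent p0,
  whereas the theorem is about the given p; this forces the extrapolation. It is carried out for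
  finite kernels on 2^M points: sums replace integrals, stopping intervals come from halving, and
  adjoints act on finite families of functionals, so that no bidual of E has to be identified. The
  price is that every constant must be explicit or chosen before M, since M tends to infinity in the
  end. The dimension is handled by going down and up again: on a coordinate axis the symbol R is the
  indicator of m >= 0, and conversely corners and boxes are compositions of half-space projections
  in the single coordinates. In the converse direction, being a Besov multiplier only means that
  some g exists; no norm estimate comes with it. The gliding hump extracts the contradiction from
  one f and its g, in place of a closed graph argument. Both directions compare f and g one dyadic
  block at a time, so that s and q enter only through the weights of the blocks.\<close>

lemma layer_cake_lower:
  fixes p t :: real
  assumes "0 < p" "0 \<le> t"
  shows "((\<lambda>x. if x < t then x powr (p - 1) else 0) has_integral (t powr p / p)) {0..}"
proof -
  have "((\<lambda>x. x powr (p - 1)) has_integral (t powr p / p)) {0..t}"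
    using has_integral_powr_from_0[of "p - 1" t] assms by simp
  then have "((\<lambda>x. if x \<in> {0..t} then x powr (p - 1) else 0) has_integral (t powr p / p)) {0..}"
    by (subst has_integral_restrict) auto
  then show ?thesis
    by (rule has_integral_spike_finite[where S = "{t}", rotated 2]) auto
qed

lemma layer_cake_upper:
  fixes r t :: real
  assumes "0 < r" "0 < t"
  shows "((\<lambda>x. if t \<le> x then x powr (- r - 1) else 0) has_integral (t powr (- r) / r)) {0..}"
proof -
  have "((\<lambda>x. x powr (- r - 1)) has_integral - (t powr (- r - 1 + 1)) / (- r - 1 + 1)) {t..}"
    using assms by (intro has_integral_powr_to_inf) auto
  then have "((\<lambda>x. if t \<le> x then x powr (- r - 1) else 0) has_integral (t powr (- r) / r)) {t..}"
    using assms by (subst has_integral_cong[where g = "\<lambda>x. x powr (- r - 1)"]) auto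
  then show ?thesis
    by (rule has_integral_on_superset) (use assms in auto)
qed

text \<open>Multiply the level estimate by x^(p-1) and integrate over x > 0. The left side becomes
  the layer cake formula; on the right, x^(p-2) integrated over x < \<open>G j\<close> and
  x^(p-p0-1) over x >= \<open>G j\<close> produce the denominators p - 1 and p0 - p. The hypothesis
  has the form that arises when a function is cut at the height x at which its image is
  measured.\<close>

lemma marcinkiewicz:
  fixes F :: "'i \<Rightarrow> real" and G :: "'j \<Rightarrow> real" and p p0 W1 W0 :: real
  assumes p: "1 < p" "p < p0" and fin: "finite I" "finite J"
    and F: "\<And>i. i \<in> I \<Longrightarrow> 0 \<le> F i" and G: "\<And>j. j \<in> J \<Longrightarrow> 0 \<le> G j"
    and W: "0 \<le> W0"
    and level: "\<And>x. 0 < x \<Longrightarrow> real (card {i\<in>I. x < F i})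
      \<le> W1 / x * (\<Sum>j | j \<in> J \<and> x < G j. G j) + W0 / x powr p0 * (\<Sum>j | j \<in> J \<and> G j \<le> x. G j powr p0)"
  shows "(\<Sum>i\<in>I. F i powr p) \<le> p * (W1 / (p - 1) + W0 / (p0 - p)) * (\<Sum>j\<in>J. G j powr p)"
proof -
  define L where "L x = (\<Sum>i\<in>I. if x < F i then x powr (p - 1) else 0)" for x
  define U1 where "U1 x = (\<Sum>j\<in>J. W1 * G j * (if x < G j then x powr (p - 1 - 1) else 0))" for x
  \<comment> \<open>The test \<open>G j \<noteq> 0\<close> is there because x^(p-p0-1) is not
    integrable at 0; the coefficient \<open>G j powr p0\<close> is 0 in that case anyway.\<close>
  define U0 where "U0 x = (\<Sum>j\<in>J. W0 * G j powr p0 *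
     (if G j \<le> x \<and> G j \<noteq> 0 then x powr (- (p0 - p) - 1) else 0))" for x
  have L: "(L has_integral (\<Sum>i\<in>I. F i powr p / p)) {0..}"
    unfolding L_def using fin F p by (intro has_integral_sum layer_cake_lower) auto
  have U1: "(U1 has_integral (\<Sum>j\<in>J. W1 * G j * (G j powr (p - 1) / (p - 1)))) {0..}"
    unfolding U1_def using fin G p by (intro has_integral_sum has_integral_mult_right layer_cake_lower) auto
  have U0: "(U0 has_integral (\<Sum>j\<in>J. W0 * G j powr p0 * (G j powr (- (p0 - p)) / (p0 - p)))) {0..}"
    unfolding U0_def
  proof (intro has_integral_sum has_integral_mult_right fin)
    fix j assume j: "j \<in> J"
    show "((\<lambda>x. if G j \<le> x \<and> G j \<noteq> 0 then x powr (- (p0 - p) - 1) else 0) has_integral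
        G j powr - (p0 - p) / (p0 - p)) {0..}"
    proof (cases "G j = 0")
      case False
      then show ?thesis using layer_cake_upper[of "p0 - p" "G j"] p G[OF j] by simp
    qed simp
  qed
  have le: "L x \<le> U1 x + U0 x" if "x \<in> {0..}" for x
  proof (cases "x = 0")
    case True
    then show ?thesis using W by (simp add: L_def U1_def U0_def powr_def cong: if_cong)
  next
    case False
    then have x: "x > 0" using that by simp
    have "L x = x powr (p - 1) * real (card {i\<in>I. x < F i})"
      unfolding L_def using fin by (simp add: sum.If_cases Int_def)
    also have "\<dots> \<le> x powr (p - 1) * (W1 / x * (\<Sum>j | j \<in> J \<and> x < G j. G j) +
        W0 / x powr p0 * (\<Sum>j | j \<in> J \<and> G j \<le> x. G j powr p0))"
      using level[OF x] by (intro mult_left_mono) auto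
    also have "\<dots> = W1 * (x powr (p - 1) / x) * (\<Sum>j | j \<in> J \<and> x < G j. G j) +
        W0 * (x powr (p - 1) / x powr p0) * (\<Sum>j | j \<in> J \<and> G j \<le> x. G j powr p0)"
      by (simp add: algebra_simps)
    also have "x powr (p - 1) / x = x powr (p - 1 - 1)"
      using x by (simp add: powr_diff power2_eq_square)
    also have "x powr (p - 1) / x powr p0 = x powr (- (p0 - p) - 1)"
      unfolding powr_diff[symmetric] by (simp add: algebra_simps)
    also have "W1 * x powr (p - 1 - 1) * (\<Sum>j | j \<in> J \<and> x < G j. G j) = U1 x"
      unfolding U1_def using fin
      by (simp add: sum_distrib_left sum.inter_filter[symmetric] if_distrib algebra_simps cong: if_cong)
    also have "W0 * x powr (- (p0 - p) - 1) * (\<Sum>j | j \<in> J \<and> G j \<le> x. G j powr p0) = U0 x"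
      unfolding U0_def sum.inter_filter[OF fin(2)] sum_distrib_left
      by (intro sum.cong) auto
    finally show ?thesis .
  qed
  have "(\<Sum>i\<in>I. F i powr p / p) \<le> (\<Sum>j\<in>J. W1 * G j * (G j powr (p - 1) / (p - 1)))
      + (\<Sum>j\<in>J. W0 * G j powr p0 * (G j powr (- (p0 - p)) / (p0 - p)))"
    using has_integral_le[OF L has_integral_add[OF U1 U0] le] .
  also have "\<dots> = (\<Sum>j\<in>J. (W1 / (p - 1) + W0 / (p0 - p)) * G j powr p)"
    unfolding sum.distrib[symmetric]
  proof (rule sum.cong[OF refl])
    fix j assume "j \<in> J"
    then have "G j * G j powr (p - 1) = G j powr p" using G[of j] p
      by (cases "G j = 0") (auto simp: powr_mult_base)
    moreover have "G j powr p0 * G j powr (- (p0 - p)) = G j powr p"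
      unfolding powr_add[symmetric] by simp
    ultimately show "W1 * G j * (G j powr (p - 1) / (p - 1)) + W0 * G j powr p0 * (G j powr - (p0 - p) / (p0 - p))
      = (W1 / (p - 1) + W0 / (p0 - p)) * G j powr p"
      by (simp add: distrib_right mult.assoc)
  qed
  finally have "(\<Sum>i\<in>I. F i powr p) / p \<le> (W1 / (p - 1) + W0 / (p0 - p)) * (\<Sum>j\<in>J. G j powr p)"
    unfolding sum_divide_distrib[symmetric] sum_distrib_left[symmetric] .
  then have "(\<Sum>i\<in>I. F i powr p) \<le> p * ((W1 / (p - 1) + W0 / (p0 - p)) * (\<Sum>j\<in>J. G j powr p))"
    using p by (subst (asm) pos_divide_le_eq) (simp_all add: mult.commute)
  then show ?thesis by (simp only: mult.assoc)
qed

text \<open>The pair \<open>(c, m)\<close> encodes the interval of length \<open>2\<^bsup>m\<^esup>\<close> starting at \<open>c\<close>.\<close>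

definition block_interval :: "nat \<times> nat \<Rightarrow> nat set"
  where "block_interval Q = {fst Q..<fst Q + 2 ^ snd Q}"

lemma finite_block_interval [simp]: "finite (block_interval Q)"
  and card_block_interval [simp]: "card (block_interval Q) = 2 ^ snd Q"
  by (simp_all add: block_interval_def)

text \<open>Bisection. A half with average above x is selected, and its average is at most 2 x
  because that of its parent is at most x; a half with average at most x is bisected again. Points
  that are never covered end up as intervals of length 1 with average at most x. The halving
  dictates lengths that are powers of 2.\<close>

lemma stopping_intervals:
  fixes f :: "nat \<Rightarrow> real"
  assumes nonneg: "\<And>i. 0 \<le> f i" and avg: "sum f (block_interval (c, m)) \<le> x * 2 ^ m"
  shows "\<exists>\<Q>. finite \<Q> \<and> disjoint_family_on block_interval \<Q> \<and>
    (\<forall>Q\<in>\<Q>. block_interval Q \<subseteq> block_interval (c, m) \<and>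
       x * 2 ^ snd Q < sum f (block_interval Q) \<and> sum f (block_interval Q) \<le> 2 * x * 2 ^ snd Q) \<and>
    (\<forall>i\<in>block_interval (c, m) - (\<Union>Q\<in>\<Q>. block_interval Q). f i \<le> x)"
  using avg
proof (induction m arbitrary: c)
  case 0
  then show ?case
    by (intro exI[of _ "{}"]) (auto simp: block_interval_def disjoint_family_on_def)
next
  case (Suc m)
  let ?I = "\<lambda>d. block_interval (d, m)"
  have split: "block_interval (c, Suc m) = ?I c \<union> ?I (c + 2 ^ m)" and disj: "?I c \<inter> ?I (c + 2 ^ m) = {}"
    by (auto simp: block_interval_def)
  define P where "P d \<Q> \<longleftrightarrow> finite \<Q> \<and> disjoint_family_on block_interval \<Q> \<and>
    (\<forall>Q\<in>\<Q>. block_interval Q \<subseteq> ?I d \<and>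
       x * 2 ^ snd Q < sum f (block_interval Q) \<and> sum f (block_interval Q) \<le> 2 * x * 2 ^ snd Q) \<and>
    (\<forall>i\<in>?I d - (\<Union>Q\<in>\<Q>. block_interval Q). f i \<le> x)" for d \<Q>
  have stop: "\<exists>\<Q>. P d \<Q>" if "d = c \<or> d = c + 2 ^ m" for d
  proof (cases "sum f (?I d) \<le> x * 2 ^ m")
    case True
    show ?thesis using Suc.IH[OF True] unfolding P_def .
  next
    case False
    have "sum f (?I d) \<le> sum f (block_interval (c, Suc m))"
      using that nonneg by (intro sum_mono2) (auto simp: split)
    then have "sum f (?I d) \<le> 2 * x * 2 ^ m" using Suc.prems by simp
    then have "P d {(d, m)}" using False by (simp add: P_def disjoint_family_on_def)
    then show ?thesis by blast
  qed
  obtain Q1 where Q1: "P c Q1" using stop[of c] by blast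
  obtain Q2 where Q2: "P (c + 2 ^ m) Q2" using stop[of "c + 2 ^ m"] by blast
  have sub: "block_interval Q \<subseteq> ?I c" if "Q \<in> Q1" for Q using Q1 that unfolding P_def by blast
  have sub': "block_interval Q \<subseteq> ?I (c + 2 ^ m)" if "Q \<in> Q2" for Q using Q2 that unfolding P_def by blast
  have d1: "block_interval Q \<inter> block_interval Q' = {}" if "Q \<in> Q1" "Q' \<in> Q1" "Q \<noteq> Q'" for Q Q'
    using Q1 that unfolding P_def disjoint_family_on_def by metis
  have d2: "block_interval Q \<inter> block_interval Q' = {}" if "Q \<in> Q2" "Q' \<in> Q2" "Q \<noteq> Q'" for Q Q'
    using Q2 that unfolding P_def disjoint_family_on_def by metis
  have d3: "block_interval Q \<inter> block_interval Q' = {}" if "Q \<in> Q1" "Q' \<in> Q2" for Q Q'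
    using sub[OF that(1)] sub'[OF that(2)] disj by blast
  have 1: "disjoint_family_on block_interval (Q1 \<union> Q2)"
    unfolding disjoint_family_on_def
  proof (intro ballI impI)
    fix Q Q' assume h: "Q \<in> Q1 \<union> Q2" "Q' \<in> Q1 \<union> Q2" "Q \<noteq> Q'"
    show "block_interval Q \<inter> block_interval Q' = {}"
      using h d1[of Q Q'] d2[of Q Q'] d3[of Q Q'] d3[of Q' Q] by (metis Un_iff inf_commute)
  qed
  have 2: "finite (Q1 \<union> Q2)" using Q1 Q2 unfolding P_def by blast
  have 3: "\<forall>Q\<in>Q1 \<union> Q2. block_interval Q \<subseteq> block_interval (c, Suc m) \<and>
      x * 2 ^ snd Q < sum f (block_interval Q) \<and> sum f (block_interval Q) \<le> 2 * x * 2 ^ snd Q"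
    using Q1 Q2 unfolding P_def split Un_iff ball_Un by (simp add: le_supI1 le_supI2)
  have 4: "\<forall>i\<in>block_interval (c, Suc m) - (\<Union>Q\<in>Q1 \<union> Q2. block_interval Q). f i \<le> x"
    using Q1 Q2 unfolding P_def split by auto
  show ?case by (rule exI[of _ "Q1 \<union> Q2"], intro conjI 1 2 3 4)
qed

text \<open>Decompose \<open>a\<close> at height x into a good part, bounded by 2 x and controlled
  by the p0 estimate, and bad parts of mean zero on the stopping intervals, controlled by
  Hoermander's condition off the exceptional sets. The exceptional sets are discarded; they are few
  because each stopping interval carries mass more than x times its length.\<close>

lemma calderon_zygmund_weak:
  fixes K :: "nat \<Rightarrow> nat \<Rightarrow> 'a::real_normed_vector \<Rightarrow>\<^sub>L 'b::real_normed_vector"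
    and M :: nat and A B D p0 x :: real
  assumes p0: "1 < p0" and nn: "0 \<le> A" "0 \<le> B" "0 \<le> D"
    and strong: "\<And>a. (\<Sum>i<2 ^ M. norm (\<Sum>j<2 ^ M. K i j (a j)) powr p0) \<le> A * (\<Sum>j<2 ^ M. norm (a j) powr p0)"
    and hormander: "\<And>Q. block_interval Q \<subseteq> {..<2 ^ M} \<Longrightarrow> \<exists>X. finite X \<and> real (card X) \<le> D * 2 ^ snd Q \<and>
      (\<forall>j\<in>block_interval Q. (\<Sum>i\<in>{..<2 ^ M} - X. norm (K i j - K i (fst Q))) \<le> B)"
    and x: "0 < x"
  shows "real (card {i\<in>{..<2 ^ M}. x < norm (\<Sum>j<2 ^ M. K i j (a j))})
    \<le> (A * 4 powr p0 + D + 4 * B + 1) / x * (\<Sum>j<2 ^ M. norm (a j))"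
proof (cases "(\<Sum>j<2 ^ M. norm (a j)) \<le> x * 2 ^ M")
  \<comment> \<open>Here the stopping process cannot start, but the trivial bound 2^M on the number
    of points is good enough. This accounts for the summand 1 in the constant.\<close>
  case False
  have "real (card {i\<in>{..<2 ^ M}. x < norm (\<Sum>j<2 ^ M. K i j (a j))}) \<le> 2 ^ M"
    using of_nat_mono[OF card_mono[of "{..<2 ^ M :: nat}"
      "{i\<in>{..<2 ^ M}. x < norm (\<Sum>j<2 ^ M. K i j (a j))}"], where 'a = real] by auto
  also have "\<dots> \<le> 1 / x * (\<Sum>j<2 ^ M. norm (a j))"
    using False x by (simp add: field_simps)
  also have "\<dots> \<le> (A * 4 powr p0 + D + 4 * B + 1) / x * (\<Sum>j<2 ^ M. norm (a j))"
    using nn x by (intro mult_right_mono divide_right_mono sum_nonneg) auto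
  finally show ?thesis .
next
  case True
  let ?N = "{..<2 ^ M :: nat}"
  let ?I = block_interval
  define S where "S = (\<Sum>j\<in>?N. norm (a j))"
  have S0: "0 \<le> S" by (simp add: S_def sum_nonneg)
  have N: "?I (0, M) = ?N" by (auto simp: block_interval_def)
  have avg: "sum (\<lambda>i. norm (a i)) (?I (0, M)) \<le> x * 2 ^ M" using True unfolding N .
  obtain \<Q> where fin: "finite \<Q>" and dis: "disjoint_family_on ?I \<Q>"
    and QQ: "\<forall>Q\<in>\<Q>. ?I Q \<subseteq> ?N \<and> x * 2 ^ snd Q < (\<Sum>i\<in>?I Q. norm (a i)) \<and>
      (\<Sum>i\<in>?I Q. norm (a i)) \<le> 2 * x * 2 ^ snd Q"
    and off': "\<forall>i\<in>?N - (\<Union>Q\<in>\<Q>. ?I Q). norm (a i) \<le> x"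
    using stopping_intervals[OF norm_ge_zero avg] unfolding N by (elim exE conjE)
  have Q: "\<And>Q. Q \<in> \<Q> \<Longrightarrow> ?I Q \<subseteq> ?N" "\<And>Q. Q \<in> \<Q> \<Longrightarrow> x * 2 ^ snd Q < (\<Sum>i\<in>?I Q. norm (a i))"
      "\<And>Q. Q \<in> \<Q> \<Longrightarrow> (\<Sum>i\<in>?I Q. norm (a i)) \<le> 2 * x * 2 ^ snd Q"
    using QQ by blast+
  have off: "norm (a i) \<le> x" if "i \<in> ?N" "\<And>Q. Q \<in> \<Q> \<Longrightarrow> i \<notin> ?I Q" for i
    using off' that by blast
  have sumQ: "(\<Sum>Q\<in>\<Q>. \<Sum>i\<in>?I Q. h i) \<le> (\<Sum>i\<in>?N. h i)" if "\<And>i. 0 \<le> h i" for h :: "nat \<Rightarrow> real"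
  proof -
    have "(\<Sum>Q\<in>\<Q>. \<Sum>i\<in>?I Q. h i) = (\<Sum>i\<in>(\<Union>Q\<in>\<Q>. ?I Q). h i)"
      using fin dis by (subst sum.UNION_disjoint) (auto simp: disjoint_family_on_def)
    also have "\<dots> \<le> (\<Sum>i\<in>?N. h i)"
      using Q(1) that by (intro sum_mono2) auto
    finally show ?thesis .
  qed
  define m where "m Q = (1 / 2 ^ snd Q) *\<^sub>R (\<Sum>i\<in>?I Q. a i)" for Q
  define b where "b Q i = (if i \<in> ?I Q then a i - m Q else 0)" for Q i
  define g where "g i = a i - (\<Sum>Q\<in>\<Q>. b Q i)" for i
  have gQ: "g i = m Q" if "Q \<in> \<Q>" "i \<in> ?I Q" for i Q
  proof -
    have "b Q' i = 0" if "Q' \<in> \<Q> - {Q}" for Q'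
      using that \<open>Q \<in> \<Q>\<close> \<open>i \<in> ?I Q\<close> dis unfolding b_def disjoint_family_on_def by auto
    then have "(\<Sum>Q\<in>\<Q>. b Q i) = b Q i"
      using fin that by (simp add: sum.remove[of \<Q> Q])
    then show ?thesis using that by (simp add: g_def b_def)
  qed
  have g_off: "g i = a i" if "\<And>Q. Q \<in> \<Q> \<Longrightarrow> i \<notin> ?I Q" for i
    using that by (simp add: g_def b_def)
  have m_le: "norm (m Q) * 2 ^ snd Q \<le> (\<Sum>i\<in>?I Q. norm (a i))" for Q
    unfolding m_def by (simp add: norm_sum)
  have g_le: "norm (g i) \<le> 2 * x" if "i \<in> ?N" for i
  proof (cases "\<exists>Q\<in>\<Q>. i \<in> ?I Q")
    case True
    then obtain Q where q: "Q \<in> \<Q>" "i \<in> ?I Q" by blast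
    have "norm (m Q) * 2 ^ snd Q \<le> 2 * x * 2 ^ snd Q" using m_le[of Q] Q(3)[OF q(1)] by linarith
    then show ?thesis using gQ[OF q] by simp
  next
    case False
    then show ?thesis using off[OF that] g_off[of i] x by force
  qed
  have b_sum: "(\<Sum>i\<in>?I Q. b Q i) = 0" for Q
    by (simp add: b_def sum_subtractf m_def sum_constant_scaleR)
  have b_norm: "(\<Sum>i\<in>?I Q. norm (b Q i)) \<le> 2 * (\<Sum>i\<in>?I Q. norm (a i))" for Q
  proof -
    have "(\<Sum>i\<in>?I Q. norm (b Q i)) \<le> (\<Sum>i\<in>?I Q. norm (a i) + norm (m Q))"
      by (intro sum_mono) (auto simp: b_def norm_triangle_ineq4)
    also have "\<dots> \<le> 2 * (\<Sum>i\<in>?I Q. norm (a i))"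
      using m_le[of Q] by (simp add: sum.distrib mult.commute)
    finally show ?thesis .
  qed
  have g_norm: "(\<Sum>i\<in>?N. norm (g i)) \<le> S"
  proof -
    let ?U = "\<Union>Q\<in>\<Q>. ?I Q"
    have U: "?U \<subseteq> ?N" using Q(1) by blast
    have "(\<Sum>i\<in>?U. norm (g i)) = (\<Sum>Q\<in>\<Q>. \<Sum>i\<in>?I Q. norm (g i))"
      using fin dis by (subst sum.UNION_disjoint) (auto simp: disjoint_family_on_def)
    also have "\<dots> = (\<Sum>Q\<in>\<Q>. norm (m Q) * 2 ^ snd Q)"
      by (intro sum.cong refl) (simp add: gQ mult.commute)
    also have "\<dots> \<le> (\<Sum>Q\<in>\<Q>. \<Sum>i\<in>?I Q. norm (a i))" by (intro sum_mono m_le)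
    also have "\<dots> = (\<Sum>i\<in>?U. norm (a i))"
      using fin dis by (subst sum.UNION_disjoint) (auto simp: disjoint_family_on_def)
    finally have "(\<Sum>i\<in>?U. norm (g i)) \<le> (\<Sum>i\<in>?U. norm (a i))" .
    moreover have "(\<Sum>i\<in>?N - ?U. norm (g i)) = (\<Sum>i\<in>?N - ?U. norm (a i))"
      by (intro sum.cong refl) (use g_off in auto)
    ultimately show ?thesis
      unfolding S_def using sum.subset_diff[OF U, of "\<lambda>i. norm (g i)"] sum.subset_diff[OF U, of "\<lambda>i. norm (a i)"] by simp
  qed
  have "\<forall>Q\<in>\<Q>. \<exists>X. finite X \<and> real (card X) \<le> D * 2 ^ snd Q \<and>
      (\<forall>j\<in>?I Q. (\<Sum>i\<in>?N - X. norm (K i j - K i (fst Q))) \<le> B)"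
    using hormander[OF Q(1)] by (intro ballI)
  from bchoice[OF this] obtain X where XX: "\<forall>Q\<in>\<Q>. finite (X Q) \<and> real (card (X Q)) \<le> D * 2 ^ snd Q \<and>
      (\<forall>j\<in>?I Q. (\<Sum>i\<in>?N - X Q. norm (K i j - K i (fst Q))) \<le> B)" ..
  have X: "\<And>Q. Q \<in> \<Q> \<Longrightarrow> finite (X Q)" "\<And>Q. Q \<in> \<Q> \<Longrightarrow> real (card (X Q)) \<le> D * 2 ^ snd Q"
    "\<And>Q j. Q \<in> \<Q> \<Longrightarrow> j \<in> ?I Q \<Longrightarrow> (\<Sum>i\<in>?N - X Q. norm (K i j - K i (fst Q))) \<le> B"
    using XX by blast+
  define T where "T u i = (\<Sum>j\<in>?N. K i j (u j))" for u i
  have T_split: "T a i = T g i + (\<Sum>Q\<in>\<Q>. T (b Q) i)" for i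
  proof -
    have "T a i = (\<Sum>j\<in>?N. K i j (g j) + (\<Sum>Q\<in>\<Q>. K i j (b Q j)))"
      by (simp add: T_def g_def blinfun.diff_right blinfun.sum_right)
    also have "\<dots> = T g i + (\<Sum>j\<in>?N. \<Sum>Q\<in>\<Q>. K i j (b Q j))" by (simp add: sum.distrib T_def)
    also have "(\<Sum>j\<in>?N. \<Sum>Q\<in>\<Q>. K i j (b Q j)) = (\<Sum>Q\<in>\<Q>. T (b Q) i)"
      unfolding T_def by (rule sum.swap)
    finally show ?thesis .
  qed
  \<comment> \<open>Chebyshev at height x / 2, together with |g|^p0 <= (2 x)^(p0-1) |g|. The
    quotient of (2 x)^p0 and (x / 2)^p0 is the origin of \<open>4 powr p0\<close>.\<close>
  have good: "real (card {i\<in>?N. x / 2 < norm (T g i)}) \<le> A * 4 powr p0 / x * S"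
  proof -
    have "(x / 2) powr p0 * real (card {i\<in>?N. x / 2 < norm (T g i)}) = (\<Sum>i | i \<in> ?N \<and> x / 2 < norm (T g i). (x / 2) powr p0)"
      by simp
    also have "\<dots> \<le> (\<Sum>i | i \<in> ?N \<and> x / 2 < norm (T g i). norm (T g i) powr p0)"
      using x p0 by (intro sum_mono powr_mono2) auto
    also have "\<dots> \<le> (\<Sum>i\<in>?N. norm (T g i) powr p0)"
      by (intro sum_mono2) auto
    also have "\<dots> \<le> A * (\<Sum>i\<in>?N. norm (g i) powr p0)"
      unfolding T_def by (rule strong)
    also have "\<dots> \<le> A * (\<Sum>i\<in>?N. (2 * x) powr (p0 - 1) * norm (g i))"
    proof (intro mult_left_mono sum_mono nn)
      fix i assume i: "i \<in> ?N"
      have "norm (g i) powr p0 = norm (g i) powr (p0 - 1) * norm (g i)"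
        using p0 by (cases "g i = 0") (auto simp: powr_diff)
      also have "\<dots> \<le> (2 * x) powr (p0 - 1) * norm (g i)"
        using g_le[OF i] p0 by (intro mult_right_mono powr_mono2) auto
      finally show "norm (g i) powr p0 \<le> (2 * x) powr (p0 - 1) * norm (g i)" .
    qed
    also have "\<dots> \<le> A * ((2 * x) powr (p0 - 1) * S)"
      unfolding sum_distrib_left[symmetric] using nn g_norm by (intro mult_left_mono) auto
    finally have *: "(x / 2) powr p0 * real (card {i\<in>?N. x / 2 < norm (T g i)}) \<le> A * ((2 * x) powr (p0 - 1) * S)" .
    have "(2 * x) powr (p0 - 1) = (x / 2) powr p0 * (4 powr p0 / (2 * x))"
    proof -
      have "(x / 2) powr p0 * 4 powr p0 = (2 * x) powr p0"
        using x by (subst powr_mult[symmetric]) auto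
      then show ?thesis using x by (simp add: powr_diff power2_eq_square)
    qed
    then have "(x / 2) powr p0 * real (card {i\<in>?N. x / 2 < norm (T g i)}) \<le> (x / 2) powr p0 * (A * 4 powr p0 / (2 * x) * S)"
      using * by (simp add: mult_ac)
    then have "real (card {i\<in>?N. x / 2 < norm (T g i)}) \<le> A * 4 powr p0 / (2 * x) * S"
      by (rule mult_left_le_imp_le) (use x in simp)
    also have "\<dots> \<le> A * 4 powr p0 / x * S"
      using x nn S0 by (intro mult_right_mono divide_left_mono) auto
    finally show ?thesis .
  qed
  let ?X = "\<Union>Q\<in>\<Q>. X Q"
  have cardX: "real (card ?X) \<le> D / x * S"
  proof -
    have "real (card ?X) \<le> (\<Sum>Q\<in>\<Q>. real (card (X Q)))"
      using of_nat_mono[OF card_UN_le[OF fin, of X], where 'a = real] by simp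
    also have "\<dots> \<le> (\<Sum>Q\<in>\<Q>. D / x * (\<Sum>i\<in>?I Q. norm (a i)))"
    proof (intro sum_mono)
      fix Q assume q: "Q \<in> \<Q>"
      have "real (card (X Q)) \<le> D / x * (x * 2 ^ snd Q)" using X(2)[OF q] x by simp
      also have "\<dots> \<le> D / x * (\<Sum>i\<in>?I Q. norm (a i))"
        using Q(2)[OF q] nn x by (intro mult_left_mono) auto
      finally show "real (card (X Q)) \<le> D / x * (\<Sum>i\<in>?I Q. norm (a i))" .
    qed
    also have "\<dots> \<le> D / x * S"
      unfolding S_def sum_distrib_left[symmetric] using nn x sumQ[of "\<lambda>i. norm (a i)"]
      by (intro mult_left_mono) auto
    finally show ?thesis .
  qed
  \<comment> \<open>Since \<open>b Q\<close> sums to 0, the column \<open>K i (fst Q)\<close> can be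
    subtracted from each \<open>K i j\<close>, which makes Hoermander's condition applicable. The
    factor 2 is the loss from \<open>a\<close> to \<open>b Q\<close>; Chebyshev at height x / 2
    turns 2 B into 4 B below.\<close>
  have Tb: "(\<Sum>i\<in>?N - X Q. norm (T (b Q) i)) \<le> 2 * B * (\<Sum>i\<in>?I Q. norm (a i))" if q: "Q \<in> \<Q>" for Q
  proof -
    have eq: "T (b Q) i = (\<Sum>j\<in>?I Q. (K i j - K i (fst Q)) (b Q j))" for i
    proof -
      have "T (b Q) i = (\<Sum>j\<in>?I Q. K i j (b Q j))"
        unfolding T_def using Q(1)[OF q] by (intro sum.mono_neutral_right) (auto simp: b_def)
      moreover have "(\<Sum>j\<in>?I Q. K i (fst Q) (b Q j)) = 0"
        by (simp add: b_sum flip: blinfun.sum_right)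
      ultimately show ?thesis by (simp add: blinfun.diff_left sum_subtractf)
    qed
    have "(\<Sum>i\<in>?N - X Q. norm (T (b Q) i)) \<le> (\<Sum>i\<in>?N - X Q. \<Sum>j\<in>?I Q. norm (K i j - K i (fst Q)) * norm (b Q j))"
      unfolding eq by (intro sum_mono order_trans[OF norm_sum] norm_blinfun)
    also have "\<dots> = (\<Sum>j\<in>?I Q. (\<Sum>i\<in>?N - X Q. norm (K i j - K i (fst Q))) * norm (b Q j))"
      by (subst sum.swap) (simp add: sum_distrib_right)
    also have "\<dots> \<le> (\<Sum>j\<in>?I Q. B * norm (b Q j))"
      using X(3)[OF q] by (intro sum_mono mult_right_mono) auto
    also have "\<dots> \<le> B * (2 * (\<Sum>i\<in>?I Q. norm (a i)))"
      unfolding sum_distrib_left[symmetric] using nn b_norm by (intro mult_left_mono) auto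
    finally show ?thesis by simp
  qed
  have bad: "real (card {i\<in>?N - ?X. x / 2 < norm (\<Sum>Q\<in>\<Q>. T (b Q) i)}) \<le> 4 * B / x * S"
  proof -
    have "x / 2 * real (card {i\<in>?N - ?X. x / 2 < norm (\<Sum>Q\<in>\<Q>. T (b Q) i)})
      = (\<Sum>i | i \<in> ?N - ?X \<and> x / 2 < norm (\<Sum>Q\<in>\<Q>. T (b Q) i). x / 2)" by simp
    also have "\<dots> \<le> (\<Sum>i | i \<in> ?N - ?X \<and> x / 2 < norm (\<Sum>Q\<in>\<Q>. T (b Q) i). norm (\<Sum>Q\<in>\<Q>. T (b Q) i))"
      by (intro sum_mono) auto
    also have "\<dots> \<le> (\<Sum>i\<in>?N - ?X. norm (\<Sum>Q\<in>\<Q>. T (b Q) i))"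
      by (intro sum_mono2) auto
    also have "\<dots> \<le> (\<Sum>i\<in>?N - ?X. \<Sum>Q\<in>\<Q>. norm (T (b Q) i))"
      by (intro sum_mono norm_sum)
    also have "\<dots> = (\<Sum>Q\<in>\<Q>. \<Sum>i\<in>?N - ?X. norm (T (b Q) i))" by (rule sum.swap)
    also have "\<dots> \<le> (\<Sum>Q\<in>\<Q>. \<Sum>i\<in>?N - X Q. norm (T (b Q) i))"
      by (intro sum_mono sum_mono2) auto
    also have "\<dots> \<le> (\<Sum>Q\<in>\<Q>. 2 * B * (\<Sum>i\<in>?I Q. norm (a i)))" by (intro sum_mono Tb)
    also have "\<dots> \<le> 2 * B * S"
      unfolding S_def sum_distrib_left[symmetric] using nn sumQ[of "\<lambda>i. norm (a i)"]
      by (intro mult_left_mono) auto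
    finally show ?thesis using x by (simp add: field_simps)
  qed
  have "{i\<in>?N. x < norm (T a i)} \<subseteq> {i\<in>?N. x / 2 < norm (T g i)} \<union> ?X \<union>
      {i\<in>?N - ?X. x / 2 < norm (\<Sum>Q\<in>\<Q>. T (b Q) i)}"
  proof
    fix i assume i: "i \<in> {i\<in>?N. x < norm (T a i)}"
    have "norm (T a i) \<le> norm (T g i) + norm (\<Sum>Q\<in>\<Q>. T (b Q) i)"
      unfolding T_split by (rule norm_triangle_ineq)
    then have "x / 2 < norm (T g i) \<or> x / 2 < norm (\<Sum>Q\<in>\<Q>. T (b Q) i)" using i by auto
    then show "i \<in> {i\<in>?N. x / 2 < norm (T g i)} \<union> ?X \<union> {i\<in>?N - ?X. x / 2 < norm (\<Sum>Q\<in>\<Q>. T (b Q) i)}"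
      using i by blast
  qed
  then have "card {i\<in>?N. x < norm (T a i)} \<le> card ({i\<in>?N. x / 2 < norm (T g i)} \<union> ?X \<union>
      {i\<in>?N - ?X. x / 2 < norm (\<Sum>Q\<in>\<Q>. T (b Q) i)})"
    using fin X(1) by (intro card_mono) auto
  also have "\<dots> \<le> card {i\<in>?N. x / 2 < norm (T g i)} + card ?X + card {i\<in>?N - ?X. x / 2 < norm (\<Sum>Q\<in>\<Q>. T (b Q) i)}"
    by (meson add_mono card_Un_le order.refl order_trans)
  finally have "real (card {i\<in>?N. x < norm (T a i)}) \<le> A * 4 powr p0 / x * S + D / x * S + 4 * B / x * S"
    using good cardX bad by linarith
  also have "\<dots> \<le> (A * 4 powr p0 + D + 4 * B + 1) / x * S"
    using S0 x by (simp add: field_simps)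
  finally show ?thesis unfolding T_def S_def .
qed

text \<open>Cut \<open>a\<close> at height x. The large values are fed into the weak estimate and
  the small ones into Chebyshev with the p0 bound, each at level x / 2; hence the factors 2 and
  \<open>2 powr p0\<close> in front of the two terms. The outcome is the level hypothesis of
  \<open>marcinkiewicz\<close>.\<close>

lemma calderon_zygmund_strong:
  fixes K :: "nat \<Rightarrow> nat \<Rightarrow> 'a::real_normed_vector \<Rightarrow>\<^sub>L 'b::real_normed_vector"
    and M :: nat and A B D p p0 :: real
  assumes p: "1 < p" "p < p0" and nn: "0 \<le> A" "0 \<le> B" "0 \<le> D"
    and strong: "\<And>a. (\<Sum>i<2 ^ M. norm (\<Sum>j<2 ^ M. K i j (a j)) powr p0) \<le> A * (\<Sum>j<2 ^ M. norm (a j) powr p0)"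
    and hormander: "\<And>Q. block_interval Q \<subseteq> {..<2 ^ M} \<Longrightarrow> \<exists>X. finite X \<and> real (card X) \<le> D * 2 ^ snd Q \<and>
      (\<forall>j\<in>block_interval Q. (\<Sum>i\<in>{..<2 ^ M} - X. norm (K i j - K i (fst Q))) \<le> B)"
  shows "(\<Sum>i<2 ^ M. norm (\<Sum>j<2 ^ M. K i j (a j)) powr p)
    \<le> p * (2 * (A * 4 powr p0 + D + 4 * B + 1) / (p - 1) + 2 powr p0 * A / (p0 - p)) * (\<Sum>j<2 ^ M. norm (a j) powr p)"
proof (rule marcinkiewicz[OF p])
  let ?W = "A * 4 powr p0 + D + 4 * B + 1"
  let ?N = "{..<2 ^ M :: nat}"
  fix x :: real assume x: "0 < x"
  define T where "T u i = (\<Sum>j\<in>?N. K i j (u j))" for u i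
  define u where "u j = (if x < norm (a j) then a j else 0)" for j
  define v where "v j = (if x < norm (a j) then 0 else a j)" for j
  have "T a i = T u i + T v i" for i
    unfolding T_def sum.distrib[symmetric] by (intro sum.cong) (auto simp: u_def v_def)
  then have le: "norm (T a i) \<le> norm (T u i) + norm (T v i)" for i
    by (simp add: norm_triangle_ineq)
  have "{i\<in>?N. x < norm (T a i)} \<subseteq> {i\<in>?N. x / 2 < norm (T u i)} \<union> {i\<in>?N. x / 2 < norm (T v i)}"
    (is "_ \<subseteq> ?U \<union> ?V")
  proof
    fix i assume "i \<in> {i\<in>?N. x < norm (T a i)}"
    then show "i \<in> ?U \<union> ?V" using le[of i] by auto
  qed
  then have "card {i\<in>?N. x < norm (T a i)} \<le> card (?U \<union> ?V)"
    by (intro card_mono) auto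
  then have "real (card {i\<in>?N. x < norm (T a i)}) \<le> real (card ?U) + real (card ?V)"
    using card_Un_le[of ?U ?V] by linarith
  also have "real (card ?U) \<le> ?W / (x / 2) * (\<Sum>j\<in>?N. norm (u j))"
    unfolding T_def using p x by (intro calderon_zygmund_weak[OF _ nn strong hormander]) auto
  also have "(\<Sum>j\<in>?N. norm (u j)) = (\<Sum>j | j \<in> ?N \<and> x < norm (a j). norm (a j))"
    by (subst sum.inter_filter) (auto simp: u_def intro!: sum.cong)
  also have "real (card ?V) \<le> 2 powr p0 * A / x powr p0 * (\<Sum>j | j \<in> ?N \<and> norm (a j) \<le> x. norm (a j) powr p0)"
  proof -
    have "(x / 2) powr p0 * real (card ?V) = (\<Sum>i\<in>?V. (x / 2) powr p0)" by simp
    also have "\<dots> \<le> (\<Sum>i\<in>?V. norm (T v i) powr p0)"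
      using x p by (intro sum_mono powr_mono2) auto
    also have "\<dots> \<le> (\<Sum>i\<in>?N. norm (T v i) powr p0)" by (intro sum_mono2) auto
    also have "\<dots> \<le> A * (\<Sum>j\<in>?N. norm (v j) powr p0)" unfolding T_def by (rule strong)
    also have "(\<Sum>j\<in>?N. norm (v j) powr p0) = (\<Sum>j\<in>?N. if norm (a j) \<le> x then norm (a j) powr p0 else 0)"
      by (intro sum.cong) (auto simp: v_def)
    also have "\<dots> = (\<Sum>j | j \<in> ?N \<and> norm (a j) \<le> x. norm (a j) powr p0)"
      by (rule sum.inter_filter[symmetric]) simp
    finally have "(x / 2) powr p0 * real (card ?V) \<le> A * (\<Sum>j | j \<in> ?N \<and> norm (a j) \<le> x. norm (a j) powr p0)" .
    moreover have "(x / 2) powr p0 = x powr p0 / 2 powr p0" using x by (simp add: powr_divide)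
    ultimately have "real (card ?V) * x powr p0 \<le> (A * (\<Sum>j | j \<in> ?N \<and> norm (a j) \<le> x. norm (a j) powr p0)) * 2 powr p0"
      by (simp add: pos_divide_le_eq mult.commute)
    then show ?thesis using x by (simp add: pos_le_divide_eq mult_ac)
  qed
  finally show "real (card {i\<in>?N. x < norm (\<Sum>j\<in>?N. K i j (a j))}) \<le>
      2 * ?W / x * (\<Sum>j | j \<in> ?N \<and> x < norm (a j). norm (a j)) +
      2 powr p0 * A / x powr p0 * (\<Sum>j | j \<in> ?N \<and> norm (a j) \<le> x. norm (a j) powr p0)"
    unfolding T_def by (simp add: mult.commute)
qed (use nn in auto)

section \<open>Norming functionals and duality\<close>

text \<open>A sublinear functional below the norm which is minimal (Zorn) is linear, since subtracting along
  a direction as in \<open>sublinear_below_norm_shift\<close> cannot decrease it.\<close>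

definition sublinear_below_norm :: "('a::real_normed_vector \<Rightarrow> real) \<Rightarrow> bool"
  where "sublinear_below_norm p \<longleftrightarrow> (\<forall>x y. p (x + y) \<le> p x + p y) \<and>
    (\<forall>t x. 0 < t \<longrightarrow> p (t *\<^sub>R x) \<le> t * p x) \<and> (\<forall>x. p x \<le> norm x)"

lemma sublinear_below_norm_lower:
  assumes "sublinear_below_norm p"
  shows "- norm x \<le> p x"
proof -
  have "p (x + - x) \<le> p x + p (- x)" "p (0 + 0) \<le> p 0 + p 0" "p (- x) \<le> norm (- x)"
    using assms unfolding sublinear_below_norm_def by blast+
  then show ?thesis by simp
qed

text \<open>The infimum is finite because t p(a) <= p(t a) <= p(x + t a) + p(-x). What matters later
  is the value at t = 1: if p is minimal, then u = p, and u x <= p(x + a) - p a becomes the reverse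
  of subadditivity.\<close>

lemma sublinear_below_norm_shift:
  fixes a :: "'a::real_normed_vector"
  assumes p: "sublinear_below_norm p"
  defines "u \<equiv> \<lambda>x. INF t\<in>{0..}. p (x + t *\<^sub>R a) - t * p a"
  shows "sublinear_below_norm u" and "u x \<le> p x" and "0 \<le> t \<Longrightarrow> u x \<le> p (x + t *\<^sub>R a) - t * p a"
proof -
  have u_eq: "u x = (INF t\<in>{0..}. p (x + t *\<^sub>R a) - t * p a)" for x by (simp add: u_def)
  have add: "p (x + y) \<le> p x + p y" and hom: "0 < t \<Longrightarrow> p (t *\<^sub>R x) \<le> t * p x" and le: "p x \<le> norm x" for x y t
    using p unfolding sublinear_below_norm_def by blast+
  have p0: "p 0 = 0" using add[of 0 0] le[of 0] by simp
  have hom0: "p (t *\<^sub>R x) \<le> t * p x" if "0 \<le> t" for t x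
    using hom[of t x] that p0 by (cases "t = 0") auto
  have bdd: "bdd_below ((\<lambda>t. p (x + t *\<^sub>R a) - t * p a) ` {0..})" for x
  proof (intro bdd_belowI2)
    fix t :: real assume "t \<in> {0..}"
    then have "p (t *\<^sub>R a) \<le> t * p a" by (intro hom0) auto
    have "p (- x) + p (x + t *\<^sub>R a) \<ge> p (t *\<^sub>R a)" using add[of "- x" "x + t *\<^sub>R a"] by simp
    have "t * p a \<le> p (x + t *\<^sub>R a) + norm x"
    proof (cases "t = 0")
      case True
      then show ?thesis using sublinear_below_norm_lower[OF p, of x] by simp
    next
      case False
      then have "t > 0" using \<open>t \<in> {0..}\<close> by auto
      have "p ((1 / t) *\<^sub>R (t *\<^sub>R a)) \<le> 1 / t * p (t *\<^sub>R a)" using \<open>t > 0\<close> by (intro hom) auto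
      then have "t * p a \<le> p (t *\<^sub>R a)" using \<open>t > 0\<close> by (simp add: field_simps)
      then show ?thesis using \<open>p (- x) + p (x + t *\<^sub>R a) \<ge> p (t *\<^sub>R a)\<close> le[of "- x"] by simp
    qed
    then show "- norm x \<le> p (x + t *\<^sub>R a) - t * p a" by simp
  qed
  have lower: "u x \<le> p (x + t *\<^sub>R a) - t * p a" if "0 \<le> t" for x t
    unfolding u_def using that by (intro cINF_lower[OF bdd]) auto
  show "0 \<le> t \<Longrightarrow> u x \<le> p (x + t *\<^sub>R a) - t * p a" by (rule lower)
  show ux: "u x \<le> p x" for x using lower[of 0 x] by simp
  have "u (x + y) \<le> u x + u y" for x y
  proof -
    have "u (x + y) \<le> (p (x + t *\<^sub>R a) - t * p a) + (p (y + s *\<^sub>R a) - s * p a)" if "0 \<le> t" "0 \<le> s" for t s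
    proof -
      have "u (x + y) \<le> p ((x + t *\<^sub>R a) + (y + s *\<^sub>R a)) - (t + s) * p a"
        using lower[of "t + s" "x + y"] that by (simp add: algebra_simps)
      also have "\<dots> \<le> p (x + t *\<^sub>R a) + p (y + s *\<^sub>R a) - (t + s) * p a" using add by simp
      finally show ?thesis by (simp add: algebra_simps)
    qed
    note pq = this
    have "u (x + y) - (p (x + t *\<^sub>R a) - t * p a) \<le> u y" if t: "0 \<le> t" for t
      unfolding u_eq[of y]
    proof (rule cINF_greatest)
      fix s :: real assume "s \<in> {0..}"
      then show "u (x + y) - (p (x + t *\<^sub>R a) - t * p a) \<le> p (y + s *\<^sub>R a) - s * p a"
        using pq[OF t, of s] by simp
    qed auto
    note pq' = this
    have "u (x + y) - u y \<le> u x"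
      unfolding u_eq[of x]
    proof (rule cINF_greatest)
      fix t :: real assume "t \<in> {0..}"
      then show "u (x + y) - u y \<le> p (x + t *\<^sub>R a) - t * p a"
        using pq'[of t] by simp
    qed auto
    then show ?thesis by simp
  qed
  moreover have "u (s *\<^sub>R x) \<le> s * u x" if s: "0 < s" for s x
  proof -
    have "u (s *\<^sub>R x) / s \<le> p (x + t *\<^sub>R a) - t * p a" if "0 \<le> t" for t
    proof -
      have "u (s *\<^sub>R x) \<le> p (s *\<^sub>R (x + t *\<^sub>R a)) - s * t * p a"
        using lower[of "s * t" "s *\<^sub>R x"] s that by (simp add: algebra_simps)
      also have "\<dots> \<le> s * p (x + t *\<^sub>R a) - s * t * p a" using hom[OF s] by simp
      finally show ?thesis using s by (simp add: field_simps)
    qed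
    then have "u (s *\<^sub>R x) / s \<le> u x" unfolding u_eq[of x] by (intro cINF_greatest) auto
    then show ?thesis using s by (simp add: field_simps)
  qed
  moreover have "u x \<le> norm x" for x using ux[of x] le[of x] by linarith
  ultimately show "sublinear_below_norm u" unfolding sublinear_below_norm_def by blast
qed

text \<open>Lower bounds of chains for Zorn's lemma. For subadditivity take p at x and q at y; one
  of them lies below the other everywhere, and its own subadditivity gives u(x + y) <= p x + q
  y.\<close>

lemma sublinear_below_norm_chain:
  assumes C: "\<And>p. p \<in> C \<Longrightarrow> sublinear_below_norm p" and ne: "C \<noteq> {}"
    and chain: "\<And>p q. p \<in> C \<Longrightarrow> q \<in> C \<Longrightarrow> (\<forall>x. p x \<le> q x) \<or> (\<forall>x. q x \<le> p x)"
  defines "u \<equiv> \<lambda>x::'a::real_normed_vector. INF p\<in>C. p x"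
  shows "sublinear_below_norm u" and "p \<in> C \<Longrightarrow> u x \<le> p x"
proof -
  have u_eq: "u x = (INF p\<in>C. p x)" for x by (simp add: u_def)
  have bdd: "bdd_below ((\<lambda>p. p x) ` C)" for x
    using sublinear_below_norm_lower[OF C] by (intro bdd_belowI2[of _ "- norm x"]) auto
  have lower: "u x \<le> p x" if "p \<in> C" for p x
    unfolding u_def by (intro cINF_lower[OF bdd] that)
  show "p \<in> C \<Longrightarrow> u x \<le> p x" by (rule lower)
  have props: "p (x + y) \<le> p x + p y" "0 < t \<Longrightarrow> p (t *\<^sub>R x) \<le> t * p x" "p x \<le> norm x" if "p \<in> C" for p x y t
    using C[OF that] unfolding sublinear_below_norm_def by blast+
  have "u (x + y) \<le> u x + u y" for x y
  proof -
    have pq: "u (x + y) \<le> p x + q y" if "p \<in> C" "q \<in> C" for p q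
      using chain[OF that]
    proof
      assume "\<forall>x. p x \<le> q x"
      then show ?thesis using lower[OF that(1), of "x + y"] props(1)[OF that(1), of x y] by (smt (verit))
    next
      assume "\<forall>x. q x \<le> p x"
      then show ?thesis using lower[OF that(2), of "x + y"] props(1)[OF that(2), of x y] by (smt (verit))
    qed
    have pq': "u (x + y) - p x \<le> u y" if p: "p \<in> C" for p
      unfolding u_eq[of y]
    proof (rule cINF_greatest[OF ne])
      fix q assume "q \<in> C"
      then show "u (x + y) - p x \<le> q y" using pq[OF p, of q] by simp
    qed
    have "u (x + y) - u y \<le> u x"
      unfolding u_eq[of x]
    proof (rule cINF_greatest[OF ne])
      fix p assume "p \<in> C"
      then show "u (x + y) - u y \<le> p x" using pq'[of p] by simp
    qed
    then show ?thesis by simp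
  qed
  moreover have "u (s *\<^sub>R x) \<le> s * u x" if s: "0 < s" for s x
  proof -
    have "u (s *\<^sub>R x) / s \<le> p x" if "p \<in> C" for p
      using lower[OF that, of "s *\<^sub>R x"] props(2)[OF that s, of x] s by (simp add: field_simps)
    then have "u (s *\<^sub>R x) / s \<le> u x" unfolding u_eq[of x] using ne by (intro cINF_greatest) auto
    then show ?thesis using s by (simp add: field_simps)
  qed
  moreover have "u x \<le> norm x" for x
    using ne lower props(3) by (meson all_not_in_conv order_trans)
  ultimately show "sublinear_below_norm u" unfolding sublinear_below_norm_def by blast
qed

text \<open>Zorn's lemma is applied below the norm shifted along x rather than below the norm
  itself: this shifted functional is at most - |x| at - x, so any linear functional below it takes
  the value |x| at x.\<close>

theorem exists_norming_functional:
  fixes x :: "'a::real_normed_vector"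
  shows "\<exists>\<psi> :: 'a \<Rightarrow>\<^sub>L real. norm \<psi> \<le> 1 \<and> blinfun_apply \<psi> x = norm x"
proof -
  define p0 where "p0 y = (INF t\<in>{0..}. norm (y + t *\<^sub>R x) - t * norm x)" for y
  have sn: "sublinear_below_norm (norm :: 'a \<Rightarrow> real)"
    by (auto simp: sublinear_below_norm_def norm_triangle_ineq)
  have p0: "sublinear_below_norm p0" and p0x: "p0 (- x) \<le> - norm x"
    using sublinear_below_norm_shift(1)[OF sn, of x] sublinear_below_norm_shift(3)[OF sn, of 1 "- x" x]
    unfolding p0_def by simp_all
  define A where "A = {p. sublinear_below_norm p \<and> (\<forall>y. p y \<le> p0 y)}"
  \<comment> \<open>The order is reversed, so that the maximal element delivered by Zorn's lemma is
    a pointwise minimal functional.\<close>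
  define R where "R p q \<longleftrightarrow> (\<forall>y. q y \<le> p y)" for p q :: "'a \<Rightarrow> real"
  have "\<exists>m\<in>A. \<forall>a\<in>A. R m a \<longrightarrow> a = m"
  proof (rule predicate_Zorn)
    show "partial_order_on A (relation_of R A)"
      by (rule partial_order_on_relation_ofI) (auto simp: R_def fun_eq_iff intro: order_trans order.antisym)
    fix C assume "C \<in> Chains (relation_of R A)"
    then have CA: "C \<subseteq> A" and ch: "\<And>p q. p \<in> C \<Longrightarrow> q \<in> C \<Longrightarrow> R p q \<or> R q p"
      by (auto simp: Chains_def relation_of_def)
    show "\<exists>u\<in>A. \<forall>a\<in>C. R a u"
    proof (cases "C = {}")
      case True
      then show ?thesis using p0 by (auto simp: A_def)
    next
      case False
      define u where "u y = (INF p\<in>C. p y)" for y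
      have Cs: "sublinear_below_norm p" if "p \<in> C" for p using CA that by (auto simp: A_def)
      have ch': "(\<forall>x. p x \<le> q x) \<or> (\<forall>x. q x \<le> p x)" if "p \<in> C" "q \<in> C" for p q
        using ch[OF that] unfolding R_def by blast
      have "sublinear_below_norm u" unfolding u_def
        by (rule sublinear_below_norm_chain(1)[OF Cs False ch'])
      moreover have le: "u y \<le> p y" if "p \<in> C" for p y unfolding u_def
        by (rule sublinear_below_norm_chain(2)[OF Cs False ch' that])
      moreover have "u y \<le> p0 y" for y
      proof -
        obtain p where "p \<in> C" using False by blast
        then have "p y \<le> p0 y" using CA by (auto simp: A_def)
        then show ?thesis using le[OF \<open>p \<in> C\<close>, of y] by linarith
      qed
      ultimately show ?thesis by (auto simp: A_def R_def)
    qed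
  qed
  then obtain p where pA: "p \<in> A" and min: "\<And>q. q \<in> A \<Longrightarrow> (\<And>y. q y \<le> p y) \<Longrightarrow> q = p"
    unfolding R_def by blast
  have p: "sublinear_below_norm p" and pp0: "p y \<le> p0 y" for y using pA by (auto simp: A_def)
  have sub: "p (y + z) \<le> p y + p z" and hom: "0 < t \<Longrightarrow> p (t *\<^sub>R y) \<le> t * p y" and le: "p y \<le> norm y" for y z t
    using p unfolding sublinear_below_norm_def by blast+
  have add: "p (y + a) = p y + p a" for y a
  proof (rule antisym)
    define u where "u y = (INF t\<in>{0..}. p (y + t *\<^sub>R a) - t * p a)" for y
    have "u = p"
    proof (rule min)
      show "u y \<le> p y" for y unfolding u_def by (rule sublinear_below_norm_shift(2)[OF p])
      then have "u y \<le> p0 y" for y using pp0[of y] by (meson order_trans)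
      then show "u \<in> A" using sublinear_below_norm_shift(1)[OF p, of a] unfolding A_def u_def by blast
    qed
    then show "p y + p a \<le> p (y + a)"
      using sublinear_below_norm_shift(3)[OF p, of 1 y a] unfolding u_def[symmetric] by simp
  qed (rule sub)
  have p_0: "p 0 = 0" using add[of 0 0] by simp
  have neg: "p (- y) = - p y" for y using add[of y "- y"] p_0 by simp
  have pos: "p (t *\<^sub>R y) = t * p y" if "0 < t" for t y
  proof (rule antisym[OF hom[OF that]])
    have "p ((1 / t) *\<^sub>R (t *\<^sub>R y)) \<le> 1 / t * p (t *\<^sub>R y)" using that by (intro hom) auto
    then show "t * p y \<le> p (t *\<^sub>R y)" using that by (simp add: field_simps)
  qed
  have scale: "p (t *\<^sub>R y) = t * p y" for t y
  proof -
    consider "t > 0" | "t = 0" | "t < 0" by linarith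
    then show ?thesis
    proof cases
      case 3
      then show ?thesis using pos[of "- t" y] neg[of "t *\<^sub>R y"] by simp
    qed (use pos p_0 in auto)
  qed
  have abs: "\<bar>p y\<bar> \<le> norm y" for y using le[of y] le[of "- y"] neg[of y] by simp
  have bl: "bounded_linear p"
    by (rule bounded_linear_intro[of _ 1]) (use add scale abs in auto)
  have "norm (Blinfun p) \<le> 1"
    using abs by (intro norm_blinfun_bound) (auto simp: bounded_linear_Blinfun_apply[OF bl])
  moreover have "p x = norm x"
    using pp0[of "- x"] p0x neg[of x] le[of x] by simp
  ultimately show ?thesis
    by (intro exI[of _ "Blinfun p"]) (simp add: bounded_linear_Blinfun_apply[OF bl])
qed

section \<open>Hoelder's inequality and adjoints of finite kernels\<close>

lemma holder_sum:
  fixes x y :: "'i \<Rightarrow> real"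
  assumes pq: "1 < p" "1 < q" "1 / p + 1 / q = 1" and fin: "finite I"
    and x: "\<And>i. i \<in> I \<Longrightarrow> 0 \<le> x i" and y: "\<And>i. i \<in> I \<Longrightarrow> 0 \<le> y i"
  shows "(\<Sum>i\<in>I. x i * y i) \<le> (\<Sum>i\<in>I. x i powr p) powr (1 / p) * (\<Sum>i\<in>I. y i powr q) powr (1 / q)"
proof -
  define X where "X = (\<Sum>i\<in>I. x i powr p)"
  define Y where "Y = (\<Sum>i\<in>I. y i powr q)"
  have XY: "0 \<le> X" "0 \<le> Y" by (simp_all add: X_def Y_def sum_nonneg)
  show ?thesis
  proof (cases "X = 0 \<or> Y = 0")
    case True
    then have "x i * y i = 0" if "i \<in> I" for i
      using fin that unfolding X_def Y_def by (auto simp: sum_nonneg_eq_0_iff)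
    then have "(\<Sum>i\<in>I. x i * y i) = 0" by (intro sum.neutral) auto
    then show ?thesis by simp
  next
    case False
    then have pos: "0 < X" "0 < Y" using XY by auto
    have "x i * y i \<le> X powr (1 / p) * Y powr (1 / q) * (x i powr p / (p * X) + y i powr q / (q * Y))" if "i \<in> I" for i
    proof -
      have "(x i / X powr (1 / p)) * (y i / Y powr (1 / q)) \<le>
        (x i / X powr (1 / p)) powr p / p + (y i / Y powr (1 / q)) powr q / q"
        using pq x[OF that] y[OF that] by (intro Youngs_inequality) auto
      also have "(x i / X powr (1 / p)) powr p = x i powr p / X"
        using pq x[OF that] pos by (simp add: powr_divide powr_powr)
      also have "(y i / Y powr (1 / q)) powr q = y i powr q / Y"
        using pq y[OF that] pos by (simp add: powr_divide powr_powr)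
      finally have "x i * y i / (X powr (1 / p) * Y powr (1 / q)) \<le> x i powr p / (p * X) + y i powr q / (q * Y)"
        by (simp add: mult.commute)
      then show ?thesis using pos by (simp add: pos_divide_le_eq mult.commute)
    qed
    then have "(\<Sum>i\<in>I. x i * y i) \<le>
      (\<Sum>i\<in>I. X powr (1 / p) * Y powr (1 / q) * (x i powr p / (p * X) + y i powr q / (q * Y)))"
      by (rule sum_mono)
    also have "\<dots> = X powr (1 / p) * Y powr (1 / q) * (X / (p * X) + Y / (q * Y))"
      by (simp add: sum_distrib_left[symmetric] sum.distrib sum_divide_distrib[symmetric] X_def Y_def)
    also have "X / (p * X) + Y / (q * Y) = 1" using pos pq by simp
    finally show ?thesis by (simp add: X_def Y_def)
  qed
qed

text \<open>Test with t = c^(q-1). As (q - 1) p = q, both sums turn into X, the sum of the c^q, and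
  X <= Z X^(1/p) is divided by X^(1/p).\<close>

lemma converse_holder_sum:
  fixes c :: "'i \<Rightarrow> real"
  assumes pq: "1 < p" "1 < q" "1 / p + 1 / q = 1" and fin: "finite I"
    and c: "\<And>i. i \<in> I \<Longrightarrow> 0 \<le> c i" and Z: "0 \<le> Z"
    and dual: "\<And>t. (\<And>i. 0 \<le> t i) \<Longrightarrow> (\<Sum>i\<in>I. t i * c i) \<le> Z * (\<Sum>i\<in>I. t i powr p) powr (1 / p)"
  shows "(\<Sum>i\<in>I. c i powr q) \<le> Z powr q"
proof -
  define X where "X = (\<Sum>i\<in>I. c i powr q)"
  have X0: "0 \<le> X" by (simp add: X_def sum_nonneg)
  have pq': "(q - 1) * p = q" using pq by (simp add: field_simps)
  have "(\<Sum>i\<in>I. c i powr (q - 1) * c i) \<le> Z * (\<Sum>i\<in>I. (c i powr (q - 1)) powr p) powr (1 / p)"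
    by (rule dual) simp
  also have "(\<Sum>i\<in>I. (c i powr (q - 1)) powr p) = X"
    unfolding X_def by (simp add: powr_powr pq')
  also have "(\<Sum>i\<in>I. c i powr (q - 1) * c i) = X"
    unfolding X_def
  proof (rule sum.cong[OF refl])
    fix i assume "i \<in> I"
    then show "c i powr (q - 1) * c i = c i powr q"
      using c[of i] pq by (cases "c i = 0") (auto simp: powr_diff)
  qed
  finally have le: "X \<le> Z * X powr (1 / p)" .
  show ?thesis
  proof (cases "X = 0")
    case False
    then have X: "0 < X" using X0 by simp
    have "X powr (1 / q) * X powr (1 / p) = X"
      unfolding powr_add[symmetric] using pq X by (simp add: add.commute)
    then have "X powr (1 / q) * X powr (1 / p) \<le> Z * X powr (1 / p)" using le by simp
    then have "X powr (1 / q) \<le> Z" by (rule mult_right_le_imp_le) (use X in simp)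
    then have "(X powr (1 / q)) powr q \<le> Z powr q" using pq by (intro powr_mono2) auto
    then show ?thesis using X pq by (simp add: powr_powr X_def)
  qed (simp add: X_def[symmetric])
qed

text \<open>The constant bounds p-th powers, so the operator norm on l^p is at most
  \<open>A powr (1 / p)\<close>. This is the reason for the exponent q / p when an estimate passes
  to the conjugate exponent.\<close>

definition lp_bounded :: "nat \<Rightarrow> real \<Rightarrow> real \<Rightarrow> (nat \<Rightarrow> nat \<Rightarrow> 'a::real_normed_vector \<Rightarrow>\<^sub>L 'b::real_normed_vector) \<Rightarrow> bool"
  where "lp_bounded N p A K \<longleftrightarrow>
    (\<forall>a. (\<Sum>i<N. norm (\<Sum>j<N. K i j (a j)) powr p) \<le> A * (\<Sum>j<N. norm (a j) powr p))"

text \<open>The exceptional set \<open>X\<close> stands for the dilated interval of the continuous theory; leaving it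
  unspecified accommodates the distance modulo \<open>N\<close>.\<close>

definition hormander :: "nat \<Rightarrow> real \<Rightarrow> real \<Rightarrow> (nat \<Rightarrow> nat \<Rightarrow> 'a::real_normed_vector \<Rightarrow>\<^sub>L 'b::real_normed_vector) \<Rightarrow> bool"
  where "hormander M B D K \<longleftrightarrow>
    (\<forall>Q. block_interval Q \<subseteq> {..<2 ^ M} \<longrightarrow> (\<exists>X. finite X \<and> real (card X) \<le> D * 2 ^ snd Q \<and>
      (\<forall>j\<in>block_interval Q. (\<Sum>i\<in>{..<2 ^ M} - X. norm (K i j - K i (fst Q))) \<le> B)))"

definition dual_kernel :: "(nat \<Rightarrow> nat \<Rightarrow> 'a::real_normed_vector \<Rightarrow>\<^sub>L 'b::real_normed_vector) \<Rightarrow>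
    nat \<Rightarrow> nat \<Rightarrow> ('b \<Rightarrow>\<^sub>L real) \<Rightarrow>\<^sub>L ('a \<Rightarrow>\<^sub>L real)"
  where "dual_kernel K j i = Blinfun (\<lambda>\<psi>. \<psi> o\<^sub>L K i j)"

lemma dual_kernel_apply: "dual_kernel K j i \<psi> = \<psi> o\<^sub>L K i j"
  unfolding dual_kernel_def
  by (subst bounded_linear_Blinfun_apply)
    (rule bounded_bilinear.bounded_linear_left[OF bounded_bilinear_blinfun_compose], rule refl)

lemma norm_dual_kernel_diff:
  fixes K :: "nat \<Rightarrow> nat \<Rightarrow> 'a::real_normed_vector \<Rightarrow>\<^sub>L 'b::real_normed_vector"
  shows "norm (dual_kernel K j i - dual_kernel K j' i') \<le> norm (K i j - K i' j')"
proof (rule norm_blinfun_bound)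
  fix \<psi> :: "'b \<Rightarrow>\<^sub>L real"
  have "(\<psi> o\<^sub>L K i j) - (\<psi> o\<^sub>L K i' j') = \<psi> o\<^sub>L (K i j - K i' j')"
    by (rule blinfun_eqI) (simp add: blinfun.diff_left blinfun.diff_right)
  then show "norm ((dual_kernel K j i - dual_kernel K j' i') \<psi>) \<le> norm (K i j - K i' j') * norm \<psi>"
    using norm_blinfun_compose[of \<psi> "K i j - K i' j'"]
    by (simp add: blinfun.diff_left dual_kernel_apply mult.commute)
qed simp

text \<open>A functional need not attain its norm, so unit vectors \<open>u j\<close> are taken with
  \<open>c j (u j)\<close> within e of the norm of \<open>c j\<close>. Pairing with weights t and
  applying Hoelder's inequality to the images under K gives the dual estimate up to e times the sum
  of the weights, and e is arbitrary.\<close>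

lemma lp_bounded_dual:
  fixes K :: "nat \<Rightarrow> nat \<Rightarrow> 'a::real_normed_vector \<Rightarrow>\<^sub>L 'b::real_normed_vector"
  assumes pq: "1 < p" "1 < q" "1 / p + 1 / q = 1" and A: "0 \<le> A" and K: "lp_bounded N p A K"
  shows "lp_bounded N q (A powr (q / p)) (dual_kernel K)"
  unfolding lp_bounded_def
proof
  fix b :: "nat \<Rightarrow> 'b \<Rightarrow>\<^sub>L real"
  define c where "c j = (\<Sum>i<N. b i o\<^sub>L K i j)" for j
  define Y where "Y = (\<Sum>i<N. norm (b i) powr q)"
  define Z where "Z = A powr (1 / p) * Y powr (1 / q)"
  have "(\<Sum>j<N. norm (c j) powr q) \<le> Z powr q"
  proof (rule converse_holder_sum[OF pq])
    fix t :: "nat \<Rightarrow> real" assume t: "\<And>i. 0 \<le> t i"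
    have main: "(\<Sum>j<N. t j * norm (c j)) \<le> e * (\<Sum>j<N. t j) + Z * (\<Sum>i<N. t i powr p) powr (1 / p)" if e: "0 < e" for e
    proof -
      have "\<exists>u. norm u \<le> 1 \<and> norm (c j) - e \<le> c j u" for j
      proof -
        have "\<exists>v. norm (c j) - e < norm (c j v) / norm v"
        proof (rule ccontr)
          assume "\<not> ?thesis"
          then have *: "norm (c j v) / norm v \<le> norm (c j) - e" for v by (simp add: not_less)
          have "norm (c j) \<le> norm (c j) - e"
          proof (rule norm_blinfun_bound)
            \<comment> \<open>With 0 / 0 = 0, the zero vector supplies the nonnegativity of the
              bound.\<close>
            show "0 \<le> norm (c j) - e" using *[of 0] by simp
            show "norm (c j v) \<le> (norm (c j) - e) * norm v" for v
              using *[of v] by (cases "v = 0") (auto simp: field_simps)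
          qed
          then show False using e by simp
        qed
        then obtain v where v: "norm (c j) - e < norm (c j v) / norm v" by blast
        define u where "u = (sgn (c j v) / norm v) *\<^sub>R v"
        have "norm u \<le> 1" by (cases "v = 0") (auto simp: u_def sgn_if)
        moreover have "c j u = norm (c j v) / norm v"
          by (simp add: u_def blinfun.scaleR_right sgn_if)
        ultimately show ?thesis using v by (intro exI[of _ u]) auto
      qed
      then obtain u where u: "\<And>j. norm (u j) \<le> 1" "\<And>j. norm (c j) - e \<le> c j (u j)" by metis
      define a where "a j = t j *\<^sub>R u j" for j
      define y where "y i = (\<Sum>j<N. K i j (a j))" for i
      have "(\<Sum>j<N. t j * norm (c j)) \<le> (\<Sum>j<N. e * t j + c j (a j))"
      proof (rule sum_mono)
        fix j
        have "t j * (norm (c j) - e) \<le> t j * c j (u j)" using t u by (intro mult_left_mono) auto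
        then show "t j * norm (c j) \<le> e * t j + c j (a j)"
          by (simp add: a_def blinfun.scaleR_right algebra_simps)
      qed
      also have "\<dots> = e * (\<Sum>j<N. t j) + (\<Sum>j<N. \<Sum>i<N. b i (K i j (a j)))"
        by (simp add: sum.distrib sum_distrib_left c_def blinfun.sum_left)
      also have "(\<Sum>j<N. \<Sum>i<N. b i (K i j (a j))) = (\<Sum>i<N. b i (y i))"
        unfolding y_def by (subst sum.swap) (simp add: blinfun.sum_right)
      also have "\<dots> \<le> (\<Sum>i<N. norm (y i) * norm (b i))"
      proof (rule sum_mono)
        fix i show "b i (y i) \<le> norm (y i) * norm (b i)"
          using norm_blinfun[of "b i" "y i"] by (simp add: mult.commute)
      qed
      also have "\<dots> \<le> (\<Sum>i<N. norm (y i) powr p) powr (1 / p) * Y powr (1 / q)"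
        unfolding Y_def by (intro holder_sum pq) auto
      also have "\<dots> \<le> (A * (\<Sum>j<N. t j powr p)) powr (1 / p) * Y powr (1 / q)"
      proof (intro mult_right_mono powr_mono2)
        have "(\<Sum>i<N. norm (y i) powr p) \<le> A * (\<Sum>j<N. norm (a j) powr p)"
          using K unfolding lp_bounded_def y_def by blast
        also have "\<dots> \<le> A * (\<Sum>j<N. t j powr p)"
          using A t u pq by (intro mult_left_mono sum_mono powr_mono2) (auto simp: a_def mult_left_le)
        finally show "(\<Sum>i<N. norm (y i) powr p) \<le> A * (\<Sum>j<N. t j powr p)" .
      qed (use pq in \<open>auto intro: sum_nonneg\<close>)
      also have "(A * (\<Sum>j<N. t j powr p)) powr (1 / p) = A powr (1 / p) * (\<Sum>j<N. t j powr p) powr (1 / p)"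
        by (rule powr_mult)
      finally show ?thesis by (simp add: Z_def mult_ac)
    qed
    show "(\<Sum>j<N. t j * norm (c j)) \<le> Z * (\<Sum>i<N. t i powr p) powr (1 / p)"
    proof (rule field_le_epsilon)
      fix e :: real assume e: "0 < e"
      have t0: "0 \<le> (\<Sum>j<N. t j)" using t by (simp add: sum_nonneg)
      \<comment> \<open>The weights are fixed before e is chosen, so e may be divided by their sum;
        adding 1 keeps the denominator positive.\<close>
      have "e / ((\<Sum>j<N. t j) + 1) * (\<Sum>j<N. t j) \<le> e"
        using e t0 by (simp add: field_simps)
      then show "(\<Sum>j<N. t j * norm (c j)) \<le> Z * (\<Sum>i<N. t i powr p) powr (1 / p) + e"
        using main[of "e / ((\<Sum>j<N. t j) + 1)"] e t0 by (smt (verit) divide_pos_pos)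
    qed
  qed (auto simp: Z_def)
  also have "Z powr q = A powr (q / p) * Y"
    using pq by (simp add: Z_def powr_mult powr_powr Y_def sum_nonneg)
  finally show "(\<Sum>j<N. norm (\<Sum>i<N. dual_kernel K j i (b i)) powr q) \<le> A powr (q / p) * (\<Sum>i<N. norm (b i) powr q)"
    by (simp add: dual_kernel_apply c_def Y_def)
qed

text \<open>Instead of passing to the bidual, the values \<open>y i\<close> of K are tested with
  functionals norming them; these form the input of the dual kernel.\<close>

lemma lp_bounded_of_dual:
  fixes K :: "nat \<Rightarrow> nat \<Rightarrow> 'a::real_normed_vector \<Rightarrow>\<^sub>L 'b::real_normed_vector"
  assumes pq: "1 < p" "1 < q" "1 / p + 1 / q = 1" and A: "0 \<le> A" and K: "lp_bounded N p A (dual_kernel K)"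
  shows "lp_bounded N q (A powr (q / p)) K"
  unfolding lp_bounded_def
proof
  fix a :: "nat \<Rightarrow> 'a"
  define y where "y i = (\<Sum>j<N. K i j (a j))" for i
  define X where "X = (\<Sum>j<N. norm (a j) powr q)"
  define Z where "Z = A powr (1 / p) * X powr (1 / q)"
  have "\<exists>\<psi> :: nat \<Rightarrow> 'b \<Rightarrow>\<^sub>L real. \<forall>i. norm (\<psi> i) \<le> 1 \<and> blinfun_apply (\<psi> i) (y i) = norm (y i)"
    by (intro choice allI exists_norming_functional)
  then obtain \<psi> :: "nat \<Rightarrow> 'b \<Rightarrow>\<^sub>L real" where \<psi>: "\<And>i. norm (\<psi> i) \<le> 1" "\<And>i. blinfun_apply (\<psi> i) (y i) = norm (y i)"
    by blast
  have "(\<Sum>i<N. norm (y i) powr q) \<le> Z powr q"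
  proof (rule converse_holder_sum[OF pq])
    fix t :: "nat \<Rightarrow> real" assume t: "\<And>i. 0 \<le> t i"
    define b where "b i = t i *\<^sub>R \<psi> i" for i
    define c where "c j = (\<Sum>i<N. dual_kernel K j i (b i))" for j
    have "(\<Sum>i<N. t i * norm (y i)) = (\<Sum>i<N. b i (y i))"
      by (simp add: b_def blinfun.scaleR_left \<psi>)
    also have "\<dots> = (\<Sum>j<N. c j (a j))"
      unfolding y_def c_def blinfun.sum_right blinfun.sum_left dual_kernel_apply
      by (subst sum.swap) simp
    also have "\<dots> \<le> (\<Sum>j<N. norm (c j) * norm (a j))"
    proof (rule sum_mono)
      fix j show "c j (a j) \<le> norm (c j) * norm (a j)"
        using norm_blinfun[of "c j" "a j"] by simp
    qed
    also have "\<dots> \<le> (\<Sum>j<N. norm (c j) powr p) powr (1 / p) * X powr (1 / q)"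
      unfolding X_def by (intro holder_sum pq) auto
    also have "\<dots> \<le> (A * (\<Sum>i<N. t i powr p)) powr (1 / p) * X powr (1 / q)"
    proof (intro mult_right_mono powr_mono2)
      have "(\<Sum>j<N. norm (c j) powr p) \<le> A * (\<Sum>i<N. norm (b i) powr p)"
        using K unfolding lp_bounded_def c_def by blast
      also have "\<dots> \<le> A * (\<Sum>i<N. t i powr p)"
        using A t \<psi> pq by (intro mult_left_mono sum_mono powr_mono2) (auto simp: b_def mult_left_le)
      finally show "(\<Sum>j<N. norm (c j) powr p) \<le> A * (\<Sum>i<N. t i powr p)" .
    qed (use pq in \<open>auto intro: sum_nonneg\<close>)
    also have "(A * (\<Sum>j<N. t j powr p)) powr (1 / p) = A powr (1 / p) * (\<Sum>j<N. t j powr p) powr (1 / p)"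
      by (rule powr_mult)
    finally show "(\<Sum>i<N. t i * norm (y i)) \<le> Z * (\<Sum>i<N. t i powr p) powr (1 / p)"
      by (simp add: Z_def mult_ac)
  qed (auto simp: Z_def)
  also have "Z powr q = A powr (q / p) * X"
    using pq by (simp add: Z_def powr_mult powr_powr X_def sum_nonneg)
  finally show "(\<Sum>i<N. norm (\<Sum>j<N. K i j (a j)) powr q) \<le> A powr (q / p) * (\<Sum>j<N. norm (a j) powr q)"
    by (simp add: y_def X_def)
qed

lemma hormander_dual:
  assumes "hormander M B D (\<lambda>i j. K j i)"
  shows "hormander M B D (dual_kernel K)"
  unfolding hormander_def
proof (intro allI impI)
  fix Q assume "block_interval Q \<subseteq> {..<2 ^ M}"
  then have "\<exists>X. finite X \<and> real (card X) \<le> D * 2 ^ snd Q \<and>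
      (\<forall>j\<in>block_interval Q. (\<Sum>i\<in>{..<2 ^ M} - X. norm (K j i - K (fst Q) i)) \<le> B)"
    using assms unfolding hormander_def by (elim allE impE)
  then obtain X where X: "finite X" "real (card X) \<le> D * 2 ^ snd Q"
      "\<forall>j\<in>block_interval Q. (\<Sum>i\<in>{..<2 ^ M} - X. norm (K j i - K (fst Q) i)) \<le> B"
    by (elim exE conjE)
  have "(\<Sum>i\<in>{..<2 ^ M} - X. norm (dual_kernel K i j - dual_kernel K i (fst Q))) \<le> B"
    if "j \<in> block_interval Q" for j
  proof -
    have "(\<Sum>i\<in>{..<2 ^ M} - X. norm (dual_kernel K i j - dual_kernel K i (fst Q))) \<le>
        (\<Sum>i\<in>{..<2 ^ M} - X. norm (K j i - K (fst Q) i))"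
      by (intro sum_mono norm_dual_kernel_diff)
    also have "\<dots> \<le> B" by (rule bspec[OF X(3) that])
    finally show ?thesis .
  qed
  then show "\<exists>X. finite X \<and> real (card X) \<le> D * 2 ^ snd Q \<and>
      (\<forall>j\<in>block_interval Q. (\<Sum>i\<in>{..<2 ^ M} - X. norm (dual_kernel K i j - dual_kernel K i (fst Q))) \<le> B)"
    using X(1,2) by (intro exI[of _ X] conjI ballI)
qed

text \<open>For p < p0 this is the strong estimate. For p > p0 the conjugate exponents satisfy q <
  q0, so the strong estimate is used for the adjoint kernel, whose Hoermander condition is the
  transposed one, and the result is dualised back. C precedes M and K in the quantifiers: the limit
  over M relies on this uniformity.\<close>

theorem calderon_zygmund_extrapolation:
  fixes p p0 A B D :: real
  assumes p: "1 < p" "1 < p0" and nn: "0 \<le> A" "0 \<le> B" "0 \<le> D"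
  shows "\<exists>C\<ge>0. \<forall>M (K :: nat \<Rightarrow> nat \<Rightarrow> 'a::real_normed_vector \<Rightarrow>\<^sub>L 'b::real_normed_vector).
    lp_bounded (2 ^ M) p0 A K \<and> hormander M B D K \<and> hormander M B D (\<lambda>i j. K j i) \<longrightarrow> lp_bounded (2 ^ M) p C K"
proof -
  define C where "C A p p0 = p * (2 * (A * 4 powr p0 + D + 4 * B + 1) / (p - 1) + 2 powr p0 * A / (p0 - p))" for A p p0 :: real
  have C0: "0 \<le> C A p p0" if "0 \<le> A" "1 < p" "p < p0" for A p p0
    using that nn by (auto simp: C_def intro!: mult_nonneg_nonneg add_nonneg_nonneg divide_nonneg_nonneg)
  \<comment> \<open>Stated for fresh types, since it is applied both to K and to
    \<open>dual_kernel K\<close>, which acts between the dual spaces.\<close>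
  have below: "lp_bounded (2 ^ M) p (C A p p0) K"
    if "1 < p" "p < p0" "0 \<le> A" "lp_bounded (2 ^ M) p0 A K" "hormander M B D K"
    for p p0 A M and K :: "nat \<Rightarrow> nat \<Rightarrow> 'c::real_normed_vector \<Rightarrow>\<^sub>L 'd::real_normed_vector"
    unfolding lp_bounded_def C_def
  proof (intro allI calderon_zygmund_strong[OF that(1-3) nn(2,3)])
    show "(\<Sum>i<2 ^ M. norm (\<Sum>j<2 ^ M. K i j (a j)) powr p0) \<le> A * (\<Sum>j<2 ^ M. norm (a j) powr p0)" for a
      using that(4) unfolding lp_bounded_def by (rule spec)
    fix Q assume "block_interval Q \<subseteq> {..<2 ^ M}"
    with that(5) show "\<exists>X. finite X \<and> real (card X) \<le> D * 2 ^ snd Q \<and>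
      (\<forall>j\<in>block_interval Q. (\<Sum>i\<in>{..<2 ^ M} - X. norm (K i j - K i (fst Q))) \<le> B)"
      unfolding hormander_def by (elim allE impE)
  qed
  consider "p < p0" | "p = p0" | "p0 < p" by linarith
  then show ?thesis
  proof cases
    case 1
    then show ?thesis using below[OF p(1) 1 nn(1)] C0[OF nn(1) p(1) 1] by blast
  next
    case 2
    then show ?thesis using nn by blast
  next
    case 3
    define q q0 where "q = p / (p - 1)" and "q0 = p0 / (p0 - 1)"
    have q: "1 < q" "1 / q + 1 / p = 1" and q0: "1 < q0" "1 / p0 + 1 / q0 = 1"
      using p by (auto simp: q_def q0_def field_simps)
    have "q < q0" using 3 p by (simp add: q_def q0_def field_simps)
    show ?thesis
    proof (intro exI[of _ "C (A powr (q0 / p0)) q q0 powr (p / q)"] conjI allI impI)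
      fix M and K :: "nat \<Rightarrow> nat \<Rightarrow> 'a \<Rightarrow>\<^sub>L 'b"
      assume h: "lp_bounded (2 ^ M) p0 A K \<and> hormander M B D K \<and> hormander M B D (\<lambda>i j. K j i)"
      have "lp_bounded (2 ^ M) q0 (A powr (q0 / p0)) (dual_kernel K)"
        using h p q0 nn by (intro lp_bounded_dual) auto
      moreover have "hormander M B D (dual_kernel K)" using h by (intro hormander_dual) auto
      ultimately have "lp_bounded (2 ^ M) q (C (A powr (q0 / p0)) q q0) (dual_kernel K)"
        using q \<open>q < q0\<close> by (intro below) auto
      then show "lp_bounded (2 ^ M) p (C (A powr (q0 / p0)) q q0 powr (p / q)) K"
        using p q \<open>q < q0\<close> C0 by (intro lp_bounded_of_dual) auto
    qed simp
  qed
qed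

section \<open>Trigonometric polynomials on the torus\<close>

lemma bounded_bilinear_scaleC: "bounded_bilinear (scaleC :: complex \<Rightarrow> 'e::complex_banach \<Rightarrow> 'e)"
proof
  have sr: "r *\<^sub>R z = complex_of_real r * z" for r and z :: complex
    by (simp add: scaleR_conv_of_real)
  fix a b :: complex and x y :: 'e and r :: real
  show "(a + b) *\<^sub>C x = a *\<^sub>C x + b *\<^sub>C x" "a *\<^sub>C (x + y) = a *\<^sub>C x + a *\<^sub>C y"
    by (rule scaleC_add_left, rule scaleC_add_right)
  show "(r *\<^sub>R a) *\<^sub>C x = r *\<^sub>R (a *\<^sub>C x)" "a *\<^sub>C (r *\<^sub>R x) = r *\<^sub>R (a *\<^sub>C x)"
    by (simp_all add: sr scaleC_scaleC scaleC_of_real[symmetric] mult.commute)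
  show "\<exists>K. \<forall>a (b::'e). norm (a *\<^sub>C b) \<le> norm a * norm b * K"
    by (intro exI[of _ 1]) (simp add: norm_scaleC)
qed

interpretation scaleC: bounded_bilinear "scaleC :: complex \<Rightarrow> 'e::complex_banach \<Rightarrow> 'e"
  by (rule bounded_bilinear_scaleC)

lemmas continuous_on_scaleC [continuous_intros] = scaleC.continuous_on

lemma scaleC_one [simp]: "1 *\<^sub>C x = (x :: 'e::complex_banach)"
  using scaleC_of_real[of 1 x] by simp

lemma real_vec_component [simp]: "real_vec k $ i = of_int (k $ i)"
  and real_vec_zero [simp]: "real_vec 0 = 0"
  and real_vec_add: "real_vec (k + m) = real_vec k + real_vec m"
  and real_vec_minus: "real_vec (- k) = - real_vec k"
  by (simp_all add: real_vec_def vec_eq_iff)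

lemma char_fun_zero [simp]: "\<e> 0 x = 1"
  and char_fun_add: "\<e> (k + m) x = \<e> k x * \<e> m x"
  and norm_char_fun [simp]: "norm (\<e> k x) = 1"
  by (simp_all add: char_fun_def real_vec_add inner_left_distrib distrib_left exp_add norm_exp_i_times)

lemma char_fun_shift: "\<e> k (x + t *\<^sub>R axis i 1) = exp (\<i> * of_real (t * of_int (k $ i))) * \<e> k x"
  by (simp add: char_fun_def inner_right_distrib inner_axis distrib_left exp_add mult.commute)

lemma continuous_on_char_fun [continuous_intros]:
  "continuous_on S g \<Longrightarrow> continuous_on S (\<lambda>x. \<e> k (g x))"
  unfolding char_fun_def by (intro continuous_intros)

lemma char_fun_periodic: "\<e> k (x + (2 * pi) *\<^sub>R axis i 1) = \<e> k x"
proof -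
  have "exp (\<i> * of_real (2 * pi * of_int (k $ i))) = 1"
    using exp_integer_2pi[of "of_int (k $ i)"] by (simp add: mult_ac)
  then show ?thesis by (simp add: char_fun_shift)
qed

definition torus_mean :: "('n::finite rvec \<Rightarrow> 'a::banach) \<Rightarrow> 'a"
  where "torus_mean f = (1 / (2 * pi) ^ CARD('n)) *\<^sub>R integral period_cube f"

lemma integrable_on_period_cube:
  fixes f :: "'n::finite rvec \<Rightarrow> 'a::banach"
  assumes "continuous_on UNIV f"
  shows "f integrable_on period_cube"
  by (rule integrable_continuous[OF continuous_on_subset[OF assms]]) simp

lemma torus_mean_const: "torus_mean (\<lambda>x::'n::finite rvec. c) = c"
proof -
  have "measure lborel (period_cube :: 'n rvec set) = (2 * pi) ^ CARD('n)"
    by (subst content_cbox_cart) (auto simp: interval_ne_empty_cart)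
  then show ?thesis by (simp add: torus_mean_def)
qed

lemma torus_mean_add:
  assumes "continuous_on UNIV f" "continuous_on UNIV g"
  shows "torus_mean (\<lambda>x. f x + g x) = torus_mean f + torus_mean g"
  unfolding torus_mean_def using assms
  by (subst integral_add) (auto intro: integrable_on_period_cube simp: scaleR_add_right)

lemma torus_mean_bounded_linear:
  assumes "bounded_linear h" "continuous_on UNIV f"
  shows "torus_mean (\<lambda>x. h (f x)) = h (torus_mean f)"
  using integral_linear[OF integrable_on_period_cube[OF assms(2)] assms(1)]
  by (simp add: torus_mean_def o_def linear_simps(5)[OF assms(1)])

lemma torus_mean_sum:
  assumes "finite I" "\<And>i. i \<in> I \<Longrightarrow> continuous_on UNIV (f i)"
  shows "torus_mean (\<lambda>x. \<Sum>i\<in>I. f i x) = (\<Sum>i\<in>I. torus_mean (f i))"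
  unfolding torus_mean_def using assms
  by (subst integral_sum) (auto intro: integrable_on_period_cube simp: scaleR_sum_right)

lemma torus_mean_mono:
  fixes f g :: "'n::finite rvec \<Rightarrow> real"
  assumes "continuous_on UNIV f" "continuous_on UNIV g" "\<And>x. f x \<le> g x"
  shows "torus_mean f \<le> torus_mean g"
  unfolding torus_mean_def using assms
  by (auto intro!: divide_right_mono integral_le integrable_on_period_cube)

lemma torus_mean_mult_left:
  fixes f :: "'n::finite rvec \<Rightarrow> real"
  shows "torus_mean (\<lambda>x. c * f x) = c * torus_mean f"
  by (simp add: torus_mean_def)

lemma torus_mean_nonneg:
  fixes f :: "'n::finite rvec \<Rightarrow> real"
  assumes "continuous_on UNIV f" "\<And>x. 0 \<le> f x"
  shows "0 \<le> torus_mean f"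
  using torus_mean_mono[of "\<lambda>_. 0" f] assms by (simp add: torus_mean_const)

lemma norm_torus_mean_le:
  assumes "continuous_on UNIV f"
  shows "norm (torus_mean f) \<le> torus_mean (\<lambda>x. norm (f x))"
  unfolding torus_mean_def using assms
  by (auto intro!: mult_left_mono divide_right_mono integral_norm_bound_integral integrable_on_period_cube continuous_intros)

text \<open>The shifted box is cut at 2 pi in coordinate i; by periodicity the slab that sticks out
  has the same integral as the slab [0, t] that was lost.\<close>

lemma torus_mean_shift:
  fixes f :: "'n::finite rvec \<Rightarrow> 'a::banach"
  assumes cont: "continuous_on UNIV f" and per: "\<And>x. f (x + (2 * pi) *\<^sub>R axis i 1) = f x"
    and t: "0 \<le> t" "t \<le> 2 * pi"
  shows "torus_mean (\<lambda>x. f (x + t *\<^sub>R axis i 1)) = torus_mean f"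
proof -
  define B :: "real \<Rightarrow> real \<Rightarrow> 'n rvec set"
    where "B a b = cbox (\<chi> j. if j = i then a else 0) (\<chi> j. if j = i then b else 2 * pi)" for a b
  have int: "f integrable_on B a b" for a b
    unfolding B_def by (rule integrable_continuous[OF continuous_on_subset[OF cont]]) simp
  have split: "integral (B a b) f = integral (B a c) f + integral (B c b) f" if "a \<le> c" "c \<le> b" for a b c
  proof -
    have mem: "x \<in> B a b \<longleftrightarrow> a \<le> x $ i \<and> x $ i \<le> b \<and> (\<forall>j. j \<noteq> i \<longrightarrow> 0 \<le> x $ j \<and> x $ j \<le> 2 * pi)" for a b x
    proof -
      have all: "(\<forall>j. P j) \<longleftrightarrow> P i \<and> (\<forall>j. j \<noteq> i \<longrightarrow> P j)" for P by (safe, auto)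
      show ?thesis unfolding B_def mem_box_cart vec_lambda_beta by (subst all) auto
    qed
    have 1: "B a b \<inter> {x. x \<bullet> axis i 1 \<le> c} = B a c" "B a b \<inter> {x. x \<bullet> axis i 1 \<ge> c} = B c b"
      using that by (auto simp: mem inner_axis)
    have "(f has_integral integral (B a c) f + integral (B c b) f) (cbox (\<chi> j. if j = i then a else 0) (\<chi> j. if j = i then b else 2 * pi))"
    proof (rule has_integral_split[where k = "axis i 1" and c = c], unfold B_def[symmetric] 1)
      show "(f has_integral integral (B a c) f) (B a c)" "(f has_integral integral (B c b) f) (B c b)"
        using int by (simp_all add: has_integral_integral[symmetric])
    qed (simp add: axis_in_Basis_iff)
    then show ?thesis unfolding B_def[symmetric] by (rule integral_unique)
  qed
  have shift: "integral (B a b) (\<lambda>x. f (x + s *\<^sub>R axis i 1)) = integral (B (a + s) (b + s)) f" for a b s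
  proof -
    have "((\<lambda>x. f (1 *\<^sub>R x + s *\<^sub>R axis i 1)) has_integral (integral (B (a + s) (b + s)) f /\<^sub>R 1 ^ DIM('n rvec)))
      (cbox (((\<chi> j. if j = i then a + s else 0) - s *\<^sub>R axis i 1) /\<^sub>R 1)
            (((\<chi> j. if j = i then b + s else 2 * pi) - s *\<^sub>R axis i 1) /\<^sub>R 1))"
      using int[of "a + s" "b + s"] unfolding B_def
      by (intro has_integral_affinity') (auto simp: has_integral_integral[symmetric])
    moreover have "(\<chi> j. if j = i then a + s else 0) - s *\<^sub>R axis i 1 = (\<chi> j. if j = i then a else 0)"
      "(\<chi> j. if j = i then b + s else 2 * pi) - s *\<^sub>R axis i 1 = (\<chi> j. if j = i then b else 2 * pi)"
      by (auto simp: vec_eq_iff axis_def)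
    ultimately show ?thesis by (intro integral_unique) (simp add: B_def)
  qed
  have cube: "period_cube = B 0 (2 * pi)"
    unfolding B_def by (rule arg_cong2[where f = cbox]) (simp_all add: vec_eq_iff)
  have "integral (B 0 (2 * pi)) (\<lambda>x. f (x + t *\<^sub>R axis i 1)) = integral (B t (2 * pi + t)) f"
    using shift[of 0 "2 * pi" t] by simp
  also have "\<dots> = integral (B 0 (2 * pi + t)) f - integral (B 0 t) f"
    using split[of 0 t "2 * pi + t"] t by simp
  also have "\<dots> = integral (B 0 (2 * pi)) f + integral (B (2 * pi) (2 * pi + t)) f - integral (B 0 t) f"
    using split[of 0 "2 * pi" "2 * pi + t"] t by simp
  also have "integral (B (2 * pi) (2 * pi + t)) f = integral (B 0 t) f"
    using shift[of 0 t "2 * pi"] by (simp add: per add.commute)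
  finally show ?thesis by (simp add: torus_mean_def cube)
qed

text \<open>If the i-th entry of k is nonzero, translation by pi / |k_i| in coordinate i multiplies
  the character by -1 and preserves the mean, so the mean is its own negative.\<close>

lemma torus_mean_char_fun: "torus_mean (\<e> k) = (if k = 0 then 1 else 0)"
proof (cases "k = 0")
  case True
  then have "\<e> k = (\<lambda>x. 1)" by auto
  then show ?thesis using True by (simp add: torus_mean_const)
next
  case False
  then obtain i where i: "k $ i \<noteq> 0" by (auto simp: vec_eq_iff)
  define t where "t = pi / \<bar>of_int (k $ i)\<bar>"
  have "1 \<le> \<bar>of_int (k $ i) :: real\<bar>" using i by linarith
  then have t: "0 \<le> t" "t \<le> 2 * pi" by (auto simp: t_def field_simps intro: order_trans[of _ pi])
  have "t * of_int (k $ i) = pi \<or> t * of_int (k $ i) = - pi"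
    using i by (auto simp: t_def abs_if)
  then have e: "exp (\<i> * of_real (t * of_int (k $ i))) = -1"
    by (auto simp: exp_minus simp del: of_real_mult)
  have "torus_mean (\<e> k) = torus_mean (\<lambda>x. \<e> k (x + t *\<^sub>R axis i 1))"
    by (rule torus_mean_shift[symmetric, OF continuous_on_char_fun[OF continuous_on_id] char_fun_periodic t])
  also have "\<dots> = torus_mean (\<lambda>x. (-1) *\<^sub>R \<e> k x)"
    unfolding char_fun_shift e by simp
  also have "\<dots> = - torus_mean (\<e> k)"
    unfolding torus_mean_def integral_cmul by simp
  finally show ?thesis using False by (simp add: equal_neg_zero)
qed

lemma torus_mean_char_fun_scaleC:
  "torus_mean (\<lambda>x. \<e> k x *\<^sub>C a) = (if k = 0 then a else 0)"
proof -
  have "torus_mean (\<lambda>x. \<e> k x *\<^sub>C a) = torus_mean (\<e> k) *\<^sub>C a"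
    by (rule torus_mean_bounded_linear[OF scaleC.bounded_linear_left continuous_on_char_fun[OF continuous_on_id]])
  then show ?thesis by (simp add: torus_mean_char_fun scaleC.zero_left)
qed

definition trig_poly :: "'n::finite zvec set \<Rightarrow> ('n zvec \<Rightarrow> 'e::complex_banach) \<Rightarrow> 'n rvec \<Rightarrow> 'e"
  where "trig_poly K a x = (\<Sum>k\<in>K. \<e> k x *\<^sub>C a k)"

lemma continuous_on_trig_poly [continuous_intros]:
  "continuous_on S g \<Longrightarrow> continuous_on S (\<lambda>x. trig_poly K a (g x))"
  unfolding trig_poly_def by (intro continuous_intros)

lemma trig_poly_periodic: "trig_poly K a (x + (2 * pi) *\<^sub>R axis i 1) = trig_poly K a x"
  by (simp add: trig_poly_def char_fun_periodic)

lemma trig_poly_mean: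
  assumes "finite K"
  shows "torus_mean (\<lambda>x. \<e> (- m) x *\<^sub>C trig_poly K a x) = (if m \<in> K then a m else 0)"
proof -
  have "torus_mean (\<lambda>x. \<e> (- m) x *\<^sub>C trig_poly K a x) = torus_mean (\<lambda>x. \<Sum>k\<in>K. \<e> (k - m) x *\<^sub>C a k)"
    by (simp add: trig_poly_def scaleC.sum_right scaleC_scaleC char_fun_add[symmetric])
  also have "\<dots> = (\<Sum>k\<in>K. if k - m = 0 then a k else 0)"
    using assms by (subst torus_mean_sum) (auto intro!: continuous_intros simp: torus_mean_char_fun_scaleC)
  also have "\<dots> = (if m \<in> K then a m else 0)"
    using assms by simp
  finally show ?thesis .
qed

lemma char_fun_has_partial:
  "((\<lambda>t. c * \<e> k (x + t *\<^sub>R axis i 1)) has_vector_derivative (c * (\<i> * of_int (k $ i))) * \<e> k x) (at 0)"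
proof -
  have "((\<lambda>t. exp (t *\<^sub>R (\<i> * of_int (k $ i)))) has_vector_derivative
      exp (0 *\<^sub>R (\<i> * of_int (k $ i))) * (\<i> * of_int (k $ i))) (at 0)"
    by (rule exp_scaleR_has_vector_derivative_right)
  then have "((\<lambda>t. exp (\<i> * of_real (t * of_int (k $ i)))) has_vector_derivative \<i> * of_int (k $ i)) (at 0)"
    by (simp add: scaleR_conv_of_real mult_ac)
  from has_vector_derivative_mult_left[OF has_vector_derivative_mult_right[OF this, of c], of "\<e> k x"]
  show ?thesis by (simp add: char_fun_shift mult.assoc)
qed

lemma partial_char_fun: "partial i (\<lambda>x. c * \<e> k x) = (\<lambda>x. (c * (\<i> * of_int (k $ i))) * \<e> k x)"
  unfolding partial_def by (rule ext, rule vector_derivative_at[OF char_fun_has_partial])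

lemma foldr_partial_char_fun:
  "\<exists>c'. foldr partial is (\<lambda>x. c * \<e> k x) = (\<lambda>x. c' * \<e> k x)"
  by (induction "is") (auto simp: partial_char_fun)

lemma char_fun_test_function [simp]: "\<e> k \<in> test_functions"
proof -
  have "smooth (\<e> k)"
    unfolding smooth_def
  proof (intro allI conjI)
    fix "is" i x
    obtain c' where c': "foldr partial is (\<e> k) = (\<lambda>x. c' * \<e> k x)"
      using foldr_partial_char_fun[of "is" 1 k] by auto
    show "continuous_on UNIV (foldr partial is (\<e> k))"
      unfolding c' by (intro continuous_intros)
    show "(\<lambda>t. foldr partial is (\<e> k) (x + t *\<^sub>R axis i 1)) differentiable (at 0)"
      unfolding c' by (rule differentiableI_vector[OF char_fun_has_partial])
  qed
  then show ?thesis by (simp add: test_functions_def char_fun_periodic)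
qed

lemma fourier_coeff_distribution_of:
  fixes g :: "'n::{finite,linorder} rvec \<Rightarrow> 'e::complex_banach"
  shows "fourier_coeff (distribution_of g) k = torus_mean (\<lambda>x. \<e> (- k) x *\<^sub>C g x)"
  by (simp add: fourier_coeff_def distribution_of_def torus_mean_def)

lemma fourier_coeff_trig_poly:
  assumes "finite K"
  shows "fourier_coeff (distribution_of (trig_poly K a)) k = (if k \<in> K then a k else 0)"
  by (simp add: fourier_coeff_distribution_of trig_poly_mean[OF assms])

text \<open>The tangent of u^p at m lies below the curve; it is Young's inequality rearranged.
  Averaged against a probability weight, with m the mean, it yields Jensen's inequality for sums and
  for means over the torus alike.\<close>

lemma powr_tangent:
  fixes u m p :: real
  assumes "1 < p" "0 \<le> u" "0 \<le> m"
  shows "p * m powr (p - 1) * u - (p - 1) * m powr p \<le> u powr p"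
proof -
  define q where "q = p / (p - 1)"
  have q: "1 < q" "1 / p + 1 / q = 1" using assms by (auto simp: q_def field_simps)
  have "u * m powr (p - 1) \<le> u powr p / p + (m powr (p - 1)) powr q / q"
    using assms q by (intro Youngs_inequality) auto
  also have "(m powr (p - 1)) powr q = m powr p" using assms by (simp add: powr_powr q_def)
  finally have "p * (u * m powr (p - 1)) \<le> p * (u powr p / p + m powr p / q)"
    using assms by (intro mult_left_mono) auto
  also have "\<dots> = u powr p + (p - 1) * m powr p"
    using assms by (simp add: q_def field_simps)
  finally show ?thesis by (simp add: mult_ac)
qed

lemma jensen_powr_sum:
  fixes w t :: "'i \<Rightarrow> real"
  assumes p: "1 < p" and fin: "finite I" and w: "\<And>i. i \<in> I \<Longrightarrow> 0 \<le> w i" "(\<Sum>i\<in>I. w i) = 1"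
    and t: "\<And>i. i \<in> I \<Longrightarrow> 0 \<le> t i"
  shows "(\<Sum>i\<in>I. w i * t i) powr p \<le> (\<Sum>i\<in>I. w i * t i powr p)"
proof -
  define m where "m = (\<Sum>i\<in>I. w i * t i)"
  have m: "0 \<le> m" unfolding m_def using w t by (intro sum_nonneg) auto
  have "m powr p = p * m powr (p - 1) * m - (p - 1) * m powr p"
    using p m by (cases "m = 0") (auto simp: powr_diff field_simps)
  also have "\<dots> = (\<Sum>i\<in>I. w i * (p * m powr (p - 1) * t i - (p - 1) * m powr p))"
  proof -
    have "(\<Sum>i\<in>I. w i * (p * m powr (p - 1) * t i - (p - 1) * m powr p))
       = (\<Sum>i\<in>I. p * m powr (p - 1) * (w i * t i) - (p - 1) * m powr p * w i)"
      by (intro sum.cong) (auto simp: algebra_simps)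
    also have "\<dots> = p * m powr (p - 1) * m - (p - 1) * m powr p"
      unfolding sum_subtractf sum_distrib_left[symmetric] w(2) m_def[symmetric] by simp
    finally show ?thesis by simp
  qed
  also have "\<dots> \<le> (\<Sum>i\<in>I. w i * t i powr p)"
    using w t m p by (intro sum_mono mult_left_mono powr_tangent) auto
  finally show ?thesis by (simp add: m_def)
qed

lemma continuous_on_powr_const:
  fixes f :: "'a::topological_space \<Rightarrow> real"
  assumes "continuous_on S f" "\<And>x. x \<in> S \<Longrightarrow> 0 \<le> f x" "0 < p"
  shows "continuous_on S (\<lambda>x. f x powr p)"
  using assms by (intro continuous_on_powr') (auto intro: continuous_intros)

lemma jensen_powr_torus_mean:
  fixes w t :: "'n::finite rvec \<Rightarrow> real"
  assumes p: "1 < p" and cont: "continuous_on UNIV w" "continuous_on UNIV t"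
    and w: "\<And>x. 0 \<le> w x" "torus_mean w = 1" and t: "\<And>x. 0 \<le> t x"
  shows "torus_mean (\<lambda>x. w x * t x) powr p \<le> torus_mean (\<lambda>x. w x * t x powr p)"
proof -
  define m where "m = torus_mean (\<lambda>x. w x * t x)"
  have m: "0 \<le> m" unfolding m_def using w t cont by (intro torus_mean_nonneg continuous_intros) auto
  have "m powr p = p * m powr (p - 1) * m - (p - 1) * m powr p"
    using p m by (cases "m = 0") (auto simp: powr_diff field_simps)
  also have "\<dots> = torus_mean (\<lambda>x. p * m powr (p - 1) * (w x * t x)) + torus_mean (\<lambda>x. - ((p - 1) * m powr p) * w x)"
    unfolding torus_mean_mult_left m_def[symmetric] w(2) by simp
  also have "\<dots> = torus_mean (\<lambda>x. p * m powr (p - 1) * (w x * t x) + - ((p - 1) * m powr p) * w x)"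
    using cont by (intro torus_mean_add[symmetric] continuous_intros)
  also have "\<dots> \<le> torus_mean (\<lambda>x. w x * t x powr p)"
  proof (rule torus_mean_mono)
    fix x
    have "w x * (p * m powr (p - 1) * t x - (p - 1) * m powr p) \<le> w x * t x powr p"
      using w t m p by (intro mult_left_mono powr_tangent) auto
    then show "p * m powr (p - 1) * (w x * t x) + - ((p - 1) * m powr p) * w x \<le> w x * t x powr p"
      by (simp add: algebra_simps)
  qed (use cont p t in \<open>auto intro!: continuous_intros continuous_on_powr_const\<close>)
  finally show ?thesis by (simp add: m_def)
qed

section \<open>Lp norms of continuous functions\<close>

lemma Lp_norm_eq_torus_mean:
  fixes f :: "'n::finite rvec \<Rightarrow> 'e::real_normed_vector"
  assumes "continuous_on UNIV f" "0 < p"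
  shows "Lp_norm p f = torus_mean (\<lambda>x. norm (f x) powr p) powr (1 / p)"
proof -
  have "continuous_on UNIV (\<lambda>x. norm (f x) powr p)"
    using assms by (intro continuous_on_powr_const continuous_intros) auto
  then have "set_integrable lborel period_cube (\<lambda>x. norm (f x) powr p)"
    unfolding set_integrable_def
    by (intro borel_integrable_compact compact_cbox) (auto intro: continuous_on_subset)
  then show ?thesis
    unfolding Lp_norm_def torus_mean_def by (simp add: set_borel_integral_eq_integral(2))
qed

lemma Lp_norm_nonneg [simp]: "0 \<le> Lp_norm p f"
  by (simp add: Lp_norm_def)

lemma Lp_norm_powr:
  assumes "continuous_on UNIV f" "0 < p"
  shows "Lp_norm p f powr p = torus_mean (\<lambda>x. norm (f x) powr p)"
proof -
  have "0 \<le> torus_mean (\<lambda>x. norm (f x) powr p)"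
    using assms by (intro torus_mean_nonneg continuous_on_powr_const continuous_intros) auto
  then show ?thesis using assms by (simp add: Lp_norm_eq_torus_mean powr_powr)
qed

lemma Lp_norm_le_iff:
  assumes "continuous_on UNIV f" "0 < p" "0 \<le> c"
  shows "Lp_norm p f \<le> c \<longleftrightarrow> torus_mean (\<lambda>x. norm (f x) powr p) \<le> c powr p"
  using assms powr_mono2[of p "Lp_norm p f" c] powr_mono2[of "1 / p" "Lp_norm p f powr p" "c powr p"]
  by (auto simp: Lp_norm_powr[symmetric] powr_powr)

lemma Lp_norm_cong_norm:
  assumes "\<And>x. norm (f x) = norm (g x)"
  shows "Lp_norm p f = Lp_norm p g"
  by (simp add: Lp_norm_def assms)

lemma Lp_norm_le_sup:
  fixes f :: "'n::finite rvec \<Rightarrow> 'e::real_normed_vector"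
  assumes "continuous_on UNIV f" "0 < p" "0 \<le> c" "\<And>x. norm (f x) \<le> c"
  shows "Lp_norm p f \<le> c"
proof -
  have "torus_mean (\<lambda>x. norm (f x) powr p) \<le> torus_mean (\<lambda>x::'n rvec. c powr p)"
    using assms by (intro torus_mean_mono powr_mono2 continuous_on_powr_const continuous_intros) auto
  then show ?thesis using assms by (simp add: Lp_norm_le_iff torus_mean_const)
qed

lemma Lp_norm_bounded_mult:
  assumes "continuous_on UNIV f" "continuous_on UNIV g" "0 < p" "0 \<le> c" "\<And>x. norm (g x) \<le> c * norm (f x)"
  shows "Lp_norm p g \<le> c * Lp_norm p f"
proof -
  have "torus_mean (\<lambda>x. norm (g x) powr p) \<le> torus_mean (\<lambda>x. c powr p * norm (f x) powr p)"
    using assms by (auto simp: powr_mult[symmetric]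
      intro!: torus_mean_mono powr_mono2 continuous_on_powr_const continuous_on_norm continuous_on_mult_left)
  then show ?thesis
    using assms by (simp add: Lp_norm_le_iff torus_mean_mult_left powr_mult Lp_norm_powr)
qed

lemma Lp_norm_scaleR:
  assumes "continuous_on UNIV f" "0 < p"
  shows "Lp_norm p (\<lambda>x. c *\<^sub>R f x) = \<bar>c\<bar> * Lp_norm p f"
proof -
  have "Lp_norm p (\<lambda>x. c *\<^sub>R f x) = torus_mean (\<lambda>x. \<bar>c\<bar> powr p * norm (f x) powr p) powr (1 / p)"
    using assms by (subst Lp_norm_eq_torus_mean) (auto intro!: continuous_intros simp: powr_mult)
  then show ?thesis
    using assms by (simp add: torus_mean_mult_left powr_mult powr_powr Lp_norm_eq_torus_mean)
qed

text \<open>Minkowski's inequality from convexity: (f + g) / (a + b) is a convex combination of f /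
  a and g / b, where a and b exceed the two norms by e / 2. The excess makes them positive even when
  a norm is 0.\<close>

lemma Lp_norm_triangle:
  assumes cont: "continuous_on UNIV f" "continuous_on UNIV g" and p: "1 < p"
  shows "Lp_norm p (\<lambda>x. f x + g x) \<le> Lp_norm p f + Lp_norm p g"
proof (rule field_le_epsilon)
  fix e :: real assume e: "0 < e"
  define a b where "a = Lp_norm p f + e / 2" and "b = Lp_norm p g + e / 2"
  have ab: "0 < a" "0 < b" using e by (auto simp: a_def b_def add_nonneg_pos)
  define u v where "u = a / (a + b)" and "v = b / (a + b)"
  have uv: "0 < u" "0 < v" "u + v = 1"
    using ab add_pos_pos[OF ab] by (auto simp: u_def v_def add_divide_distrib[symmetric])
  have "norm (f x + g x) powr p \<le> (a + b) powr p * (u / a powr p * norm (f x) powr p + v / b powr p * norm (g x) powr p)" for x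
  proof -
    have "norm (f x + g x) \<le> norm (f x) + norm (g x)" by (rule norm_triangle_ineq)
    also have "\<dots> = (a + b) * (u * (norm (f x) / a) + v * (norm (g x) / b))"
    proof -
      have "(a + b) * u = a" "(a + b) * v = b" using add_pos_pos[OF ab] by (simp_all add: u_def v_def)
      then have "(a + b) * (u * (norm (f x) / a) + v * (norm (g x) / b)) = a * (norm (f x) / a) + b * (norm (g x) / b)"
        unfolding distrib_left mult.assoc[symmetric] by simp
      then show ?thesis using ab by simp
    qed
    finally have "norm (f x + g x) powr p \<le> ((a + b) * (u * (norm (f x) / a) + v * (norm (g x) / b))) powr p"
      using p by (intro powr_mono2) auto
    also have "\<dots> = (a + b) powr p * (u * (norm (f x) / a) + v * (norm (g x) / b)) powr p"
      by (rule powr_mult)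
    also have "(u * (norm (f x) / a) + v * (norm (g x) / b)) powr p \<le> u * (norm (f x) / a) powr p + v * (norm (g x) / b) powr p"
      using jensen_powr_sum[OF p, of "{True, False}" "\<lambda>i. if i then u else v" "\<lambda>i. if i then norm (f x) / a else norm (g x) / b"]
        uv ab by simp
    finally show ?thesis using ab by (simp add: powr_divide)
  qed
  note pointwise = this
  have p0: "0 < p" using p by simp
  have cf: "continuous_on UNIV (\<lambda>x. norm (f x) powr p)" and cg: "continuous_on UNIV (\<lambda>x. norm (g x) powr p)"
    and cfg: "continuous_on UNIV (\<lambda>x. norm (f x + g x) powr p)"
    using cont p0 by (auto intro!: continuous_on_powr_const continuous_on_norm continuous_on_add)
  have "torus_mean (\<lambda>x. norm (f x + g x) powr p) \<le>
     torus_mean (\<lambda>x. (a + b) powr p * (u / a powr p * norm (f x) powr p + v / b powr p * norm (g x) powr p))"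
    by (rule torus_mean_mono[OF cfg _ pointwise]) (intro continuous_on_mult_left continuous_on_add cf cg)
  also have "\<dots> = (a + b) powr p * (u / a powr p * Lp_norm p f powr p + v / b powr p * Lp_norm p g powr p)"
    unfolding torus_mean_mult_left torus_mean_add[OF continuous_on_mult_left[OF cf] continuous_on_mult_left[OF cg]]
      Lp_norm_powr[OF cont(1) p0] Lp_norm_powr[OF cont(2) p0] ..
  also have "\<dots> \<le> (a + b) powr p * (u / a powr p * a powr p + v / b powr p * b powr p)"
    using uv e p by (intro mult_left_mono add_mono powr_mono2) (auto simp: a_def b_def)
  also have "\<dots> = (a + b) powr p" using uv ab by simp
  finally have "Lp_norm p (\<lambda>x. f x + g x) \<le> a + b"
    using cont p ab by (subst Lp_norm_le_iff) (auto intro: continuous_intros)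
  then show "Lp_norm p (\<lambda>x. f x + g x) \<le> Lp_norm p f + Lp_norm p g + e" by (simp add: a_def b_def)
qed

lemma Lp_norm_zero [simp]: "0 < p \<Longrightarrow> Lp_norm p (\<lambda>x. 0) = 0"
  by (simp add: Lp_norm_def)

lemma Lp_norm_sum:
  assumes "finite I" "\<And>i. i \<in> I \<Longrightarrow> continuous_on UNIV (f i)" "1 < p"
  shows "Lp_norm p (\<lambda>x. \<Sum>i\<in>I. f i x) \<le> (\<Sum>i\<in>I. Lp_norm p (f i))"
  using assms
proof (induction I rule: finite_induct)
  case (insert i I)
  have "Lp_norm p (\<lambda>x. f i x + (\<Sum>i\<in>I. f i x)) \<le> Lp_norm p (f i) + Lp_norm p (\<lambda>x. \<Sum>i\<in>I. f i x)"
    using insert by (intro Lp_norm_triangle continuous_on_sum) auto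
  then show ?case using insert by simp
qed simp

text \<open>The symbol is a plain function on E at each frequency, so that indicators such as
  \<open>if P k then x else 0\<close> can be composed and summed without wrapping them as bounded
  operators.\<close>

definition Lp_multiplier_bound :: "real \<Rightarrow> ('n::finite zvec \<Rightarrow> 'e::complex_banach \<Rightarrow> 'e) \<Rightarrow> real \<Rightarrow> bool"
  where "Lp_multiplier_bound p m C \<longleftrightarrow>
    (\<forall>K a. finite K \<longrightarrow> Lp_norm p (trig_poly K (\<lambda>k. m k (a k))) \<le> C * Lp_norm p (trig_poly K a))"

lemma Lp_multiplier_boundD:
  "Lp_multiplier_bound p m C \<Longrightarrow> finite K \<Longrightarrow>
    Lp_norm p (trig_poly K (\<lambda>k. m k (a k))) \<le> C * Lp_norm p (trig_poly K a)"
  by (simp add: Lp_multiplier_bound_def)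

lemma continuous_trig_poly [simp]: "continuous_on S (trig_poly K a)"
  using continuous_on_trig_poly[OF continuous_on_id] by simp

lemma Lp_multiplier_bound_compose:
  assumes "Lp_multiplier_bound p m C" "Lp_multiplier_bound p m' C'" "0 \<le> C"
  shows "Lp_multiplier_bound p (\<lambda>k x. m k (m' k x)) (C * C')"
  unfolding Lp_multiplier_bound_def
proof (intro allI impI)
  fix K :: "'a zvec set" and a :: "'a zvec \<Rightarrow> 'b" assume K: "finite K"
  have "Lp_norm p (trig_poly K (\<lambda>k. m k (m' k (a k)))) \<le> C * Lp_norm p (trig_poly K (\<lambda>k. m' k (a k)))"
    by (rule Lp_multiplier_boundD[OF assms(1) K])
  also have "\<dots> \<le> C * (C' * Lp_norm p (trig_poly K a))"
    using assms(3) Lp_multiplier_boundD[OF assms(2) K] by (intro mult_left_mono)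
  finally show "Lp_norm p (trig_poly K (\<lambda>k. m k (m' k (a k)))) \<le> C * C' * Lp_norm p (trig_poly K a)" by simp
qed

lemma Lp_multiplier_bound_sum:
  assumes "finite I" "1 < p" "\<And>i. i \<in> I \<Longrightarrow> Lp_multiplier_bound p (m i) (C i)"
  shows "Lp_multiplier_bound p (\<lambda>k x. \<Sum>i\<in>I. m i k x) (\<Sum>i\<in>I. C i)"
  unfolding Lp_multiplier_bound_def
proof (intro allI impI)
  fix K :: "'b zvec set" and a :: "'b zvec \<Rightarrow> 'c" assume K: "finite K"
  have "trig_poly K (\<lambda>k. \<Sum>i\<in>I. m i k (a k)) = (\<lambda>x. \<Sum>i\<in>I. trig_poly K (\<lambda>k. m i k (a k)) x)"
    unfolding trig_poly_def scaleC.sum_right by (rule ext) (rule sum.swap)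
  then have "Lp_norm p (trig_poly K (\<lambda>k. \<Sum>i\<in>I. m i k (a k))) \<le> (\<Sum>i\<in>I. Lp_norm p (trig_poly K (\<lambda>k. m i k (a k))))"
    using assms by (simp add: Lp_norm_sum)
  also have "\<dots> \<le> (\<Sum>i\<in>I. C i * Lp_norm p (trig_poly K a))"
    by (intro sum_mono Lp_multiplier_boundD assms K)
  finally show "Lp_norm p (trig_poly K (\<lambda>k. \<Sum>i\<in>I. m i k (a k))) \<le> (\<Sum>i\<in>I. C i) * Lp_norm p (trig_poly K a)"
    by (simp add: sum_distrib_right)
qed

text \<open>A complex-linear A commutes with multiplication by characters, hence acts on the values
  of the polynomial.\<close>

lemma Lp_multiplier_bound_const:
  fixes A :: "'e::complex_banach \<Rightarrow>\<^sub>L 'e"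
  assumes "A \<in> L_ops" "0 < p"
  shows "Lp_multiplier_bound p (\<lambda>k :: 'n::finite zvec. blinfun_apply A) (norm A)"
  unfolding Lp_multiplier_bound_def
proof (intro allI impI)
  fix K :: "'n zvec set" and a :: "'n zvec \<Rightarrow> 'e" assume K: "finite K"
  have "trig_poly K (\<lambda>k. blinfun_apply A (a k)) x = blinfun_apply A (trig_poly K a x)" for x
    using assms(1) by (simp add: trig_poly_def blinfun.sum_right L_ops_def)
  then show "Lp_norm p (trig_poly K (\<lambda>k. blinfun_apply A (a k))) \<le> norm A * Lp_norm p (trig_poly K a)"
    by (intro Lp_norm_bounded_mult continuous_trig_poly assms) (simp_all add: norm_blinfun)
qed

lemma trig_poly_shift: "trig_poly ((\<lambda>k. k + c) ` K) a x = \<e> c x *\<^sub>C trig_poly K (\<lambda>k. a (k + c)) x"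
  unfolding trig_poly_def
  by (subst sum.reindex) (auto simp: scaleC.sum_right scaleC_scaleC char_fun_add mult.commute)

lemma Lp_norm_trig_poly_shift:
  "Lp_norm p (trig_poly ((\<lambda>k. k + c) ` K) a) = Lp_norm p (trig_poly K (\<lambda>k. a (k + c)))"
  by (rule Lp_norm_cong_norm) (simp add: trig_poly_shift norm_scaleC)

text \<open>Multiplication by the character of frequency c translates the spectrum and leaves the
  pointwise norm unchanged.\<close>

lemma Lp_multiplier_bound_shift:
  assumes "Lp_multiplier_bound p m C"
  shows "Lp_multiplier_bound p (\<lambda>k. m (k - c)) C"
  unfolding Lp_multiplier_bound_def
proof (intro allI impI)
  fix K :: "'a zvec set" and a :: "'a zvec \<Rightarrow> 'b" assume K: "finite K"
  define L where "L = (\<lambda>k. k - c) ` K"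
  have KL: "K = (\<lambda>k. k + c) ` L" by (auto simp: L_def image_image)
  have "finite L" using K by (simp add: L_def)
  from Lp_multiplier_boundD[OF assms this, of "\<lambda>k. a (k + c)"]
  show "Lp_norm p (trig_poly K (\<lambda>k. m (k - c) (a k))) \<le> C * Lp_norm p (trig_poly K a)"
    unfolding KL Lp_norm_trig_poly_shift by simp
qed

text \<open>The discrete multiplier condition recovers the coefficients from the polynomial and sums
  over the nonzero ones. Summing over any finite K that contains them gives the same polynomial, so
  the condition can be phrased with coefficient families.\<close>

lemma UMD_space_iff:
  "UMD_space TYPE('n::{finite,linorder}) TYPE('e::complex_banach) \<longleftrightarrow>
    (\<exists>p>1. \<exists>C>0. Lp_multiplier_bound p (\<lambda>k. blinfun_apply ((riesz_projection :: 'n zvec \<Rightarrow> 'e \<Rightarrow>\<^sub>L 'e) k)) C)"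
proof -
  let ?R = "riesz_projection :: 'n zvec \<Rightarrow> 'e \<Rightarrow>\<^sub>L 'e"
  have bdd: "bounded (range ?R)"
    by (rule finite_imp_bounded, rule finite_subset[of _ "{id_blinfun, 0}"]) (auto simp: riesz_projection_def)
  have sum_eq: "(\<lambda>x. \<Sum>k | c k \<noteq> 0. \<e> k x *\<^sub>C blinfun_apply (?R k) (c k)) = trig_poly K (\<lambda>k. blinfun_apply (?R k) (a k))"
    if "finite K" "c = fourier_coeff (distribution_of (trig_poly K a))" for K a c
  proof
    fix x
    have c: "c k = (if k \<in> K then a k else 0)" for k by (simp add: that fourier_coeff_trig_poly)
    show "(\<Sum>k | c k \<noteq> 0. \<e> k x *\<^sub>C blinfun_apply (?R k) (c k)) = trig_poly K (\<lambda>k. blinfun_apply (?R k) (a k)) x"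
      unfolding trig_poly_def using that(1)
      by (intro sum.mono_neutral_cong_left) (auto simp: c blinfun.zero_right scaleC.zero_right split: if_splits)
  qed
  have trig: "trig_polys = {trig_poly K a | K (a :: 'n zvec \<Rightarrow> 'e). finite K}"
    by (auto simp: trig_polys_def trig_poly_def[abs_def] fun_eq_iff)
  have "discrete_Lp_multiplier p ?R \<longleftrightarrow> (\<exists>C>0. Lp_multiplier_bound p (\<lambda>k. blinfun_apply (?R k)) C)" for p
  proof -
    have "(\<forall>f\<in>trig_polys. let c = fourier_coeff (distribution_of f)
         in Lp_norm p (\<lambda>x. \<Sum>k | c k \<noteq> 0. \<e> k x *\<^sub>C blinfun_apply (?R k) (c k)) \<le> C * Lp_norm p f)
      \<longleftrightarrow> Lp_multiplier_bound p (\<lambda>k. blinfun_apply (?R k)) C" for C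
      unfolding trig Lp_multiplier_bound_def Let_def
    proof (intro iffI ballI allI impI)
      fix K :: "'n zvec set" and a :: "'n zvec \<Rightarrow> 'e"
      assume h: "\<forall>f\<in>{trig_poly K a |K a. finite K}.
         Lp_norm p (\<lambda>x. \<Sum>k | fourier_coeff (distribution_of f) k \<noteq> 0. \<e> k x *\<^sub>C blinfun_apply (?R k) (fourier_coeff (distribution_of f) k))
           \<le> C * Lp_norm p f" and K: "finite K"
      have "trig_poly K a \<in> {trig_poly K a |K a. finite K}" using K by blast
      from bspec[OF h this]
      show "Lp_norm p (trig_poly K (\<lambda>k. blinfun_apply (?R k) (a k))) \<le> C * Lp_norm p (trig_poly K a)"
        unfolding sum_eq[OF K refl] .
    next
      fix f :: "'n rvec \<Rightarrow> 'e"
      assume h: "\<forall>K a. finite K \<longrightarrow> Lp_norm p (trig_poly K (\<lambda>k. blinfun_apply (?R k) (a k))) \<le> C * Lp_norm p (trig_poly K a)"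
        and "f \<in> {trig_poly K a |K a. finite K}"
      then obtain K a where f: "f = trig_poly K a" and K: "finite K" by blast
      show "Lp_norm p (\<lambda>x. \<Sum>k | fourier_coeff (distribution_of f) k \<noteq> 0. \<e> k x *\<^sub>C blinfun_apply (?R k) (fourier_coeff (distribution_of f) k))
           \<le> C * Lp_norm p f"
        unfolding f sum_eq[OF K refl] using h K by blast
    qed
    then show ?thesis using bdd unfolding discrete_Lp_multiplier_def by simp
  qed
  then show ?thesis by (simp add: UMD_space_def)
qed

section \<open>The Riesz kernel on a cyclic group\<close>

definition root_of_unity :: "nat \<Rightarrow> int \<Rightarrow> complex"
  where "root_of_unity N m = cis (2 * pi * of_int m / of_nat N)"

lemma norm_root_of_unity [simp]: "norm (root_of_unity N m) = 1"
  and root_of_unity_zero [simp]: "root_of_unity N 0 = 1"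
  and root_of_unity_nonzero [simp]: "root_of_unity N m \<noteq> 0"
  and root_of_unity_add: "root_of_unity N (a + b) = root_of_unity N a * root_of_unity N b"
  and cnj_root_of_unity: "cnj (root_of_unity N m) = root_of_unity N (- m)"
  by (simp_all add: root_of_unity_def cis_mult cis_cnj algebra_simps add_divide_distrib)

lemma root_of_unity_power: "root_of_unity N m ^ j = root_of_unity N (m * int j)"
proof -
  have "root_of_unity N m ^ j = cis (real j * (2 * pi * of_int m / of_nat N))"
    by (simp only: root_of_unity_def Complex.DeMoivre)
  also have "\<dots> = root_of_unity N (m * int j)"
    unfolding root_of_unity_def by (rule arg_cong[of _ _ cis]) simp
  finally show ?thesis .
qed

lemma root_of_unity_eq_1_iff:
  assumes "0 < N"
  shows "root_of_unity N m = 1 \<longleftrightarrow> int N dvd m"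
proof
  assume "root_of_unity N m = 1"
  then obtain n :: int where "2 * pi * of_int m / of_nat N = of_int n * (2 * pi)"
    unfolding root_of_unity_def cis_eq_1_iff by blast
  then have "real_of_int m = real_of_int (n * int N)" using assms by (simp add: field_simps)
  then have "m = n * int N" by linarith
  then show "int N dvd m" by simp
next
  assume "int N dvd m"
  then obtain n where "m = int N * n" by blast
  then have "2 * pi * of_int m / of_nat N = of_int n * (2 * pi)" using assms by simp
  then show "root_of_unity N m = 1" unfolding root_of_unity_def cis_eq_1_iff by blast
qed

lemma root_of_unity_cong:
  assumes "0 < N" "int N dvd a - b"
  shows "root_of_unity N a = root_of_unity N b"
  using root_of_unity_add[of N "a - b" b] root_of_unity_eq_1_iff[OF assms(1), of "a - b"] assms(2) by simp

lemma sum_root_of_unity: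
  assumes "0 < N"
  shows "(\<Sum>j<N. root_of_unity N (m * int j)) = (if int N dvd m then of_nat N else 0)"
proof (cases "int N dvd m")
  case True
  then have "root_of_unity N (m * int j) = 1" for j
    using assms by (simp add: root_of_unity_eq_1_iff)
  then show ?thesis using True by simp
next
  case False
  then have ne: "root_of_unity N m \<noteq> 1" using assms by (simp add: root_of_unity_eq_1_iff)
  have "(\<Sum>j<N. root_of_unity N (m * int j)) = (\<Sum>j<N. root_of_unity N m ^ j)"
    by (simp add: root_of_unity_power)
  also have "\<dots> = (root_of_unity N m ^ N - 1) / (root_of_unity N m - 1)"
    by (rule geometric_sum[OF ne])
  also have "root_of_unity N m ^ N = 1"
    unfolding root_of_unity_power using assms by (simp add: root_of_unity_eq_1_iff)
  finally show ?thesis using False by simp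
qed

section \<open>Fejer kernels and their samples at roots of unity\<close>

definition fejer_weight :: "nat \<Rightarrow> int \<Rightarrow> real"
  where "fejer_weight N m = 1 - \<bar>of_int m\<bar> / of_nat N"

definition fejer :: "nat \<Rightarrow> real \<Rightarrow> real"
  where "fejer N t = (cmod (\<Sum>k<N. cis (real k * t)))\<^sup>2 / N"

lemma fejer_nonneg: "0 \<le> fejer N t"
  by (simp add: fejer_def)

lemma fejer_minus: "fejer N (- t) = fejer N t"
proof -
  have "(\<Sum>k<N. cis (real k * - t)) = cnj (\<Sum>k<N. cis (real k * t))"
    by (simp add: cis_cnj)
  then show ?thesis unfolding fejer_def by (simp only: complex_mod_cnj)
qed

lemma continuous_on_fejer [continuous_intros]:
  "continuous_on S f \<Longrightarrow> continuous_on S (\<lambda>x. fejer N (f x))"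
  unfolding fejer_def by (cases "N = 0") (auto intro!: continuous_intros)

lemma card_difference_eq:
  assumes "\<bar>m\<bar> < int N"
  shows "card {(k, k'). k < N \<and> k' < N \<and> int k - int k' = m} = N - nat \<bar>m\<bar>"
proof (cases "0 \<le> m")
  case True
  have "{(k, k'). k < N \<and> k' < N \<and> int k - int k' = m} = (\<lambda>k. (k + nat m, k)) ` {..<N - nat m}"
  proof (intro set_eqI iffI)
    fix x assume "x \<in> {(k, k'). k < N \<and> k' < N \<and> int k - int k' = m}"
    then show "x \<in> (\<lambda>k. (k + nat m, k)) ` {..<N - nat m}"
      using True by (cases x) (auto intro!: image_eqI[of _ _ "snd x"])
  qed (use True in auto)
  then show ?thesis using True by (simp add: card_image inj_on_def)
next
  case False
  have "{(k, k'). k < N \<and> k' < N \<and> int k - int k' = m} = (\<lambda>k. (k, k + nat (- m))) ` {..<N - nat (- m)}"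
  proof (intro set_eqI iffI)
    fix x assume "x \<in> {(k, k'). k < N \<and> k' < N \<and> int k - int k' = m}"
    then show "x \<in> (\<lambda>k. (k, k + nat (- m))) ` {..<N - nat (- m)}"
      using False by (cases x) (auto intro!: image_eqI[of _ _ "fst x"])
  qed (use False in auto)
  then show ?thesis using False by (simp add: card_image inj_on_def)
qed

text \<open>Expand the squared modulus of the geometric sum as a double sum and group the pairs by
  their difference m; there are N - |m| of them.\<close>

lemma fejer_eq_sum:
  assumes "0 < N"
  shows "complex_of_real (fejer N t) = (\<Sum>m\<in>{- int N<..<int N}. of_real (fejer_weight N m) * cis (of_int m * t))"
proof -
  let ?S = "{..<N} \<times> {..<N}"
  let ?g = "\<lambda>(k, k'). int k - int k'"
  define D where "D = (\<Sum>k<N. cis (real k * t))"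
  have "D * cnj D = (\<Sum>k<N. \<Sum>k'<N. cis (real k * t) * cis (- (real k' * t)))"
    by (simp add: D_def sum_product cis_cnj)
  also have "\<dots> = (\<Sum>x\<in>?S. cis (of_int (?g x) * t))"
    unfolding sum.cartesian_product by (intro sum.cong) (auto simp: cis_mult algebra_simps)
  also have "\<dots> = (\<Sum>m\<in>{- int N<..<int N}. \<Sum>x\<in>{x. x \<in> ?S \<and> ?g x = m}. cis (of_int (?g x) * t))"
    by (intro sum.group[symmetric]) auto
  also have "\<dots> = (\<Sum>m\<in>{- int N<..<int N}. of_nat N * (of_real (fejer_weight N m) * cis (of_int m * t)))"
  proof (intro sum.cong refl)
    fix m assume m: "m \<in> {- int N<..<int N}"
    have "{x. x \<in> ?S \<and> ?g x = m} = {(k, k'). k < N \<and> k' < N \<and> int k - int k' = m}"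
    proof (rule Collect_cong)
      fix x show "x \<in> ?S \<and> ?g x = m \<longleftrightarrow> (case x of (k, k') \<Rightarrow> k < N \<and> k' < N \<and> int k - int k' = m)"
        by (cases x) (simp add: conj_assoc)
    qed
    then have "card {x. x \<in> ?S \<and> ?g x = m} = N - nat \<bar>m\<bar>" using card_difference_eq[of m N] m by (simp add: abs_less_iff)
    moreover have "real (N - nat \<bar>m\<bar>) = N * fejer_weight N m"
      using m assms by (auto simp: fejer_weight_def field_simps of_nat_diff)
    ultimately have "real (card {x. x \<in> ?S \<and> ?g x = m}) = real N * fejer_weight N m" by simp
    from arg_cong[OF this, of complex_of_real]
    have c: "complex_of_nat (card {x. x \<in> ?S \<and> ?g x = m}) = of_nat N * of_real (fejer_weight N m)"
      by simp
    have "(\<Sum>x\<in>{x. x \<in> ?S \<and> ?g x = m}. cis (of_int (?g x) * t)) = (\<Sum>x\<in>{x. x \<in> ?S \<and> ?g x = m}. cis (of_int m * t))"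
      by (intro sum.cong refl) auto
    then show "(\<Sum>x\<in>{x. x \<in> ?S \<and> ?g x = m}. cis (of_int (?g x) * t)) = of_nat N * (of_real (fejer_weight N m) * cis (of_int m * t))"
      by (simp only: sum_constant c mult.assoc)
  qed
  finally have "D * cnj D = of_nat N * (\<Sum>m\<in>{- int N<..<int N}. of_real (fejer_weight N m) * cis (of_int m * t))"
    by (simp add: sum_distrib_left)
  moreover have "D * cnj D = of_real ((cmod D)\<^sup>2)" by (rule complex_norm_square[symmetric])
  ultimately have "complex_of_real ((cmod D)\<^sup>2) = of_nat N * (\<Sum>m\<in>{- int N<..<int N}. of_real (fejer_weight N m) * cis (of_int m * t))"
    by simp
  moreover have "fejer N t = (cmod D)\<^sup>2 / N" by (simp only: fejer_def D_def)
  ultimately show ?thesis using assms by simp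
qed

text \<open>Summation over the N equispaced points annihilates every frequency not divisible by N,
  and m = 0 is the only multiple of N with |m| < N. Thus the samples divided by N are weights with
  sum 1.\<close>

lemma sum_fejer:
  assumes N: "0 < N"
  shows "(\<Sum>j<N. fejer N (t - 2 * pi * real j / real N)) = real N"
proof -
  have "complex_of_real (\<Sum>j<N. fejer N (t - 2 * pi * real j / real N)) =
     (\<Sum>j<N. \<Sum>m\<in>{- int N<..<int N}. of_real (fejer_weight N m) * cis (of_int m * t) * root_of_unity N (- m * int j))"
    unfolding of_real_sum fejer_eq_sum[OF N]
    by (intro sum.cong refl) (simp add: root_of_unity_def mult.assoc cis_mult algebra_simps)
  also have "\<dots> = (\<Sum>m\<in>{- int N<..<int N}. of_real (fejer_weight N m) * cis (of_int m * t) * (\<Sum>j<N. root_of_unity N (- m * int j)))"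
    by (subst sum.swap) (simp add: sum_distrib_left)
  also have "\<dots> = (\<Sum>m\<in>{- int N<..<int N}. if m = 0 then of_nat N else 0)"
  proof (intro sum.cong refl)
    fix m assume m: "m \<in> {- int N<..<int N}"
    have "int N dvd - m \<longleftrightarrow> m = 0" using m dvd_imp_le_int[of m "int N"] by (cases "m = 0") auto
    then show "of_real (fejer_weight N m) * cis (of_int m * t) * (\<Sum>j<N. root_of_unity N (- m * int j)) = (if m = 0 then of_nat N else 0)"
      unfolding sum_root_of_unity[OF N] by (simp add: fejer_weight_def)
  qed
  also have "\<dots> = of_real (real N)" using N by simp
  finally show ?thesis by (simp only: of_real_eq_iff)
qed

text \<open>The weight occurs squared because transference smooths twice by a Fejer kernel, once in passing
  from the cyclic group to the torus and once in passing back.\<close>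

definition riesz_kernel :: "nat \<Rightarrow> int \<Rightarrow> complex"
  where "riesz_kernel N t = (1 / of_nat N) * (\<Sum>m<N. of_real ((fejer_weight N (int m))\<^sup>2) * root_of_unity N (int m * t))"

lemma riesz_kernel_cong:
  assumes "0 < N" "int N dvd a - b"
  shows "riesz_kernel N a = riesz_kernel N b"
proof -
  have "root_of_unity N (int m * a) = root_of_unity N (int m * b)" for m
    using assms by (intro root_of_unity_cong) (auto simp: right_diff_distrib[symmetric])
  then show ?thesis by (simp add: riesz_kernel_def)
qed

lemma riesz_kernel_minus: "riesz_kernel N (- t) = cnj (riesz_kernel N t)"
  by (simp add: riesz_kernel_def cnj_root_of_unity)

text \<open>The sum telescopes because q r - z q(r - 1) = r^2. For |z| < 1, \<open>q c\<close> is
  the value of the full series of (c - m)^2 z^m, which is where the formula for q comes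
  from.\<close>

lemma sum_square_geometric:
  fixes z c :: complex
  assumes "z \<noteq> 1"
  defines "q \<equiv> \<lambda>r. r\<^sup>2 / (1 - z) - 2 * z * r / (1 - z)\<^sup>2 + z * (1 + z) / (1 - z) ^ 3"
  shows "(\<Sum>m<n. (c - of_nat m)\<^sup>2 * z ^ m) = q c - q (c - of_nat n) * z ^ n"
proof (induction n)
  case (Suc n)
  have step: "q r - z * q (r - 1) = r\<^sup>2" for r
  proof -
    define y where "y = inverse (1 - z)"
    have "y * (1 - z) = 1" using assms(1) by (simp add: y_def)
    then have "(r\<^sup>2 * y - 2 * z * r * y\<^sup>2 + z * (1 + z) * y ^ 3)
        - z * ((r - 1)\<^sup>2 * y - 2 * z * (r - 1) * y\<^sup>2 + z * (1 + z) * y ^ 3) = r\<^sup>2"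
      by algebra
    then show ?thesis by (simp add: q_def y_def divide_inverse power_inverse)
  qed
  have "q (c - of_nat n) - z * q (c - of_nat (Suc n)) = (c - of_nat n)\<^sup>2"
    using step[of "c - of_nat n"] by (simp add: algebra_simps)
  note eq = this
  have "(c - of_nat n)\<^sup>2 * z ^ n = q (c - of_nat n) * z ^ n - q (c - of_nat (Suc n)) * z ^ Suc n"
    unfolding eq[symmetric] by (simp add: algebra_simps)
  then show ?case using Suc by simp
qed simp

text \<open>As z^N = 1, the sum is q(N) - q(0), in which the term with (1 - z)^3 cancels. The two
  remaining terms are explicit enough for differences in t to be estimated.\<close>

lemma riesz_kernel_closed_form:
  assumes N: "0 < N" and t: "\<not> int N dvd t"
  defines "z \<equiv> root_of_unity N t"
  shows "riesz_kernel N t = (1 / of_nat N) * (1 / (1 - z) - 2 / of_nat N * (z / (1 - z)\<^sup>2))"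
proof -
  have z: "z \<noteq> 1" using root_of_unity_eq_1_iff[OF N] t by (simp add: z_def)
  have zN: "z ^ N = 1" unfolding z_def root_of_unity_power using root_of_unity_eq_1_iff[OF N] by simp
  let ?N = "of_nat N :: complex"
  have N0: "?N \<noteq> 0" using N by simp
  have "(\<Sum>m<N. of_real ((fejer_weight N (int m))\<^sup>2) * root_of_unity N (int m * t)) = (\<Sum>m<N. (?N - of_nat m)\<^sup>2 * z ^ m / ?N\<^sup>2)"
  proof (intro sum.cong refl)
    fix m assume "m \<in> {..<N}"
    have "complex_of_real (fejer_weight N (int m)) = (?N - of_nat m) / ?N"
      using N0 by (simp add: fejer_weight_def diff_divide_distrib)
    then show "of_real ((fejer_weight N (int m))\<^sup>2) * root_of_unity N (int m * t) = (?N - of_nat m)\<^sup>2 * z ^ m / ?N\<^sup>2"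
      by (simp add: z_def root_of_unity_power mult.commute power_divide)
  qed
  also have "\<dots> = (\<Sum>m<N. (?N - of_nat m)\<^sup>2 * z ^ m) / ?N\<^sup>2" by (simp add: sum_divide_distrib)
  also have "(\<Sum>m<N. (?N - of_nat m)\<^sup>2 * z ^ m) = ?N\<^sup>2 / (1 - z) - 2 * z * ?N / (1 - z)\<^sup>2"
    unfolding sum_square_geometric[OF z] zN by simp
  also have "\<dots> / ?N\<^sup>2 = 1 / (1 - z) - 2 / ?N * (z / (1 - z)\<^sup>2)"
    using N0 by (simp add: diff_divide_distrib power2_eq_square)
  finally show ?thesis unfolding riesz_kernel_def by simp
qed

section \<open>Distances between roots of unity and smoothness of the Riesz kernel\<close>

lemma sin_ge_quarter:
  fixes x :: real
  assumes "0 \<le> x" "x \<le> pi / 2"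
  shows "x / 4 \<le> sin x"
proof (cases "x \<le> pi / 6")
  case True
  define f where "f x = sin x - x / 4" for x :: real
  have "f 0 \<le> f x"
  proof (rule DERIV_nonneg_imp_nondecreasing[OF assms(1)])
    fix y assume y: "0 \<le> y" "y \<le> x"
    have "cos (pi / 3) \<le> cos y" using y True by (intro cos_monotone_0_pi_le) auto
    then have "0 \<le> cos y - 1 / 4" by (simp add: cos_60)
    moreover have "(f has_real_derivative cos y - 1 / 4) (at y)"
      unfolding f_def by (auto intro!: derivative_eq_intros)
    ultimately show "\<exists>d. (f has_real_derivative d) (at y) \<and> 0 \<le> d" by blast
  qed
  then show ?thesis by (simp add: f_def)
next
  case False
  then have "sin (pi / 6) \<le> sin x" using assms by (intro sin_monotone_2pi_le) auto
  moreover have "x / 4 \<le> 1 / 2" using assms pi_less_4 by simp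
  ultimately show ?thesis by (simp add: sin_30)
qed

lemma norm_1_minus_cis: "norm (1 - cis t) = 2 * \<bar>sin (t / 2)\<bar>"
proof -
  have "(norm (1 - cis t))\<^sup>2 = (1 - cos t)\<^sup>2 + (sin t)\<^sup>2"
    by (simp add: cmod_power2)
  also have "\<dots> = 2 - 2 * cos t"
    using sin_cos_squared_add[of t] by (simp add: power2_eq_square algebra_simps)
  also have "cos t = 1 - 2 * (sin (t / 2))\<^sup>2"
    using cos_double_sin[of "t / 2"] by simp
  also have "2 - 2 * (1 - 2 * (sin (t / 2))\<^sup>2) = (2 * \<bar>sin (t / 2)\<bar>)\<^sup>2"
    by (simp add: power_mult_distrib)
  finally show ?thesis by (rule power2_eq_imp_eq) auto
qed

lemma norm_1_minus_root_lower:
  assumes N: "0 < N" and t: "2 * \<bar>t\<bar> \<le> int N"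
  shows "pi * \<bar>of_int t\<bar> / (2 * real N) \<le> norm (1 - root_of_unity N t)"
proof -
  define x where "x = pi * \<bar>of_int t\<bar> / real N"
  have "real_of_int (2 * \<bar>t\<bar>) \<le> real_of_int (int N)" using t by (simp only: of_int_le_iff)
  then have "x \<le> pi / 2" using N by (simp add: x_def field_simps)
  moreover have "0 \<le> x" by (simp add: x_def)
  ultimately have "x / 4 \<le> sin x" by (intro sin_ge_quarter)
  moreover have "norm (1 - root_of_unity N t) = 2 * \<bar>sin x\<bar>"
  proof -
    have "norm (1 - root_of_unity N t) = 2 * \<bar>sin (pi * of_int t / real N)\<bar>"
      unfolding root_of_unity_def norm_1_minus_cis by simp
    moreover have "\<bar>sin (pi * of_int t / real N)\<bar> = \<bar>sin x\<bar>"
      unfolding x_def by (cases "0 \<le> t") (auto simp: abs_if)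
    ultimately show ?thesis by simp
  qed
  ultimately have "x / 2 \<le> norm (1 - root_of_unity N t)" by linarith
  then show ?thesis by (simp add: x_def)
qed

lemma norm_root_diff_upper:
  assumes N: "0 < N"
  shows "norm (root_of_unity N a - root_of_unity N b) \<le> 2 * pi * \<bar>of_int (a - b)\<bar> / real N"
proof -
  have "root_of_unity N a - root_of_unity N b = - root_of_unity N b * (1 - root_of_unity N (a - b))"
    using root_of_unity_add[of N "a - b" b] by (simp add: algebra_simps)
  then have "norm (root_of_unity N a - root_of_unity N b) = norm (1 - root_of_unity N (a - b))"
    by (simp add: norm_mult)
  also have "\<dots> = 2 * \<bar>sin (pi * of_int (a - b) / real N)\<bar>"
    unfolding root_of_unity_def norm_1_minus_cis by simp
  also have "\<dots> \<le> 2 * \<bar>pi * of_int (a - b) / real N\<bar>"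
    by (intro mult_left_mono abs_sin_x_le_abs_x) simp
  finally show ?thesis by (simp add: abs_mult)
qed

text \<open>Discrete counterpart of |k'(t)| <= C / t^2. In the closed form, |1 - u| and |1 - v| are
  at least of order |t| / N, while |u - v| is at most of order l / N; common denominators then give
  l / t^2 after division by N.\<close>

lemma riesz_kernel_diff:
  assumes N: "0 < N" and t: "2 * \<bar>t\<bar> \<le> int N" and s: "0 \<le> s" "s \<le> l" and l: "8 * l < \<bar>t\<bar>"
  shows "norm (riesz_kernel N (t - s) - riesz_kernel N t) \<le> 27 * of_int l / (of_int t)\<^sup>2"
proof -
  define u where "u = root_of_unity N t"
  define v where "v = root_of_unity N (t - s)"
  define T where "T = \<bar>real_of_int t\<bar>"
  define n where "n = real N"
  have n: "0 < n" using N by (simp add: n_def)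
  have l0: "0 \<le> l" using s by simp
  have T: "1 \<le> T" "8 * real_of_int l \<le> T" using l l0 by (auto simp: T_def)
  have uv: "norm (u - v) \<le> 2 * pi * of_int l / n"
  proof -
    have "norm (u - v) \<le> 2 * pi * \<bar>of_int (t - (t - s))\<bar> / real N"
      unfolding u_def v_def by (rule norm_root_diff_upper[OF N])
    also have "\<dots> \<le> 2 * pi * of_int l / n"
      unfolding n_def using s by (intro divide_right_mono mult_left_mono) auto
    finally show ?thesis .
  qed
  have a: "pi * T / (2 * n) \<le> norm (1 - u)"
    unfolding u_def T_def n_def by (rule norm_1_minus_root_lower[OF N t])
  \<comment> \<open>The condition 8 l < |t| is calibrated here: it makes |u - v| at most half of the
    lower bound for |1 - u|, so v stays away from 1 as well.\<close>
  have b: "pi * T / (4 * n) \<le> norm (1 - v)"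
  proof -
    have "norm (1 - u) \<le> norm (1 - v) + norm (u - v)"
      using norm_triangle_ineq[of "1 - v" "v - u"] by (simp add: norm_minus_commute)
    moreover have "2 * pi * of_int l / n \<le> pi * T / (4 * n)"
      using T n by (simp add: field_simps)
    moreover have "pi * T / (2 * n) = pi * T / (4 * n) + pi * T / (4 * n)" by simp
    ultimately show ?thesis using a uv by linarith
  qed
  have pos: "0 < pi * T / (2 * n)" "0 < pi * T / (4 * n)" using T n by auto
  have u1: "u \<noteq> 1" and v1: "v \<noteq> 1" using a b pos by auto
  have nd: "\<not> int N dvd t" "\<not> int N dvd (t - s)"
    using u1 v1 root_of_unity_eq_1_iff[OF N] unfolding u_def v_def by auto
  have eq: "riesz_kernel N (t - s) - riesz_kernel N t = (1 / of_nat N) *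
      ((1 / (1 - v) - 1 / (1 - u)) - 2 / of_nat N * (v / (1 - v)\<^sup>2 - u / (1 - u)\<^sup>2))"
    unfolding riesz_kernel_closed_form[OF N nd(1)] riesz_kernel_closed_form[OF N nd(2)] u_def v_def
    by (simp add: algebra_simps)
  define \<alpha> \<beta> where "\<alpha> = norm (1 - u)" and "\<beta> = norm (1 - v)"
  have ab: "0 < \<alpha>" "0 < \<beta>" using u1 v1 by (auto simp: \<alpha>_def \<beta>_def)
  have "1 / \<alpha> \<le> 1 / (pi * T / (2 * n))" "1 / \<beta> \<le> 1 / (pi * T / (4 * n))"
    unfolding \<alpha>_def \<beta>_def using a b pos by (simp_all only: frac_le zero_le_one order_refl)
  then have ia: "1 / \<alpha> \<le> 2 * n / (pi * T)" and ib: "1 / \<beta> \<le> 4 * n / (pi * T)"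
    by simp_all
  have first: "norm (1 / (1 - v) - 1 / (1 - u)) \<le> norm (u - v) * (1 / \<alpha> * (1 / \<beta>))"
  proof -
    have "1 / (1 - v) - 1 / (1 - u) = (v - u) / ((1 - v) * (1 - u))"
      using u1 v1 by (simp add: divide_simps)
    then show ?thesis by (simp add: norm_divide norm_mult \<alpha>_def \<beta>_def norm_minus_commute mult.commute)
  qed
  have second: "norm (v / (1 - v)\<^sup>2 - u / (1 - u)\<^sup>2) \<le> norm (u - v) * (1 / \<alpha> * (1 / \<beta>)) * (1 / \<alpha> + 1 / \<beta>)"
  proof -
    have "v / (1 - v)\<^sup>2 - u / (1 - u)\<^sup>2 = (v * (1 - u)\<^sup>2 - u * (1 - v)\<^sup>2) / ((1 - v)\<^sup>2 * (1 - u)\<^sup>2)"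
      using u1 v1 by (simp add: diff_frac_eq)
    also have "v * (1 - u)\<^sup>2 - u * (1 - v)\<^sup>2 = (v - u) * ((1 - u) + u * (1 - v))"
      by (simp add: power2_eq_square algebra_simps)
    finally have "norm (v / (1 - v)\<^sup>2 - u / (1 - u)\<^sup>2) = norm (u - v) * norm ((1 - u) + u * (1 - v)) / (\<beta>\<^sup>2 * \<alpha>\<^sup>2)"
      by (simp add: norm_divide norm_mult norm_power \<alpha>_def \<beta>_def norm_minus_commute)
    also have "norm ((1 - u) + u * (1 - v)) \<le> \<alpha> + \<beta>"
      unfolding \<alpha>_def \<beta>_def by (rule norm_triangle_le) (simp add: norm_mult u_def)
    also have "norm (u - v) * (\<alpha> + \<beta>) / (\<beta>\<^sup>2 * \<alpha>\<^sup>2) = norm (u - v) * (1 / \<alpha> * (1 / \<beta>)) * (1 / \<alpha> + 1 / \<beta>)"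
      using ab by (simp add: field_simps power2_eq_square)
    finally show ?thesis using ab by (simp add: divide_right_mono mult_left_mono)
  qed
  define w where "w = norm (u - v) * (1 / \<alpha> * (1 / \<beta>))"
  have w0: "0 \<le> w" using ab by (simp add: w_def)
  have w: "w \<le> 16 * of_int l * n / (pi * T\<^sup>2)"
  proof -
    have "w \<le> (2 * pi * of_int l / n) * ((2 * n / (pi * T)) * (4 * n / (pi * T)))"
      unfolding w_def using uv ia ib ab l0 n T by (intro mult_mono) auto
    also have "\<dots> = 16 * of_int l * n / (pi * T\<^sup>2)"
      using n T by (simp add: power2_eq_square mult_ac)
    finally show ?thesis .
  qed
  have "norm (riesz_kernel N (t - s) - riesz_kernel N t) \<le> 1 / n * (w + 2 / n * (w * (1 / \<alpha> + 1 / \<beta>)))"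
    unfolding eq norm_mult
  proof (intro mult_mono)
    show "norm (1 / (1 - v) - 1 / (1 - u) - 2 / of_nat N * (v / (1 - v)\<^sup>2 - u / (1 - u)\<^sup>2)) \<le> w + 2 / n * (w * (1 / \<alpha> + 1 / \<beta>))"
    proof (rule norm_triangle_le_diff, rule add_mono)
      show "norm (2 / of_nat N * (v / (1 - v)\<^sup>2 - u / (1 - u)\<^sup>2)) \<le> 2 / n * (w * (1 / \<alpha> + 1 / \<beta>))"
      proof -
        have "norm (2 / of_nat N * W) = 2 / n * norm W" for W :: complex
          by (simp add: norm_mult norm_divide n_def)
        then show ?thesis using second n by (simp only: w_def) (intro mult_left_mono, auto)
      qed
    qed (use first in \<open>simp add: w_def\<close>)
  qed (use n in \<open>auto simp: n_def norm_divide\<close>)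
  \<comment> \<open>The second term of the closed form is not larger in order than the first: since
    T >= 1 and pi > 3, the two reciprocals add up to at most 2 n.\<close>
  also have "2 / n * (w * (1 / \<alpha> + 1 / \<beta>)) \<le> 4 * w"
  proof -
    have "1 / \<alpha> + 1 / \<beta> \<le> 6 * n / (pi * T)"
    proof -
      have "1 / \<alpha> + 1 / \<beta> \<le> 2 * n / (pi * T) + 4 * n / (pi * T)" by (rule add_mono[OF ia ib])
      also have "\<dots> = 6 * n / (pi * T)" by (simp add: add_divide_distrib[symmetric])
      finally show ?thesis .
    qed
    also have "\<dots> \<le> 2 * n"
    proof -
      have "3 * 1 \<le> pi * T" using pi_gt3 T by (intro mult_mono) auto
      then have "2 * n * (3 * 1) \<le> 2 * n * (pi * T)" using n by (intro mult_left_mono) auto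
      then have "6 * n \<le> 2 * n * (pi * T)" by simp
      then show ?thesis using \<open>3 * 1 \<le> pi * T\<close> by (simp add: pos_divide_le_eq)
    qed
    finally have "w * (1 / \<alpha> + 1 / \<beta>) \<le> w * (2 * n)" by (intro mult_left_mono w0)
    then have "2 / n * (w * (1 / \<alpha> + 1 / \<beta>)) \<le> 2 / n * (w * (2 * n))"
      by (rule mult_left_mono) (use n in auto)
    then show ?thesis using n by simp
  qed
  also have "1 / n * (w + 4 * w) = 5 * w / n" by simp
  also have "\<dots> \<le> 5 * (16 * of_int l * n / (pi * T\<^sup>2)) / n"
    using w n by (intro divide_right_mono mult_left_mono) auto
  \<comment> \<open>80 is 5 times 16, and 80 / pi < 27 because pi > 3.\<close>
  also have "\<dots> = 80 / pi * (of_int l / T\<^sup>2)" using n by simp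
  also have "\<dots> \<le> 27 * (of_int l / T\<^sup>2)"
    using pi_gt3 l0 by (intro mult_right_mono) (auto simp: pos_divide_le_eq)
  finally show ?thesis using n by (simp add: T_def divide_right_mono)
qed

text \<open>1 / (y + 1)^2 <= 1 / y - 1 / (y + 1) telescopes; the factor 2 accounts for the two signs
  of t.\<close>

lemma sum_inverse_squares_le:
  fixes I :: "int set"
  assumes fin: "finite I" and l: "0 < l" and I: "\<And>t. t \<in> I \<Longrightarrow> l < \<bar>t\<bar>"
  shows "(\<Sum>t\<in>I. 1 / (real_of_int t)\<^sup>2) \<le> 2 / of_int l"
proof -
  have pos: "(\<Sum>t\<in>J. 1 / (real_of_int t)\<^sup>2) \<le> 1 / of_int l" if J: "finite J" "\<And>t. t \<in> J \<Longrightarrow> l < t" for J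
  proof -
    have tel: "(\<Sum>t\<in>{l<..l + int n}. 1 / (real_of_int t)\<^sup>2) \<le> 1 / of_int l - 1 / of_int (l + int n)" for n
    proof (induction n)
      case (Suc n)
      have "{l<..l + int (Suc n)} = insert (l + int (Suc n)) {l<..l + int n}" using l by auto
      then have "(\<Sum>t\<in>{l<..l + int (Suc n)}. 1 / (real_of_int t)\<^sup>2) =
          1 / (real_of_int (l + int (Suc n)))\<^sup>2 + (\<Sum>t\<in>{l<..l + int n}. 1 / (real_of_int t)\<^sup>2)" by simp
      also have "1 / (real_of_int (l + int (Suc n)))\<^sup>2 \<le> 1 / of_int (l + int n) - 1 / of_int (l + int (Suc n))"
      proof -
        define y where "y = real_of_int (l + int n)"
        have y: "0 < y" using l by (simp add: y_def)
        have "1 / y - 1 / (y + 1) = 1 / (y * (y + 1))" using y by (simp add: field_simps)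
        moreover have "1 / (y + 1)\<^sup>2 \<le> 1 / (y * (y + 1))"
          using y by (intro divide_left_mono) (auto simp: power2_eq_square)
        moreover have "real_of_int (l + int (Suc n)) = y + 1" by (simp add: y_def)
        ultimately show ?thesis by (simp only: y_def[symmetric])
      qed
      finally show ?case using Suc by linarith
    qed simp
    obtain n where n: "J \<subseteq> {l<..l + int n}"
    proof -
      have "t \<in> {l<..l + int (nat (\<Sum>t\<in>J. \<bar>t\<bar>))}" if "t \<in> J" for t
      proof -
        have "\<bar>t\<bar> \<le> (\<Sum>t\<in>J. \<bar>t\<bar>)" using J(1) that by (intro member_le_sum) auto
        then show ?thesis using J(2)[OF that] l by auto
      qed
      then show thesis using that by blast
    qed
    have "(\<Sum>t\<in>J. 1 / (real_of_int t)\<^sup>2) \<le> (\<Sum>t\<in>{l<..l + int n}. 1 / (real_of_int t)\<^sup>2)"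
      using n by (intro sum_mono2) auto
    also have "\<dots> \<le> 1 / of_int l - 1 / of_int (l + int n)" by (rule tel)
    also have "\<dots> \<le> 1 / of_int l" using l by simp
    finally show ?thesis .
  qed
  have "(\<Sum>t\<in>I. 1 / (real_of_int t)\<^sup>2) = (\<Sum>t\<in>I \<inter> {0<..}. 1 / (real_of_int t)\<^sup>2) + (\<Sum>t\<in>I - {0<..}. 1 / (real_of_int t)\<^sup>2)"
    using fin sum.Int_Diff by blast
  also have "(\<Sum>t\<in>I - {0<..}. 1 / (real_of_int t)\<^sup>2) = (\<Sum>t\<in>uminus ` (I - {0<..}). 1 / (real_of_int t)\<^sup>2)"
    by (subst sum.reindex) auto
  also have "\<dots> \<le> 1 / of_int l" using fin I l by (intro pos) force+
  also have "(\<Sum>t\<in>I \<inter> {0<..}. 1 / (real_of_int t)\<^sup>2) \<le> 1 / of_int l" using fin I l by (intro pos) force+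
  finally show ?thesis by simp
qed

text \<open>X consists of the residues within distance 8 l of c modulo N, at most 16 l + 1 <= 17 l
  points. Off X the differences are at most 27 l / t^2 at distinct t with |t| > 8 l, and their sum
  is at most 27 l times 2 / (8 l), which is below 7. The transposed estimate has the same terms,
  because reflecting the argument conjugates the kernel.\<close>

lemma riesz_kernel_hormander:
  fixes c l N :: nat
  assumes N: "0 < N" and l: "0 < l"
  shows "\<exists>X. finite X \<and> card X \<le> 17 * l \<and> (\<forall>j\<in>{c..<c + l}.
    (\<Sum>i\<in>{..<N} - X. norm (riesz_kernel N (int i - int j) - riesz_kernel N (int i - int c))) \<le> 7 \<and>
    (\<Sum>i\<in>{..<N} - X. norm (riesz_kernel N (int j - int i) - riesz_kernel N (int c - int i))) \<le> 7)"
proof -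
  define X where "X = (\<lambda>t. nat ((int c + t) mod int N)) ` {- 8 * int l..8 * int l}"
  \<comment> \<open>The representative of i - c modulo N of least absolute value, as required by the
    hypothesis 2 |t| <= N of \<open>riesz_kernel_diff\<close>.\<close>
  define rep where "rep i = (let r = (int i - int c) mod int N in if 2 * r \<le> int N then r else r - int N)" for i :: nat
  have rep_mod: "rep i mod int N = (int i - int c) mod int N" for i
    unfolding rep_def Let_def by (simp add: mod_simps)
  have rep_dvd: "int N dvd (int i - int c) - rep i" for i
    using rep_mod[of i] by (metis mod_eq_dvd_iff)
  have rep_half: "2 * \<bar>rep i\<bar> \<le> int N" for i
  proof -
    have "0 \<le> (int i - int c) mod int N" "(int i - int c) mod int N < int N" using N by simp_all
    then show ?thesis unfolding rep_def Let_def by simp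
  qed
  have rep_far: "8 * int l < \<bar>rep i\<bar>" if i: "i \<in> {..<N} - X" for i
  proof (rule ccontr)
    assume "\<not> ?thesis"
    then have "rep i \<in> {- 8 * int l..8 * int l}" by auto
    moreover have "(int c + rep i) mod int N = int i"
    proof -
      have "(int c + rep i) mod int N = (int c + (int i - int c)) mod int N"
        using rep_mod[of i] by (metis mod_add_right_eq)
      then show ?thesis using i by simp
    qed
    ultimately have "i \<in> X" unfolding X_def by (intro image_eqI[of _ _ "rep i"]) auto
    then show False using i by simp
  qed
  have rep_inj: "inj_on rep {..<N}"
  proof (rule inj_onI)
    fix i i' assume h: "i \<in> {..<N}" "i' \<in> {..<N}" "rep i = rep i'"
    then have "(int i - int c) mod int N = (int i' - int c) mod int N" using rep_mod by metis
    then have "int N dvd int i - int i'" by (simp add: mod_eq_dvd_iff)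
    then show "i = i'" using h zdvd_imp_le[of "int N" "int i - int i'"] zdvd_imp_le[of "int N" "int i' - int i"]
      by (cases i i' rule: linorder_cases) (auto simp: dvd_diff_commute)
  qed
  have diff: "norm (riesz_kernel N (int i - int j) - riesz_kernel N (int i - int c)) \<le> 27 * real l * (1 / (real_of_int (rep i))\<^sup>2)"
    if i: "i \<in> {..<N} - X" and j: "j \<in> {c..<c + l}" for i j
  proof -
    have "riesz_kernel N (int i - int c) = riesz_kernel N (rep i)"
      by (rule riesz_kernel_cong[OF N rep_dvd])
    moreover have "riesz_kernel N (int i - int j) = riesz_kernel N (rep i - (int j - int c))"
      by (rule riesz_kernel_cong[OF N]) (use rep_dvd[of i] in \<open>simp add: algebra_simps\<close>)
    moreover have "norm (riesz_kernel N (rep i - (int j - int c)) - riesz_kernel N (rep i)) \<le> 27 * of_int (int l) / (of_int (rep i))\<^sup>2"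
      by (rule riesz_kernel_diff[OF N rep_half]) (use j rep_far[OF i] in auto)
    ultimately show ?thesis by simp
  qed
  have sum: "(\<Sum>i\<in>{..<N} - X. norm (riesz_kernel N (int i - int j) - riesz_kernel N (int i - int c))) \<le> 7"
    if j: "j \<in> {c..<c + l}" for j
  proof -
    have "(\<Sum>i\<in>{..<N} - X. norm (riesz_kernel N (int i - int j) - riesz_kernel N (int i - int c))) \<le>
        (\<Sum>i\<in>{..<N} - X. 27 * real l * (1 / (real_of_int (rep i))\<^sup>2))"
      using diff j by (intro sum_mono) auto
    also have "\<dots> = 27 * real l * (\<Sum>t\<in>rep ` ({..<N} - X). 1 / (real_of_int t)\<^sup>2)"
      using rep_inj by (subst sum.reindex) (auto simp: sum_distrib_left intro: inj_on_subset)
    also have "\<dots> \<le> 27 * real l * (2 / of_int (8 * int l))"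
      using rep_far l by (intro mult_left_mono sum_inverse_squares_le) auto
    also have "\<dots> \<le> 7" using l by simp
    finally show ?thesis .
  qed
  have neg: "norm (riesz_kernel N (int j - int i) - riesz_kernel N (int c - int i)) =
      norm (riesz_kernel N (int i - int j) - riesz_kernel N (int i - int c))" for i j
  proof -
    have "riesz_kernel N (int j - int i) - riesz_kernel N (int c - int i) =
        cnj (riesz_kernel N (int i - int j) - riesz_kernel N (int i - int c))"
      by (simp flip: riesz_kernel_minus)
    then show ?thesis by (simp only: complex_mod_cnj)
  qed
  have "card X \<le> 17 * l"
  proof -
    have "card X \<le> card {- 8 * int l..8 * int l}" unfolding X_def by (rule card_image_le) simp
    also have "\<dots> \<le> 17 * l" using l by simp
    finally show ?thesis .
  qed
  moreover have "finite X" by (simp add: X_def)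
  ultimately show ?thesis using sum unfolding neg by (intro exI[of _ X]) blast
qed

section \<open>Transference between cyclic groups and the torus\<close>

lemma char_fun_axis: "\<e> (axis l m) y = cis (of_int m * y $ l)"
proof -
  have "real_vec (axis l m) = axis l (of_int m)" by (simp add: vec_eq_iff axis_def)
  then show ?thesis by (simp add: char_fun_def inner_axis' cis_conv_exp)
qed

lemma axis_uminus: "axis l (- m :: int) = - axis l m"
  by (simp add: vec_eq_iff axis_def)

lemma axis_component_eq_iff: "axis l (m::int) = axis l m' \<longleftrightarrow> m = m'"
  by (metis axis_nth)

lemma fejer_char_fun:
  assumes "0 < N"
  shows "complex_of_real (fejer N (s - y $ l)) =
    (\<Sum>m\<in>{- int N<..<int N}. of_real (fejer_weight N m) * cis (of_int m * s) * \<e> (- axis l m) y)"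
  unfolding fejer_eq_sum[OF assms] axis_uminus[symmetric] char_fun_axis
  by (intro sum.cong refl) (simp add: mult.assoc cis_mult algebra_simps)

lemma torus_mean_fejer:
  assumes N: "0 < N"
  shows "torus_mean (\<lambda>y::'n::finite rvec. fejer N (s - y $ l)) = 1"
proof -
  have "complex_of_real (torus_mean (\<lambda>y::'n rvec. fejer N (s - y $ l))) = torus_mean (\<lambda>y::'n rvec. complex_of_real (fejer N (s - y $ l)))"
    by (rule torus_mean_bounded_linear[symmetric]) (intro bounded_linear_of_real continuous_intros)+
  also have "\<dots> = (\<Sum>m\<in>{- int N<..<int N}. torus_mean (\<lambda>y::'n rvec. of_real (fejer_weight N m) * cis (of_int m * s) * \<e> (- axis l m) y))"
    unfolding fejer_char_fun[OF N] by (rule torus_mean_sum) (intro finite_greaterThanLessThan_int continuous_intros)+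
  also have "\<dots> = (\<Sum>m\<in>{- int N<..<int N}. if m = 0 then 1 else 0)"
  proof (intro sum.cong refl)
    fix m
    have "torus_mean (\<lambda>y::'n rvec. of_real (fejer_weight N m) * cis (of_int m * s) * \<e> (- axis l m) y) =
        of_real (fejer_weight N m) * cis (of_int m * s) * torus_mean (\<e> (- axis l m :: 'n zvec))"
      by (rule torus_mean_bounded_linear[OF bounded_linear_mult_right]) (intro continuous_intros)
    also have "torus_mean (\<e> (- axis l m :: 'n zvec)) = (if m = 0 then 1 else 0)"
      unfolding torus_mean_char_fun by (simp add: vec_eq_iff axis_def)
    finally show "torus_mean (\<lambda>y::'n rvec. of_real (fejer_weight N m) * cis (of_int m * s) * \<e> (- axis l m) y) = (if m = 0 then 1 else 0)"
      by (simp add: fejer_weight_def)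
  qed
  also have "\<dots> = 1" using N by simp
  finally show ?thesis by simp
qed

definition riesz_op :: "nat \<Rightarrow> nat \<Rightarrow> nat \<Rightarrow> 'e::complex_banach \<Rightarrow>\<^sub>L 'e"
  where "riesz_op N i j = Blinfun (\<lambda>x. riesz_kernel N (int i - int j) *\<^sub>C x)"

lemma riesz_op_apply: "blinfun_apply (riesz_op N i j) x = riesz_kernel N (int i - int j) *\<^sub>C x"
  unfolding riesz_op_def by (subst bounded_linear_Blinfun_apply) (auto intro: scaleC.bounded_linear_right)

lemma norm_riesz_op_diff:
  "norm (riesz_op N i j - riesz_op N i' j' :: 'e::complex_banach \<Rightarrow>\<^sub>L 'e) \<le> norm (riesz_kernel N (int i - int j) - riesz_kernel N (int i' - int j'))"
  by (rule norm_blinfun_bound) (auto simp: blinfun.diff_left riesz_op_apply norm_scaleC simp flip: scaleC.diff_left)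

lemma riesz_op_hormander:
  "hormander M 7 17 (riesz_op (2 ^ M) :: nat \<Rightarrow> nat \<Rightarrow> 'e::complex_banach \<Rightarrow>\<^sub>L 'e)"
  "hormander M 7 17 (\<lambda>i j. riesz_op (2 ^ M) j i :: 'e::complex_banach \<Rightarrow>\<^sub>L 'e)"
proof -
  have ex: "\<exists>X. finite X \<and> real (card X) \<le> 17 * 2 ^ snd Q \<and> (\<forall>j\<in>block_interval Q.
      (\<Sum>i\<in>{..<2 ^ M} - X. norm (riesz_op (2 ^ M) i j - riesz_op (2 ^ M) i (fst Q) :: 'e \<Rightarrow>\<^sub>L 'e)) \<le> 7 \<and>
      (\<Sum>i\<in>{..<2 ^ M} - X. norm (riesz_op (2 ^ M) j i - riesz_op (2 ^ M) (fst Q) i :: 'e \<Rightarrow>\<^sub>L 'e)) \<le> 7)" for Q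
  proof -
    define r where "r = riesz_kernel (2 ^ M)"
    have pos: "(0::nat) < 2 ^ M" "(0::nat) < 2 ^ snd Q" by simp_all
    obtain X where X: "finite X" "card X \<le> 17 * 2 ^ snd Q" "\<forall>j\<in>{fst Q..<fst Q + 2 ^ snd Q}.
      (\<Sum>i\<in>{..<2 ^ M} - X. norm (r (int i - int j) - r (int i - int (fst Q)))) \<le> 7 \<and>
      (\<Sum>i\<in>{..<2 ^ M} - X. norm (r (int j - int i) - r (int (fst Q) - int i))) \<le> 7"
      using riesz_kernel_hormander[OF pos, of "fst Q"] unfolding r_def by (elim exE conjE)
    have "(\<Sum>i\<in>{..<2 ^ M} - X. norm (riesz_op (2 ^ M) i j - riesz_op (2 ^ M) i (fst Q) :: 'e \<Rightarrow>\<^sub>L 'e)) \<le> 7 \<and>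
      (\<Sum>i\<in>{..<2 ^ M} - X. norm (riesz_op (2 ^ M) j i - riesz_op (2 ^ M) (fst Q) i :: 'e \<Rightarrow>\<^sub>L 'e)) \<le> 7"
      if "j \<in> block_interval Q" for j
    proof -
      have j: "j \<in> {fst Q..<fst Q + 2 ^ snd Q}" using that by (simp add: block_interval_def)
      have "(\<Sum>i\<in>{..<2 ^ M} - X. norm (riesz_op (2 ^ M) i j - riesz_op (2 ^ M) i (fst Q) :: 'e \<Rightarrow>\<^sub>L 'e)) \<le>
          (\<Sum>i\<in>{..<2 ^ M} - X. norm (r (int i - int j) - r (int i - int (fst Q))))"
        unfolding r_def by (intro sum_mono norm_riesz_op_diff)
      moreover have "(\<Sum>i\<in>{..<2 ^ M} - X. norm (riesz_op (2 ^ M) j i - riesz_op (2 ^ M) (fst Q) i :: 'e \<Rightarrow>\<^sub>L 'e)) \<le>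
          (\<Sum>i\<in>{..<2 ^ M} - X. norm (r (int j - int i) - r (int (fst Q) - int i)))"
        unfolding r_def by (intro sum_mono norm_riesz_op_diff)
      ultimately show ?thesis using bspec[OF X(3) j] by linarith
    qed
    moreover have "real (card X) \<le> 17 * 2 ^ snd Q"
      using of_nat_mono[OF X(2), where 'a = real] by simp
    ultimately show ?thesis using X(1) by (intro exI[of _ X]) simp
  qed
  show "hormander M 7 17 (riesz_op (2 ^ M) :: nat \<Rightarrow> nat \<Rightarrow> 'e \<Rightarrow>\<^sub>L 'e)"
    unfolding hormander_def
  proof (intro allI impI)
    fix Q
    from ex[of Q] obtain X where X: "finite X" "real (card X) \<le> 17 * 2 ^ snd Q"
      "\<forall>j\<in>block_interval Q. (\<Sum>i\<in>{..<2 ^ M} - X. norm (riesz_op (2 ^ M) i j - riesz_op (2 ^ M) i (fst Q) :: 'e \<Rightarrow>\<^sub>L 'e)) \<le> 7"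
      unfolding ball_conj_distrib by (elim exE conjE)
    then show "\<exists>X. finite X \<and> real (card X) \<le> 17 * 2 ^ snd Q \<and>
      (\<forall>j\<in>block_interval Q. (\<Sum>i\<in>{..<2 ^ M} - X. norm (riesz_op (2 ^ M) i j - riesz_op (2 ^ M) i (fst Q) :: 'e \<Rightarrow>\<^sub>L 'e)) \<le> 7)"
      by (intro exI[of _ X]) simp
  qed
  show "hormander M 7 17 (\<lambda>i j. riesz_op (2 ^ M) j i :: 'e \<Rightarrow>\<^sub>L 'e)"
    unfolding hormander_def
  proof (intro allI impI)
    fix Q
    from ex[of Q] obtain X where X: "finite X" "real (card X) \<le> 17 * 2 ^ snd Q"
      "\<forall>j\<in>block_interval Q. (\<Sum>i\<in>{..<2 ^ M} - X. norm (riesz_op (2 ^ M) j i - riesz_op (2 ^ M) (fst Q) i :: 'e \<Rightarrow>\<^sub>L 'e)) \<le> 7"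
      unfolding ball_conj_distrib by (elim exE conjE)
    then show "\<exists>X. finite X \<and> real (card X) \<le> 17 * 2 ^ snd Q \<and>
      (\<forall>j\<in>block_interval Q. (\<Sum>i\<in>{..<2 ^ M} - X. norm (riesz_op (2 ^ M) j i - riesz_op (2 ^ M) (fst Q) i :: 'e \<Rightarrow>\<^sub>L 'e)) \<le> 7)"
      by (intro exI[of _ X]) simp
  qed
qed

lemma continuous_on_fejer_shift:
  "continuous_on UNIV (\<lambda>y::'n::finite rvec. fejer N (s - y $ l))"
  "continuous_on UNIV (\<lambda>y::'n::finite rvec. fejer N (y $ l - s))"
  by (intro continuous_intros)+

lemma sum_fejer_reflected:
  assumes "0 < N"
  shows "(\<Sum>j<N. fejer N (2 * pi * real j / real N - t)) = real N"
proof -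
  have "fejer N (2 * pi * real j / real N - t) = fejer N (t - 2 * pi * real j / real N)" for j
    using fejer_minus[of N "t - 2 * pi * real j / real N"] by simp
  then show ?thesis using sum_fejer[OF assms] by simp
qed

text \<open>Spread \<open>a\<close> over the torus along one axis by Fejer kernels centred at the
  N-th division points, apply the Riesz projection, and come back by averaging against Fejer
  kernels. Both passages are contractions between the torus and the normalised counting measure:
  Jensen's inequality applies, as the kernels have total mass 1 in the summation variable and in the
  integration variable. On the axis the n-dimensional symbol is the indicator of m >= 0.\<close>

lemma riesz_op_lp_bounded:
  assumes bound: "Lp_multiplier_bound p (\<lambda>k::'n::{finite,linorder} zvec. blinfun_apply (riesz_projection k :: 'e::complex_banach \<Rightarrow>\<^sub>L 'e)) C"
    and C: "0 \<le> C" and p: "1 < p" and N: "0 < N"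
  shows "lp_bounded N p (C powr p) (riesz_op N :: nat \<Rightarrow> nat \<Rightarrow> 'e \<Rightarrow>\<^sub>L 'e)"
  unfolding lp_bounded_def
proof
  fix a :: "nat \<Rightarrow> 'e"
  obtain l :: 'n where True by blast
  define Z where "Z = {- int N<..<int N}"
  have Z: "finite Z" by (simp add: Z_def)
  define K :: "'n zvec set" where "K = axis l ` Z"
  have K: "finite K" by (simp add: K_def Z)
  have inj: "inj_on (axis l) Z" by (rule inj_onI) (simp add: axis_component_eq_iff)
  define X where "X j = 2 * pi * real j / real N" for j
  \<comment> \<open>Fourier coefficients of the spread-out function; the first
    \<open>fejer_weight\<close> enters here, and \<open>f_eq\<close> identifies the sum.\<close>
  define b :: "'n zvec \<Rightarrow> 'e" where
    "b k = (\<Sum>j<N. (of_real (fejer_weight N (k $ l) / N) * root_of_unity N (- (k $ l) * int j)) *\<^sub>C a j)" for k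
  define c where "c k = blinfun_apply (riesz_projection k) (b k)" for k
  define f where "f = trig_poly K b"
  define g where "g = trig_poly K c"
  have f_eq: "f y = (\<Sum>j<N. (fejer N (y $ l - X j) / N) *\<^sub>R a j)" for y
  proof -
    have "f y = (\<Sum>m\<in>Z. \<Sum>j<N. (of_real (fejer_weight N m / N) * (cis (of_int m * y $ l) * root_of_unity N (- m * int j))) *\<^sub>C a j)"
      unfolding f_def trig_poly_def K_def sum.reindex[OF inj] b_def
      by (simp add: char_fun_axis scaleC.sum_right scaleC_scaleC mult_ac)
    also have "\<dots> = (\<Sum>m\<in>Z. \<Sum>j<N. (of_real (fejer_weight N m) * cis (of_int m * (y $ l - X j)) / of_nat N) *\<^sub>C a j)"
    proof (intro sum.cong refl arg_cong2[where f = scaleC])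
      fix m j
      have "cis (of_int m * y $ l) * root_of_unity N (- m * int j) = cis (of_int m * (y $ l - X j))"
        by (simp add: root_of_unity_def cis_mult X_def algebra_simps)
      then show "of_real (fejer_weight N m / N) * (cis (of_int m * y $ l) * root_of_unity N (- m * int j)) =
          of_real (fejer_weight N m) * cis (of_int m * (y $ l - X j)) / of_nat N" by simp
    qed
    also have "\<dots> = (\<Sum>j<N. ((\<Sum>m\<in>Z. of_real (fejer_weight N m) * cis (of_int m * (y $ l - X j))) / of_nat N) *\<^sub>C a j)"
      by (subst sum.swap) (simp add: scaleC.sum_left sum_divide_distrib)
    also have "\<dots> = (\<Sum>j<N. (fejer N (y $ l - X j) / N) *\<^sub>R a j)"
      unfolding Z_def fejer_eq_sum[OF N, symmetric] by (simp flip: scaleC_of_real)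
    finally show ?thesis .
  qed
  have f_le: "norm (f y) powr p \<le> (\<Sum>j<N. norm (a j) powr p / N * fejer N (y $ l - X j))" for y
  proof -
    have "norm (f y) \<le> (\<Sum>j<N. fejer N (y $ l - X j) / N * norm (a j))"
      unfolding f_eq by (rule order_trans[OF norm_sum]) (simp add: fejer_nonneg)
    then have "norm (f y) powr p \<le> (\<Sum>j<N. fejer N (y $ l - X j) / N * norm (a j)) powr p"
      using p by (intro powr_mono2) auto
    also have "\<dots> \<le> (\<Sum>j<N. fejer N (y $ l - X j) / N * norm (a j) powr p)"
    proof (rule jensen_powr_sum[OF p])
      show "(\<Sum>j<N. fejer N (y $ l - X j) / N) = 1"
        unfolding sum_divide_distrib[symmetric] X_def sum_fejer[OF N] using N by simp
    qed (auto simp: fejer_nonneg)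
    also have "\<dots> = (\<Sum>j<N. norm (a j) powr p / N * fejer N (y $ l - X j))"
      by (simp add: mult_ac)
    finally show ?thesis .
  qed
  have cf: "continuous_on UNIV f" and cg: "continuous_on UNIV g" by (simp_all add: f_def g_def)
  have p0: "0 < p" using p by simp
  have cgp: "continuous_on UNIV (\<lambda>y. norm (g y) powr p)" and cfp: "continuous_on UNIV (\<lambda>y. norm (f y) powr p)"
    using cf cg p by (auto intro!: continuous_on_powr_const continuous_on_norm)
  have "Lp_norm p f powr p \<le> torus_mean (\<lambda>y. \<Sum>j<N. norm (a j) powr p / N * fejer N (y $ l - X j))"
    unfolding Lp_norm_powr[OF cf p0] using f_le
    by (intro torus_mean_mono cfp continuous_on_sum continuous_on_mult_left continuous_on_fejer_shift)
  also have "\<dots> = (\<Sum>j<N. norm (a j) powr p / N * torus_mean (\<lambda>y::'n rvec. fejer N (y $ l - X j)))"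
    unfolding torus_mean_mult_left[symmetric]
    by (rule torus_mean_sum) (intro finite_lessThan continuous_on_mult_left continuous_on_fejer_shift)+
  also have "\<dots> = (\<Sum>j<N. norm (a j) powr p) / N"
  proof -
    have "torus_mean (\<lambda>y::'n rvec. fejer N (y $ l - s)) = 1" for s
    proof -
      have "fejer N (y $ l - s) = fejer N (s - y $ l)" for y :: "'n rvec"
        using fejer_minus[of N "s - y $ l"] by simp
      then show ?thesis using torus_mean_fejer[OF N, of s l] by simp
    qed
    then show ?thesis by (simp add: sum_divide_distrib)
  qed
  finally have Lf: "Lp_norm p f powr p \<le> (\<Sum>j<N. norm (a j) powr p) / N" .
  have Lg: "Lp_norm p g \<le> C * Lp_norm p f"
    unfolding f_def g_def c_def by (rule Lp_multiplier_boundD[OF bound K])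
  \<comment> \<open>Averaging against the second Fejer kernel multiplies the coefficient at m by
    \<open>fejer_weight\<close> once more, and the projection has removed m < 0; what remains is
    convolution with \<open>riesz_kernel\<close>.\<close>
  have out_eq: "(\<Sum>j<N. riesz_op N i j (a j)) = torus_mean (\<lambda>y. fejer N (X i - y $ l) *\<^sub>R g y)" for i
  proof -
    have c_axis: "c (axis l m) = (if 0 \<le> m then b (axis l m) else 0)" for m
    proof -
      have "(\<forall>j. 0 \<le> axis l m $ j) \<longleftrightarrow> 0 \<le> m" by (auto simp: axis_def)
      then show ?thesis by (simp add: c_def riesz_projection_def)
    qed
    have "torus_mean (\<lambda>y. fejer N (X i - y $ l) *\<^sub>R g y) =
        torus_mean (\<lambda>y. \<Sum>m\<in>Z. (of_real (fejer_weight N m) * cis (of_int m * X i)) *\<^sub>C (\<e> (- axis l m) y *\<^sub>C g y))"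
      unfolding scaleC_of_real[symmetric] fejer_char_fun[OF N] Z_def[symmetric] scaleC.sum_left scaleC_scaleC ..
    also have "\<dots> = (\<Sum>m\<in>Z. torus_mean (\<lambda>y. (of_real (fejer_weight N m) * cis (of_int m * X i)) *\<^sub>C (\<e> (- axis l m) y *\<^sub>C g y)))"
      by (rule torus_mean_sum[OF Z]) (intro continuous_intros cg)
    also have "\<dots> = (\<Sum>m\<in>Z. (of_real (fejer_weight N m) * cis (of_int m * X i)) *\<^sub>C (if 0 \<le> m then b (axis l m) else 0))"
    proof (intro sum.cong refl)
      fix m assume m: "m \<in> Z"
      have "torus_mean (\<lambda>y. (of_real (fejer_weight N m) * cis (of_int m * X i)) *\<^sub>C (\<e> (- axis l m) y *\<^sub>C g y)) =
        (of_real (fejer_weight N m) * cis (of_int m * X i)) *\<^sub>C torus_mean (\<lambda>y. \<e> (- axis l m) y *\<^sub>C g y)"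
        by (rule torus_mean_bounded_linear[OF scaleC.bounded_linear_right]) (intro continuous_intros cg)
      also have "torus_mean (\<lambda>y. \<e> (- axis l m) y *\<^sub>C g y) = c (axis l m)"
        unfolding g_def trig_poly_mean[OF K] using m by (simp add: K_def)
      finally show "torus_mean (\<lambda>y. (of_real (fejer_weight N m) * cis (of_int m * X i)) *\<^sub>C (\<e> (- axis l m) y *\<^sub>C g y)) =
        (of_real (fejer_weight N m) * cis (of_int m * X i)) *\<^sub>C (if 0 \<le> m then b (axis l m) else 0)"
        unfolding c_axis .
    qed
    also have "\<dots> = (\<Sum>m\<in>int ` {..<N}. (of_real (fejer_weight N m) * cis (of_int m * X i)) *\<^sub>C b (axis l m))"
    proof (rule sum.mono_neutral_cong_right[OF Z])
      show "int ` {..<N} \<subseteq> Z" by (auto simp: Z_def)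
      show "\<forall>m\<in>Z - int ` {..<N}. (of_real (fejer_weight N m) * cis (of_int m * X i)) *\<^sub>C (if 0 \<le> m then b (axis l m) else 0) = 0"
      proof
        fix m assume m: "m \<in> Z - int ` {..<N}"
        have "\<not> 0 \<le> m"
        proof
          assume "0 \<le> m"
          then have "m \<in> int ` {..<N}" using m by (intro image_eqI[of _ _ "nat m"]) (auto simp: Z_def)
          then show False using m by simp
        qed
        then show "(of_real (fejer_weight N m) * cis (of_int m * X i)) *\<^sub>C (if 0 \<le> m then b (axis l m) else 0) = 0"
          by (simp add: scaleC.zero_right)
      qed
    qed auto
    also have "\<dots> = (\<Sum>m<N. (of_real (fejer_weight N (int m)) * cis (real m * X i)) *\<^sub>C b (axis l (int m)))"
      by (subst sum.reindex) auto
    also have "\<dots> = (\<Sum>m<N. \<Sum>j<N. ((1 / of_nat N) * (of_real ((fejer_weight N (int m))\<^sup>2) * root_of_unity N (int m * (int i - int j)))) *\<^sub>C a j)"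
      unfolding b_def scaleC.sum_right scaleC_scaleC
    proof (intro sum.cong refl arg_cong2[where f = scaleC])
      fix m j
      have "cis (real m * X i) * root_of_unity N (- int m * int j) = root_of_unity N (int m * (int i - int j))"
        by (simp add: root_of_unity_def cis_mult X_def algebra_simps diff_divide_distrib)
      then show "complex_of_real (fejer_weight N (int m)) * cis (real m * X i) *
          (complex_of_real (fejer_weight N (axis l (int m) $ l) / real N) * root_of_unity N (- (axis l (int m) $ l) * int j)) =
          1 / of_nat N * (complex_of_real ((fejer_weight N (int m))\<^sup>2) * root_of_unity N (int m * (int i - int j)))"
        by (simp add: power2_eq_square mult_ac)
    qed
    also have "\<dots> = (\<Sum>j<N. riesz_op N i j (a j))"
      by (subst sum.swap) (simp add: riesz_op_apply riesz_kernel_def sum_distrib_left flip: scaleC.sum_left)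
    finally show ?thesis ..
  qed
  have out_le: "norm (\<Sum>j<N. riesz_op N i j (a j)) powr p \<le> torus_mean (\<lambda>y. fejer N (X i - y $ l) * norm (g y) powr p)" for i
  proof -
    have "norm (\<Sum>j<N. riesz_op N i j (a j)) \<le> torus_mean (\<lambda>y. norm (fejer N (X i - y $ l) *\<^sub>R g y))"
      unfolding out_eq by (rule norm_torus_mean_le) (intro continuous_on_scaleR continuous_on_fejer_shift cg)
    also have "\<dots> = torus_mean (\<lambda>y. fejer N (X i - y $ l) * norm (g y))"
      by (simp add: fejer_nonneg)
    finally have "norm (\<Sum>j<N. riesz_op N i j (a j)) powr p \<le> torus_mean (\<lambda>y. fejer N (X i - y $ l) * norm (g y)) powr p"
      using p by (intro powr_mono2) auto
    also have "\<dots> \<le> torus_mean (\<lambda>y. fejer N (X i - y $ l) * norm (g y) powr p)"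
      by (rule jensen_powr_torus_mean[OF p continuous_on_fejer_shift(1) continuous_on_norm[OF cg]])
        (auto simp: fejer_nonneg torus_mean_fejer[OF N])
    finally show ?thesis .
  qed
  have "(\<Sum>i<N. norm (\<Sum>j<N. riesz_op N i j (a j)) powr p) \<le> (\<Sum>i<N. torus_mean (\<lambda>y. fejer N (X i - y $ l) * norm (g y) powr p))"
    by (intro sum_mono out_le)
  also have "\<dots> = torus_mean (\<lambda>y. \<Sum>i<N. fejer N (X i - y $ l) * norm (g y) powr p)"
    by (rule torus_mean_sum[symmetric]) (intro finite_lessThan continuous_on_mult continuous_on_fejer_shift cgp)+
  also have "\<dots> = torus_mean (\<lambda>y. N * norm (g y) powr p)"
    unfolding sum_distrib_right[symmetric] X_def sum_fejer_reflected[OF N] ..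
  also have "\<dots> = N * Lp_norm p g powr p"
    unfolding torus_mean_mult_left Lp_norm_powr[OF cg p0] ..
  also have "\<dots> \<le> N * (C * Lp_norm p f) powr p"
    using Lg p by (intro mult_left_mono powr_mono2) auto
  also have "\<dots> = C powr p * (N * Lp_norm p f powr p)"
    by (simp add: powr_mult)
  also have "\<dots> \<le> C powr p * (N * ((\<Sum>j<N. norm (a j) powr p) / N))"
    by (rule mult_left_mono[OF mult_left_mono[OF Lf]]) auto
  also have "\<dots> = C powr p * (\<Sum>j<N. norm (a j) powr p)" using N by simp
  finally show "(\<Sum>i<N. norm (\<Sum>j<N. riesz_op N i j (a j)) powr p) \<le> C powr p * (\<Sum>j<N. norm (a j) powr p)" .
qed

text \<open>Convolution on the cyclic group is diagonal in its characters; orthogonality selects the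
  one m in {0..<N} congruent to k.\<close>

lemma riesz_kernel_eigenvalue:
  assumes N: "0 < N"
  shows "(\<Sum>j<N. riesz_kernel N (int i - int j) * root_of_unity N (k * int j)) =
    of_real ((fejer_weight N (k mod int N))\<^sup>2) * root_of_unity N (k * int i)"
proof -
  define n where "n = nat (k mod int N)"
  have n: "int n = k mod int N" "n < N" using N by (auto simp: n_def nat_less_iff)
  have "(\<Sum>j<N. riesz_kernel N (int i - int j) * root_of_unity N (k * int j)) =
     (\<Sum>j<N. \<Sum>m<N. (1 / of_nat N) * (of_real ((fejer_weight N (int m))\<^sup>2) * root_of_unity N (int m * int i)) * root_of_unity N ((k - int m) * int j))"
  proof (intro sum.cong refl)
    fix j
    have "root_of_unity N (int m * (int i - int j)) * root_of_unity N (k * int j) =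
      root_of_unity N (int m * int i) * root_of_unity N ((k - int m) * int j)" for m
      by (simp add: algebra_simps flip: root_of_unity_add)
    then show "riesz_kernel N (int i - int j) * root_of_unity N (k * int j) = (\<Sum>m<N. (1 / of_nat N) * (of_real ((fejer_weight N (int m))\<^sup>2) * root_of_unity N (int m * int i)) * root_of_unity N ((k - int m) * int j))"
      by (simp add: riesz_kernel_def sum_distrib_left sum_distrib_right mult.assoc)
  qed
  also have "\<dots> = (\<Sum>m<N. (1 / of_nat N) * (of_real ((fejer_weight N (int m))\<^sup>2) * root_of_unity N (int m * int i)) * (\<Sum>j<N. root_of_unity N ((k - int m) * int j)))"
    by (subst sum.swap) (simp add: sum_distrib_left)
  also have "\<dots> = (\<Sum>m<N. if m = n then of_real ((fejer_weight N (int m))\<^sup>2) * root_of_unity N (int m * int i) else 0)"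
  proof (intro sum.cong refl)
    fix m assume m: "m \<in> {..<N}"
    have "int N dvd k - int m \<longleftrightarrow> m = n"
    proof -
      have "int N dvd k - int m \<longleftrightarrow> k mod int N = int m mod int N" by (simp add: mod_eq_dvd_iff)
      also have "int m mod int N = int m" using m by simp
      finally show ?thesis unfolding n(1)[symmetric] by auto
    qed
    then show "(1 / of_nat N) * (of_real ((fejer_weight N (int m))\<^sup>2) * root_of_unity N (int m * int i)) * (\<Sum>j<N. root_of_unity N ((k - int m) * int j))
      = (if m = n then of_real ((fejer_weight N (int m))\<^sup>2) * root_of_unity N (int m * int i) else 0)"
      unfolding sum_root_of_unity[OF N] using N by simp
  qed
  also have "\<dots> = of_real ((fejer_weight N (int n))\<^sup>2) * root_of_unity N (int n * int i)"
    using n(2) by simp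
  also have "root_of_unity N (int n * int i) = root_of_unity N (k * int i)"
    unfolding n(1) by (rule root_of_unity_cong[OF N]) (simp add: mod_eq_dvd_iff[symmetric] mod_simps)
  finally show ?thesis by (simp only: n(1))
qed

text \<open>For fixed x, the values of the polynomial at the N points x + \<open>X j\<close> along
  the l-th axis form a sequence to which the cyclic bound applies. By the eigenvalue formula its
  image consists of the values of the multiplied polynomial. Integrating over x and using
  translation invariance gives the bound on the torus with the same constant.\<close>

lemma Lp_norm_riesz_symbol:
  fixes K :: "'n::{finite,linorder} zvec set" and a :: "'n zvec \<Rightarrow> 'e::complex_banach"
  assumes bound: "lp_bounded N p A (riesz_op N :: nat \<Rightarrow> nat \<Rightarrow> 'e \<Rightarrow>\<^sub>L 'e)" and A: "0 \<le> A" and p: "1 < p" and N: "0 < N"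
  shows "Lp_norm p (trig_poly K (\<lambda>k. (fejer_weight N (k $ l mod int N))\<^sup>2 *\<^sub>R a k)) \<le> A powr (1 / p) * Lp_norm p (trig_poly K a)"
proof -
  define X where "X j = 2 * pi * real j / real N" for j
  define F where "F = trig_poly K a"
  define H where "H = trig_poly K (\<lambda>k. (fejer_weight N (k $ l mod int N))\<^sup>2 *\<^sub>R a k)"
  have p0: "0 < p" using p by simp
  have X: "0 \<le> X j" "X j \<le> 2 * pi" if "j < N" for j
    using that N by (simp_all add: X_def pos_divide_le_eq)
  have e: "\<e> k (x + X j *\<^sub>R axis l 1) = root_of_unity N (k $ l * int j) * \<e> k x" for k x j
    by (simp add: char_fun_shift root_of_unity_def X_def cis_conv_exp mult_ac)
  have conv: "(\<Sum>j<N. riesz_op N i j (F (x + X j *\<^sub>R axis l 1))) = H (x + X i *\<^sub>R axis l 1)" for x i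
  proof -
    have "(\<Sum>j<N. riesz_op N i j (F (x + X j *\<^sub>R axis l 1))) =
        (\<Sum>j<N. \<Sum>k\<in>K. (riesz_kernel N (int i - int j) * root_of_unity N (k $ l * int j) * \<e> k x) *\<^sub>C a k)"
      by (simp add: F_def trig_poly_def riesz_op_apply e scaleC.sum_right scaleC_scaleC mult.assoc)
    also have "\<dots> = (\<Sum>k\<in>K. ((\<Sum>j<N. riesz_kernel N (int i - int j) * root_of_unity N (k $ l * int j)) * \<e> k x) *\<^sub>C a k)"
      by (subst sum.swap) (simp add: sum_distrib_right scaleC.sum_left)
    also have "\<dots> = H (x + X i *\<^sub>R axis l 1)"
      unfolding riesz_kernel_eigenvalue[OF N] H_def trig_poly_def e
      by (intro sum.cong refl) (simp add: scaleC_scaleC mult_ac flip: scaleC_of_real)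
    finally show ?thesis .
  qed
  have cont: "continuous_on UNIV F" "continuous_on UNIV H" by (simp_all add: F_def H_def)
  have cp: "continuous_on UNIV (\<lambda>x. norm (F x) powr p)" "continuous_on UNIV (\<lambda>x. norm (H x) powr p)"
    using cont p by (auto intro!: continuous_on_powr_const continuous_on_norm)
  have cs: "continuous_on UNIV (\<lambda>x. norm (F (x + s)) powr p)" "continuous_on UNIV (\<lambda>x. norm (H (x + s)) powr p)" for s
    using continuous_on_compose2[OF cp(1), of UNIV "\<lambda>x. x + s"] continuous_on_compose2[OF cp(2), of UNIV "\<lambda>x. x + s"]
    by (simp_all add: continuous_on_add)
  have per: "norm (F (x + (2 * pi) *\<^sub>R axis l 1)) powr p = norm (F x) powr p"
    "norm (H (x + (2 * pi) *\<^sub>R axis l 1)) powr p = norm (H x) powr p" for x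
    by (simp_all add: F_def H_def trig_poly_periodic)
  have "N * Lp_norm p H powr p = (\<Sum>i<N. torus_mean (\<lambda>x. norm (H (x + X i *\<^sub>R axis l 1)) powr p))"
    using X by (simp add: Lp_norm_powr[OF cont(2) p0] torus_mean_shift[OF cp(2) per(2)])
  also have "\<dots> = torus_mean (\<lambda>x. \<Sum>i<N. norm (H (x + X i *\<^sub>R axis l 1)) powr p)"
    by (rule torus_mean_sum[symmetric]) (intro finite_lessThan cs)+
  also have "\<dots> \<le> torus_mean (\<lambda>x. A * (\<Sum>j<N. norm (F (x + X j *\<^sub>R axis l 1)) powr p))"
  proof (rule torus_mean_mono)
    fix x show "(\<Sum>i<N. norm (H (x + X i *\<^sub>R axis l 1)) powr p) \<le> A * (\<Sum>j<N. norm (F (x + X j *\<^sub>R axis l 1)) powr p)"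
      using bound unfolding lp_bounded_def conv[symmetric] by (rule spec)
  qed (intro continuous_on_sum continuous_on_mult_left cs)+
  also have "\<dots> = A * (\<Sum>j<N. torus_mean (\<lambda>x. norm (F (x + X j *\<^sub>R axis l 1)) powr p))"
    unfolding torus_mean_mult_left by (subst torus_mean_sum) (intro finite_lessThan cs refl)+
  also have "\<dots> = A * (N * Lp_norm p F powr p)"
    using X by (simp add: Lp_norm_powr[OF cont(1) p0] torus_mean_shift[OF cp(1) per(1)])
  finally have "N * Lp_norm p H powr p \<le> N * (A * Lp_norm p F powr p)" by (simp add: mult_ac)
  then have "Lp_norm p H powr p \<le> A * Lp_norm p F powr p"
    by (rule mult_left_le_imp_le) (use N in simp)
  also have "\<dots> = (A powr (1 / p) * Lp_norm p F) powr p"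
    using A p by (simp add: powr_mult powr_powr)
  finally have "torus_mean (\<lambda>x. norm (H x) powr p) \<le> (A powr (1 / p) * Lp_norm p F) powr p"
    unfolding Lp_norm_powr[OF cont(2) p0] .
  then have "Lp_norm p H \<le> A powr (1 / p) * Lp_norm p F"
    by (subst Lp_norm_le_iff[OF cont(2) p0]) auto
  then show ?thesis by (simp only: F_def H_def)
qed

text \<open>For \<open>m < 0\<close> the residue is \<open>N + m\<close>, whose weight \<open>-m / N\<close> tends to 0.\<close>

lemma riesz_symbol_tendsto:
  "(\<lambda>M. (fejer_weight (2 ^ M) (m mod int (2 ^ M)))\<^sup>2) \<longlonglongrightarrow> (if 0 \<le> m then 1 else 0)"
proof -
  have lim: "(\<lambda>M. c / 2 ^ M) \<longlonglongrightarrow> 0" for c :: real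
    using tendsto_mult_right_zero[OF LIMSEQ_inverse_realpow_zero[of 2], of c] by (simp add: divide_inverse)
  have "\<forall>\<^sub>F M in sequentially. \<bar>m\<bar> < 2 ^ M"
  proof -
    have "\<bar>m\<bar> < 2 ^ M" if "nat \<bar>m\<bar> \<le> M" for M
    proof -
      have "\<bar>m\<bar> \<le> int M" using that by linarith
      also have "int M < int (2 ^ M)" by (subst of_nat_less_iff) (rule less_exp)
      finally show ?thesis by simp
    qed
    then show ?thesis unfolding eventually_sequentially by blast
  qed
  note ev = this
  show ?thesis
  proof (cases "0 \<le> m")
    case True
    have "(\<lambda>M. (1 - of_int m / 2 ^ M)\<^sup>2) \<longlonglongrightarrow> (1 - 0 :: real)\<^sup>2" by (intro tendsto_intros lim)
    moreover have "\<forall>\<^sub>F M in sequentially. (1 - of_int m / 2 ^ M)\<^sup>2 = (fejer_weight (2 ^ M) (m mod int (2 ^ M)))\<^sup>2"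
      using ev by eventually_elim (use True in \<open>simp add: fejer_weight_def\<close>)
    ultimately have "(\<lambda>M. (fejer_weight (2 ^ M) (m mod int (2 ^ M)))\<^sup>2) \<longlonglongrightarrow> (1 - 0)\<^sup>2"
      by (rule Lim_transform_eventually)
    then show ?thesis using True by simp
  next
    case False
    have "(\<lambda>M. (- of_int m / 2 ^ M)\<^sup>2) \<longlonglongrightarrow> (0 :: real)\<^sup>2" by (intro tendsto_intros lim)
    moreover have "\<forall>\<^sub>F M in sequentially. (- of_int m / 2 ^ M)\<^sup>2 = (fejer_weight (2 ^ M) (m mod int (2 ^ M)))\<^sup>2"
      using ev
    proof eventually_elim
      case (elim M)
      have "m mod int (2 ^ M) = (m + int (2 ^ M)) mod int (2 ^ M)" by simp
      also have "\<dots> = m + 2 ^ M" using elim False by (subst mod_pos_pos_trivial) auto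
      finally have "fejer_weight (2 ^ M) (m mod int (2 ^ M)) = 1 - \<bar>of_int m + 2 ^ M\<bar> / 2 ^ M"
        by (simp add: fejer_weight_def)
      also have "\<bar>of_int m + 2 ^ M :: real\<bar> = of_int m + 2 ^ M"
      proof -
        have "real_of_int (- m) \<le> real_of_int (2 ^ M)" using elim by (subst of_int_le_iff) linarith
        then show ?thesis by simp
      qed
      also have "1 - (of_int m + 2 ^ M) / 2 ^ M = (- of_int m / 2 ^ M :: real)" by (simp add: field_simps)
      finally show ?case by simp
    qed
    ultimately have "(\<lambda>M. (fejer_weight (2 ^ M) (m mod int (2 ^ M)))\<^sup>2) \<longlonglongrightarrow> 0\<^sup>2"
      by (rule Lim_transform_eventually)
    then show ?thesis using False by simp
  qed
qed

text \<open>On a finite spectrum the symbols converge to the half-space indicator, and the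
  difference is controlled in the sup norm by finitely many coefficients; the bound survives the
  limit because A is the same for every M.\<close>

lemma coordinate_projection_bound:
  assumes bound: "\<And>M. lp_bounded (2 ^ M) p A (riesz_op (2 ^ M) :: nat \<Rightarrow> nat \<Rightarrow> 'e::complex_banach \<Rightarrow>\<^sub>L 'e)"
    and A: "0 \<le> A" and p: "1 < p"
  shows "Lp_multiplier_bound p (\<lambda>(k :: 'n::{finite,linorder} zvec) (x :: 'e). if 0 \<le> k $ l then x else 0) (A powr (1 / p))"
  unfolding Lp_multiplier_bound_def
proof (intro allI impI)
  fix K :: "'n zvec set" and a :: "'n zvec \<Rightarrow> 'e" assume K: "finite K"
  define \<sigma> where "\<sigma> M k = (fejer_weight (2 ^ M) (k $ l mod int (2 ^ M)))\<^sup>2" for M and k :: "'n zvec"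
  define \<pi> where "\<pi> k = (if 0 \<le> k $ l then 1 else 0 :: real)" for k :: "'n zvec"
  let ?L = "Lp_norm p (trig_poly K (\<lambda>k. if 0 \<le> k $ l then a k else 0))"
  have le: "?L \<le> A powr (1 / p) * Lp_norm p (trig_poly K a) + (\<Sum>k\<in>K. \<bar>\<pi> k - \<sigma> M k\<bar> * norm (a k))" for M
  proof -
    have "trig_poly K (\<lambda>k. if 0 \<le> k $ l then a k else 0) x =
        trig_poly K (\<lambda>k. \<sigma> M k *\<^sub>R a k) x + trig_poly K (\<lambda>k. (\<pi> k - \<sigma> M k) *\<^sub>R a k) x" for x
      unfolding trig_poly_def sum.distrib[symmetric] scaleC.add_right[symmetric]
      by (intro sum.cong refl arg_cong2[where f = scaleC]) (simp add: \<pi>_def algebra_simps)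
    then have eq: "trig_poly K (\<lambda>k. if 0 \<le> k $ l then a k else 0) =
        (\<lambda>x. trig_poly K (\<lambda>k. \<sigma> M k *\<^sub>R a k) x + trig_poly K (\<lambda>k. (\<pi> k - \<sigma> M k) *\<^sub>R a k) x)"
      by (rule ext)
    have "?L \<le> Lp_norm p (trig_poly K (\<lambda>k. \<sigma> M k *\<^sub>R a k)) + Lp_norm p (trig_poly K (\<lambda>k. (\<pi> k - \<sigma> M k) *\<^sub>R a k))"
      unfolding eq by (rule Lp_norm_triangle[OF continuous_trig_poly continuous_trig_poly p])
    also have "Lp_norm p (trig_poly K (\<lambda>k. \<sigma> M k *\<^sub>R a k)) \<le> A powr (1 / p) * Lp_norm p (trig_poly K a)"
      unfolding \<sigma>_def by (rule Lp_norm_riesz_symbol[OF bound A p]) simp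
    also have "Lp_norm p (trig_poly K (\<lambda>k. (\<pi> k - \<sigma> M k) *\<^sub>R a k)) \<le> (\<Sum>k\<in>K. \<bar>\<pi> k - \<sigma> M k\<bar> * norm (a k))"
      using p by (intro Lp_norm_le_sup continuous_trig_poly sum_nonneg)
        (auto simp: trig_poly_def norm_scaleC intro!: order_trans[OF norm_sum])
    finally show ?thesis by simp
  qed
  have "(\<lambda>M. A powr (1 / p) * Lp_norm p (trig_poly K a) + (\<Sum>k\<in>K. \<bar>\<pi> k - \<sigma> M k\<bar> * norm (a k)))
    \<longlonglongrightarrow> A powr (1 / p) * Lp_norm p (trig_poly K a) + (\<Sum>k\<in>K. \<bar>\<pi> k - \<pi> k\<bar> * norm (a k))"
    unfolding \<sigma>_def \<pi>_def by (intro tendsto_intros riesz_symbol_tendsto)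
  then have "?L \<le> A powr (1 / p) * Lp_norm p (trig_poly K a) + (\<Sum>k\<in>K. \<bar>\<pi> k - \<pi> k\<bar> * norm (a k))"
    by (rule LIMSEQ_le_const) (use le in blast)
  then show "?L \<le> A powr (1 / p) * Lp_norm p (trig_poly K a)" by simp
qed

text \<open>This is where the exponent p0 of the UMD property is exchanged for p; 7 and 17 are the
  constants of \<open>riesz_op_hormander\<close>.\<close>

theorem UMD_coordinate_projection_bound:
  assumes "UMD_space TYPE('n::{finite,linorder}) TYPE('e::complex_banach)" and p: "1 < p"
  shows "\<exists>C\<ge>0. \<forall>l. Lp_multiplier_bound p (\<lambda>(k :: 'n zvec) (x :: 'e). if 0 \<le> k $ l then x else 0) C"
proof -
  obtain p0 C0 where p0: "1 < p0" "0 < C0"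
    and bound: "Lp_multiplier_bound p0 (\<lambda>k. blinfun_apply ((riesz_projection :: 'n zvec \<Rightarrow> 'e \<Rightarrow>\<^sub>L 'e) k)) C0"
    using assms(1) unfolding UMD_space_iff by blast
  obtain A where A: "0 \<le> A" and ext: "\<forall>M (K :: nat \<Rightarrow> nat \<Rightarrow> 'e \<Rightarrow>\<^sub>L 'e).
    lp_bounded (2 ^ M) p0 (C0 powr p0) K \<and> hormander M 7 17 K \<and> hormander M 7 17 (\<lambda>i j. K j i) \<longrightarrow> lp_bounded (2 ^ M) p A K"
    using calderon_zygmund_extrapolation[OF p p0(1), of "C0 powr p0" 7 17] by auto
  have "lp_bounded (2 ^ M) p A (riesz_op (2 ^ M) :: nat \<Rightarrow> nat \<Rightarrow> 'e \<Rightarrow>\<^sub>L 'e)" for M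
    using ext riesz_op_hormander riesz_op_lp_bounded[OF bound _ p0(1), of "2 ^ M"] p0(2) by auto
  then have "Lp_multiplier_bound p (\<lambda>(k :: 'n zvec) (x :: 'e). if 0 \<le> k $ l then x else 0) (A powr (1 / p))" for l
    by (rule coordinate_projection_bound[OF _ A p])
  then show ?thesis by (intro exI[of _ "A powr (1 / p)"]) auto
qed

section \<open>Multipliers of bounded variation\<close>

lemma finite_zvec_interval [simp]: "finite {\<alpha>..\<beta> :: 'n::finite zvec}"
proof (rule finite_subset)
  show "{\<alpha>..\<beta>} \<subseteq> vec_lambda ` (\<Pi>\<^sub>E i\<in>UNIV. {\<alpha> $ i..\<beta> $ i})"
  proof
    fix k assume "k \<in> {\<alpha>..\<beta>}"
    then show "k \<in> vec_lambda ` (\<Pi>\<^sub>E i\<in>UNIV. {\<alpha> $ i..\<beta> $ i})"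
      by (intro image_eqI[of _ _ "vec_nth k"]) (auto simp: less_eq_vec_def PiE_def)
  qed
  show "finite (vec_lambda ` (\<Pi>\<^sub>E i\<in>(UNIV :: 'n set). {\<alpha> $ i..\<beta> $ i}))"
    by (intro finite_imageI finite_PiE) auto
qed

lemma set_coords [simp]: "set (coords :: 'n::{finite,linorder} list) = UNIV"
  and distinct_coords [simp]: "distinct (coords :: 'n::{finite,linorder} list)"
  by (simp_all add: coords_def)

text \<open>The difference operator of the variation with the exponent \<open>\<gamma>\<^sub>\<xi>\<close> built in: along the faces
  \<open>x\<^sub>j = \<alpha>\<^sub>j\<close> no difference is taken.\<close>

definition face_diff :: "'n::finite zvec \<Rightarrow> 'n \<Rightarrow> ('n zvec \<Rightarrow> 'b::ab_group_add) \<Rightarrow> 'n zvec \<Rightarrow> 'b"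
  where "face_diff \<alpha> j N x = (if x $ j \<noteq> \<alpha> $ j then N x - N (x - axis j 1) else N x)"

text \<open>The exponent depends on the fixed \<xi>, whereas the operators evaluate at shifted
  points. Distinctness saves the argument: a shift in coordinate j leaves the coordinates still to
  be processed unchanged, so the face tests at x and at \<xi> agree whenever they are made. On a
  face the exponent is 0, and the value 0 of \<open>diff_op\<close> there is never reached.\<close>

lemma foldr_diff_op_eq_face_diff:
  assumes "distinct js" "\<And>j. j \<in> set js \<Longrightarrow> x $ j = \<xi> $ j"
  shows "foldr (\<lambda>j. diff_op \<alpha> j ^^ ((\<chi> j. if \<xi> $ j \<noteq> \<alpha> $ j then 1 else 0) $ j)) js N x = foldr (face_diff \<alpha>) js N x"
  using assms
proof (induction js arbitrary: x)
  case (Cons j js)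
  let ?G = "foldr (\<lambda>j. diff_op \<alpha> j ^^ ((\<chi> j. if \<xi> $ j \<noteq> \<alpha> $ j then 1 else 0) $ j)) js N"
  let ?H = "foldr (face_diff \<alpha>) js N"
  have "?G x = ?H x" using Cons.prems by (intro Cons.IH) auto
  moreover have "?G (x - axis j 1) = ?H (x - axis j 1)"
    using Cons.prems by (intro Cons.IH) (auto simp: axis_def)
  moreover have "x $ j = \<xi> $ j" using Cons.prems by simp
  ultimately show ?case using diff_op_def[of \<alpha> j ?G x] by (simp add: face_diff_def[of _ _ ?H])
qed simp

lemma multi_compose_diff_op:
  "multi_compose (diff_op \<alpha>) (\<chi> j. if \<xi> $ j \<noteq> \<alpha> $ j then 1 else 0) N \<xi> = foldr (face_diff \<alpha>) coords N \<xi>"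
  unfolding multi_compose_def by (rule foldr_diff_op_eq_face_diff) auto

lemma variation_eq: "variation \<alpha> \<beta> N = (\<Sum>\<xi>\<in>{\<alpha>..\<beta>}. norm (foldr (face_diff \<alpha>) coords N \<xi>))"
  unfolding variation_def multi_compose_diff_op ..

lemma telescope_int:
  fixes h :: "int \<Rightarrow> 'b::ab_group_add"
  assumes "a \<le> b"
  shows "(\<Sum>t\<in>{a..b}. if t \<noteq> a then h t - h (t - 1) else h t) = h b"
  using assms
proof (induction b rule: int_ge_induct)
  case (step b)
  have "{a..b + 1} = insert (b + 1) {a..b}" using step.hyps by auto
  then show ?case using step by simp
qed simp

text \<open>The coordinates in \<open>js\<close> run from \<alpha> to k while the others are frozen
  at k. Summing over coordinate j telescopes to its value at the upper end, the undifferenced term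
  on the face supplying the lower one.\<close>

lemma sum_foldr_face_diff:
  fixes N :: "'n::finite zvec \<Rightarrow> 'b::ab_group_add"
  assumes "\<alpha> \<le> k" "distinct js"
  shows "(\<Sum>\<xi> | \<xi> \<in> {\<alpha>..k} \<and> (\<forall>i. i \<notin> set js \<longrightarrow> \<xi> $ i = k $ i). foldr (face_diff \<alpha>) js N \<xi>) = N k"
  using assms(2)
proof (induction js)
  case Nil
  have "{\<xi>. \<xi> \<in> {\<alpha>..k} \<and> (\<forall>i. i \<notin> set [] \<longrightarrow> \<xi> $ i = k $ i)} = {k}"
    using assms(1) by (auto simp: vec_eq_iff)
  then show ?case by simp
next
  case (Cons j js)
  define A where "A js = {\<xi>. \<xi> \<in> {\<alpha>..k} \<and> (\<forall>i. i \<notin> set js \<longrightarrow> \<xi> $ i = k $ i)}" for js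
  define u where "u \<eta> t = (\<chi> i. if i = j then t else \<eta> $ i)" for \<eta> :: "'n zvec" and t
  define G where "G = foldr (face_diff \<alpha>) js N"
  have finA: "finite (A js)" for js by (rule finite_subset[of _ "{\<alpha>..k}"]) (auto simp: A_def)
  have jn: "j \<notin> set js" using Cons.prems by simp
  have ak: "\<alpha> $ i \<le> k $ i" for i using assms(1) by (simp add: less_eq_vec_def)
  have bij: "bij_betw (\<lambda>(\<eta>, t). u \<eta> t) (A js \<times> {\<alpha> $ j..k $ j}) (A (j # js))"
  proof (rule bij_betw_byWitness[where f' = "\<lambda>\<xi>. (u \<xi> (k $ j), \<xi> $ j)"])
    show "\<forall>a\<in>A js \<times> {\<alpha> $ j..k $ j}. (\<lambda>\<xi>. (u \<xi> (k $ j), \<xi> $ j)) ((\<lambda>(\<eta>, t). u \<eta> t) a) = a"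
      using jn by (auto simp: A_def u_def vec_eq_iff)
    show "\<forall>a'\<in>A (j # js). (\<lambda>(\<eta>, t). u \<eta> t) (u a' (k $ j), a' $ j) = a'"
      by (auto simp: A_def u_def vec_eq_iff)
    show "(\<lambda>(\<eta>, t). u \<eta> t) ` (A js \<times> {\<alpha> $ j..k $ j}) \<subseteq> A (j # js)"
      by (auto simp: A_def u_def less_eq_vec_def)
    show "(\<lambda>\<xi>. (u \<xi> (k $ j), \<xi> $ j)) ` A (j # js) \<subseteq> A js \<times> {\<alpha> $ j..k $ j}"
      using ak by (auto simp: A_def u_def less_eq_vec_def)
  qed
  have u_self: "u \<eta> (k $ j) = \<eta>" if "\<eta> \<in> A js" for \<eta>
    using that jn by (auto simp: A_def u_def vec_eq_iff)
  have "(\<Sum>\<xi>\<in>A (j # js). face_diff \<alpha> j G \<xi>) = (\<Sum>(\<eta>, t)\<in>A js \<times> {\<alpha> $ j..k $ j}. face_diff \<alpha> j G (u \<eta> t))"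
    using sum.reindex_bij_betw[OF bij, of "face_diff \<alpha> j G"] by (simp add: case_prod_beta)
  also have "\<dots> = (\<Sum>\<eta>\<in>A js. \<Sum>t\<in>{\<alpha> $ j..k $ j}. face_diff \<alpha> j G (u \<eta> t))"
    by (simp add: sum.cartesian_product)
  also have "\<dots> = (\<Sum>\<eta>\<in>A js. G \<eta>)"
  proof (rule sum.cong[OF refl])
    fix \<eta> assume \<eta>: "\<eta> \<in> A js"
    have "u \<eta> t - axis j 1 = u \<eta> (t - 1)" for t by (auto simp: u_def vec_eq_iff axis_def)
    then have "face_diff \<alpha> j G (u \<eta> t) = (if t \<noteq> \<alpha> $ j then G (u \<eta> t) - G (u \<eta> (t - 1)) else G (u \<eta> t))" for t
      by (simp add: face_diff_def) (simp add: u_def)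
    then have "(\<Sum>t\<in>{\<alpha> $ j..k $ j}. face_diff \<alpha> j G (u \<eta> t)) = G (u \<eta> (k $ j))"
      using telescope_int[OF ak, of j "\<lambda>t. G (u \<eta> t)"] by simp
    then show "(\<Sum>t\<in>{\<alpha> $ j..k $ j}. face_diff \<alpha> j G (u \<eta> t)) = G \<eta>" by (simp add: u_self[OF \<eta>])
  qed
  also have "\<dots> = N k" using Cons unfolding A_def G_def by simp
  finally show ?case unfolding A_def G_def by simp
qed

lemma sum_face_diff:
  fixes N :: "'n::{finite,linorder} zvec \<Rightarrow> 'b::ab_group_add"
  assumes "\<alpha> \<le> k"
  shows "(\<Sum>\<xi>\<in>{\<alpha>..k}. foldr (face_diff \<alpha>) coords N \<xi>) = N k"
proof -
  have "{\<xi>. \<xi> \<in> {\<alpha>..k} \<and> (\<forall>i. i \<notin> set coords \<longrightarrow> \<xi> $ i = k $ i)} = {\<alpha>..k}" by auto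
  then show ?thesis using sum_foldr_face_diff[OF assms distinct_coords, of N] by (simp only:)
qed

section \<open>Half-space, corner and box projections\<close>

lemma L_ops_zero [simp]: "0 \<in> L_ops"
  and L_ops_id [simp]: "id_blinfun \<in> L_ops"
  and L_ops_diff: "A \<in> L_ops \<Longrightarrow> B \<in> L_ops \<Longrightarrow> A - B \<in> L_ops"
  by (simp_all add: L_ops_def blinfun.diff_left scaleC.diff_right scaleC.zero_right)

lemma foldr_face_diff_L_ops:
  assumes "\<And>k. N k \<in> L_ops"
  shows "foldr (face_diff \<alpha>) js N x \<in> L_ops"
  using assms by (induction js arbitrary: x) (auto simp: face_diff_def L_ops_diff)

lemma Lp_multiplier_bound_id: "Lp_multiplier_bound p (\<lambda>k x. x) 1"
  by (simp add: Lp_multiplier_bound_def)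

lemma Lp_multiplier_bound_complement:
  fixes P :: "'n::finite zvec \<Rightarrow> bool"
  assumes "Lp_multiplier_bound p (\<lambda>k (x :: 'e::complex_banach). if P k then x else 0) C" "1 < p"
  shows "Lp_multiplier_bound p (\<lambda>k (x :: 'e). if P k then 0 else x) (1 + C)"
  unfolding Lp_multiplier_bound_def
proof (intro allI impI)
  fix K :: "'n zvec set" and a :: "'n zvec \<Rightarrow> 'e" assume K: "finite K"
  let ?m = "\<lambda>k. if P k then a k else 0"
  have eq: "trig_poly K (\<lambda>k. if P k then 0 else a k) = (\<lambda>x. trig_poly K a x + trig_poly K (\<lambda>k. - ?m k) x)"
    unfolding trig_poly_def sum.distrib[symmetric] scaleC.add_right[symmetric] by (intro ext sum.cong) auto
  have "Lp_norm p (trig_poly K (\<lambda>k. if P k then 0 else a k)) \<le> Lp_norm p (trig_poly K a) + Lp_norm p (trig_poly K (\<lambda>k. - ?m k))"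
    unfolding eq by (rule Lp_norm_triangle[OF continuous_trig_poly continuous_trig_poly assms(2)])
  also have "Lp_norm p (trig_poly K (\<lambda>k. - ?m k)) = Lp_norm p (trig_poly K ?m)"
    by (rule Lp_norm_cong_norm) (simp add: trig_poly_def scaleC.minus_right sum_negf)
  also have "\<dots> \<le> C * Lp_norm p (trig_poly K a)"
    by (rule Lp_multiplier_boundD[OF assms(1) K])
  finally show "Lp_norm p (trig_poly K (\<lambda>k. if P k then 0 else a k)) \<le> (1 + C) * Lp_norm p (trig_poly K a)"
    by (simp add: distrib_right)
qed

lemma Lp_multiplier_bound_all:
  fixes P :: "'n::finite \<Rightarrow> 'n zvec \<Rightarrow> bool"
  assumes "\<And>i. Lp_multiplier_bound p (\<lambda>k (x::'e::complex_banach). if P i k then x else 0) C" "0 \<le> C"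
  shows "Lp_multiplier_bound p (\<lambda>k (x::'e). if \<forall>i. P i k then x else 0) (C ^ CARD('n))"
proof -
  have "Lp_multiplier_bound p (\<lambda>k (x::'e). if \<forall>i\<in>S. P i k then x else 0) (C ^ card S)" if "finite S" for S
    using that
  proof (induction S rule: finite_induct)
    case empty
    then show ?case by (simp add: Lp_multiplier_bound_id)
  next
    case (insert i S)
    have "Lp_multiplier_bound p (\<lambda>k (x::'e). if P i k then (if \<forall>i\<in>S. P i k then x else 0) else 0) (C * C ^ card S)"
      by (rule Lp_multiplier_bound_compose[OF assms(1) insert.IH assms(2)])
    moreover have "(\<lambda>k (x::'e). if P i k then (if \<forall>i\<in>S. P i k then x else 0) else 0) = (\<lambda>k x. if \<forall>i\<in>insert i S. P i k then x else 0)"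
      by (intro ext) auto
    ultimately show ?case using insert by simp
  qed
  from this[of UNIV] show ?thesis by simp
qed

context
  fixes p C :: real
  assumes proj: "\<And>l. Lp_multiplier_bound p (\<lambda>(k :: 'n::{finite,linorder} zvec) (x :: 'e::complex_banach). if 0 \<le> k $ l then x else 0) C"
    and C: "0 \<le> C" and p: "1 < p"
begin

lemma halfspace_bound: "Lp_multiplier_bound p (\<lambda>(k :: 'n zvec) (x :: 'e). if t \<le> k $ l then x else 0) C"
  using Lp_multiplier_bound_shift[OF proj[of l], of "axis l t"] by simp

lemma corner_bound: "Lp_multiplier_bound p (\<lambda>(k :: 'n zvec) (x :: 'e). if \<xi> \<le> k then x else 0) (C ^ CARD('n))"
  unfolding less_eq_vec_def by (rule Lp_multiplier_bound_all[OF halfspace_bound C])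

lemma opposite_corner_bound: "Lp_multiplier_bound p (\<lambda>(k :: 'n zvec) (x :: 'e). if k \<le> \<xi> then x else 0) ((1 + C) ^ CARD('n))"
proof -
  have "Lp_multiplier_bound p (\<lambda>(k :: 'n zvec) (x :: 'e). if k $ i \<le> \<xi> $ i then x else 0) (1 + C)" for i
  proof -
    have eq: "(\<lambda>(k :: 'n zvec) (x :: 'e). if \<xi> $ i + 1 \<le> k $ i then 0 else x) = (\<lambda>k x. if k $ i \<le> \<xi> $ i then x else 0)"
      by (intro ext) auto
    from Lp_multiplier_bound_complement[OF halfspace_bound p, of "\<xi> $ i + 1" i] show ?thesis unfolding eq .
  qed
  then show ?thesis unfolding less_eq_vec_def using C by (intro Lp_multiplier_bound_all) auto
qed

lemma box_bound: "Lp_multiplier_bound p (\<lambda>(k :: 'n zvec) (x :: 'e). if k \<in> {\<alpha>..\<beta>} then x else 0) (C ^ CARD('n) * (1 + C) ^ CARD('n))"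
proof -
  have "(\<lambda>(k :: 'n zvec) (x :: 'e). if k \<in> {\<alpha>..\<beta>} then x else 0) = (\<lambda>k x. if \<alpha> \<le> k then (if k \<le> \<beta> then x else 0) else 0)"
    by (intro ext) auto
  then show ?thesis using Lp_multiplier_bound_compose[OF corner_bound[of \<alpha>] opposite_corner_bound[of \<beta>]] C by simp
qed

text \<open>By \<open>sum_face_diff\<close> the value at k is the sum of the differences over \<xi>
  <= k. Read as a sum over all \<xi> of a constant operator after a corner projection, it is
  estimated term by term with one constant for all corners, so only the norms of the differences
  accumulate.\<close>

lemma variation_multiplier_bound:
  fixes M :: "'n zvec \<Rightarrow> 'e \<Rightarrow>\<^sub>L 'e"
  assumes M: "\<And>k. M k \<in> L_ops"
  shows "Lp_multiplier_bound p (\<lambda>k. blinfun_apply (cut {\<alpha>..\<beta>} M k))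
    (C ^ CARD('n) * (C ^ CARD('n) * (1 + C) ^ CARD('n)) * variation \<alpha> \<beta> (cut {\<alpha>..\<beta>} M))"
proof -
  define N where "N = cut {\<alpha>..\<beta>} M"
  define D where "D \<xi> = foldr (face_diff \<alpha>) coords N \<xi>" for \<xi>
  define B where "B = C ^ CARD('n) * (C ^ CARD('n) * (1 + C) ^ CARD('n))"
  have N_ops: "N k \<in> L_ops" for k using M by (simp add: N_def cut_def)
  have D_ops: "D \<xi> \<in> L_ops" for \<xi> unfolding D_def by (rule foldr_face_diff_L_ops[OF N_ops])
  \<comment> \<open>Above the box the sum over \<xi> <= k need not vanish although the cut-off
    symbol does; the additional box projection repairs this.\<close>
  have tm: "Lp_multiplier_bound p (\<lambda>k x. blinfun_apply (D \<xi>) (if \<xi> \<le> k then (if k \<in> {\<alpha>..\<beta>} then x else 0) else 0)) (norm (D \<xi>) * B)" for \<xi>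
    unfolding B_def using C p
    by (intro Lp_multiplier_bound_compose[OF Lp_multiplier_bound_const[OF D_ops]]
        Lp_multiplier_bound_compose[OF corner_bound box_bound]) auto
  have sum: "Lp_multiplier_bound p (\<lambda>k x. \<Sum>\<xi>\<in>{\<alpha>..\<beta>}. blinfun_apply (D \<xi>) (if \<xi> \<le> k then (if k \<in> {\<alpha>..\<beta>} then x else 0) else 0))
      (\<Sum>\<xi>\<in>{\<alpha>..\<beta>}. norm (D \<xi>) * B)"
    by (intro Lp_multiplier_bound_sum tm p finite_zvec_interval)
  have eq: "(\<Sum>\<xi>\<in>{\<alpha>..\<beta>}. blinfun_apply (D \<xi>) (if \<xi> \<le> k then (if k \<in> {\<alpha>..\<beta>} then x else 0) else 0)) = blinfun_apply (N k) x" for k x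
  proof (cases "k \<in> {\<alpha>..\<beta>}")
    case False
    then have "(if \<xi> \<le> k then (if k \<in> {\<alpha>..\<beta>} then x else 0) else 0) = 0" for \<xi> by (simp only: if_False if_cancel)
    moreover have "N k = 0" using False by (simp only: N_def cut_def if_False)
    ultimately show ?thesis by (simp only: blinfun.zero_right blinfun.zero_left sum.neutral_const)
  next
    case True
    have "(\<Sum>\<xi>\<in>{\<alpha>..\<beta>}. blinfun_apply (D \<xi>) (if \<xi> \<le> k then (if k \<in> {\<alpha>..\<beta>} then x else 0) else 0)) = (\<Sum>\<xi>\<in>{\<alpha>..k}. blinfun_apply (D \<xi>) x)"
      using True by (intro sum.mono_neutral_cong_right) (auto simp: blinfun.zero_right)
    also have "\<dots> = blinfun_apply (N k) x"
      using sum_face_diff[of \<alpha> k N] True by (simp add: D_def flip: blinfun.sum_left)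
    finally show ?thesis .
  qed
  have "(\<Sum>\<xi>\<in>{\<alpha>..\<beta>}. norm (D \<xi>) * B) = B * variation \<alpha> \<beta> N"
    unfolding variation_eq D_def by (simp add: sum_distrib_left mult.commute)
  with sum show ?thesis unfolding eq B_def N_def by simp
qed

end

text \<open>Differencing the indicator of a corner in coordinate j replaces the condition a_j <= x_j
  by a_j = x_j. After all coordinates the single point a is left, so a corner has variation at most
  the norm of its value.\<close>

lemma foldr_face_diff_corner:
  assumes a: "\<alpha> \<le> a" and N: "\<And>k. k \<in> {\<alpha>..\<beta>} \<Longrightarrow> N k = (if a \<le> k then A else (0 :: 'b::ab_group_add))"
    and "distinct js" "x \<in> {\<alpha>..\<beta>}"
  shows "foldr (face_diff \<alpha>) js N x = (if (\<forall>j. j \<in> set js \<longrightarrow> x $ j = a $ j) \<and> (\<forall>j. j \<notin> set js \<longrightarrow> a $ j \<le> x $ j) then A else 0)"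
  using assms(3,4)
proof (induction js arbitrary: x)
  case Nil
  then show ?case by (simp add: N less_eq_vec_def)
next
  case (Cons j js)
  define P where "P \<longleftrightarrow> (\<forall>i. i \<in> set js \<longrightarrow> x $ i = a $ i) \<and> (\<forall>i. i \<notin> set js \<longrightarrow> i \<noteq> j \<longrightarrow> a $ i \<le> x $ i)"
  have jn: "j \<notin> set js" and dist: "distinct js" using Cons.prems by auto
  have Gx: "foldr (face_diff \<alpha>) js N x = (if P \<and> a $ j \<le> x $ j then A else 0)"
    unfolding Cons.IH[OF dist Cons.prems(2)] P_def using jn by (intro if_cong refl) metis
  have aj: "\<alpha> $ j \<le> a $ j" using a by (simp add: less_eq_vec_def)
  have goal: "(if (\<forall>i. i \<in> set (j # js) \<longrightarrow> x $ i = a $ i) \<and> (\<forall>i. i \<notin> set (j # js) \<longrightarrow> a $ i \<le> x $ i) then A else 0) =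
      (if P \<and> x $ j = a $ j then A else 0)"
    unfolding P_def by (intro if_cong refl) auto
  note step = face_diff_def[of \<alpha> j "foldr (face_diff \<alpha>) js N"]
  show ?case
  \<comment> \<open>On the face no difference is taken, yet a_j <= x_j already means equality, as a
    lies above \<alpha>.\<close>
  proof (cases "x $ j = \<alpha> $ j")
    case True
    then show ?thesis unfolding goal using aj by (auto simp: step Gx)
  next
    case False
    have "x - axis j 1 \<in> {\<alpha>..\<beta>}"
    proof -
      have "\<alpha> $ i \<le> x $ i" "x $ i \<le> \<beta> $ i" for i using Cons.prems(2) by (auto simp: less_eq_vec_def)
      moreover have "\<alpha> $ j < x $ j" using False \<open>\<And>i. \<alpha> $ i \<le> x $ i\<close>[of j] by simp
      ultimately show ?thesis by (auto simp: less_eq_vec_def axis_def intro: order_trans[OF _ \<open>\<And>i. x $ i \<le> \<beta> $ i\<close>])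
    qed
    note IH = Cons.IH[OF dist this]
    have comp: "(x - axis j 1) $ i = (if i = j then x $ j - 1 else x $ i)" for i by (simp add: axis_def)
    have "foldr (face_diff \<alpha>) js N (x - axis j 1) = (if P \<and> a $ j \<le> x $ j - 1 then A else 0)"
    proof -
      have A1: "(\<forall>i. i \<in> set js \<longrightarrow> (if i = j then c else x $ i) = a $ i) \<longleftrightarrow> (\<forall>i. i \<in> set js \<longrightarrow> x $ i = a $ i)" for c
        using jn by auto
      have A2: "(\<forall>i. i \<notin> set js \<longrightarrow> a $ i \<le> (if i = j then c else x $ i)) \<longleftrightarrow>
          (\<forall>i. i \<notin> set js \<longrightarrow> i \<noteq> j \<longrightarrow> a $ i \<le> x $ i) \<and> a $ j \<le> c" (is "?l \<longleftrightarrow> ?r") for c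
      proof
        assume l: ?l
        show ?r
        proof (intro conjI allI impI)
          show "a $ j \<le> c" using l jn by (auto dest: spec[of _ j])
        next
          fix i assume "i \<notin> set js" "i \<noteq> j"
          then show "a $ i \<le> x $ i" using l by (auto dest: spec[of _ i])
        qed
      qed auto
      show ?thesis unfolding IH comp P_def A1 A2 conj_assoc ..
    qed
    then show ?thesis unfolding goal using False by (auto simp: step Gx)
  qed
qed

lemma variation_corner_le:
  assumes "\<alpha> \<le> a" and N: "\<And>k. k \<in> {\<alpha>..\<beta>} \<Longrightarrow> N k = (if a \<le> k then A else (0 :: 'b::real_normed_vector))"
  shows "variation \<alpha> \<beta> N \<le> norm A"
proof -
  have "variation \<alpha> \<beta> N = (\<Sum>\<xi>\<in>{\<alpha>..\<beta>}. if \<xi> = a then norm A else 0)"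
    unfolding variation_eq
  proof (rule sum.cong[OF refl])
    fix \<xi> assume "\<xi> \<in> {\<alpha>..\<beta>}"
    from foldr_face_diff_corner[OF assms(1) N distinct_coords this]
    show "norm (foldr (face_diff \<alpha>) coords N \<xi>) = (if \<xi> = a then norm A else 0)"
      by (auto simp: vec_eq_iff)
  qed
  also have "\<dots> \<le> norm A" by simp
  finally show ?thesis .
qed

section \<open>Periodic distributions\<close>

lemma partial_eqI: "((\<lambda>t. f (x + t *\<^sub>R axis i 1)) has_vector_derivative D) (at 0) \<Longrightarrow> partial i f x = D"
  unfolding partial_def by (rule vector_derivative_at)

lemma differentiable_has_partial:
  "(\<lambda>t. f (x + t *\<^sub>R axis i 1)) differentiable (at 0) \<Longrightarrow>
    ((\<lambda>t. f (x + t *\<^sub>R axis i 1)) has_vector_derivative partial i f x) (at 0)"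
  unfolding partial_def by (simp add: vector_derivative_works)

lemma smooth_linear_combination:
  fixes f g :: "'n::finite rvec \<Rightarrow> complex"
  assumes "smooth f" "smooth g"
  shows "foldr partial is (\<lambda>x. a * f x + b * g x) = (\<lambda>x. a * foldr partial is f x + b * foldr partial is g x)"
    and "smooth (\<lambda>x. a * f x + b * g x)"
proof -
  have cont: "continuous_on UNIV (foldr partial is f)" "continuous_on UNIV (foldr partial is g)" for "is"
    using assms unfolding smooth_def by blast+
  have diff: "(\<lambda>t. foldr partial is f (x + t *\<^sub>R axis i 1)) differentiable (at 0)"
    "(\<lambda>t. foldr partial is g (x + t *\<^sub>R axis i 1)) differentiable (at 0)" for "is" i x
    using assms unfolding smooth_def by blast+
  show eq: "foldr partial is (\<lambda>x. a * f x + b * g x) = (\<lambda>x. a * foldr partial is f x + b * foldr partial is g x)" for "is"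
  proof (induction "is")
    case (Cons i "is")
    have "partial i (\<lambda>x. a * foldr partial is f x + b * foldr partial is g x) x =
        a * partial i (foldr partial is f) x + b * partial i (foldr partial is g) x" for x
      by (intro partial_eqI has_vector_derivative_add has_vector_derivative_mult_right differentiable_has_partial diff)
    then show ?case unfolding foldr_Cons comp_def Cons.IH by (intro ext)
  qed simp
  show "smooth (\<lambda>x. a * f x + b * g x)"
    unfolding smooth_def eq using cont diff
    by (auto intro!: continuous_intros derivative_intros differentiable_mult)
qed

lemma test_functions_linear_combination:
  assumes "\<phi> \<in> test_functions" "\<psi> \<in> test_functions"
  shows "(\<lambda>x. a * \<phi> x + b * \<psi> x) \<in> test_functions"
  using assms smooth_linear_combination(2)[of \<phi> \<psi> a b] by (simp add: test_functions_def)

lemma test_functions_add: "\<phi> \<in> test_functions \<Longrightarrow> \<psi> \<in> test_functions \<Longrightarrow> (\<lambda>x. \<phi> x + \<psi> x) \<in> test_functions"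
  and test_functions_diff: "\<phi> \<in> test_functions \<Longrightarrow> \<psi> \<in> test_functions \<Longrightarrow> (\<lambda>x. \<phi> x - \<psi> x) \<in> test_functions"
  and test_functions_cmult: "\<phi> \<in> test_functions \<Longrightarrow> (\<lambda>x. c * \<phi> x) \<in> test_functions"
  using test_functions_linear_combination[of \<phi> \<psi> 1 1] test_functions_linear_combination[of \<phi> \<psi> 1 "-1"]
    test_functions_linear_combination[of \<phi> \<phi> c 0] by simp_all

lemma test_functions_partial:
  assumes "\<phi> \<in> test_functions"
  shows "partial i \<phi> \<in> test_functions"
proof -
  have s: "\<forall>is. continuous_on UNIV (foldr partial is \<phi>) \<and>
      (\<forall>i x. (\<lambda>t. foldr partial is \<phi> (x + t *\<^sub>R axis i 1)) differentiable (at 0))"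
    and per: "\<And>i x. \<phi> (x + (2 * pi) *\<^sub>R axis i 1) = \<phi> x"
    using assms unfolding test_functions_def smooth_def by blast+
  have "smooth (partial i \<phi>)"
    unfolding smooth_def
  proof
    fix "is"
    show "continuous_on UNIV (foldr partial is (partial i \<phi>)) \<and>
      (\<forall>j x. (\<lambda>t. foldr partial is (partial i \<phi>) (x + t *\<^sub>R axis j 1)) differentiable (at 0))"
      using spec[OF s, of "is @ [i]"] by simp
  qed
  moreover have "partial i \<phi> (x + (2 * pi) *\<^sub>R axis j 1) = partial i \<phi> x" for j x
  proof -
    have "\<phi> (x + (2 * pi) *\<^sub>R axis j 1 + t *\<^sub>R axis i 1) = \<phi> (x + t *\<^sub>R axis i 1)" for t
      using per[of "x + t *\<^sub>R axis i 1" j] by (simp add: add_ac)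
    then show ?thesis by (simp add: partial_def)
  qed
  ultimately show ?thesis by (simp add: test_functions_def)
qed

lemma test_function_continuous: "\<phi> \<in> test_functions \<Longrightarrow> continuous_on UNIV \<phi>"
  unfolding test_functions_def smooth_def by (auto dest: spec[of _ "[]"])

lemma test_function_has_partial:
  assumes "\<phi> \<in> test_functions"
  shows "((\<lambda>t. \<phi> (x + t *\<^sub>R axis i 1)) has_vector_derivative partial i \<phi> x) (at 0)"
proof -
  have "\<forall>i x. (\<lambda>t. foldr partial [] \<phi> (x + t *\<^sub>R axis i 1)) differentiable (at 0)"
    using assms unfolding test_functions_def smooth_def by blast
  then have "(\<lambda>t. \<phi> (x + t *\<^sub>R axis i 1)) differentiable (at 0)" by simp
  then show ?thesis by (rule differentiable_has_partial)
qed

lemma has_partial_along_line: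
  assumes "\<And>y. ((\<lambda>t. h (y + t *\<^sub>R axis i 1)) has_vector_derivative h' y) (at 0)"
  shows "((\<lambda>t. h (x + t *\<^sub>R axis i 1)) has_vector_derivative h' (x + t *\<^sub>R axis i 1)) (at t)"
proof -
  have "((\<lambda>s. h ((x + t *\<^sub>R axis i 1) + s *\<^sub>R axis i 1)) has_vector_derivative h' (x + t *\<^sub>R axis i 1)) (at (t - t))"
    using assms[of "x + t *\<^sub>R axis i 1"] by simp
  moreover have "((\<lambda>s. s - t) has_vector_derivative 1) (at t)"
    by (auto intro!: derivative_eq_intros)
  ultimately have "((\<lambda>s. h ((x + t *\<^sub>R axis i 1) + s *\<^sub>R axis i 1)) \<circ> (\<lambda>s. s - t) has_vector_derivative 1 *\<^sub>R h' (x + t *\<^sub>R axis i 1)) (at t)"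
    by (intro vector_diff_chain_at)
  moreover have "(\<lambda>s. h ((x + t *\<^sub>R axis i 1) + s *\<^sub>R axis i 1)) \<circ> (\<lambda>s. s - t) = (\<lambda>s. h (x + s *\<^sub>R axis i 1))"
    by (simp add: o_def algebra_simps)
  ultimately show ?thesis by simp
qed

text \<open>By periodicity the mean of h(x + t e_i) does not depend on t; differentiating under the
  integral at t = 0 gives the claim. One-sided parameters t in [0, 1] suffice and fit the range of
  \<open>torus_mean_shift\<close>.\<close>

lemma torus_mean_partial_zero:
  fixes h h' :: "'n::finite rvec \<Rightarrow> complex"
  assumes cont: "continuous_on UNIV h" "continuous_on UNIV h'"
    and per: "\<And>x. h (x + (2 * pi) *\<^sub>R axis i 1) = h x"
    and deriv: "\<And>x. ((\<lambda>t. h (x + t *\<^sub>R axis i 1)) has_vector_derivative h' x) (at 0)"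
  shows "torus_mean h' = 0"
proof -
  define F where "F t = integral period_cube (\<lambda>x. h (x + t *\<^sub>R axis i 1))" for t :: real
  have F_eq: "F = (\<lambda>t. integral period_cube (\<lambda>x. h (x + t *\<^sub>R axis i 1)))" by (simp add: F_def fun_eq_iff)
  have "((\<lambda>t. integral period_cube (\<lambda>x. h (x + t *\<^sub>R axis i 1))) has_vector_derivative
      integral period_cube (\<lambda>x. h' (x + 0 *\<^sub>R axis i 1))) (at 0 within {0..1})"
  proof (rule leibniz_rule_vector_derivative)
    fix t x
    show "((\<lambda>t. h (x + t *\<^sub>R axis i 1)) has_vector_derivative h' (x + t *\<^sub>R axis i 1)) (at t within {0..1})"
      using has_partial_along_line[OF deriv] by (rule has_vector_derivative_at_within)
  next
    fix t :: real
    show "(\<lambda>x. h (x + t *\<^sub>R axis i 1)) integrable_on period_cube"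
      by (intro integrable_on_period_cube continuous_on_compose2[OF cont(1)] continuous_intros) auto
  next
    show "continuous_on ({0..1} \<times> period_cube) (\<lambda>(t, x). h' (x + t *\<^sub>R axis i 1))"
      unfolding case_prod_beta by (intro continuous_on_compose2[OF cont(2)] continuous_intros) auto
  qed auto
  then have "(F has_vector_derivative integral period_cube h') (at 0 within {0..1})"
    unfolding F_eq by simp
  moreover have "(F has_vector_derivative 0) (at 0 within {0..1})"
  proof (rule has_vector_derivative_transform)
    show "((\<lambda>t. F 0) has_vector_derivative 0) (at 0 within {0..1})" by (rule has_vector_derivative_const)
    fix t :: real assume "t \<in> {0..1}"
    then have "torus_mean (\<lambda>x. h (x + t *\<^sub>R axis i 1)) = torus_mean h"
      using pi_gt3 by (intro torus_mean_shift cont per) auto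
    then show "F t = F 0" by (simp add: F_def torus_mean_def)
  qed auto
  moreover have "at (0::real) within {0..1} \<noteq> bot"
    by (simp add: at_within_Icc_at_right)
  ultimately have "integral period_cube h' = 0" by (metis vector_derivative_unique_within)
  then show ?thesis by (simp add: torus_mean_def)
qed

text \<open>In the usual sign convention this is the Fourier coefficient at - k. With this sign, a
  distribution with coefficients c pairs with \<phi> as the sum of
  \<open>test_coeff \<phi> k *\<^sub>C c k\<close>.\<close>

definition test_coeff :: "('n::finite rvec \<Rightarrow> complex) \<Rightarrow> 'n zvec \<Rightarrow> complex"
  where "test_coeff \<phi> k = torus_mean (\<lambda>x. \<phi> x * \<e> k x)"

lemma test_coeff_partial:
  assumes "\<phi> \<in> test_functions"
  shows "test_coeff (partial i \<phi>) k = - (\<i> * of_int (k $ i)) * test_coeff \<phi> k"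
proof -
  have cont: "continuous_on UNIV (\<lambda>x. \<phi> x * \<e> k x)" "continuous_on UNIV (\<lambda>x. partial i \<phi> x * \<e> k x)"
    using test_function_continuous[OF assms] test_function_continuous[OF test_functions_partial[OF assms]]
    by (auto intro!: continuous_intros)
  have "torus_mean (\<lambda>x. partial i \<phi> x * \<e> k x + (\<i> * of_int (k $ i)) * (\<phi> x * \<e> k x)) = 0"
  proof (rule torus_mean_partial_zero[where h = "\<lambda>x. \<phi> x * \<e> k x" and i = i])
    show "\<phi> (x + (2 * pi) *\<^sub>R axis i 1) * \<e> k (x + (2 * pi) *\<^sub>R axis i 1) = \<phi> x * \<e> k x" for x
      using assms by (simp add: test_functions_def char_fun_periodic)
    fix x
    have "((\<lambda>t. \<phi> (x + t *\<^sub>R axis i 1) * (1 * \<e> k (x + t *\<^sub>R axis i 1))) has_vector_derivative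
        \<phi> (x + 0 *\<^sub>R axis i 1) * (1 * (\<i> * of_int (k $ i)) * \<e> k x) + partial i \<phi> x * (1 * \<e> k (x + 0 *\<^sub>R axis i 1))) (at 0)"
      by (intro has_vector_derivative_mult test_function_has_partial assms char_fun_has_partial)
    then show "((\<lambda>t. \<phi> (x + t *\<^sub>R axis i 1) * \<e> k (x + t *\<^sub>R axis i 1)) has_vector_derivative
        partial i \<phi> x * \<e> k x + (\<i> * of_int (k $ i)) * (\<phi> x * \<e> k x)) (at 0)"
      by (simp add: algebra_simps)
  qed (intro continuous_on_add continuous_on_mult_left cont)+
  also have "torus_mean (\<lambda>x. partial i \<phi> x * \<e> k x + (\<i> * of_int (k $ i)) * (\<phi> x * \<e> k x)) =
      test_coeff (partial i \<phi>) k + (\<i> * of_int (k $ i)) * test_coeff \<phi> k"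
    unfolding test_coeff_def
    by (subst torus_mean_add) (auto intro!: cont continuous_on_mult_left simp: torus_mean_bounded_linear[OF bounded_linear_mult_right cont(1)])
  finally show ?thesis by (simp add: add_eq_0_iff)
qed

lemma funpow_partial_test_functions:
  "\<phi> \<in> test_functions \<Longrightarrow> (partial i ^^ r) \<phi> \<in> test_functions"
  by (induction r) (auto intro: test_functions_partial)

lemma test_coeff_funpow_partial:
  assumes "\<phi> \<in> test_functions"
  shows "test_coeff ((partial i ^^ r) \<phi>) k = (- (\<i> * of_int (k $ i))) ^ r * test_coeff \<phi> k"
  by (induction r) (simp_all add: test_coeff_partial funpow_partial_test_functions assms)

lemma finite_multi_abs_le [simp]: "finite {\<alpha> :: 'n::finite mindex. multi_abs \<alpha> \<le> r}"
proof (rule finite_subset)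
  show "{\<alpha> :: 'n mindex. multi_abs \<alpha> \<le> r} \<subseteq> vec_lambda ` (\<Pi>\<^sub>E i\<in>UNIV. {..r})"
  proof
    fix \<alpha> :: "'n mindex" assume "\<alpha> \<in> {\<alpha>. multi_abs \<alpha> \<le> r}"
    then have "\<alpha> $ i \<le> r" for i
      using member_le_sum[of i UNIV "\<lambda>i. \<alpha> $ i"] by (simp add: multi_abs_def)
    then show "\<alpha> \<in> vec_lambda ` (\<Pi>\<^sub>E i\<in>UNIV. {..r})"
      by (intro image_eqI[of _ _ "vec_nth \<alpha>"]) (auto simp: PiE_def)
  qed
  show "finite (vec_lambda ` (\<Pi>\<^sub>E i\<in>(UNIV :: 'n set). {..r}))"
    by (intro finite_imageI finite_PiE) auto
qed

lemma foldr_funpow_test_functions: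
  "\<phi> \<in> test_functions \<Longrightarrow> foldr (\<lambda>j. partial j ^^ (\<alpha> $ j)) js \<phi> \<in> test_functions"
  by (induction js) (auto intro: funpow_partial_test_functions)

lemma mpartial_test_functions: "\<phi> \<in> test_functions \<Longrightarrow> mpartial \<alpha> \<phi> \<in> test_functions"
  unfolding multi_compose_def by (rule foldr_funpow_test_functions)

lemma norm_mpartial_le_seminorm:
  assumes \<phi>: "\<phi> \<in> test_functions" and "multi_abs \<alpha> \<le> r" "x \<in> period_cube"
  shows "norm (mpartial \<alpha> \<phi> x) \<le> test_seminorm r \<phi>"
proof -
  have "compact ((\<lambda>x. norm (mpartial \<alpha> \<phi> x)) ` period_cube)"
    using test_function_continuous[OF mpartial_test_functions[OF \<phi>]]
    by (intro compact_continuous_image continuous_intros compact_cbox) (auto intro: continuous_on_subset)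
  then have "bdd_above ((\<lambda>x. norm (mpartial \<alpha> \<phi> x)) ` period_cube)"
    by (intro bounded_imp_bdd_above compact_imp_bounded)
  then have "norm (mpartial \<alpha> \<phi> x) \<le> (SUP x\<in>period_cube. norm (mpartial \<alpha> \<phi> x))"
    by (intro cSUP_upper assms(3))
  also have "\<dots> \<le> test_seminorm r \<phi>"
    unfolding test_seminorm_def using assms(2) by (intro Max_ge) auto
  finally show ?thesis .
qed

lemma mpartial_single:
  "mpartial (\<chi> j. if j = i then r else 0) \<phi> = (partial i ^^ r) \<phi>"
proof -
  have "foldr (\<lambda>j. partial j ^^ ((\<chi> j. if j = i then r else 0) $ j)) js \<phi> = (if i \<in> set js then (partial i ^^ r) \<phi> else \<phi>)"
    if "distinct js" for js
    using that by (induction js) auto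
  then show ?thesis by (simp add: multi_compose_def coords_def)
qed

lemma norm_torus_mean_le_bound:
  fixes f :: "'n::finite rvec \<Rightarrow> 'a::banach"
  assumes "continuous_on UNIV f" "\<And>x. x \<in> period_cube \<Longrightarrow> norm (f x) \<le> B"
  shows "norm (torus_mean f) \<le> B"
proof -
  have "norm (integral period_cube f) \<le> integral period_cube (\<lambda>x::'n rvec. B)"
    using assms by (intro integral_norm_bound_integral integrable_on_period_cube) auto
  then have "norm (torus_mean f) \<le> torus_mean (\<lambda>x::'n rvec. B)"
    unfolding torus_mean_def by (simp add: divide_right_mono)
  then show ?thesis by (simp add: torus_mean_const)
qed

section \<open>Rapid decay of test coefficients and polynomial growth of distributions\<close>

definition freq_size :: "'n::finite zvec \<Rightarrow> real"
  where "freq_size k = 1 + (\<Sum>i\<in>UNIV. \<bar>of_int (k $ i)\<bar>)"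

lemma freq_size_ge_1: "1 \<le> freq_size k"
  by (simp add: freq_size_def sum_nonneg)

lemma component_le_freq_size: "1 + \<bar>of_int (k $ i)\<bar> \<le> freq_size k"
  unfolding freq_size_def using member_le_sum[of i UNIV "\<lambda>i. \<bar>of_int (k $ i)\<bar> :: real"] by simp

lemma test_coeff_decay:
  fixes \<phi> :: "'n::{finite,linorder} rvec \<Rightarrow> complex"
  assumes \<phi>: "\<phi> \<in> test_functions"
  shows "freq_size k ^ r * norm (test_coeff \<phi> k) \<le> real (CARD('n) + 1) ^ r * test_seminorm r \<phi>"
proof -
  have le: "norm (test_coeff (mpartial \<alpha> \<phi>) k) \<le> test_seminorm r \<phi>" if "multi_abs \<alpha> \<le> r" for \<alpha>
    unfolding test_coeff_def
  proof (rule norm_torus_mean_le_bound)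
    show "continuous_on UNIV (\<lambda>x. mpartial \<alpha> \<phi> x * \<e> k x)"
      using test_function_continuous[OF mpartial_test_functions[OF \<phi>]] by (intro continuous_intros)
  qed (simp add: norm_mult norm_mpartial_le_seminorm[OF \<phi> that])
  have comp: "\<bar>of_int (k $ i)\<bar> ^ r * norm (test_coeff \<phi> k) \<le> test_seminorm r \<phi>" for i
  proof -
    have "multi_abs (\<chi> j. if j = i then r else 0) \<le> r" by (simp add: multi_abs_def)
    from le[OF this] show ?thesis
      by (simp add: mpartial_single test_coeff_funpow_partial[OF \<phi>] norm_mult norm_power)
  qed
  have zero: "norm (test_coeff \<phi> k) \<le> test_seminorm r \<phi>"
  proof -
    \<comment> \<open>The zero multi-index, written with an arbitrary coordinate so that
      \<open>mpartial_single\<close> applies with exponent 0.\<close>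
    have "multi_abs (\<chi> j. if j = undefined then 0 else (0::nat)) \<le> r" by (simp add: multi_abs_def)
    from le[OF this] show ?thesis by (simp only: mpartial_single funpow_0)
  qed
  obtain t :: real where t: "t = 1 \<or> (\<exists>i. t = \<bar>of_int (k $ i)\<bar>)" "1 \<le> t" "\<And>i. \<bar>of_int (k $ i)\<bar> \<le> t"
  proof -
    define T where "T = insert 1 (range (\<lambda>i. \<bar>of_int (k $ i)\<bar> :: real))"
    have "Max T \<in> T" by (rule Max_in) (auto simp: T_def)
    moreover have "y \<le> Max T" if "y \<in> T" for y using that by (intro Max_ge) (auto simp: T_def)
    ultimately show thesis using that[of "Max T"] by (auto simp: T_def)
  qed
  have "t ^ r * norm (test_coeff \<phi> k) \<le> test_seminorm r \<phi>" using t(1) comp zero by auto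
  moreover have "freq_size k ^ r \<le> (real (CARD('n) + 1) * t) ^ r"
  proof (rule power_mono)
    have "(\<Sum>i\<in>UNIV. \<bar>of_int (k $ i)\<bar>) \<le> (\<Sum>i\<in>(UNIV :: 'n set). t)" by (intro sum_mono t(3))
    then show "freq_size k \<le> real (CARD('n) + 1) * t" using t(2) by (simp add: freq_size_def algebra_simps)
  qed (use freq_size_ge_1[of k] in simp)
  ultimately have "freq_size k ^ r * norm (test_coeff \<phi> k) \<le> (real (CARD('n) + 1) * t) ^ r * norm (test_coeff \<phi> k)"
    by (intro mult_right_mono) auto
  also have "\<dots> = real (CARD('n) + 1) ^ r * (t ^ r * norm (test_coeff \<phi> k))"
    by (simp add: power_mult_distrib)
  also have "\<dots> \<le> real (CARD('n) + 1) ^ r * test_seminorm r \<phi>"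
    by (rule mult_left_mono) (use \<open>t ^ r * norm (test_coeff \<phi> k) \<le> test_seminorm r \<phi>\<close> in auto)
  finally show ?thesis .
qed

definition lattice_weight :: "'n::finite zvec \<Rightarrow> real"
  where "lattice_weight k = (\<Prod>i\<in>UNIV. 1 / (1 + \<bar>of_int (k $ i)\<bar>)\<^sup>2)"

lemma lattice_weight_nonneg: "0 \<le> lattice_weight k"
  unfolding lattice_weight_def by (intro prod_nonneg) auto

text \<open>A finite set of frequencies lies in a cube, over which the sum of products factors into
  one-dimensional sums. Each of these is at most 5: three terms with |t| <= 1, plus 2 from
  \<open>sum_inverse_squares_le\<close>.\<close>

lemma lattice_weight_summable: "(lattice_weight :: 'n::finite zvec \<Rightarrow> real) summable_on UNIV"
proof (rule nonneg_bdd_above_summable_on)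
  have one: "(\<Sum>t\<in>{-b..b}. 1 / (1 + \<bar>real_of_int t\<bar>)\<^sup>2) \<le> 5" for b :: int
  proof -
    have "(\<Sum>t\<in>{-b..b}. 1 / (1 + \<bar>real_of_int t\<bar>)\<^sup>2) \<le> (\<Sum>t\<in>{-1..1} \<union> ({-b..b} - {-1..1}). 1 / (1 + \<bar>real_of_int t\<bar>)\<^sup>2)"
      by (intro sum_mono2) auto
    also have "\<dots> = (\<Sum>t\<in>{-1..1}. 1 / (1 + \<bar>real_of_int t\<bar>)\<^sup>2) + (\<Sum>t\<in>{-b..b} - {-1..1}. 1 / (1 + \<bar>real_of_int t\<bar>)\<^sup>2)"
      by (rule sum.union_disjoint) auto
    also have "(\<Sum>t\<in>{-1..1}. 1 / (1 + \<bar>real_of_int t\<bar>)\<^sup>2) \<le> (\<Sum>t\<in>{-1..1::int}. 1)"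
    proof (rule sum_mono)
      fix t :: int
      have "1 \<le> (1 + \<bar>real_of_int t\<bar>)\<^sup>2" by (rule one_le_power) simp
      then show "1 / (1 + \<bar>real_of_int t\<bar>)\<^sup>2 \<le> 1" by simp
    qed
    also have "(\<Sum>t\<in>{-b..b} - {-1..1}. 1 / (1 + \<bar>real_of_int t\<bar>)\<^sup>2) \<le> (\<Sum>t\<in>{-b..b} - {-1..1}. 1 / (real_of_int t)\<^sup>2)"
    proof (rule sum_mono)
      fix t :: int assume "t \<in> {-b..b} - {-1..1}"
      then have "t \<noteq> 0" by auto
      have "(real_of_int t)\<^sup>2 \<le> (1 + \<bar>real_of_int t\<bar>)\<^sup>2"
        by (rule power2_le_iff_abs_le[THEN iffD2]) auto
      then show "1 / (1 + \<bar>real_of_int t\<bar>)\<^sup>2 \<le> 1 / (real_of_int t)\<^sup>2"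
        using \<open>t \<noteq> 0\<close> by (intro divide_left_mono mult_pos_pos) auto
    qed
    also have "\<dots> \<le> 2 / of_int 1" by (rule sum_inverse_squares_le) auto
    finally show ?thesis by simp
  qed
  show "bdd_above (sum (lattice_weight :: 'n zvec \<Rightarrow> real) ` {F. F \<subseteq> UNIV \<and> finite F})"
  proof (rule bdd_aboveI2)
    fix F :: "'n zvec set" assume "F \<in> {F. F \<subseteq> UNIV \<and> finite F}"
    then have F: "finite F" by simp
    define b :: int where "b = (\<Sum>k\<in>F. \<Sum>i\<in>UNIV. \<bar>k $ i\<bar>)"
    have b: "\<bar>k $ i\<bar> \<le> b" if "k \<in> F" for k i
    proof -
      have "\<bar>k $ i\<bar> \<le> (\<Sum>i\<in>UNIV. \<bar>k $ i\<bar>)" by (intro member_le_sum) auto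
      also have "\<dots> \<le> b" unfolding b_def using F that by (intro member_le_sum[where f = "\<lambda>k. \<Sum>i\<in>UNIV. \<bar>k $ i\<bar>"] sum_nonneg) auto
      finally show ?thesis .
    qed
    have "sum lattice_weight F \<le> sum lattice_weight (vec_lambda ` (\<Pi>\<^sub>E i\<in>(UNIV :: 'n set). {-b..b}))"
    proof (intro sum_mono2 finite_imageI finite_PiE)
      show "F \<subseteq> vec_lambda ` (\<Pi>\<^sub>E i\<in>UNIV. {-b..b})"
      proof
        fix k assume "k \<in> F"
        then show "k \<in> vec_lambda ` (\<Pi>\<^sub>E i\<in>UNIV. {-b..b})"
          using b[of k] by (intro image_eqI[of _ _ "vec_nth k"]) (auto simp: PiE_def abs_le_iff minus_le_iff)
      qed
    qed (auto simp: lattice_weight_nonneg)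
    also have "\<dots> = (\<Sum>g\<in>(\<Pi>\<^sub>E i\<in>(UNIV :: 'n set). {-b..b}). \<Prod>i\<in>UNIV. 1 / (1 + \<bar>real_of_int (g i)\<bar>)\<^sup>2)"
      by (subst sum.reindex) (auto simp: lattice_weight_def inj_on_def vec_lambda_inject)
    also have "\<dots> = (\<Prod>i\<in>(UNIV :: 'n set). \<Sum>t\<in>{-b..b}. 1 / (1 + \<bar>real_of_int t\<bar>)\<^sup>2)"
      by (rule prod_sum_PiE[symmetric]) auto
    also have "\<dots> \<le> (\<Prod>i\<in>(UNIV :: 'n set). 5)"
      by (intro prod_mono conjI one sum_nonneg) auto
    finally show "sum lattice_weight F \<le> 5 ^ CARD('n)" by simp
  qed
qed (rule lattice_weight_nonneg)

lemma freq_size_power_ge: "1 \<le> freq_size (k :: 'n::finite zvec) ^ (2 * CARD('n)) * lattice_weight k"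
proof -
  have "1 = (\<Prod>i\<in>(UNIV :: 'n set). (1 + \<bar>of_int (k $ i)\<bar>)\<^sup>2) * lattice_weight k"
    unfolding lattice_weight_def prod.distrib[symmetric] by (intro prod.neutral[symmetric]) (auto simp: add_nonneg_eq_0_iff)
  also have "(\<Prod>i\<in>(UNIV :: 'n set). (1 + \<bar>of_int (k $ i)\<bar>)\<^sup>2) \<le> (\<Prod>i\<in>(UNIV :: 'n set). (freq_size k)\<^sup>2)"
    by (intro prod_mono conjI power_mono component_le_freq_size) auto
  also have "\<dots> = freq_size k ^ (2 * CARD('n))" by (simp add: power_mult)
  finally show ?thesis using lattice_weight_nonneg[of k] by (simp add: mult_right_mono)
qed

definition polynomially_bounded :: "('n::finite zvec \<Rightarrow> 'e::real_normed_vector) \<Rightarrow> bool"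
  where "polynomially_bounded c \<longleftrightarrow> (\<exists>C m. \<forall>k. norm (c k) \<le> C * freq_size k ^ m)"

text \<open>The distribution is the pairing of c with the test coefficients. Their decay beats the
  growth of c and makes the series absolutely convergent, with sum bounded by one seminorm; this
  bound is the continuity.\<close>

lemma exists_distribution_with_coeffs:
  fixes c :: "'n::{finite,linorder} zvec \<Rightarrow> 'e::complex_banach"
  assumes "polynomially_bounded c"
  shows "\<exists>g\<in>distributions. \<forall>k. fourier_coeff g k = c k"
proof -
  obtain C m where Cm: "\<And>k. norm (c k) \<le> C * freq_size k ^ m"
    using assms unfolding polynomially_bounded_def by blast
  have C: "0 \<le> C"
  proof -
    have "0 \<le> C * freq_size (0 :: 'n zvec) ^ m" using Cm[of 0] by (rule order_trans[OF norm_ge_zero])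
    then show ?thesis using freq_size_ge_1[of "0 :: 'n zvec"] by (simp add: freq_size_def)
  qed
  \<comment> \<open>m derivatives absorb the growth of c, and 2 n more leave the summable
    \<open>lattice_weight\<close>.\<close>
  define r where "r = m + 2 * CARD('n)"
  define A where "A = C * real (CARD('n) + 1) ^ r"
  define W where "W = infsum (lattice_weight :: 'n zvec \<Rightarrow> real) UNIV"
  have A: "0 \<le> A" using C by (simp add: A_def)
  have W: "0 \<le> W" unfolding W_def by (intro infsum_nonneg lattice_weight_nonneg)
  define h where "h \<phi> k = test_coeff \<phi> k *\<^sub>C c k" for \<phi> k
  have h_le: "norm (h \<phi> k) \<le> A * test_seminorm r \<phi> * lattice_weight k" if \<phi>: "\<phi> \<in> test_functions" for \<phi> k
  proof -
    have "norm (h \<phi> k) \<le> norm (test_coeff \<phi> k) * (C * freq_size k ^ m)"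
      unfolding h_def norm_scaleC by (intro mult_left_mono Cm) auto
    also have "\<dots> \<le> norm (test_coeff \<phi> k) * (C * freq_size k ^ m) * (freq_size k ^ (2 * CARD('n)) * lattice_weight k)"
      using mult_left_mono[OF freq_size_power_ge[of k], of "norm (test_coeff \<phi> k) * (C * freq_size k ^ m)"]
        C freq_size_ge_1[of k] by simp
    also have "\<dots> = C * (freq_size k ^ r * norm (test_coeff \<phi> k)) * lattice_weight k"
      by (simp add: r_def power_add mult_ac)
    also have "\<dots> \<le> C * (real (CARD('n) + 1) ^ r * test_seminorm r \<phi>) * lattice_weight k"
      by (intro mult_right_mono mult_left_mono test_coeff_decay \<phi> C lattice_weight_nonneg)
    finally show ?thesis by (simp add: A_def mult_ac)
  qed
  have abs: "(\<lambda>k. norm (h \<phi> k)) summable_on UNIV" if \<phi>: "\<phi> \<in> test_functions" for \<phi>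
  proof (rule summable_on_comparison_test)
    show "(\<lambda>k. A * test_seminorm r \<phi> * lattice_weight k) summable_on UNIV"
      by (intro summable_on_cmult_right lattice_weight_summable)
  qed (use h_le[OF \<phi>] in auto)
  have summ: "h \<phi> summable_on UNIV" if "\<phi> \<in> test_functions" for \<phi>
    using abs[OF that] by (rule abs_summable_summable)
  define G where "G \<phi> = infsum (h \<phi>) UNIV" for \<phi>
  have G_le: "norm (G \<phi>) \<le> A * W * test_seminorm r \<phi>" if \<phi>: "\<phi> \<in> test_functions" for \<phi>
  proof -
    have "norm (G \<phi>) \<le> infsum (\<lambda>k. norm (h \<phi> k)) UNIV"
      unfolding G_def by (rule norm_infsum_bound[OF abs[OF \<phi>]])
    also have "\<dots> \<le> infsum (\<lambda>k :: 'n zvec. A * test_seminorm r \<phi> * lattice_weight k) UNIV"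
    proof (rule infsum_mono)
      show "(\<lambda>k. norm (h \<phi> k)) summable_on UNIV" by (rule abs[OF \<phi>])
      show "(\<lambda>k :: 'n zvec. A * test_seminorm r \<phi> * lattice_weight k) summable_on UNIV"
        by (rule summable_on_cmult_right[OF lattice_weight_summable])
    qed (rule h_le[OF \<phi>])
    also have "\<dots> = A * test_seminorm r \<phi> * W"
      unfolding W_def by (rule infsum_cmult_right) (rule lattice_weight_summable)
    finally show ?thesis by (simp add: mult_ac)
  qed
  have coeff_lin: "test_coeff (\<lambda>x. a * \<phi> x + b * \<psi> x) k = a * test_coeff \<phi> k + b * test_coeff \<psi> k"
    if "\<phi> \<in> test_functions" "\<psi> \<in> test_functions" for \<phi> \<psi> :: "'n rvec \<Rightarrow> complex" and a b k
  proof -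
    have cont: "continuous_on UNIV (\<lambda>x. \<phi> x * \<e> k x)" "continuous_on UNIV (\<lambda>x. \<psi> x * \<e> k x)"
      using that test_function_continuous by (auto intro!: continuous_intros)
    have "test_coeff (\<lambda>x. a * \<phi> x + b * \<psi> x) k = torus_mean (\<lambda>x. a * (\<phi> x * \<e> k x) + b * (\<psi> x * \<e> k x))"
      unfolding test_coeff_def by (simp add: algebra_simps)
    also have "\<dots> = torus_mean (\<lambda>x. a * (\<phi> x * \<e> k x)) + torus_mean (\<lambda>x. b * (\<psi> x * \<e> k x))"
      by (intro torus_mean_add continuous_on_mult_left cont)
    also have "\<dots> = a * test_coeff \<phi> k + b * test_coeff \<psi> k"
      unfolding test_coeff_def by (simp only: torus_mean_bounded_linear[OF bounded_linear_mult_right] cont)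
    finally show ?thesis .
  qed
  have G_lin: "G (\<lambda>x. a * \<phi> x + b * \<psi> x) = a *\<^sub>C G \<phi> + b *\<^sub>C G \<psi>"
    if "\<phi> \<in> test_functions" "\<psi> \<in> test_functions" for \<phi> \<psi> :: "'n rvec \<Rightarrow> complex" and a b
  proof -
    have s: "(\<lambda>k. a *\<^sub>C h \<phi> k) summable_on UNIV" if "\<phi> \<in> test_functions" for a \<phi>
      by (rule summable_on_bounded_linear[OF scaleC.bounded_linear_right summ[OF that]])
    have e: "infsum (\<lambda>k. a *\<^sub>C h \<phi> k) UNIV = a *\<^sub>C G \<phi>" if "\<phi> \<in> test_functions" for a \<phi>
      unfolding G_def
      by (rule infsumI[OF has_sum_bounded_linear[OF scaleC.bounded_linear_right has_sum_infsum[OF summ[OF that]]]])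
    have "G (\<lambda>x. a * \<phi> x + b * \<psi> x) = infsum (\<lambda>k. a *\<^sub>C h \<phi> k + b *\<^sub>C h \<psi> k) UNIV"
      unfolding G_def h_def[abs_def] coeff_lin[OF that] by (simp add: scaleC_add_left scaleC_scaleC)
    also have "\<dots> = infsum (\<lambda>k. a *\<^sub>C h \<phi> k) UNIV + infsum (\<lambda>k. b *\<^sub>C h \<psi> k) UNIV"
      by (intro infsum_add s that)
    finally show ?thesis by (simp add: e that)
  qed
  define g where "g = restrict G test_functions"
  have "g \<in> distributions"
    unfolding distributions_def mem_Collect_eq
  proof (intro conjI ballI allI impI)
    show "g \<in> extensional test_functions" by (simp add: g_def)
  next
    fix \<phi> \<psi> :: "'n rvec \<Rightarrow> complex" assume t: "\<phi> \<in> test_functions" "\<psi> \<in> test_functions"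
    show "g (\<lambda>x. \<phi> x + \<psi> x) = g \<phi> + g \<psi>"
      using G_lin[OF t, of 1 1] test_functions_add[OF t] t by (simp add: g_def)
  next
    fix a and \<phi> :: "'n rvec \<Rightarrow> complex" assume t: "\<phi> \<in> test_functions"
    show "g (\<lambda>x. a * \<phi> x) = a *\<^sub>C g \<phi>"
      using G_lin[OF t t, of a 0] test_functions_cmult[OF t] t by (simp add: g_def scaleC.zero_left)
  next
    fix \<phi> :: "'n rvec \<Rightarrow> complex" and \<epsilon> :: real assume t: "\<phi> \<in> test_functions" and "0 < \<epsilon>"
    define \<delta> where "\<delta> = \<epsilon> / (A * W + 1)"
    have AW: "0 < A * W + 1" using A W by (simp add: add_nonneg_pos)
    have "0 < \<delta>" using \<open>0 < \<epsilon>\<close> AW by (simp add: \<delta>_def)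
    moreover have "norm (g \<psi> - g \<phi>) < \<epsilon>" if \<psi>: "\<psi> \<in> test_functions" and lt: "test_seminorm r (\<lambda>x. \<psi> x - \<phi> x) < \<delta>" for \<psi>
    proof -
      have "g \<psi> - g \<phi> = G (\<lambda>x. \<psi> x - \<phi> x)"
        using G_lin[OF \<psi> t, of 1 "-1"] \<psi> t by (simp add: g_def scaleC.minus_left)
      also have "norm \<dots> \<le> A * W * test_seminorm r (\<lambda>x. \<psi> x - \<phi> x)"
        by (rule G_le[OF test_functions_diff[OF \<psi> t]])
      also have "\<dots> \<le> A * W * \<delta>" using lt A W by (intro mult_left_mono) auto
      also have "\<dots> < (A * W + 1) * \<delta>" using \<open>0 < \<delta>\<close> by simp
      also have "\<dots> = \<epsilon>" using AW by (simp add: \<delta>_def)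
      finally show ?thesis .
    qed
    ultimately show "\<exists>k. \<exists>\<delta>>0. \<forall>\<psi>\<in>test_functions. test_seminorm k (\<lambda>x. \<psi> x - \<phi> x) < \<delta> \<longrightarrow> norm (g \<psi> - g \<phi>) < \<epsilon>"
      by blast
  qed
  moreover have "fourier_coeff g k = c k" for k
  proof -
    have "test_coeff (\<e> (- k)) k' = (if k' = k then 1 else 0)" for k'
    proof -
      have "test_coeff (\<e> (- k)) k' = torus_mean (\<e> (k' - k))"
        unfolding test_coeff_def by (simp add: char_fun_add[symmetric])
      then show ?thesis by (simp add: torus_mean_char_fun)
    qed
    then have "h (\<e> (- k)) k' = (if k' = k then c k else 0)" for k'
      by (simp add: h_def scaleC.zero_left)
    then have "G (\<e> (- k)) = infsum (h (\<e> (- k))) {k}"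
      unfolding G_def by (intro infsum_cong_neutral) auto
    then have "G (\<e> (- k)) = c k"
      using \<open>\<And>k'. h (\<e> (- k)) k' = (if k' = k then c k else 0)\<close> by simp
    then show ?thesis by (simp add: fourier_coeff_def g_def)
  qed
  ultimately show ?thesis by blast
qed

lemma funpow_partial_char_fun:
  "(partial i ^^ r) (\<lambda>x. c * \<e> k x) = (\<lambda>x. (c * (\<i> * of_int (k $ i)) ^ r) * \<e> k x)"
proof (induction r)
  case (Suc r)
  have "(partial i ^^ Suc r) (\<lambda>x. c * \<e> k x) = (\<lambda>x. (c * (\<i> * of_int (k $ i)) ^ r * (\<i> * of_int (k $ i))) * \<e> k x)"
    by (simp only: funpow.simps comp_def Suc.IH partial_char_fun)
  then show ?case by (simp add: mult_ac)
qed simp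

lemma mpartial_char_fun:
  "\<exists>c'. mpartial \<alpha> (\<lambda>x. c * \<e> k x) = (\<lambda>x. c' * \<e> k x) \<and> norm c' \<le> norm c * freq_size k ^ multi_abs \<alpha>"
proof -
  have "\<exists>c'. foldr (\<lambda>j. partial j ^^ (\<alpha> $ j)) js (\<lambda>x. c * \<e> k x) = (\<lambda>x. c' * \<e> k x) \<and>
      norm c' \<le> norm c * freq_size k ^ (\<Sum>j\<leftarrow>js. \<alpha> $ j)" for js
  proof (induction js)
    case Nil
    then show ?case by (intro exI[of _ c]) simp
  next
    case (Cons j js)
    then obtain c' where c': "foldr (\<lambda>j. partial j ^^ (\<alpha> $ j)) js (\<lambda>x. c * \<e> k x) = (\<lambda>x. c' * \<e> k x)"
      "norm c' \<le> norm c * freq_size k ^ (\<Sum>j\<leftarrow>js. \<alpha> $ j)" by blast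
    have "norm (c' * (\<i> * of_int (k $ j)) ^ (\<alpha> $ j)) \<le> norm c * freq_size k ^ (\<Sum>j\<leftarrow>js. \<alpha> $ j) * freq_size k ^ (\<alpha> $ j)"
      unfolding norm_mult norm_power
      using c'(2) component_le_freq_size[of k j] freq_size_ge_1[of k]
      by (intro mult_mono power_mono) (auto simp: norm_mult)
    then show ?case
      by (intro exI[of _ "c' * (\<i> * of_int (k $ j)) ^ (\<alpha> $ j)"])
        (simp add: c'(1) funpow_partial_char_fun power_add mult_ac)
  qed
  from this[of coords] show ?thesis
    by (simp add: multi_compose_def multi_abs_def sum_list_distinct_conv_sum_set coords_def)
qed

lemma test_seminorm_char_fun:
  "test_seminorm r (\<lambda>x. c * \<e> k x) \<le> norm c * freq_size (k :: 'n::{finite,linorder} zvec) ^ r"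
proof -
  have "(SUP x\<in>period_cube. norm (mpartial \<alpha> (\<lambda>x. c * \<e> k x) x)) \<le> norm c * freq_size k ^ r"
    if "multi_abs \<alpha> \<le> r" for \<alpha>
  proof -
    obtain c' where c': "mpartial \<alpha> (\<lambda>x. c * \<e> k x) = (\<lambda>x. c' * \<e> k x)" "norm c' \<le> norm c * freq_size k ^ multi_abs \<alpha>"
      using mpartial_char_fun by blast
    have "(period_cube :: 'n rvec set) \<noteq> {}" by (auto simp: interval_ne_empty_cart)
    moreover have "norm c * freq_size k ^ multi_abs \<alpha> \<le> norm c * freq_size k ^ r"
      using that freq_size_ge_1[of k] by (intro mult_left_mono power_increasing) auto
    ultimately show ?thesis unfolding c'(1) using c'(2)
      by (intro cSUP_least) (auto simp: norm_mult)
  qed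
  moreover have "multi_abs (0 :: 'n mindex) \<le> r" by (simp add: multi_abs_def)
  ultimately show ?thesis unfolding test_seminorm_def by (subst Max_le_iff) auto
qed

text \<open>Continuity at 0 yields r and \<delta> such that f is below 1 in norm on the
  \<delta>-ball of the r-th seminorm. A character has r-th seminorm at most
  \<open>freq_size k ^ r\<close>, so scaling it into that ball gives growth of order r.\<close>

lemma distribution_polynomially_bounded:
  fixes f :: "('n::{finite,linorder} rvec \<Rightarrow> complex) \<Rightarrow> 'e::complex_banach"
  assumes f: "f \<in> distributions"
  shows "polynomially_bounded (fourier_coeff f)"
proof -
  have z: "(\<lambda>x::'n rvec. 0 * \<e> 0 x) \<in> test_functions" by (intro test_functions_cmult char_fun_test_function)
  have hom: "f (\<lambda>x. c * \<phi> x) = c *\<^sub>C f \<phi>" if "\<phi> \<in> test_functions" for c \<phi>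
    using f that unfolding distributions_def by blast
  have f0: "f (\<lambda>x. 0) = 0" using hom[OF char_fun_test_function, of 0 0] by (simp add: scaleC.zero_left)
  have z': "(\<lambda>x::'n rvec. 0) \<in> test_functions" using z by simp
  have "\<forall>\<phi>\<in>test_functions. \<forall>\<epsilon>>0. \<exists>k. \<exists>\<delta>>0. \<forall>\<psi>\<in>test_functions.
       test_seminorm k (\<lambda>x. \<psi> x - \<phi> x) < \<delta> \<longrightarrow> norm (f \<psi> - f \<phi>) < \<epsilon>"
    using f unfolding distributions_def by blast
  from bspec[OF this z'] have "\<exists>k. \<exists>\<delta>>0. \<forall>\<psi>\<in>test_functions.
       test_seminorm k (\<lambda>x. \<psi> x - 0) < \<delta> \<longrightarrow> norm (f \<psi> - f (\<lambda>x. 0)) < 1"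
    by (rule allE[of _ 1]) simp
  then obtain r \<delta> where d: "0 < \<delta>" and cont': "\<forall>\<psi>\<in>test_functions.
       test_seminorm r (\<lambda>x. \<psi> x - 0) < \<delta> \<longrightarrow> norm (f \<psi> - f (\<lambda>x. 0)) < 1"
    by (elim exE conjE)
  have cont: "norm (f \<psi> - f (\<lambda>x. 0)) < 1" if "\<psi> \<in> test_functions" "test_seminorm r (\<lambda>x. \<psi> x - 0) < \<delta>" for \<psi>
    using bspec[OF cont' that(1)] that(2) by (rule mp)
  have "norm (fourier_coeff f k) \<le> 2 / \<delta> * freq_size k ^ r" for k
  proof -
    have S: "0 < freq_size (- k)" using freq_size_ge_1[of "- k"] by linarith
    have Sk: "freq_size (- k) = freq_size k" by (simp add: freq_size_def)
    \<comment> \<open>Chosen so that the scaled character has seminorm at most \<delta> / 2,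
      strictly inside the ball.\<close>
    define c where "c = \<delta> / (2 * freq_size (- k) ^ r)"
    have c: "0 < c" using S d by (simp add: c_def)
    have "test_seminorm r (\<lambda>x. complex_of_real c * \<e> (- k) x) \<le> c * freq_size (- k) ^ r"
      using test_seminorm_char_fun[of r "complex_of_real c" "- k"] c by simp
    also have "\<dots> = \<delta> / 2" using S by (simp add: c_def)
    finally have "test_seminorm r (\<lambda>x. complex_of_real c * \<e> (- k) x - 0) < \<delta>" using d by simp
    from cont[OF test_functions_cmult[OF char_fun_test_function] this]
    have "norm (f (\<lambda>x. complex_of_real c * \<e> (- k) x)) < 1" by (simp add: f0)
    then have "c * norm (fourier_coeff f k) < 1"
      using c by (simp add: hom[OF char_fun_test_function] norm_scaleC fourier_coeff_def)
    then have "norm (fourier_coeff f k) \<le> 1 / c" using c by (simp add: field_simps)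
    then show ?thesis by (simp add: c_def Sk mult.commute)
  qed
  then show ?thesis unfolding polynomially_bounded_def by blast
qed

section \<open>Coarse blocks and dyadic annuli\<close>

lemma length_coords [simp]: "length (coords :: 'n::{finite,linorder} list) = CARD('n)"
  by (simp add: coords_def)

lemma coarse_Suc_iff:
  fixes k :: "'n::{finite,linorder} zvec"
  assumes "0 < d"
  shows "k \<in> coarse d \<longleftrightarrow> (\<forall>i<direction d. \<bar>k $ i\<bar> < 2 ^ (level TYPE('n) d + 1)) \<and>
    2 ^ level TYPE('n) d \<le> \<bar>k $ direction d\<bar> \<and> \<bar>k $ direction d\<bar> < 2 ^ (level TYPE('n) d + 1) \<and>
    (\<forall>i>direction d. \<bar>k $ i\<bar> < 2 ^ level TYPE('n) d)"
  using assms by (simp add: coarse_def Let_def)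

lemma coarse_component_less:
  fixes k :: "'n::{finite,linorder} zvec"
  assumes "k \<in> coarse d" "0 < d"
  shows "\<bar>k $ i\<bar> < 2 ^ (level TYPE('n) d + 1)"
proof -
  consider "i < direction d" | "i = direction d" | "direction d < i" by force
  then show ?thesis
  proof cases
    case 3
    then have "\<bar>k $ i\<bar> < 2 ^ level TYPE('n) d" using assms coarse_Suc_iff[OF assms(2)] by blast
    also have "(2::int) ^ level TYPE('n) d \<le> 2 ^ (level TYPE('n) d + 1)" by (rule power_increasing) auto
    finally show ?thesis .
  qed (use assms coarse_Suc_iff[OF assms(2)] in blast)+
qed

text \<open>The level r is determined by 2^r <= max |k_i| < 2^(r+1), and the direction is the last
  coordinate with |k_i| >= 2^r. Together they determine d - 1 as quotient and remainder modulo
  n.\<close>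

lemma coarse_unique:
  fixes k :: "'n::{finite,linorder} zvec"
  assumes "k \<in> coarse d" "k \<in> coarse d'"
  shows "d = d'"
proof -
  have zero: "0 \<notin> (coarse d :: 'n zvec set)" if "0 < d" for d
    unfolding coarse_Suc_iff[OF that] by (simp add: not_le)
  have level_le: "level TYPE('n) d' \<le> level TYPE('n) d" if k: "k \<in> coarse d" "k \<in> coarse d'" and d: "0 < d" "0 < d'" for d d'
  proof (rule ccontr)
    assume "\<not> ?thesis"
    then have "(2::int) ^ (level TYPE('n) d + 1) \<le> 2 ^ level TYPE('n) d'" by (intro power_increasing) auto
    also have "\<dots> \<le> \<bar>k $ direction d'\<bar>" using k(2) coarse_Suc_iff[OF d(2)] by blast
    also have "\<dots> < 2 ^ (level TYPE('n) d + 1)" by (rule coarse_component_less[OF k(1) d(1)])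
    finally show False by simp
  qed
  have dir_le: "(direction d' :: 'n) \<le> direction d"
    if k: "k \<in> coarse d" "k \<in> coarse d'" and d: "0 < d" "0 < d'" and l: "level TYPE('n) d = level TYPE('n) d'" for d d'
  proof (rule ccontr)
    assume "\<not> ?thesis"
    then have "\<bar>k $ direction d'\<bar> < 2 ^ level TYPE('n) d" using k(1) coarse_Suc_iff[OF d(1)] by (auto simp: not_le)
    moreover have "2 ^ level TYPE('n) d' \<le> \<bar>k $ direction d'\<bar>" using k(2) coarse_Suc_iff[OF d(2)] by blast
    ultimately show False using l by simp
  qed
  show ?thesis
  proof (cases "d = 0 \<or> d' = 0")
    case True
    then show ?thesis using assms zero[of d] zero[of d'] by (cases d; cases d') (auto simp: coarse_def[of 0])
  next
    case False
    then have d: "0 < d" "0 < d'" by auto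
    have l: "level TYPE('n) d = level TYPE('n) d'"
      using level_le[OF assms d] level_le[OF assms(2,1) d(2,1)] by (rule antisym[rotated])
    have "(direction d :: 'n) = direction d'"
      using dir_le[OF assms d l] dir_le[OF assms(2,1) d(2,1) l[symmetric]] by (rule antisym[rotated])
    then have "(d - 1) mod CARD('n) = (d' - 1) mod CARD('n)"
      unfolding direction_def by (subst (asm) nth_eq_iff_index_eq) auto
    then have "d - 1 = d' - 1" using l unfolding level_def by (metis div_mult_mod_eq)
    then show ?thesis using d by simp
  qed
qed

text \<open>Take for r the binary order of magnitude of the largest |k_i|, and for l the last
  coordinate that reaches 2^r.\<close>

lemma coarse_cover:
  fixes k :: "'n::{finite,linorder} zvec"
  shows "\<exists>d. k \<in> coarse d"
proof (cases "k = 0")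
  case True
  then show ?thesis by (intro exI[of _ 0]) (simp add: coarse_def)
next
  case False
  define m where "m = Max (range (\<lambda>i. \<bar>k $ i\<bar>))"
  have m_ge: "\<bar>k $ i\<bar> \<le> m" for i unfolding m_def by (intro Max_ge) auto
  have "m \<in> range (\<lambda>i. \<bar>k $ i\<bar>)" unfolding m_def by (intro Max_in) auto
  then obtain i0 where i0: "m = \<bar>k $ i0\<bar>" by blast
  obtain i1 where "k $ i1 \<noteq> 0" using False by (auto simp: vec_eq_iff)
  then have m1: "1 \<le> m" using m_ge[of i1] by linarith
  have "\<exists>r. 2 ^ r \<le> m \<and> m < 2 ^ (r + 1)"
  proof -
    define r where "r = (LEAST r. m < 2 ^ (r + 1))"
    have "m < 2 ^ (nat m + 1)"
    proof -
      have "m \<le> int (nat m)" by simp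
      also have "int (nat m) < int (2 ^ nat m)" by (subst of_nat_less_iff) (rule less_exp)
      finally show ?thesis using m1 by simp
    qed
    then have less: "m < 2 ^ (r + 1)" unfolding r_def by (rule LeastI)
    have "2 ^ r \<le> m"
    proof (cases r)
      case (Suc r')
      then have "\<not> m < 2 ^ (r' + 1)" unfolding r_def by (intro not_less_Least) simp
      then show ?thesis using Suc by simp
    qed (use m1 in simp)
    then show ?thesis using less by blast
  qed
  then obtain r where r: "2 ^ r \<le> m" "m < 2 ^ (r + 1)" by blast
  define L where "L = {i. 2 ^ r \<le> \<bar>k $ i\<bar>}"
  define l where "l = Max L"
  have "L \<noteq> {}" using r i0 by (auto simp: L_def)
  then have lL: "l \<in> L" unfolding l_def by (intro Max_in) auto
  have l_max: "\<bar>k $ i\<bar> < 2 ^ r" if "l < i" for i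
  proof (rule ccontr)
    assume "\<not> ?thesis"
    then have "i \<in> L" by (simp add: L_def)
    then have "i \<le> l" unfolding l_def by (intro Max_ge) auto
    then show False using that by simp
  qed
  have "l \<in> set coords" by simp
  then obtain j where j: "j < CARD('n)" "coords ! j = l" unfolding in_set_conv_nth by auto
  \<comment> \<open>Positions in \<open>coords\<close> count from 0, directions of blocks from 1;
    hence the successor.\<close>
  define d where "d = Suc (CARD('n) * r + j)"
  have "direction d = l" "level TYPE('n) d = r" using j by (simp_all add: d_def direction_def level_def)
  moreover have "\<bar>k $ i\<bar> < 2 ^ (r + 1)" for i using m_ge[of i] r by linarith
  moreover have "0 < d" by (simp add: d_def)
  ultimately have "k \<in> coarse d" using lL l_max by (simp add: coarse_Suc_iff L_def)
  then show ?thesis by blast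
qed

definition coarse_piece :: "nat \<Rightarrow> ('n::{finite,linorder} zvec \<Rightarrow> 'b::zero) \<Rightarrow> 'n zvec \<Rightarrow> 'b"
  where "coarse_piece d M = cut (coarse d) M"

lemma coarse_split:
  assumes "0 < d" "k \<in> coarse d"
  shows "(k \<in> coarse_pos d) \<noteq> (k \<in> coarse_neg d)"
proof -
  have "(2::int) ^ level TYPE('a) d \<le> \<bar>k $ direction d\<bar>" using assms coarse_Suc_iff by blast
  moreover have "(0::int) < 2 ^ level TYPE('a) d" by simp
  ultimately have "k $ direction d \<noteq> 0" by linarith
  then show ?thesis using assms by (auto simp: coarse_pos_def coarse_neg_def)
qed

lemma coarse_piece_bound:
  fixes M :: "'n::{finite,linorder} zvec \<Rightarrow> 'e::complex_banach \<Rightarrow>\<^sub>L 'e"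
  assumes proj: "\<And>l. Lp_multiplier_bound p (\<lambda>(k :: 'n zvec) (x :: 'e). if 0 \<le> k $ l then x else 0) C"
    and C: "0 \<le> C" and p: "1 < p" and M: "\<And>k. M k \<in> L_ops"
  shows "Lp_multiplier_bound p (\<lambda>k. blinfun_apply (coarse_piece d M k))
    (C ^ CARD('n) * (C ^ CARD('n) * (1 + C) ^ CARD('n)) * coarse_Var d M)"
proof -
  define B where "B = C ^ CARD('n) * (C ^ CARD('n) * (1 + C) ^ CARD('n))"
  have box: "Lp_multiplier_bound p (\<lambda>k. blinfun_apply (cut G M k)) (B * Var G M)"
    if "\<exists>\<alpha> \<beta>. \<alpha> \<le> \<beta> \<and> G = {\<alpha>..\<beta>}" for G :: "'n zvec set"
  proof -
    from that obtain \<alpha> \<beta> where ab: "\<alpha> \<le> \<beta>" and G: "G = {\<alpha>..\<beta>}" by blast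
    show ?thesis unfolding G Var_atLeastAtMost[OF ab] B_def
      by (rule variation_multiplier_bound[OF proj C p M])
  qed
  show ?thesis
  proof (cases "d = 0")
    case True
    have "coarse 0 = {0..0 :: 'n zvec}" by (simp add: coarse_def)
    then have "\<exists>\<alpha> \<beta>. \<alpha> \<le> \<beta> \<and> coarse 0 = {\<alpha>..\<beta> :: 'n zvec}" by (intro exI[of _ 0]) simp
    from box[OF this] show ?thesis using True by (simp add: coarse_Var_def coarse_piece_def B_def)
  next
    case False
    then have d: "0 < d" by simp
    have eq: "blinfun_apply (coarse_piece d M k) x =
        (\<Sum>b\<in>{True, False}. blinfun_apply (if b then cut (coarse_pos d) M k else cut (coarse_neg d) M k) x)" for k x
    proof (cases "k \<in> coarse d")
      case True
      then show ?thesis using coarse_split[OF d True] by (auto simp: coarse_piece_def cut_def blinfun.zero_left)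
    next
      case False
      then show ?thesis by (auto simp: coarse_piece_def cut_def coarse_pos_def coarse_neg_def blinfun.zero_left)
    qed
    have "Lp_multiplier_bound p (\<lambda>k x. \<Sum>b\<in>{True, False}. blinfun_apply (if b then cut (coarse_pos d) M k else cut (coarse_neg d) M k) x)
      (\<Sum>b\<in>{True, False}. if b then B * Var (coarse_pos d) M else B * Var (coarse_neg d) M)"
      using box[OF coarse_pos_interval[OF d]] box[OF coarse_neg_interval[OF d]]
      by (intro Lp_multiplier_bound_sum p) auto
    then show ?thesis unfolding eq[symmetric] using False by (simp add: coarse_Var_def B_def algebra_simps)
  qed
qed

section \<open>Dyadic annuli against coarse blocks\<close>

lemma resolution_support:
  assumes "resolution_of_unity \<phi>" "\<phi> j x \<noteq> 0"
  shows "x \<in> dyadic_annulus j"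
proof -
  have "x \<in> closure {x. \<phi> j x \<noteq> 0}" using assms(2) closure_subset[of "{x. \<phi> j x \<noteq> 0}"] by blast
  then show ?thesis using assms(1) unfolding resolution_of_unity_def by blast
qed

lemma dyadic_annulus_norm_le: "x \<in> dyadic_annulus j \<Longrightarrow> norm x \<le> 2 ^ (j + 1)"
  by (cases "j = 0") (auto simp: dyadic_annulus_def)

lemma dyadic_annulus_norm_ge: "x \<in> dyadic_annulus j \<Longrightarrow> 0 < j \<Longrightarrow> 2 ^ (j - 1) \<le> norm x"
  by (auto simp: dyadic_annulus_def)

lemma component_le_norm_real_vec: "\<bar>of_int (k $ i)\<bar> \<le> norm (real_vec k)"
  using component_le_norm_cart[of "real_vec k" i] by simp

lemma norm_real_vec_le: "norm (real_vec k) \<le> (\<Sum>i\<in>UNIV. \<bar>of_int (k $ i)\<bar>)"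
  using norm_le_l1_cart[of "real_vec k"] by simp

lemma finite_norm_real_vec_le: "finite {k :: 'n::finite zvec. norm (real_vec k) \<le> R}"
proof (rule finite_subset)
  show "{k :: 'n zvec. norm (real_vec k) \<le> R} \<subseteq> {(\<chi> i. - \<lfloor>R\<rfloor>)..(\<chi> i. \<lfloor>R\<rfloor>)}"
  proof
    fix k :: "'n zvec" assume "k \<in> {k. norm (real_vec k) \<le> R}"
    then have "\<bar>of_int (k $ i)\<bar> \<le> R" for i using component_le_norm_real_vec[of k i] by simp
    then have "\<bar>k $ i\<bar> \<le> \<lfloor>R\<rfloor>" for i by (simp add: le_floor_iff)
    then show "k \<in> {(\<chi> i. - \<lfloor>R\<rfloor>)..(\<chi> i. \<lfloor>R\<rfloor>)}" by (auto simp: less_eq_vec_def abs_le_iff minus_le_iff)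
  qed
qed simp

lemma finite_dyadic_support:
  assumes "resolution_of_unity \<phi>"
  shows "finite {k. \<phi> j (real_vec k) \<noteq> 0}"
  by (rule finite_subset[OF _ finite_norm_real_vec_le[of "2 ^ (j + 1)"]])
    (use dyadic_annulus_norm_le resolution_support[OF assms] in blast)

lemma dyadic_block_eq_trig_poly:
  "dyadic_block \<phi> j f = trig_poly {k. \<phi> j (real_vec k) \<noteq> 0} (\<lambda>k. \<phi> j (real_vec k) *\<^sub>C fourier_coeff f k)"
  by (simp add: fun_eq_iff dyadic_block_def trig_poly_def)

text \<open>A coarse block of level r fixes the maximum norm up to a factor 2, an annulus the
  Euclidean norm up to a factor 4. If the two meet, then r <= j + 1 and j <= r + n + 1; this leaves
  at most n + 3 levels with n blocks each, and d = 0.\<close>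

lemma coarse_window:
  fixes \<phi> :: "nat \<Rightarrow> 'n::{finite,linorder} rvec \<Rightarrow> complex"
  assumes \<phi>: "resolution_of_unity \<phi>"
  defines "W \<equiv> \<lambda>j. {d. \<exists>k\<in>coarse d. \<phi> j (real_vec k) \<noteq> 0}"
  shows "finite (W j)" and "card (W j) \<le> 1 + CARD('n) * (CARD('n) + 3)"
proof -
  let ?n = "CARD('n)"
  have sub: "W j \<subseteq> insert 0 (Suc ` {?n * (j - (?n + 1))..<?n * (j + 2)})"
  proof
    fix d assume "d \<in> W j"
    then obtain k where k: "k \<in> coarse d" "\<phi> j (real_vec k) \<noteq> 0" by (auto simp: W_def)
    note supp = resolution_support[OF \<phi> k(2)]
    show "d \<in> insert 0 (Suc ` {?n * (j - (?n + 1))..<?n * (j + 2)})"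
    proof (cases "d = 0")
      case False
      then have d: "0 < d" by simp
      define r where "r = level TYPE('n) d"
      have "real_of_int (2 ^ r) \<le> real_of_int \<bar>k $ direction d\<bar>"
        unfolding of_int_le_iff r_def using k(1) coarse_Suc_iff[OF d] by blast
      also have "\<dots> \<le> norm (real_vec k)" using component_le_norm_real_vec[of k "direction d"] by simp
      also have "\<dots> \<le> 2 ^ (j + 1)" by (rule dyadic_annulus_norm_le[OF supp])
      finally have "(2::real) ^ r \<le> 2 ^ (j + 1)" by simp
      then have r1: "r \<le> j + 1" by (subst (asm) power_increasing_iff) auto
      \<comment> \<open>The Euclidean norm is below n 2^(r+1), and n is crudely bounded by 2^n to
        stay with powers of 2.\<close>
      have r2: "j \<le> r + ?n + 1"
      proof (cases "j = 0")
        case False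
        have "(2::real) ^ (j - 1) \<le> norm (real_vec k)" using dyadic_annulus_norm_ge[OF supp] False by simp
        also have "\<dots> \<le> (\<Sum>i\<in>UNIV. \<bar>of_int (k $ i)\<bar>)" by (rule norm_real_vec_le)
        also have "\<dots> < (\<Sum>i\<in>(UNIV :: 'n set). 2 ^ (r + 1))"
        proof (rule sum_strict_mono)
          fix i
          have "real_of_int \<bar>k $ i\<bar> < real_of_int (2 ^ (r + 1))"
            unfolding of_int_less_iff r_def by (rule coarse_component_less[OF k(1) d])
          then show "\<bar>of_int (k $ i)\<bar> < (2::real) ^ (r + 1)" by simp
        qed auto
        also have "\<dots> = real ?n * 2 ^ (r + 1)" by simp
        also have "\<dots> \<le> 2 ^ ?n * 2 ^ (r + 1)"
          by (intro mult_right_mono) (auto intro!: less_imp_le of_nat_less_two_power)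
        finally have "(2::real) ^ (j - 1) < 2 ^ (?n + (r + 1))" by (simp add: power_add)
        then have "j - 1 < ?n + (r + 1)" by (subst (asm) power_strict_increasing_iff) auto
        then show ?thesis by simp
      qed simp
      have dr: "?n * r \<le> d - 1" "d - 1 < ?n * (r + 1)"
        unfolding r_def level_def using div_mult_mod_eq[of "d - 1" ?n] mod_less_divisor[of ?n "d - 1"]
        by (simp_all add: algebra_simps dividend_less_times_div)
      have "?n * (j - (?n + 1)) \<le> ?n * r" using r2 by (intro mult_le_mono2) linarith
      then have lower: "?n * (j - (?n + 1)) \<le> d - 1" using dr(1) by (rule order_trans)
      have "?n * (r + 1) \<le> ?n * (j + 2)" using r1 by (intro mult_le_mono2) simp
      with dr(2) have "d - 1 < ?n * (j + 2)" by (rule less_le_trans)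
      with lower have "d - 1 \<in> {?n * (j - (?n + 1))..<?n * (j + 2)}" by (simp only: atLeastLessThan_iff)
      then show ?thesis using d by (intro insertI2 image_eqI[of _ _ "d - 1"]) auto
    qed simp
  qed
  then show "finite (W j)" by (rule finite_subset) simp
  have "card (W j) \<le> card (insert 0 (Suc ` {?n * (j - (?n + 1))..<?n * (j + 2)}))"
    using sub by (intro card_mono) auto
  also have "\<dots> = 1 + (?n * (j + 2) - ?n * (j - (?n + 1)))"
    by (subst card_insert_disjoint) (auto simp: card_image)
  also have "?n * (j + 2) - ?n * (j - (?n + 1)) = ?n * ((j + 2) - (j - (?n + 1)))"
    by (rule diff_mult_distrib2[symmetric])
  also have "\<dots> \<le> ?n * (?n + 3)" by (intro mult_le_mono2) linarith
  finally show "card (W j) \<le> 1 + ?n * (?n + 3)" by simp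
qed

lemma besov_norm_finite_transfer:
  fixes f g :: "('n::finite rvec \<Rightarrow> complex) \<Rightarrow> 'e::complex_banach"
  assumes le: "\<And>j. Lp_norm p (dyadic_block \<phi> j g) \<le> C * Lp_norm p (dyadic_block \<phi> j f)" and C: "0 \<le> C"
    and fin: "besov_norm \<phi> s p q f < \<infinity>"
  shows "besov_norm \<phi> s p q g < \<infinity>"
proof (cases "q = \<infinity>")
  case True
  define S where "S = (SUP j. ennreal (2 powr (s * real j) * Lp_norm p (dyadic_block \<phi> j f)))"
  have S: "S < \<infinity>" using fin True by (simp add: besov_norm_def S_def)
  have "besov_norm \<phi> s p q g \<le> ennreal C * S"
    unfolding besov_norm_def using True
  proof (simp, intro SUP_least)
    fix j
    have "2 powr (s * real j) * Lp_norm p (dyadic_block \<phi> j g) \<le> 2 powr (s * real j) * (C * Lp_norm p (dyadic_block \<phi> j f))"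
      by (intro mult_left_mono le) simp
    then have "ennreal (2 powr (s * real j) * Lp_norm p (dyadic_block \<phi> j g)) \<le> ennreal (C * (2 powr (s * real j) * Lp_norm p (dyadic_block \<phi> j f)))"
      by (intro ennreal_leI) (simp add: mult_ac)
    also have "\<dots> = ennreal C * ennreal (2 powr (s * real j) * Lp_norm p (dyadic_block \<phi> j f))"
      using C by (intro ennreal_mult) auto
    also have "\<dots> \<le> ennreal C * S" unfolding S_def by (intro mult_left_mono SUP_upper) auto
    finally show "ennreal (2 powr (s * real j) * Lp_norm p (dyadic_block \<phi> j g)) \<le> ennreal C * S" .
  qed
  also have "\<dots> < \<infinity>" using S by (simp add: ennreal_mult_less_top)
  finally show ?thesis .
next
  case False
  define Q where "Q = enn2real q"
  define T where "T h j = 2 powr (s * real j * Q) * Lp_norm p (dyadic_block \<phi> j h) powr Q"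
    for h :: "('n rvec \<Rightarrow> complex) \<Rightarrow> 'e" and j
  have norm_eq: "besov_norm \<phi> s p q h = (if (\<Sum>j. ennreal (T h j)) = \<infinity> then \<infinity> else ennreal (enn2real (\<Sum>j. ennreal (T h j)) powr (1 / Q)))"
    for h :: "('n rvec \<Rightarrow> complex) \<Rightarrow> 'e"
    using False by (simp add: besov_norm_def Let_def T_def Q_def)
  have Sf: "(\<Sum>j. ennreal (T f j)) < \<infinity>"
    using fin unfolding norm_eq by (auto split: if_splits simp: less_top)
  have "(\<Sum>j. ennreal (T g j)) \<le> (\<Sum>j. ennreal (C powr Q) * ennreal (T f j))"
  proof (intro suminf_le)
    fix j
    have "Lp_norm p (dyadic_block \<phi> j g) powr Q \<le> (C * Lp_norm p (dyadic_block \<phi> j f)) powr Q"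
      using le by (intro powr_mono2) (auto simp: Q_def)
    then have "T g j \<le> C powr Q * T f j"
      unfolding T_def by (simp add: powr_mult mult.left_commute mult_left_mono)
    then have "ennreal (T g j) \<le> ennreal (C powr Q * T f j)" by (rule ennreal_leI)
    also have "\<dots> = ennreal (C powr Q) * ennreal (T f j)" by (intro ennreal_mult) (auto simp: T_def)
    finally show "ennreal (T g j) \<le> ennreal (C powr Q) * ennreal (T f j)" .
  qed auto
  also have "\<dots> = ennreal (C powr Q) * (\<Sum>j. ennreal (T f j))" by simp
  also have "\<dots> < \<infinity>" using Sf by (simp add: ennreal_mult_less_top)
  finally show ?thesis unfolding norm_eq by (auto simp: less_top)
qed

text \<open>The distribution g is produced first, from polynomial growth of the products. As
  \<open>M k\<close> is complex-linear it commutes with the scalar \<phi>_j, so block j of g is M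
  applied to block j of f; splitting M over the coarse blocks of the window bounds it with a
  constant that does not depend on j.\<close>

theorem UMD_imp_besov_multiplier:
  fixes \<phi> :: "nat \<Rightarrow> 'n::{finite,linorder} rvec \<Rightarrow> complex"
    and M :: "'n zvec \<Rightarrow> 'e::complex_banach \<Rightarrow>\<^sub>L 'e"
  assumes \<phi>: "resolution_of_unity \<phi>" and p: "1 < p"
    and UMD: "UMD_space TYPE('n) TYPE('e)"
    and M: "\<And>k. M k \<in> L_ops" and bv: "bounded_coarse_variation M"
  shows "besov_multiplier \<phi> s p q M"
  unfolding besov_multiplier_def
proof
  fix f :: "('n rvec \<Rightarrow> complex) \<Rightarrow> 'e" assume "f \<in> besov_space \<phi> s p q"
  then have f: "f \<in> distributions" and fin: "besov_norm \<phi> s p q f < \<infinity>"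
    by (auto simp: besov_space_def)
  obtain C where C: "0 \<le> C"
    and proj: "\<And>l. Lp_multiplier_bound p (\<lambda>(k :: 'n zvec) (x :: 'e). if 0 \<le> k $ l then x else 0) C"
    using UMD_coordinate_projection_bound[OF UMD p] by blast
  define B where "B = C ^ CARD('n) * (C ^ CARD('n) * (1 + C) ^ CARD('n))"
  have B: "0 \<le> B" using C by (simp add: B_def)
  obtain b where b: "\<And>k. norm (M k) \<le> b" using bv by (auto simp: bounded_coarse_variation_def bounded_iff)
  obtain v where v: "\<And>d. coarse_Var d M \<le> v" using bv by (auto simp: bounded_coarse_variation_def bdd_above_def)
  obtain Cf m where Cf: "\<And>k. norm (fourier_coeff f k) \<le> Cf * freq_size k ^ m"
    using distribution_polynomially_bounded[OF f] unfolding polynomially_bounded_def by blast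
  have "polynomially_bounded (\<lambda>k. blinfun_apply (M k) (fourier_coeff f k))"
    unfolding polynomially_bounded_def
  proof (intro exI allI)
    fix k
    have "norm (blinfun_apply (M k) (fourier_coeff f k)) \<le> norm (M k) * norm (fourier_coeff f k)" by (rule norm_blinfun)
    also have "\<dots> \<le> b * (Cf * freq_size k ^ m)"
      using b[of k] Cf[of k] order_trans[OF norm_ge_zero b] by (intro mult_mono) auto
    finally show "norm (blinfun_apply (M k) (fourier_coeff f k)) \<le> (b * Cf) * freq_size k ^ m" by (simp add: mult.assoc)
  qed
  then obtain g where g: "g \<in> distributions" and gk: "\<And>k. fourier_coeff g k = blinfun_apply (M k) (fourier_coeff f k)"
    using exists_distribution_with_coeffs[of "\<lambda>k. blinfun_apply (M k) (fourier_coeff f k)"] by blast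
  define w where "w = real (1 + CARD('n) * (CARD('n) + 3))"
  \<comment> \<open>Taking the maximum with 0 gives a nonnegative bound at once.\<close>
  define V where "V = max 0 v"
  have "Lp_norm p (dyadic_block \<phi> j g) \<le> (w * (B * V)) * Lp_norm p (dyadic_block \<phi> j f)" for j
  proof -
    define S where "S = {k :: 'n zvec. \<phi> j (real_vec k) \<noteq> 0}"
    define W where "W = {d. \<exists>k\<in>coarse d. \<phi> j (real_vec k) \<noteq> 0}"
    define a where "a k = \<phi> j (real_vec k) *\<^sub>C fourier_coeff f k" for k
    have S: "finite S" unfolding S_def by (rule finite_dyadic_support[OF \<phi>])
    have W: "finite W" "card W \<le> 1 + CARD('n) * (CARD('n) + 3)"
      unfolding W_def by (rule coarse_window[OF \<phi>])+
    have "dyadic_block \<phi> j g = trig_poly S (\<lambda>k. \<Sum>d\<in>W. blinfun_apply (coarse_piece d M k) (a k))"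
    proof
      fix x
      have "(\<Sum>d\<in>W. blinfun_apply (coarse_piece d M k) (a k)) = \<phi> j (real_vec k) *\<^sub>C fourier_coeff g k" if k: "k \<in> S" for k
      proof -
        obtain d0 where d0: "k \<in> coarse d0" using coarse_cover by blast
        then have "d0 \<in> W" using k by (auto simp: W_def S_def)
        have "(\<Sum>d\<in>W. blinfun_apply (coarse_piece d M k) (a k)) = (\<Sum>d\<in>W. if d = d0 then blinfun_apply (M k) (a k) else 0)"
        proof (rule sum.cong[OF refl])
          fix d
          show "blinfun_apply (coarse_piece d M k) (a k) = (if d = d0 then blinfun_apply (M k) (a k) else 0)"
          proof (cases "d = d0")
            case False
            then have "k \<notin> coarse d" using coarse_unique d0 by blast
            then show ?thesis using False by (simp add: coarse_piece_def cut_def blinfun.zero_left)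
          qed (simp add: coarse_piece_def cut_def d0)
        qed
        also have "\<dots> = blinfun_apply (M k) (a k)" using W(1) \<open>d0 \<in> W\<close> by simp
        also have "\<dots> = \<phi> j (real_vec k) *\<^sub>C blinfun_apply (M k) (fourier_coeff f k)"
          using M[of k] by (simp add: a_def L_ops_def)
        finally show ?thesis by (simp add: gk)
      qed
      then show "dyadic_block \<phi> j g x = trig_poly S (\<lambda>k. \<Sum>d\<in>W. blinfun_apply (coarse_piece d M k) (a k)) x"
        unfolding dyadic_block_eq_trig_poly S_def[symmetric] trig_poly_def by simp
    qed
    moreover have "Lp_multiplier_bound p (\<lambda>k x. \<Sum>d\<in>W. blinfun_apply (coarse_piece d M k) x) (\<Sum>d\<in>W. B * coarse_Var d M)"
      unfolding B_def by (intro Lp_multiplier_bound_sum W(1) p coarse_piece_bound proj C M)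
    ultimately have "Lp_norm p (dyadic_block \<phi> j g) \<le> (\<Sum>d\<in>W. B * coarse_Var d M) * Lp_norm p (trig_poly S a)"
      using Lp_multiplier_boundD[OF _ S] by simp
    also have "\<dots> \<le> (w * (B * V)) * Lp_norm p (trig_poly S a)"
    proof (intro mult_right_mono)
      have "(\<Sum>d\<in>W. B * coarse_Var d M) \<le> (\<Sum>d\<in>W. B * V)"
      proof (intro sum_mono mult_left_mono B)
        fix d show "coarse_Var d M \<le> V" using v[of d] by (simp add: V_def)
      qed
      also have "\<dots> = real (card W) * (B * V)" by simp
      also have "\<dots> \<le> w * (B * V)"
        unfolding w_def using W(2) B by (intro mult_right_mono of_nat_mono) (auto simp: V_def)
      finally show "(\<Sum>d\<in>W. B * coarse_Var d M) \<le> w * (B * V)" .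
    qed simp
    also have "trig_poly S a = dyadic_block \<phi> j f"
      unfolding dyadic_block_eq_trig_poly S_def a_def ..
    finally show ?thesis .
  qed
  moreover have "0 \<le> w * (B * V)" using B by (simp add: w_def V_def)
  ultimately have "besov_norm \<phi> s p q g < \<infinity>" by (rule besov_norm_finite_transfer[OF _ _ fin])
  then have "g \<in> besov_space \<phi> s p q" using g by (simp add: besov_space_def)
  then show "\<exists>g\<in>besov_space \<phi> s p q. \<forall>k. fourier_coeff g k = blinfun_apply (M k) (fourier_coeff f k)"
    using gk by blast
qed

section \<open>Riesz projections translated to dyadic points\<close>

text \<open>Walk from x to x + y parallel to the axes, one coordinate at a time, and use the mean
  value inequality on each segment.\<close>

lemma lipschitz_of_bounded_partials:
  fixes h :: "'n::finite rvec \<Rightarrow> complex"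
  assumes deriv: "\<And>i y. ((\<lambda>t. h (y + t *\<^sub>R axis i 1)) has_vector_derivative h' i y) (at 0)"
    and B: "\<And>i y. norm (h' i y) \<le> B"
  shows "norm (h (x + y) - h x) \<le> B * (\<Sum>i\<in>UNIV. \<bar>y $ i\<bar>)"
proof -
  have line: "norm (h (x + t *\<^sub>R axis i 1) - h x) \<le> B * \<bar>t\<bar>" for x t i
  proof -
    have "norm (h (x + t *\<^sub>R axis i 1) - h (x + 0 *\<^sub>R axis i 1)) \<le> B * norm (t - 0)"
    proof (rule differentiable_bound[OF convex_UNIV])
      fix s :: real
      show "((\<lambda>t. h (x + t *\<^sub>R axis i 1)) has_derivative (\<lambda>r. r *\<^sub>R h' i (x + s *\<^sub>R axis i 1))) (at s within UNIV)"
        using has_partial_along_line[OF deriv, of x i s] by (simp add: has_vector_derivative_def)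
      show "onorm (\<lambda>r. r *\<^sub>R h' i (x + s *\<^sub>R axis i 1)) \<le> B"
        by (rule onorm_le) (use B in \<open>auto simp: mult.commute[of B] intro!: mult_left_mono\<close>)
    qed auto
    then show ?thesis by simp
  qed
  have "norm (h (x + (\<Sum>i\<in>S. (y $ i) *\<^sub>R axis i 1)) - h x) \<le> B * (\<Sum>i\<in>S. \<bar>y $ i\<bar>)" if "finite S" for S
    using that
  proof (induction S rule: finite_induct)
    case (insert i S)
    let ?z = "x + (\<Sum>i\<in>S. (y $ i) *\<^sub>R axis i 1)"
    have "norm (h (?z + (y $ i) *\<^sub>R axis i 1) - h x) \<le> norm (h (?z + (y $ i) *\<^sub>R axis i 1) - h ?z) + norm (h ?z - h x)"
      using norm_triangle_ineq[of "h (?z + (y $ i) *\<^sub>R axis i 1) - h ?z" "h ?z - h x"] by simp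
    also have "\<dots> \<le> B * \<bar>y $ i\<bar> + B * (\<Sum>i\<in>S. \<bar>y $ i\<bar>)" by (intro add_mono line insert.IH)
    finally show ?case using insert by (simp add: algebra_simps)
  qed simp
  from this[of UNIV] show ?thesis
    using basis_expansion[of y] by (simp add: scalar_mult_eq_scaleR)
qed

text \<open>This is the symbol estimate for |\<alpha>| = 1: \<phi>_j varies little over distances
  that are small compared with 2^j.\<close>

lemma resolution_lipschitz:
  fixes \<phi> :: "nat \<Rightarrow> 'n::{finite,linorder} rvec \<Rightarrow> complex"
  assumes \<phi>: "resolution_of_unity \<phi>"
  shows "\<exists>L\<ge>0. \<forall>j x y. norm (\<phi> j (x + y) - \<phi> j x) \<le> L / 2 ^ j * (\<Sum>i\<in>UNIV. \<bar>y $ i\<bar>)"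
proof -
  have "\<exists>C>0. \<forall>j \<xi>. norm (partial i (\<phi> j) \<xi>) \<le> C / 2 ^ j" for i
  proof -
    define \<alpha> :: "'n mindex" where "\<alpha> = (\<chi> j. if j = i then 1 else 0)"
    have "\<exists>C>0. \<forall>j \<xi>. norm (mpartial \<alpha> (\<phi> j) \<xi>) \<le> C * 2 powr (- real j * real (multi_abs \<alpha>)) * indicator (dyadic_annulus j) \<xi>"
      using \<phi> unfolding resolution_of_unity_def by blast
    then obtain C where C: "0 < C" and le: "\<forall>j \<xi>. norm (mpartial \<alpha> (\<phi> j) \<xi>) \<le>
        C * 2 powr (- real j * real (multi_abs \<alpha>)) * indicator (dyadic_annulus j) \<xi>" by (elim exE conjE)
    have "norm (partial i (\<phi> j) \<xi>) \<le> C / 2 ^ j" for j \<xi>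
    proof -
      have "multi_abs \<alpha> = 1" by (simp add: multi_abs_def \<alpha>_def)
      moreover have "mpartial \<alpha> (\<phi> j) = partial i (\<phi> j)"
        unfolding \<alpha>_def by (subst mpartial_single) simp
      ultimately have "norm (partial i (\<phi> j) \<xi>) \<le> C * 2 powr (- real j) * indicator (dyadic_annulus j) \<xi>"
        using spec[OF spec[OF le, of j], of \<xi>] by simp
      also have "\<dots> \<le> C * 2 powr (- real j) * 1" using C by (intro mult_left_mono) (auto simp: indicator_def)
      also have "\<dots> = C / 2 ^ j" by (simp add: powr_minus powr_realpow divide_inverse)
      finally show ?thesis .
    qed
    then show ?thesis using C by blast
  qed
  then obtain C where C: "\<And>i. 0 < C i" "\<And>i j \<xi>. norm (partial i (\<phi> j) \<xi>) \<le> C i / 2 ^ j" by metis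
  define L where "L = (\<Sum>i\<in>UNIV. C i)"
  have CL: "C i \<le> L" for i unfolding L_def using C(1) by (intro member_le_sum) (auto intro: less_imp_le)
  have "norm (\<phi> j (x + y) - \<phi> j x) \<le> L / 2 ^ j * (\<Sum>i\<in>UNIV. \<bar>y $ i\<bar>)" for j x y
  proof (rule lipschitz_of_bounded_partials)
    have "smooth (\<phi> j)" using \<phi> by (simp add: resolution_of_unity_def schwartz_def)
    then have "\<forall>i x. (\<lambda>t. foldr partial [] (\<phi> j) (x + t *\<^sub>R axis i 1)) differentiable (at 0)"
      unfolding smooth_def by blast
    then show "((\<lambda>t. \<phi> j (y + t *\<^sub>R axis i 1)) has_vector_derivative partial i (\<phi> j) y) (at 0)" for i y
      by (intro differentiable_has_partial) simp
    show "norm (partial i (\<phi> j) y) \<le> L / 2 ^ j" for i y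
      using C(2)[of i j y] CL[of i] by (meson divide_right_mono order_trans zero_le_numeral zero_le_power)
  qed
  moreover have "0 \<le> L" unfolding L_def using C(1) by (intro sum_nonneg) (auto intro: less_imp_le)
  ultimately show ?thesis by blast
qed

text \<open>For i other than r, the sphere |x| = 2^r is disjoint from the annulus of \<phi>_i or
  touches its boundary. Moving x radially inwards (i > r) or outwards (i < r) leaves the annulus, so
  \<phi>_i vanishes at x by continuity, and the partition of unity leaves \<phi>_r = 1. Hence the
  choice of dyadic points as centres.\<close>

lemma resolution_at_dyadic_sphere:
  fixes \<phi> :: "nat \<Rightarrow> 'n::{finite,linorder} rvec \<Rightarrow> complex"
  assumes \<phi>: "resolution_of_unity \<phi>" and x: "norm x = 2 ^ r"
  shows "\<phi> i x = (if i = r then 1 else 0)"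
proof -
  have cont: "continuous_on UNIV (\<phi> i)" for i
  proof -
    have "smooth (\<phi> i)" using \<phi> by (simp add: resolution_of_unity_def schwartz_def)
    then have "continuous_on UNIV (foldr partial [] (\<phi> i))" unfolding smooth_def by blast
    then show ?thesis by simp
  qed
  have vanish: "\<phi> i x = 0" if t: "t \<longlonglongrightarrow> 1" and zero: "\<And>n. \<phi> i (t n *\<^sub>R x) = 0" for i and t :: "nat \<Rightarrow> real"
  proof -
    have "(\<lambda>n. t n *\<^sub>R x) \<longlonglongrightarrow> 1 *\<^sub>R x" using t by (intro tendsto_intros)
    then have "(\<lambda>n. \<phi> i (t n *\<^sub>R x)) \<longlonglongrightarrow> \<phi> i (1 *\<^sub>R x)"
      using cont[of i] by (intro continuous_on_tendsto_compose[OF cont]) auto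
    then have "(\<lambda>n. 0) \<longlonglongrightarrow> \<phi> i x" by (simp add: zero)
    then show ?thesis by (simp add: LIMSEQ_const_iff)
  qed
  have lim: "(\<lambda>n. inverse (real (Suc n))) \<longlonglongrightarrow> 0" by (rule LIMSEQ_inverse_real_of_nat)
  have off: "\<phi> i x = 0" if "i \<noteq> r" for i
  proof (cases "r < i")
    case True
    show ?thesis
    proof (rule vanish)
      show "(\<lambda>n. 1 - inverse (real (Suc n))) \<longlonglongrightarrow> 1" using tendsto_diff[OF tendsto_const lim, of 1] by simp
      fix n
      have c: "0 \<le> 1 - inverse (real (Suc n))" "1 - inverse (real (Suc n)) < 1" by (simp_all add: field_simps)
      have "norm ((1 - inverse (real (Suc n))) *\<^sub>R x) < 2 ^ r" using c x by simp
      also have "(2::real) ^ r \<le> 2 ^ (i - 1)" using True by (intro power_increasing) auto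
      finally have "\<not> 2 ^ (i - 1) \<le> norm ((1 - inverse (real (Suc n))) *\<^sub>R x)" by (simp only: not_le)
      moreover have "0 < i" using True by simp
      ultimately show "\<phi> i ((1 - inverse (real (Suc n))) *\<^sub>R x) = 0"
        using dyadic_annulus_norm_ge[OF resolution_support[OF \<phi>]] by blast
    qed
  next
    case False
    then have ir: "i < r" using that by simp
    show ?thesis
    proof (rule vanish)
      show "(\<lambda>n. 1 + inverse (real (Suc n))) \<longlonglongrightarrow> 1" using tendsto_add[OF tendsto_const lim, of 1] by simp
      fix n
      have "(2::real) ^ (i + 1) \<le> 2 ^ r" using ir by (intro power_increasing) auto
      also have "\<dots> < (1 + inverse (real (Suc n))) * 2 ^ r" by (simp add: distrib_right)
      also have "\<dots> = norm ((1 + inverse (real (Suc n))) *\<^sub>R x)" using x by (simp add: add_nonneg_nonneg)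
      finally have "\<not> norm ((1 + inverse (real (Suc n))) *\<^sub>R x) \<le> 2 ^ (i + 1)" by (simp only: not_le)
      then show "\<phi> i ((1 + inverse (real (Suc n))) *\<^sub>R x) = 0"
        using dyadic_annulus_norm_le[OF resolution_support[OF \<phi>]] by blast
    qed
  qed
  have "(\<lambda>j. \<phi> j x) sums 1" using \<phi> by (simp add: resolution_of_unity_def)
  moreover have "(\<lambda>j. \<phi> j x) sums \<phi> r x"
  proof -
    have "(\<lambda>j. \<phi> j x) = (\<lambda>j. if j = r then \<phi> r x else 0)" using off by (intro ext) auto
    then show ?thesis using sums_single[of r "\<lambda>j. \<phi> r x"] by simp
  qed
  ultimately have "\<phi> r x = 1" by (rule sums_unique2[symmetric])
  then show ?thesis using off by simp
qed

section \<open>Dyadic points on the first coordinate axis\<close>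

definition first_coord :: "'n::{finite,linorder}"
  where "first_coord = coords ! 0"

definition dyadic_point :: "nat \<Rightarrow> 'n::{finite,linorder} zvec"
  where "dyadic_point r = axis first_coord (2 ^ r)"

lemma norm_dyadic_point: "norm (real_vec (dyadic_point r :: 'n::{finite,linorder} zvec)) = 2 ^ r"
proof -
  have "real_vec (dyadic_point r :: 'n zvec) = 2 ^ r *\<^sub>R axis first_coord 1"
    by (simp add: vec_eq_iff dyadic_point_def axis_def)
  then show ?thesis by (simp add: axis_in_Basis_iff)
qed

lemma direction_first: "direction (CARD('n) * r + 1) = (first_coord :: 'n::{finite,linorder})"
  and level_first: "level TYPE('n) (CARD('n) * r + 1) = r"
  by (simp_all add: direction_def first_coord_def level_def)

text \<open>Combines the exact value at the dyadic point with the Lipschitz bound. The condition r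
  <= i + 1 admits the lower neighbour i = r - 1 and costs the factor 2.\<close>

lemma resolution_near_dyadic_point:
  fixes \<phi> :: "nat \<Rightarrow> 'n::{finite,linorder} rvec \<Rightarrow> complex"
  assumes \<phi>: "resolution_of_unity \<phi>" and L: "0 \<le> L"
    and lip: "\<And>j x y. norm (\<phi> j (x + y) - \<phi> j x) \<le> L / 2 ^ j * (\<Sum>i\<in>UNIV. \<bar>y $ i\<bar>)"
    and i: "r \<le> i + 1"
  shows "norm (\<phi> i (real_vec (\<kappa> + dyadic_point r)) - (if i = r then 1 else 0)) \<le> 2 * L / 2 ^ r * freq_size \<kappa>"
proof -
  have "norm (\<phi> i (real_vec (dyadic_point r) + real_vec \<kappa>) - \<phi> i (real_vec (dyadic_point r))) \<le> L / 2 ^ i * (\<Sum>l\<in>UNIV. \<bar>real_vec \<kappa> $ l\<bar>)"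
    by (rule lip)
  also have "\<phi> i (real_vec (dyadic_point r)) = (if i = r then 1 else 0)"
    by (rule resolution_at_dyadic_sphere[OF \<phi> norm_dyadic_point])
  also have "L / 2 ^ i * (\<Sum>l\<in>UNIV. \<bar>real_vec \<kappa> $ l\<bar>) \<le> 2 * L / 2 ^ r * freq_size \<kappa>"
  proof (intro mult_mono)
    have "(2::real) ^ r \<le> 2 ^ (i + 1)" using i by (intro power_increasing) auto
    then have "L * 2 ^ r \<le> L * (2 * 2 ^ i)" using L by (intro mult_left_mono) auto
    then show "L / 2 ^ i \<le> 2 * L / 2 ^ r" by (simp add: field_simps)
  qed (use L in \<open>auto simp: freq_size_def intro: sum_nonneg\<close>)
  finally show ?thesis by (simp add: real_vec_add add.commute)
qed

text \<open>A displacement of norm below 2^(r-1) keeps the point strictly between the spheres of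
  radii 2^(r-1) and 2^(r+1), where only the annuli r - 1, r and r + 1 are met.\<close>

lemma resolution_far_dyadic_point:
  fixes \<phi> :: "nat \<Rightarrow> 'n::{finite,linorder} rvec \<Rightarrow> complex"
  assumes \<phi>: "resolution_of_unity \<phi>" and \<kappa>: "freq_size \<kappa> \<le> 2 ^ (r - 1)" "1 \<le> r"
    and nz: "\<phi> i (real_vec (\<kappa> + dyadic_point r)) \<noteq> 0"
  shows "i \<le> r + 1 \<and> r \<le> i + 1"
proof -
  define y where "y = real_vec (\<kappa> + dyadic_point r)"
  have "norm (real_vec \<kappa>) < freq_size \<kappa>"
    using norm_real_vec_le[of \<kappa>] by (simp add: freq_size_def)
  then have k: "norm (real_vec \<kappa>) < 2 ^ (r - 1)" using \<kappa> by linarith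
  have r2: "(2::real) ^ r = 2 * 2 ^ (r - 1)" using \<kappa>(2) by (cases r) auto
  have pos: "(0::real) < 2 ^ (r - 1)" by simp
  have y: "y = real_vec \<kappa> + real_vec (dyadic_point r)" by (simp add: y_def real_vec_add)
  have upper: "norm y < 2 ^ (r + 1)"
    using norm_triangle_ineq[of "real_vec \<kappa>" "real_vec (dyadic_point r)"] k r2 pos unfolding y norm_dyadic_point power_add power_one_right by linarith
  have lower: "2 ^ (r - 1) < norm y"
    using norm_triangle_ineq4[of y "real_vec \<kappa>"] k r2 norm_dyadic_point[of r, where 'n = 'n] unfolding y by simp
  note supp = resolution_support[OF \<phi> nz, folded y_def]
  have "i \<le> r + 1"
  proof (rule ccontr)
    assume "\<not> ?thesis"
    then have "(2::real) ^ (r + 1) \<le> 2 ^ (i - 1)" by (intro power_increasing) auto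
    moreover have "2 ^ (i - 1) \<le> norm y" using dyadic_annulus_norm_ge[OF supp] \<open>\<not> i \<le> r + 1\<close> by simp
    ultimately show False using upper by simp
  qed
  moreover have "r \<le> i + 1"
  proof (rule ccontr)
    assume "\<not> ?thesis"
    then have "(2::real) ^ (i + 1) \<le> 2 ^ (r - 1)" by (intro power_increasing) auto
    then show False using dyadic_annulus_norm_le[OF supp] lower by simp
  qed
  ultimately show ?thesis ..
qed

text \<open>Only every other dyadic level is used: then the block on the other side of the hyperplane
  \<open>k\<^sub>1 = 2\<^bsup>r\<^esup>\<close> carries the value 0, and near \<open>2\<^bsup>r\<^esup> \<delta>\<^sub>1\<close> the multiplier is a translate of the
  Riesz projection.\<close>

definition translated_riesz :: "'n::{finite,linorder} zvec \<Rightarrow> 'e::complex_banach \<Rightarrow>\<^sub>L 'e"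
  where "translated_riesz k = (if \<exists>r. even r \<and> k \<in> coarse_pos (CARD('n) * r + 1) \<and>
    (\<forall>i. i \<noteq> first_coord \<longrightarrow> 0 \<le> k $ i) then id_blinfun else 0)"

lemma coarse_pos_unique:
  "k \<in> coarse_pos d \<Longrightarrow> k \<in> coarse_pos d' \<Longrightarrow> d = d'"
  by (rule coarse_unique) (auto simp: coarse_pos_def)

lemma dyadic_point_coarse_pos: "(dyadic_point r :: 'n::{finite,linorder} zvec) \<in> coarse_pos (CARD('n) * r + 1)"
  unfolding coarse_pos_def mem_Collect_eq
  by (subst coarse_Suc_iff) (auto simp only: direction_first level_first, auto simp: dyadic_point_def axis_def)

text \<open>If \<kappa> >= 0, the displaced point stays in the positive part of block n r + 1. If
  some entry other than the first is negative, the sign condition fails. If the first entry is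
  negative, the first coordinate lies between 2^(r-1) and 2^r, so only level r - 1 could contain the
  point, and that level is odd.\<close>

lemma translated_riesz_near:
  fixes \<kappa> :: "'n::{finite,linorder} zvec"
  assumes \<kappa>: "freq_size \<kappa> \<le> 2 ^ (r - 1)" and r: "even r" "1 \<le> r"
  shows "translated_riesz (\<kappa> + dyadic_point r) = (riesz_projection \<kappa> :: 'e::complex_banach \<Rightarrow>\<^sub>L 'e)"
proof -
  let ?k = "\<kappa> + dyadic_point r"
  have k_first: "?k $ first_coord = \<kappa> $ first_coord + 2 ^ r" by (simp add: dyadic_point_def)
  have k_other: "?k $ i = \<kappa> $ i" if "i \<noteq> first_coord" for i using that by (simp add: dyadic_point_def axis_def)
  have small: "\<bar>\<kappa> $ i\<bar> < 2 ^ (r - 1)" for i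
  proof -
    have "real_of_int \<bar>\<kappa> $ i\<bar> < real_of_int (2 ^ (r - 1))" using component_le_freq_size[of \<kappa> i] \<kappa> by simp
    then show ?thesis by (simp only: of_int_less_iff)
  qed
  have r2: "(2::int) ^ r = 2 * 2 ^ (r - 1)" using r(2) by (cases r) auto
  have p: "(0::int) < 2 ^ (r - 1)" by simp
  show ?thesis
  proof (cases "\<forall>i. 0 \<le> \<kappa> $ i")
    case True
    have less: "\<bar>?k $ i\<bar> < 2 ^ r" if "i \<noteq> first_coord" for i
      using small[of i] r2 p unfolding k_other[OF that] by linarith
    have less': "\<bar>?k $ i\<bar> < 2 ^ (r + 1)" for i
    proof (cases "i = first_coord")
      case True
      then show ?thesis using small[of first_coord] r2 p k_first by simp
    next
      case False
      then show ?thesis using less[OF False] by simp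
    qed
    have ge: "2 ^ r \<le> ?k $ first_coord" using True k_first by simp
    have "?k \<in> coarse_pos (CARD('n) * r + 1)"
      unfolding coarse_pos_def mem_Collect_eq
    proof
      have "0 < CARD('n) * r + 1" by simp
      then show "?k \<in> coarse (CARD('n) * r + 1)"
        unfolding coarse_Suc_iff[OF \<open>0 < CARD('n) * r + 1\<close>] direction_first level_first
        using less less' ge by auto
      show "0 < ?k $ direction (CARD('n) * r + 1)"
        unfolding direction_first using ge p r2 by linarith
    qed
    then have "translated_riesz ?k = (id_blinfun :: 'e \<Rightarrow>\<^sub>L 'e)"
      unfolding translated_riesz_def using r(1) True k_other by auto
    then show ?thesis using True by (simp add: riesz_projection_def)
  next
    case False
    then obtain i where i: "\<kappa> $ i < 0" by (auto simp: not_le)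
    have "\<not> (\<exists>r'. even r' \<and> ?k \<in> coarse_pos (CARD('n) * r' + 1) \<and> (\<forall>i. i \<noteq> first_coord \<longrightarrow> 0 \<le> ?k $ i))"
    proof
      assume "\<exists>r'. even r' \<and> ?k \<in> coarse_pos (CARD('n) * r' + 1) \<and> (\<forall>i. i \<noteq> first_coord \<longrightarrow> 0 \<le> ?k $ i)"
      then obtain r' where r': "even r'" "?k \<in> coarse_pos (CARD('n) * r' + 1)" and nn: "\<forall>i. i \<noteq> first_coord \<longrightarrow> 0 \<le> ?k $ i"
        by blast
      have "i = first_coord"
      proof (rule ccontr)
        assume ne: "i \<noteq> first_coord"
        then have "0 \<le> ?k $ i" using nn by blast
        then show False using i k_other[OF ne] by simp
      qed
      then have lt: "?k $ first_coord < 2 ^ r" using i k_first by simp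
      have gt: "2 ^ (r - 1) < ?k $ first_coord" using small[of first_coord] k_first r2 by simp
      have pos: "0 < CARD('n) * r' + 1" by simp
      have c: "2 ^ r' \<le> \<bar>?k $ first_coord\<bar>" "\<bar>?k $ first_coord\<bar> < 2 ^ (r' + 1)"
        using r'(2) unfolding coarse_pos_def mem_Collect_eq coarse_Suc_iff[OF pos] direction_first level_first by blast+
      \<comment> \<open>Together these force r' = r - 1, against the parity of both levels.\<close>
      have "(2::int) ^ r' < 2 ^ r" "(2::int) ^ (r - 1) < 2 ^ (r' + 1)" using c lt gt p by linarith+
      then have "r' < r" "r - 1 < r' + 1" by (simp_all only: power_strict_increasing_iff one_less_numeral_iff semiring_norm)
      then have "r = Suc r'" by linarith
      then show False using r(1) r'(1) by simp
    qed
    then have "translated_riesz ?k = (0 :: 'e \<Rightarrow>\<^sub>L 'e)" unfolding translated_riesz_def by (simp only: if_False)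
    moreover have "riesz_projection \<kappa> = (0 :: 'e \<Rightarrow>\<^sub>L 'e)" using False by (simp only: riesz_projection_def if_False)
    ultimately show ?thesis by simp
  qed
qed

lemma norm_id_blinfun_le: "norm (id_blinfun :: 'a::real_normed_vector \<Rightarrow>\<^sub>L 'a) \<le> 1"
  by (rule norm_blinfun_bound) auto

lemma norm_translated_riesz_le: "norm (translated_riesz k :: 'e::complex_banach \<Rightarrow>\<^sub>L 'e) \<le> 1"
  by (auto simp: translated_riesz_def norm_id_blinfun_le)

lemma translated_riesz_L_ops: "translated_riesz k \<in> L_ops"
  by (simp add: translated_riesz_def)

text \<open>On the positive part of block n r + 1 with r even, the first coordinate is at least 2^r
  throughout. Thus the sign conditions on the other coordinates describe the corner above
  \<open>dyadic_point r\<close>, and a corner has variation at most 1. On the other interval pieces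
  with d > 0 the symbol is 0.\<close>

lemma translated_riesz_bounded_variation:
  "bounded_coarse_variation (translated_riesz :: 'n::{finite,linorder} zvec \<Rightarrow> 'e::complex_banach \<Rightarrow>\<^sub>L 'e)"
  (is "bounded_coarse_variation ?M")
proof -
  have zero: "Var G ?M \<le> 0" if "\<exists>\<alpha> \<beta>. \<alpha> \<le> \<beta> \<and> G = {\<alpha>..\<beta>}" "\<And>k. k \<in> G \<Longrightarrow> ?M k = 0" for G
  proof -
    from that(1) obtain \<alpha> \<beta> where ab: "\<alpha> \<le> \<beta>" and G: "G = {\<alpha>..\<beta>}" by blast
    have "variation \<alpha> \<beta> (cut {\<alpha>..\<beta>} ?M) \<le> norm (0 :: 'e \<Rightarrow>\<^sub>L 'e)"
      by (rule variation_corner_le[of \<alpha> \<alpha>]) (use that(2) G in \<open>auto simp: cut_def\<close>)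
    then show ?thesis unfolding G Var_atLeastAtMost[OF ab] by simp
  qed
  have "coarse_Var d ?M \<le> 1" for d
  proof (cases "d = 0")
    case True
    have "coarse 0 = {0..0 :: 'n zvec}" by (simp add: coarse_def)
    then have "Var (coarse 0) ?M = variation 0 0 (cut {0..0} ?M)"
      using Var_atLeastAtMost[of 0 "0 :: 'n zvec" ?M] by simp
    also have "\<dots> \<le> norm (?M 0)"
      by (rule variation_corner_le[of 0 0]) (auto simp: cut_def)
    also have "\<dots> \<le> 1" by (rule norm_translated_riesz_le)
    finally show ?thesis using True by (simp add: coarse_Var_def)
  next
    case False
    then have d: "0 < d" by simp
    have neg: "Var (coarse_neg d) ?M \<le> 0"
    proof (rule zero[OF coarse_neg_interval[OF d]])
      fix k :: "'n zvec" assume k: "k \<in> coarse_neg d"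
      have "k \<notin> coarse_pos d'" for d'
      proof
        assume "k \<in> coarse_pos d'"
        then have "d = d'" using k coarse_unique[of k d d'] by (simp add: coarse_pos_def coarse_neg_def)
        then show False using k \<open>k \<in> coarse_pos d'\<close> by (simp add: coarse_pos_def coarse_neg_def)
      qed
      then show "?M k = 0" by (simp add: translated_riesz_def)
    qed
    have pos: "Var (coarse_pos d) ?M \<le> 1"
    proof (cases "\<exists>r. even r \<and> d = CARD('n) * r + 1")
      case True
      then obtain r where r: "even r" "d = CARD('n) * r + 1" by blast
      obtain \<alpha> \<beta> :: "'n zvec" where ab: "\<alpha> \<le> \<beta>" and G: "coarse_pos d = {\<alpha>..\<beta>}" using coarse_pos_interval[OF d] by blast
      have dp: "dyadic_point r \<in> {\<alpha>..\<beta>}" using dyadic_point_coarse_pos[of r, where 'n = 'n] r(2) G by simp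
      have "variation \<alpha> \<beta> (cut {\<alpha>..\<beta>} ?M) \<le> norm (id_blinfun :: 'e \<Rightarrow>\<^sub>L 'e)"
      proof (rule variation_corner_le[of \<alpha> "dyadic_point r"])
        show "\<alpha> \<le> dyadic_point r" using dp by simp
        fix k assume k: "k \<in> {\<alpha>..\<beta>}"
        then have kd: "k \<in> coarse_pos d" by (simp only: G)
        have "2 ^ r \<le> k $ first_coord"
        proof -
          have "2 ^ r \<le> \<bar>k $ first_coord\<bar>" "0 < k $ first_coord"
            using kd unfolding coarse_pos_def mem_Collect_eq coarse_Suc_iff[OF d] unfolding r(2) direction_first level_first by blast+
          then show ?thesis by linarith
        qed
        then have corner: "dyadic_point r \<le> k \<longleftrightarrow> (\<forall>i. i \<noteq> first_coord \<longrightarrow> 0 \<le> k $ i)"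
          unfolding less_eq_vec_def by (auto simp: dyadic_point_def axis_def split: if_split_asm)
        have "(\<exists>r. even r \<and> k \<in> coarse_pos (CARD('n) * r + 1) \<and> (\<forall>i. i \<noteq> first_coord \<longrightarrow> 0 \<le> k $ i)) \<longleftrightarrow> (\<forall>i. i \<noteq> first_coord \<longrightarrow> 0 \<le> k $ i)"
          using r kd by blast
        then show "cut {\<alpha>..\<beta>} ?M k = (if dyadic_point r \<le> k then id_blinfun else 0)"
          using k by (simp only: cut_def if_True translated_riesz_def corner)
      qed
      also have "\<dots> \<le> 1" by (rule norm_id_blinfun_le)
      finally show ?thesis unfolding G Var_atLeastAtMost[OF ab] .
    next
      case False
      have "Var (coarse_pos d) ?M \<le> 0"
      proof (rule zero[OF coarse_pos_interval[OF d]])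
        fix k :: "'n zvec" assume k: "k \<in> coarse_pos d"
        have "\<not> (\<exists>r. even r \<and> k \<in> coarse_pos (CARD('n) * r + 1) \<and> (\<forall>i. i \<noteq> first_coord \<longrightarrow> 0 \<le> k $ i))"
          using coarse_pos_unique[OF k] False by blast
        then show "?M k = 0" by (simp only: translated_riesz_def if_False)
      qed
      then show ?thesis by simp
    qed
    show ?thesis using False pos neg by (simp add: coarse_Var_def)
  qed
  then have "bdd_above (range (\<lambda>d. coarse_Var d ?M))" by (intro bdd_aboveI2[of _ _ 1])
  moreover have "bounded (range ?M)" using norm_translated_riesz_le by (intro boundedI[of _ 1]) auto
  ultimately show ?thesis by (simp add: bounded_coarse_variation_def)
qed

section \<open>A gliding hump\<close>

text \<open>Stated for a general h because it serves both f and its image g, which have pieces at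
  the same places. The piece at \<open>J m\<close> is seen by the blocks \<open>J m - 1\<close>,
  \<open>J m\<close> and \<open>J m + 1\<close> only, and the gaps in J keep these windows disjoint;
  a block therefore sees one piece or none.\<close>

lemma dyadic_block_scaled_pieces:
  fixes \<phi> :: "nat \<Rightarrow> 'n::{finite,linorder} rvec \<Rightarrow> complex"
    and h :: "('n rvec \<Rightarrow> complex) \<Rightarrow> 'e::complex_banach" and b :: "nat \<Rightarrow> 'n zvec \<Rightarrow> 'e"
  assumes \<phi>: "resolution_of_unity \<phi>" and K: "\<And>m. finite (K m)"
    and J: "\<And>m. 1 \<le> J m" "\<And>m m'. m < m' \<Longrightarrow> J m + 4 \<le> J m'"
    and small: "\<And>m \<kappa>. \<kappa> \<in> K m \<Longrightarrow> freq_size \<kappa> \<le> 2 ^ (J m - 1)"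
    and on: "\<And>m \<kappa>. \<kappa> \<in> K m \<Longrightarrow> fourier_coeff h (\<kappa> + dyadic_point (J m)) = c m *\<^sub>R b m \<kappa>"
    and off: "\<And>k. (\<And>m. k - dyadic_point (J m) \<notin> K m) \<Longrightarrow> fourier_coeff h k = 0"
  shows "i \<le> J m + 1 \<Longrightarrow> J m \<le> i + 1 \<Longrightarrow> Lp_norm p (dyadic_block \<phi> i h) =
      Lp_norm p (\<lambda>x. c m *\<^sub>R trig_poly (K m) (\<lambda>\<kappa>. \<phi> i (real_vec (\<kappa> + dyadic_point (J m))) *\<^sub>C b m \<kappa>) x)"
    and "(\<And>m. \<not> (i \<le> J m + 1 \<and> J m \<le> i + 1)) \<Longrightarrow> dyadic_block \<phi> i h = (\<lambda>x. 0)"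
proof -
  have near: "i \<le> J m + 1 \<and> J m \<le> i + 1" if "\<kappa> \<in> K m" "\<phi> i (real_vec (\<kappa> + dyadic_point (J m))) \<noteq> 0" for i m \<kappa>
    by (rule resolution_far_dyadic_point[OF \<phi> small[OF that(1)] J(1) that(2)])
  have unique: "m = m'" if "i \<le> J m + 1 \<and> J m \<le> i + 1" "i \<le> J m' + 1 \<and> J m' \<le> i + 1" for m m'
    using that J(2)[of m m'] J(2)[of m' m] by (cases m m' rule: linorder_cases) auto
  let ?S = "{k. \<phi> i (real_vec k) \<noteq> 0}"
  have S: "finite ?S" by (rule finite_dyadic_support[OF \<phi>])
  show "(\<And>m. \<not> (i \<le> J m + 1 \<and> J m \<le> i + 1)) \<Longrightarrow> dyadic_block \<phi> i h = (\<lambda>x. 0)"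
  proof
    fix x assume far: "\<And>m. \<not> (i \<le> J m + 1 \<and> J m \<le> i + 1)"
    have "fourier_coeff h k = 0" if k: "k \<in> ?S" for k
    proof (rule off)
      fix m show "k - dyadic_point (J m) \<notin> K m"
      proof
        assume "k - dyadic_point (J m) \<in> K m"
        from near[OF this, of i] k far[of m] show False by simp
      qed
    qed
    then show "dyadic_block \<phi> i h x = 0"
      unfolding dyadic_block_eq_trig_poly trig_poly_def by (intro sum.neutral) (simp add: scaleC.zero_right)
  qed
  assume im: "i \<le> J m + 1" "J m \<le> i + 1"
  define L where "L = (\<lambda>\<kappa>. \<kappa> + dyadic_point (J m)) ` K m"
  have "dyadic_block \<phi> i h = trig_poly L (\<lambda>k. \<phi> i (real_vec k) *\<^sub>C fourier_coeff h k)"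
  proof
    fix x
    show "dyadic_block \<phi> i h x = trig_poly L (\<lambda>k. \<phi> i (real_vec k) *\<^sub>C fourier_coeff h k) x"
      unfolding dyadic_block_eq_trig_poly trig_poly_def
    proof (rule sum.mono_neutral_cong)
      show "finite L" using K by (simp add: L_def)
      show "\<e> k x *\<^sub>C \<phi> i (real_vec k) *\<^sub>C fourier_coeff h k = 0" if "k \<in> L - ?S" for k
        using that by (simp add: scaleC.zero_left scaleC.zero_right)
      show "\<e> k x *\<^sub>C \<phi> i (real_vec k) *\<^sub>C fourier_coeff h k = 0" if k: "k \<in> ?S - L" for k
      proof -
        have "fourier_coeff h k = 0"
        proof (rule off)
          fix m' show "k - dyadic_point (J m') \<notin> K m'"
          proof
            assume k': "k - dyadic_point (J m') \<in> K m'"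
            have "i \<le> J m' + 1 \<and> J m' \<le> i + 1" using near[OF k', of i] k by simp
            then have "m' = m" using unique im by blast
            then have "k \<in> L" using k' unfolding L_def by (intro image_eqI[of _ _ "k - dyadic_point (J m)"]) auto
            then show False using k by simp
          qed
        qed
        then show ?thesis by (simp add: scaleC.zero_right)
      qed
    qed (auto intro: S)
  qed
  then have "Lp_norm p (dyadic_block \<phi> i h) = Lp_norm p (trig_poly (K m) (\<lambda>\<kappa>. \<phi> i (real_vec (\<kappa> + dyadic_point (J m))) *\<^sub>C fourier_coeff h (\<kappa> + dyadic_point (J m))))"
    by (simp add: L_def Lp_norm_trig_poly_shift)
  also have "trig_poly (K m) (\<lambda>\<kappa>. \<phi> i (real_vec (\<kappa> + dyadic_point (J m))) *\<^sub>C fourier_coeff h (\<kappa> + dyadic_point (J m))) =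
      (\<lambda>x. c m *\<^sub>R trig_poly (K m) (\<lambda>\<kappa>. \<phi> i (real_vec (\<kappa> + dyadic_point (J m))) *\<^sub>C b m \<kappa>) x)"
    unfolding trig_poly_def scaleR_sum_right
    by (intro ext sum.cong refl) (simp add: on scaleC.scaleR_right)
  finally show "Lp_norm p (dyadic_block \<phi> i h) =
      Lp_norm p (\<lambda>x. c m *\<^sub>R trig_poly (K m) (\<lambda>\<kappa>. \<phi> i (real_vec (\<kappa> + dyadic_point (J m))) *\<^sub>C b m \<kappa>) x)" .
qed

text \<open>Replacing nearly constant weights by the constant t changes the norm by at most the sup
  norm of the difference. It is used with t = 1 on the central block of a piece and t = 0 on the two
  neighbours.\<close>

lemma Lp_norm_trig_poly_perturb:
  assumes p: "1 < p" and close: "\<And>\<kappa>. \<kappa> \<in> K \<Longrightarrow> norm (w \<kappa> - of_real t) \<le> \<delta> \<kappa>"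
    and e: "(\<Sum>\<kappa>\<in>K. \<delta> \<kappa> * norm (b \<kappa>)) \<le> e"
  shows "Lp_norm p (trig_poly K (\<lambda>\<kappa>. w \<kappa> *\<^sub>C b \<kappa>)) \<le> \<bar>t\<bar> * Lp_norm p (trig_poly K b) + e"
    and "\<bar>t\<bar> * Lp_norm p (trig_poly K b) \<le> Lp_norm p (trig_poly K (\<lambda>\<kappa>. w \<kappa> *\<^sub>C b \<kappa>)) + e"
proof -
  have p0: "0 < p" using p by simp
  define D where "D = trig_poly K (\<lambda>\<kappa>. (w \<kappa> - of_real t) *\<^sub>C b \<kappa>)"
  have e0: "0 \<le> e"
  proof -
    have "0 \<le> (\<Sum>\<kappa>\<in>K. \<delta> \<kappa> * norm (b \<kappa>))"
      using close by (intro sum_nonneg mult_nonneg_nonneg) (auto intro: order_trans[OF norm_ge_zero])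
    then show ?thesis using e by simp
  qed
  have D: "Lp_norm p D \<le> e"
  proof (rule Lp_norm_le_sup[OF _ p0 e0])
    fix x
    have "norm (D x) \<le> (\<Sum>\<kappa>\<in>K. norm (\<e> \<kappa> x *\<^sub>C (w \<kappa> - of_real t) *\<^sub>C b \<kappa>))"
      unfolding D_def trig_poly_def by (rule norm_sum)
    also have "\<dots> \<le> (\<Sum>\<kappa>\<in>K. \<delta> \<kappa> * norm (b \<kappa>))"
      using close by (intro sum_mono) (simp add: norm_scaleC mult_right_mono)
    finally show "norm (D x) \<le> e" using e by simp
  qed (simp add: D_def)
  have t: "Lp_norm p (\<lambda>x. t *\<^sub>R trig_poly K b x) = \<bar>t\<bar> * Lp_norm p (trig_poly K b)"
    by (rule Lp_norm_scaleR[OF continuous_trig_poly p0])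
  have split: "trig_poly K (\<lambda>\<kappa>. w \<kappa> *\<^sub>C b \<kappa>) x = t *\<^sub>R trig_poly K b x + D x" for x
    unfolding D_def trig_poly_def scaleR_sum_right sum.distrib[symmetric]
    by (intro sum.cong refl) (simp add: scaleC.diff_left scaleC_of_real scaleC.scaleR_right scaleC.diff_right)
  have "trig_poly K (\<lambda>\<kappa>. w \<kappa> *\<^sub>C b \<kappa>) = (\<lambda>x. t *\<^sub>R trig_poly K b x + D x)" using split by (rule ext)
  then have "Lp_norm p (trig_poly K (\<lambda>\<kappa>. w \<kappa> *\<^sub>C b \<kappa>)) \<le> Lp_norm p (\<lambda>x. t *\<^sub>R trig_poly K b x) + Lp_norm p D"
    by (simp only:) (rule Lp_norm_triangle[OF _ _ p], auto simp: D_def intro!: continuous_on_scaleR)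
  then show "Lp_norm p (trig_poly K (\<lambda>\<kappa>. w \<kappa> *\<^sub>C b \<kappa>)) \<le> \<bar>t\<bar> * Lp_norm p (trig_poly K b) + e"
    using D t by linarith
  have eq: "(\<lambda>x. t *\<^sub>R trig_poly K b x) = (\<lambda>x. trig_poly K (\<lambda>\<kappa>. w \<kappa> *\<^sub>C b \<kappa>) x + - D x)"
    unfolding split by simp
  have "Lp_norm p (\<lambda>x. t *\<^sub>R trig_poly K b x) \<le> Lp_norm p (trig_poly K (\<lambda>\<kappa>. w \<kappa> *\<^sub>C b \<kappa>)) + Lp_norm p (\<lambda>x. - D x)"
    unfolding eq by (rule Lp_norm_triangle[OF _ _ p]) (auto simp: D_def intro!: continuous_on_minus)
  moreover have "Lp_norm p (\<lambda>x. - D x) = Lp_norm p D" by (rule Lp_norm_cong_norm) simp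
  ultimately show "\<bar>t\<bar> * Lp_norm p (trig_poly K b) \<le> Lp_norm p (trig_poly K (\<lambda>\<kappa>. w \<kappa> *\<^sub>C b \<kappa>)) + e"
    using D t by linarith
qed

lemma besov_norm_finite_imp_bounded:
  fixes f :: "('n::finite rvec \<Rightarrow> complex) \<Rightarrow> 'e::complex_banach"
  assumes fin: "besov_norm \<phi> s p q f < \<infinity>" and q: "1 \<le> q"
  shows "\<exists>B. \<forall>j. 2 powr (s * real j) * Lp_norm p (dyadic_block \<phi> j f) \<le> B"
proof (cases "q = \<infinity>")
  case True
  define S where "S = (SUP j. ennreal (2 powr (s * real j) * Lp_norm p (dyadic_block \<phi> j f)))"
  have S: "S < \<infinity>" using fin True by (simp add: besov_norm_def S_def)
  have "2 powr (s * real j) * Lp_norm p (dyadic_block \<phi> j f) \<le> enn2real S" for j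
  proof -
    have "ennreal (2 powr (s * real j) * Lp_norm p (dyadic_block \<phi> j f)) \<le> S"
      unfolding S_def by (rule SUP_upper) simp
    then have "enn2real (ennreal (2 powr (s * real j) * Lp_norm p (dyadic_block \<phi> j f))) \<le> enn2real S"
      using S by (intro enn2real_mono) (auto simp: less_top[symmetric])
    then show ?thesis by simp
  qed
  then show ?thesis by blast
next
  case False
  define Q where "Q = enn2real q"
  have "enn2real 1 \<le> enn2real q" using q False by (intro enn2real_mono) (auto simp: less_top[symmetric])
  then have Q: "1 \<le> Q" by (simp add: Q_def)
  define T where "T j = 2 powr (s * real j * Q) * Lp_norm p (dyadic_block \<phi> j f) powr Q" for j
  define S where "S = (\<Sum>j. ennreal (T j))"
  have S: "S < \<infinity>"
    using fin False unfolding besov_norm_def Let_def T_def[symmetric] Q_def[symmetric] S_def[symmetric]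
    by (simp add: less_top[symmetric] split: if_split_asm)
  have "2 powr (s * real j) * Lp_norm p (dyadic_block \<phi> j f) \<le> enn2real S powr (1 / Q)" for j
  proof -
    have "ennreal (T j) \<le> S"
      unfolding S_def using sum_le_suminf[of "\<lambda>j. ennreal (T j)" "{j}"] by simp
    then have "enn2real (ennreal (T j)) \<le> enn2real S"
      using S by (intro enn2real_mono) (auto simp: less_top[symmetric])
    then have "T j \<le> enn2real S" by (simp add: T_def)
    moreover have "T j = (2 powr (s * real j) * Lp_norm p (dyadic_block \<phi> j f)) powr Q"
      by (simp add: T_def powr_mult powr_powr)
    ultimately have "((2 powr (s * real j) * Lp_norm p (dyadic_block \<phi> j f)) powr Q) powr (1 / Q) \<le> enn2real S powr (1 / Q)"
      using Q by (intro powr_mono2) auto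
    then show ?thesis using Q by (simp add: powr_powr)
  qed
  then show ?thesis by blast
qed

text \<open>Each m is responsible for at most three indices i, and the sizes are geometric in m;
  with exponent Q >= 1 the powers are still dominated by 2^(-m). So the partial sums are at most 3
  times 2 times \<open>D powr Q\<close>.\<close>

lemma besov_norm_finite_of_sparse:
  fixes f :: "('n::finite rvec \<Rightarrow> complex) \<Rightarrow> 'e::complex_banach"
  assumes q: "1 \<le> q" and D: "0 \<le> D" and J: "\<And>m. m < J m"
    and near: "\<And>i m. i \<le> J m + 1 \<Longrightarrow> J m \<le> i + 1 \<Longrightarrow> 2 powr (s * real i) * Lp_norm p (dyadic_block \<phi> i f) \<le> D * (1 / 2) ^ m"
    and far: "\<And>i. (\<And>m. \<not> (i \<le> J m + 1 \<and> J m \<le> i + 1)) \<Longrightarrow> Lp_norm p (dyadic_block \<phi> i f) = 0"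
  shows "besov_norm \<phi> s p q f < \<infinity>"
proof (cases "q = \<infinity>")
  case True
  define t where "t i = 2 powr (s * real i) * Lp_norm p (dyadic_block \<phi> i f)" for i
  have "t i \<le> D" for i
  proof (cases "\<exists>m. i \<le> J m + 1 \<and> J m \<le> i + 1")
    case True
    then obtain m where m: "i \<le> J m + 1" "J m \<le> i + 1" by blast
    have "t i \<le> D * (1 / 2) ^ m" unfolding t_def by (rule near[OF m])
    also have "\<dots> \<le> D * 1" using D by (intro mult_left_mono power_le_one) auto
    finally show ?thesis by simp
  next
    case False
    then have "Lp_norm p (dyadic_block \<phi> i f) = 0" using far by blast
    then show ?thesis using D by (simp add: t_def)
  qed
  then have "(SUP i. ennreal (t i)) \<le> ennreal D" by (intro SUP_least ennreal_leI)
  also have "\<dots> < \<infinity>" by simp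
  finally show ?thesis using True by (simp add: besov_norm_def t_def)
next
  case False
  define Q where "Q = enn2real q"
  have "enn2real 1 \<le> enn2real q" using q False by (intro enn2real_mono) (auto simp: less_top[symmetric])
  then have Q: "1 \<le> Q" by (simp add: Q_def)
  define T where "T j = 2 powr (s * real j * Q) * Lp_norm p (dyadic_block \<phi> j f) powr Q" for j
  have T_eq: "T j = (2 powr (s * real j) * Lp_norm p (dyadic_block \<phi> j f)) powr Q" for j
    by (simp add: T_def powr_mult powr_powr)
  have T_near: "T i \<le> D powr Q * (1 / 2) ^ m" if "i \<le> J m + 1" "J m \<le> i + 1" for i m
  proof -
    have "T i \<le> (D * (1 / 2) ^ m) powr Q"
      unfolding T_eq using near[OF that] Q by (intro powr_mono2) auto
    also have "\<dots> = D powr Q * ((1 / 2) ^ m) powr Q" by (rule powr_mult)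
    also have "((1 / 2) ^ m) powr Q \<le> ((1 / 2 :: real) ^ m) powr 1"
      using Q by (intro powr_mono' power_le_one) auto
    finally show ?thesis by (simp add: mult_left_mono)
  qed
  have partial: "(\<Sum>i<n. T i) \<le> 6 * D powr Q" for n
  proof -
    have "T i \<le> (\<Sum>m\<le>n. if i \<le> J m + 1 \<and> J m \<le> i + 1 then D powr Q * (1 / 2) ^ m else 0)" if i: "i < n" for i
    proof (cases "\<exists>m. i \<le> J m + 1 \<and> J m \<le> i + 1")
      case True
      then obtain m where m: "i \<le> J m + 1" "J m \<le> i + 1" by blast
      \<comment> \<open>Because m < \<open>J m\<close> <= i + 1 <= n, truncating the sum over m at n
        loses no piece that meets a block below n.\<close>
      have "m \<in> {..n}" using J[of m] m(2) i by simp
      have "T i \<le> (if i \<le> J m + 1 \<and> J m \<le> i + 1 then D powr Q * (1 / 2) ^ m else 0)" using T_near[OF m] m by simp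
      also have "\<dots> \<le> (\<Sum>m\<le>n. if i \<le> J m + 1 \<and> J m \<le> i + 1 then D powr Q * (1 / 2) ^ m else 0)"
        using \<open>m \<in> {..n}\<close> by (intro member_le_sum[where f = "\<lambda>m. if i \<le> J m + 1 \<and> J m \<le> i + 1 then D powr Q * (1 / 2) ^ m else 0"]) auto
      finally show ?thesis .
    next
      case False
      then have "Lp_norm p (dyadic_block \<phi> i f) = 0" using far by blast
      then have "T i = 0" using Q by (simp add: T_def)
      then show ?thesis by (simp add: sum_nonneg)
    qed
    then have "(\<Sum>i<n. T i) \<le> (\<Sum>i<n. \<Sum>m\<le>n. if i \<le> J m + 1 \<and> J m \<le> i + 1 then D powr Q * (1 / 2) ^ m else 0)"
      by (intro sum_mono) simp
    also have "\<dots> = (\<Sum>m\<le>n. \<Sum>i<n. if i \<le> J m + 1 \<and> J m \<le> i + 1 then D powr Q * (1 / 2) ^ m else 0)"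
      by (rule sum.swap)
    also have "\<dots> \<le> (\<Sum>m\<le>n. 3 * (D powr Q * (1 / 2) ^ m))"
    proof (rule sum_mono)
      fix m
      have "(\<Sum>i<n. if i \<le> J m + 1 \<and> J m \<le> i + 1 then D powr Q * (1 / 2) ^ m else 0) =
          real (card {i\<in>{..<n}. i \<le> J m + 1 \<and> J m \<le> i + 1}) * (D powr Q * (1 / 2) ^ m)"
        by (subst sum.inter_filter[symmetric]) auto
      also have "\<dots> \<le> 3 * (D powr Q * (1 / 2) ^ m)"
      proof (rule mult_right_mono)
        have "card {i\<in>{..<n}. i \<le> J m + 1 \<and> J m \<le> i + 1} \<le> card {J m - 1..J m + 1}"
          by (intro card_mono) auto
        also have "\<dots> \<le> 3" by simp
        finally show "real (card {i\<in>{..<n}. i \<le> J m + 1 \<and> J m \<le> i + 1}) \<le> 3" by simp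
      qed simp
      finally show "(\<Sum>i<n. if i \<le> J m + 1 \<and> J m \<le> i + 1 then D powr Q * (1 / 2) ^ m else 0) \<le> 3 * (D powr Q * (1 / 2) ^ m)" .
    qed
    also have "\<dots> = 3 * D powr Q * (\<Sum>m\<le>n. (1 / 2) ^ m)" by (simp add: sum_distrib_left mult.assoc)
    also have "\<dots> \<le> 3 * D powr Q * 2"
    proof (rule mult_left_mono)
      have "(\<Sum>m\<le>n. (1 / 2 :: real) ^ m) = 2 - (1 / 2) ^ n" by (induction n) auto
      then show "(\<Sum>m\<le>n. (1 / 2 :: real) ^ m) \<le> 2" by simp
    qed simp
    finally show ?thesis by simp
  qed
  have "(\<Sum>j. ennreal (T j)) \<le> ennreal (6 * D powr Q)"
    unfolding suminf_eq_SUP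
  proof (rule SUP_least)
    fix n
    have "(\<Sum>i<n. ennreal (T i)) = ennreal (\<Sum>i<n. T i)" by (rule sum_ennreal) (simp add: T_def)
    then show "(\<Sum>i<n. ennreal (T i)) \<le> ennreal (6 * D powr Q)" using partial[of n] by (simp add: ennreal_leI)
  qed
  then have "(\<Sum>j. ennreal (T j)) < \<infinity>" by (rule le_less_trans) simp
  then show ?thesis using False by (simp add: besov_norm_def Let_def T_def[symmetric] Q_def[symmetric])
qed

text \<open>Violate the bound with constant 4^j and scale the image to norm 2^j; the original then
  has norm at most 2^j / 4^j = 2^(-j).\<close>

lemma unbounded_multiplier_pieces:
  fixes m :: "'n::finite zvec \<Rightarrow> 'e::complex_banach \<Rightarrow>\<^sub>L 'e"
  assumes p: "1 < p" and unb: "\<And>C. 0 < C \<Longrightarrow> \<not> Lp_multiplier_bound p (\<lambda>k. blinfun_apply (m k)) C"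
  shows "\<exists>K a. finite K \<and> Lp_norm p (trig_poly K a) \<le> (1 / 2) ^ j \<and> 2 ^ j \<le> Lp_norm p (trig_poly K (\<lambda>k. blinfun_apply (m k) (a k)))"
proof -
  have p0: "0 < p" using p by simp
  obtain K a where K: "finite K" and big: "4 ^ j * Lp_norm p (trig_poly K a) < Lp_norm p (trig_poly K (\<lambda>k. blinfun_apply (m k) (a k)))"
    using unb[of "4 ^ j"] unfolding Lp_multiplier_bound_def by (auto simp: not_le)
  define N where "N = Lp_norm p (trig_poly K (\<lambda>k. blinfun_apply (m k) (a k)))"
  have N: "0 < N" using big Lp_norm_nonneg[of p "trig_poly K a"] unfolding N_def
    by (meson le_less_trans mult_nonneg_nonneg zero_le_numeral zero_le_power)
  define t where "t = 2 ^ j / N"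
  have t: "0 < t" using N by (simp add: t_def)
  have scale: "Lp_norm p (trig_poly K (\<lambda>k. t *\<^sub>R c k)) = t * Lp_norm p (trig_poly K c)" for c :: "'n zvec \<Rightarrow> 'e"
  proof -
    have "trig_poly K (\<lambda>k. t *\<^sub>R c k) = (\<lambda>x. t *\<^sub>R trig_poly K c x)"
      by (simp add: fun_eq_iff trig_poly_def scaleR_sum_right scaleC.scaleR_right)
    then show ?thesis using Lp_norm_scaleR[OF continuous_trig_poly p0, of t K c] t by simp
  qed
  have "4 ^ j * Lp_norm p (trig_poly K (\<lambda>k. t *\<^sub>R a k)) = t * (4 ^ j * Lp_norm p (trig_poly K a))"
    unfolding scale by simp
  also have "\<dots> \<le> t * N" using big t by (simp add: N_def)
  also have "\<dots> = 2 ^ j" using N by (simp add: t_def)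
  finally have "Lp_norm p (trig_poly K (\<lambda>k. t *\<^sub>R a k)) \<le> 2 ^ j / 4 ^ j"
    by (simp add: pos_le_divide_eq mult.commute)
  also have "(2::real) ^ j / 4 ^ j = (1 / 2) ^ j" by (simp flip: power_divide)
  finally have "Lp_norm p (trig_poly K (\<lambda>k. t *\<^sub>R a k)) \<le> (1 / 2) ^ j" .
  moreover have "Lp_norm p (trig_poly K (\<lambda>k. blinfun_apply (m k) (t *\<^sub>R a k))) = 2 ^ j"
    unfolding blinfun.scaleR_right scale N_def[symmetric] using N by (simp add: t_def)
  ultimately show ?thesis using K by (intro exI[of _ K] exI[of _ "\<lambda>k. t *\<^sub>R a k"]) simp
qed

lemma eventually_le_power2: "\<forall>\<^sub>F r in sequentially. x \<le> (2::real) ^ (r - 1)"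
proof -
  obtain n where n: "x < 2 ^ n" using real_arch_pow[of 2 x] by auto
  have "x \<le> (2::real) ^ (r - 1)" if "n + 1 \<le> r" for r
  proof -
    have "(2::real) ^ n \<le> 2 ^ (r - 1)" using that by (intro power_increasing) auto
    then show ?thesis using n by linarith
  qed
  then show ?thesis unfolding eventually_sequentially by blast
qed

text \<open>All bad polynomials are packed into one f. The existence of g in the Besov space bounds
  every weighted block of g by one number B, while the central block of the m-th piece is at least
  of size 2^m - 1.\<close>

theorem besov_multipliers_imp_UMD:
  fixes \<phi> :: "nat \<Rightarrow> 'n::{finite,linorder} rvec \<Rightarrow> complex"
  assumes \<phi>: "resolution_of_unity \<phi>" and p: "1 < p" and q: "1 \<le> q"
    and mult: "besov_multiplier \<phi> s p q (translated_riesz :: 'n zvec \<Rightarrow> 'e::complex_banach \<Rightarrow>\<^sub>L 'e)"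
  shows "UMD_space TYPE('n) TYPE('e)"
proof (rule ccontr)
  assume "\<not> UMD_space TYPE('n) TYPE('e)"
  let ?R = "riesz_projection :: 'n zvec \<Rightarrow> 'e \<Rightarrow>\<^sub>L 'e"
  have unb: "\<not> Lp_multiplier_bound p (\<lambda>k. blinfun_apply (?R k)) C" if "0 < C" for C
    using \<open>\<not> UMD_space TYPE('n) TYPE('e)\<close> p that unfolding UMD_space_iff by blast
  have "\<forall>m. \<exists>Ka. finite (fst Ka) \<and> Lp_norm p (trig_poly (fst Ka) (snd Ka)) \<le> (1 / 2) ^ m \<and>
      2 ^ m \<le> Lp_norm p (trig_poly (fst Ka) (\<lambda>k. blinfun_apply (?R k) (snd Ka k)))"
    using unbounded_multiplier_pieces[OF p unb] by simp
  then obtain Ka where Ka: "\<forall>m. finite (fst (Ka m)) \<and> Lp_norm p (trig_poly (fst (Ka m)) (snd (Ka m))) \<le> (1 / 2) ^ m \<and>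
      2 ^ m \<le> Lp_norm p (trig_poly (fst (Ka m)) (\<lambda>k. blinfun_apply (?R k) (snd (Ka m) k)))"
    by (rule choice[THEN exE])
  define K where "K m = fst (Ka m)" for m
  define a where "a m = snd (Ka m)" for m
  have K: "finite (K m)" and a_le: "Lp_norm p (trig_poly (K m) (a m)) \<le> (1 / 2) ^ m"
    and Ra_ge: "2 ^ m \<le> Lp_norm p (trig_poly (K m) (\<lambda>k. blinfun_apply (?R k) (a m k)))" for m
    using Ka unfolding K_def a_def by blast+
  obtain L where L: "0 \<le> L" and lip: "\<And>j x y. norm (\<phi> j (x + y) - \<phi> j x) \<le> L / 2 ^ j * (\<Sum>i\<in>UNIV. \<bar>y $ i\<bar>)"
    using resolution_lipschitz[OF \<phi>] by blast
  define \<delta> where "\<delta> r \<kappa> = 2 * L / 2 ^ r * freq_size \<kappa>" for r and \<kappa> :: "'n zvec"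
  have \<delta>0: "0 \<le> \<delta> r \<kappa>" for r \<kappa> unfolding \<delta>_def using L freq_size_ge_1[of \<kappa>] by simp
  \<comment> \<open>Requirements on a place r for the m-th piece: the spectrum is small against 2^r,
    so it stays in three annuli and sees \<open>translated_riesz\<close> as the Riesz symbol; the
    coefficients are small against 2^r, for polynomial growth; and treating \<phi>_i as constant on
    the piece costs at most 2^(-m).\<close>
  define G where "G m r \<longleftrightarrow> 1 \<le> r \<and> (\<forall>\<kappa>\<in>K m. freq_size \<kappa> \<le> 2 ^ (r - 1) \<and> norm (a m \<kappa>) \<le> 2 ^ (r - 1)) \<and>
      (\<Sum>\<kappa>\<in>K m. \<delta> r \<kappa> * norm (a m \<kappa>)) \<le> (1 / 2) ^ m" for m r
  have "\<forall>\<^sub>F r in sequentially. G m r" for m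
  proof -
    have "\<forall>\<^sub>F r in sequentially. \<forall>\<kappa>\<in>K m. freq_size \<kappa> \<le> 2 ^ (r - 1) \<and> norm (a m \<kappa>) \<le> 2 ^ (r - 1)"
      using K by (intro eventually_ball_finite ballI eventually_conj eventually_le_power2)
    moreover have "\<forall>\<^sub>F r in sequentially. (\<Sum>\<kappa>\<in>K m. \<delta> r \<kappa> * norm (a m \<kappa>)) \<le> (1 / 2) ^ m"
    proof -
      define Y where "Y = (\<Sum>\<kappa>\<in>K m. 2 * L * freq_size \<kappa> * norm (a m \<kappa>))"
      have "\<forall>\<^sub>F r in sequentially. Y * 2 ^ m \<le> 2 ^ (r - 1)" by (rule eventually_le_power2)
      then show ?thesis
      proof eventually_elim
        case (elim r)
        have "(\<Sum>\<kappa>\<in>K m. \<delta> r \<kappa> * norm (a m \<kappa>)) = Y / 2 ^ r"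
          unfolding Y_def \<delta>_def sum_divide_distrib by (intro sum.cong refl) simp
        also have "\<dots> \<le> (1 / 2) ^ m"
        proof -
          have "(2::real) ^ (r - 1) \<le> 2 ^ r" by (rule power_increasing) auto
          then have "Y * 2 ^ m \<le> 2 ^ r" using elim by linarith
          then show ?thesis by (simp add: power_divide field_simps)
        qed
        finally show ?case .
      qed
    qed
    ultimately show ?thesis unfolding G_def using eventually_ge_at_top[of 1] by eventually_elim blast
  qed
  then have "\<forall>m. \<exists>T. \<forall>r\<ge>T. G m r" unfolding eventually_sequentially by blast
  then obtain T where T: "\<And>m r. T m \<le> r \<Longrightarrow> G m r" by metis
  \<comment> \<open>The factor 4 makes every \<open>J m\<close> even and the gaps at least 4;
    summing \<open>T i + 1\<close> gives monotonicity and \<open>T m\<close> <=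
    \<open>J m\<close>.\<close>
  define J where "J m = 4 * (\<Sum>i\<le>m. T i + 1)" for m
  have J_ge: "T m \<le> J m" for m
  proof -
    have "T m + 1 \<le> (\<Sum>i\<le>m. T i + 1)" by (intro member_le_sum) auto
    then show ?thesis by (simp add: J_def)
  qed
  have J_even: "even (J m)" for m by (simp add: J_def)
  have J_step: "J m + 4 \<le> J (Suc m)" for m by (simp add: J_def)
  have J_mono: "J m + 4 \<le> J m'" if "m < m'" for m m'
    using that
  proof (induction m')
    case (Suc m')
    then show ?case using J_step[of m'] by (cases "m = m'") auto
  qed simp
  have J_gt: "m < J m" for m
  proof (induction m)
    case 0
    then show ?case by (simp add: J_def)
  next
    case (Suc m)
    then show ?case using J_step[of m] by linarith
  qed
  have G: "1 \<le> J m" "\<And>\<kappa>. \<kappa> \<in> K m \<Longrightarrow> freq_size \<kappa> \<le> 2 ^ (J m - 1)" "\<And>\<kappa>. \<kappa> \<in> K m \<Longrightarrow> norm (a m \<kappa>) \<le> 2 ^ (J m - 1)"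
    "(\<Sum>\<kappa>\<in>K m. \<delta> (J m) \<kappa> * norm (a m \<kappa>)) \<le> (1 / 2) ^ m" for m
    using T[OF J_ge[of m]] unfolding G_def by blast+
  \<comment> \<open>The first coordinate alone locates a piece. This separates the spectra of
    different pieces and later bounds 2^(\<open>J m\<close>) by twice
    \<open>freq_size k\<close>.\<close>
  have first: "2 ^ (J m - 1) < k $ first_coord \<and> k $ first_coord < 2 ^ (J m + 1)"
    if "k - dyadic_point (J m) \<in> K m" for k m
  proof -
    define \<kappa> where "\<kappa> = k - dyadic_point (J m)"
    have "real_of_int \<bar>\<kappa> $ first_coord\<bar> < real_of_int (2 ^ (J m - 1))"
      using component_le_freq_size[of \<kappa> first_coord] G(2)[of \<kappa> m] that by (simp add: \<kappa>_def)
    then have "\<bar>\<kappa> $ first_coord\<bar> < 2 ^ (J m - 1)" by (simp only: of_int_less_iff)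
    moreover have "\<kappa> $ first_coord = k $ first_coord - 2 ^ J m" by (simp add: \<kappa>_def dyadic_point_def)
    moreover have "(2::int) ^ J m = 2 * 2 ^ (J m - 1)" using G(1)[of m] by (cases "J m") auto
    ultimately show ?thesis by (simp only: power_add power_one_right) linarith
  qed
  have unique: "m = m'" if "k - dyadic_point (J m) \<in> K m" "k - dyadic_point (J m') \<in> K m'" for k m m'
  proof -
    have "\<not> m < m'" if k: "k - dyadic_point (J m) \<in> K m" "k - dyadic_point (J m') \<in> K m'" for m m'
    proof
      assume "m < m'"
      have "(2::int) ^ (J m + 1) \<le> 2 ^ (J m' - 1)" using J_mono[OF \<open>m < m'\<close>] by (intro power_increasing) auto
      then show False using first[OF k(1)] first[OF k(2)] by linarith
    qed
    from this[OF that] this[OF that(2,1)] show ?thesis by linarith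
  qed
  define c where "c m = 2 powr (- s * real (J m))" for m
  \<comment> \<open>By \<open>unique\<close> the index set has at most one element; the sum avoids
    choosing m and is 0 off the pieces.\<close>
  define F where "F k = (\<Sum>m | k - dyadic_point (J m) \<in> K m. c m *\<^sub>R a m (k - dyadic_point (J m)))" for k
  have F_on: "F k = c m *\<^sub>R a m (k - dyadic_point (J m))" if "k - dyadic_point (J m) \<in> K m" for k m
  proof -
    have "{m. k - dyadic_point (J m) \<in> K m} = {m}" using that unique[of k] by blast
    then show ?thesis by (simp add: F_def)
  qed
  have F_off: "F k = 0" if "\<And>m. k - dyadic_point (J m) \<notin> K m" for k
    using that by (simp add: F_def)
  have "polynomially_bounded F"
  proof -
    \<comment> \<open>The rescaling factor is at most the N-th power of 2^(\<open>J m\<close>), and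
      the coefficients contribute one more power.\<close>
    define N where "N = nat \<lceil>\<bar>s\<bar>\<rceil>"
    have "norm (F k) \<le> 2 ^ (N + 1) * freq_size k ^ (N + 1)" for k
    proof (cases "\<exists>m. k - dyadic_point (J m) \<in> K m")
      case True
      then obtain m where m: "k - dyadic_point (J m) \<in> K m" by blast
      have "norm (F k) = c m * norm (a m (k - dyadic_point (J m)))" unfolding F_on[OF m] by (simp add: c_def)
      also have "\<dots> \<le> (2 ^ J m) ^ N * 2 ^ J m"
      proof (intro mult_mono)
        have "- s * real (J m) \<le> real N * real (J m)"
          by (intro mult_right_mono order_trans[OF _ real_nat_ceiling_ge[of "\<bar>s\<bar>", folded N_def]]) auto
        then have "c m \<le> 2 powr (real N * real (J m))" unfolding c_def by (intro powr_mono) auto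
        also have "\<dots> = 2 powr (real (J m * N))" by (simp add: mult.commute)
        also have "\<dots> = (2 ^ J m) ^ N" by (subst powr_realpow) (auto simp: power_mult)
        finally show "c m \<le> (2 ^ J m) ^ N" .
        have "(2::real) ^ (J m - 1) \<le> 2 ^ J m" by (rule power_increasing) auto
        then show "norm (a m (k - dyadic_point (J m))) \<le> 2 ^ J m" using G(3)[OF m] by linarith
      qed auto
      also have "\<dots> = (2 ^ J m) ^ (N + 1)" by simp
      also have "\<dots> \<le> (2 * freq_size k) ^ (N + 1)"
      proof (rule power_mono)
        have "real_of_int (2 ^ (J m - 1)) < real_of_int (k $ first_coord)"
          using first[OF m] by (simp only: of_int_less_iff)
        then have "(2::real) ^ (J m - 1) < real_of_int (k $ first_coord)"
          by (simp only: of_int_power of_int_numeral)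
        then have "(2::real) ^ (J m - 1) \<le> freq_size k" using component_le_freq_size[of k first_coord] by linarith
        moreover have "(2::real) ^ J m = 2 * 2 ^ (J m - 1)" using G(1)[of m] by (cases "J m") auto
        ultimately show "(2::real) ^ J m \<le> 2 * freq_size k" by linarith
      qed simp
      finally show ?thesis unfolding power_mult_distrib .
    next
      case False
      then have "F k = 0" using F_off by blast
      then show ?thesis using freq_size_ge_1[of k] by simp
    qed
    then show ?thesis unfolding polynomially_bounded_def by blast
  qed
  then obtain f where f: "f \<in> distributions" and fk: "\<And>k. fourier_coeff f k = F k"
    using exists_distribution_with_coeffs by blast
  have weight: "2 powr (s * real i) * (\<bar>c m\<bar> * y) = 2 powr (s * (real i - real (J m))) * y" for i m y
    by (simp add: c_def powr_add[symmetric] algebra_simps flip: mult.assoc)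
  have p0: "0 < p" using p by simp
  have F_shift: "fourier_coeff f (\<kappa> + dyadic_point (J m)) = c m *\<^sub>R a m \<kappa>" if "\<kappa> \<in> K m" for \<kappa> m
    using F_on[of "\<kappa> + dyadic_point (J m)" m] that by (simp add: fk)
  have F_none: "fourier_coeff f k = 0" if "\<And>m. k - dyadic_point (J m) \<notin> K m" for k
    using F_off[OF that] by (simp add: fk)
  note pieces = dyadic_block_scaled_pieces[where \<phi> = \<phi> and K = K and J = J and c = c, OF \<phi> K G(1)]
  have block_f: "Lp_norm p (dyadic_block \<phi> i f) =
      Lp_norm p (\<lambda>x. c m *\<^sub>R trig_poly (K m) (\<lambda>\<kappa>. \<phi> i (real_vec (\<kappa> + dyadic_point (J m))) *\<^sub>C a m \<kappa>) x)" if "i \<le> J m + 1" "J m \<le> i + 1" for i m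
    by (rule pieces(1)[where b = a and h = f]; fact J_mono G(2) F_shift F_none that)
  have block_f_zero: "dyadic_block \<phi> i f = (\<lambda>x. 0)" if "\<And>m. \<not> (i \<le> J m + 1 \<and> J m \<le> i + 1)" for i
    by (rule pieces(2)[where b = a and h = f]; fact J_mono G(2) F_shift F_none that)
  have "besov_norm \<phi> s p q f < \<infinity>"
  \<comment> \<open>\<open>2 powr \<bar>s\<bar>\<close> compares the weights of neighbouring levels;
    the 2 adds the norm of the piece and the perturbation error, each at most 2^(-m).\<close>
  proof (rule besov_norm_finite_of_sparse[where D = "2 powr \<bar>s\<bar> * 2" and J = J, OF q _ J_gt])
    fix i m assume im: "i \<le> J m + 1" "J m \<le> i + 1"
    have "Lp_norm p (trig_poly (K m) (\<lambda>\<kappa>. \<phi> i (real_vec (\<kappa> + dyadic_point (J m))) *\<^sub>C a m \<kappa>)) \<le>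
        \<bar>if i = J m then 1 else 0\<bar> * Lp_norm p (trig_poly (K m) (a m)) + (1 / 2) ^ m"
    proof (rule Lp_norm_trig_poly_perturb(1)[OF p _ G(4)])
      fix \<kappa>
      show "norm (\<phi> i (real_vec (\<kappa> + dyadic_point (J m))) - of_real (if i = J m then 1 else 0)) \<le> \<delta> (J m) \<kappa>"
        using resolution_near_dyadic_point[OF \<phi> L lip im(2), of \<kappa>] by (simp add: \<delta>_def split: if_split_asm)
    qed
    also have "\<dots> \<le> 2 * (1 / 2) ^ m" using a_le[of m] by simp
    finally have le: "Lp_norm p (trig_poly (K m) (\<lambda>\<kappa>. \<phi> i (real_vec (\<kappa> + dyadic_point (J m))) *\<^sub>C a m \<kappa>)) \<le> 2 * (1 / 2) ^ m" .
    have "2 powr (s * real i) * Lp_norm p (dyadic_block \<phi> i f) = 2 powr (s * (real i - real (J m))) *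
        Lp_norm p (trig_poly (K m) (\<lambda>\<kappa>. \<phi> i (real_vec (\<kappa> + dyadic_point (J m))) *\<^sub>C a m \<kappa>))"
      unfolding block_f[OF im] Lp_norm_scaleR[OF continuous_trig_poly p0] by (rule weight)
    also have "\<dots> \<le> 2 powr \<bar>s\<bar> * (2 * (1 / 2) ^ m)"
    proof (intro mult_mono le powr_mono)
      have "\<bar>s * (real i - real (J m))\<bar> \<le> \<bar>s\<bar> * 1"
        unfolding abs_mult using im by (intro mult_left_mono) auto
      then show "s * (real i - real (J m)) \<le> \<bar>s\<bar>" by linarith
    qed auto
    finally show "2 powr (s * real i) * Lp_norm p (dyadic_block \<phi> i f) \<le> 2 powr \<bar>s\<bar> * 2 * (1 / 2) ^ m" by simp
  next
    fix i assume "\<And>m. \<not> (i \<le> J m + 1 \<and> J m \<le> i + 1)"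
    then have "dyadic_block \<phi> i f = (\<lambda>x. 0)" by (rule block_f_zero)
    then show "Lp_norm p (dyadic_block \<phi> i f) = 0" using p0 by simp
  qed simp
  then have "f \<in> besov_space \<phi> s p q" using f by (simp add: besov_space_def)
  then obtain g where g: "g \<in> besov_space \<phi> s p q"
    and gk: "\<And>k. fourier_coeff g k = blinfun_apply (translated_riesz k) (fourier_coeff f k)"
    using mult unfolding besov_multiplier_def by blast
  have "besov_norm \<phi> s p q g < \<infinity>" using g by (simp add: besov_space_def)
  then obtain B where B: "\<And>j. 2 powr (s * real j) * Lp_norm p (dyadic_block \<phi> j g) \<le> B"
    using besov_norm_finite_imp_bounded[OF _ q] by blast
  define b where "b m \<kappa> = blinfun_apply (?R \<kappa>) (a m \<kappa>)" for m \<kappa>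
  have b_le: "norm (b m \<kappa>) \<le> norm (a m \<kappa>)" for m \<kappa>
    by (simp add: b_def riesz_projection_def blinfun.zero_left)
  have block_g: "Lp_norm p (dyadic_block \<phi> i g) =
      Lp_norm p (\<lambda>x. c m *\<^sub>R trig_poly (K m) (\<lambda>\<kappa>. \<phi> i (real_vec (\<kappa> + dyadic_point (J m))) *\<^sub>C b m \<kappa>) x)" if "i \<le> J m + 1" "J m \<le> i + 1" for i m
  proof (rule pieces(1)[where b = b and h = g])
    fix m \<kappa> assume \<kappa>: "\<kappa> \<in> K m"
    have "fourier_coeff f (\<kappa> + dyadic_point (J m)) = c m *\<^sub>R a m \<kappa>" by (rule F_shift[OF \<kappa>])
    moreover have "translated_riesz (\<kappa> + dyadic_point (J m)) = ?R \<kappa>"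
      by (rule translated_riesz_near[OF G(2)[OF \<kappa>] J_even G(1)])
    ultimately show "fourier_coeff g (\<kappa> + dyadic_point (J m)) = c m *\<^sub>R b m \<kappa>"
      by (simp add: gk b_def blinfun.scaleR_right)
  next
    fix k assume "\<And>m. k - dyadic_point (J m) \<notin> K m"
    then have "F k = 0" by (rule F_off)
    then show "fourier_coeff g k = 0" by (simp add: gk fk blinfun.zero_right)
  qed (fact J_mono G(2) that)+
  \<comment> \<open>Only the central block is inspected: \<phi> is nearly 1 on the piece there, the
    rescaling cancels the weight, and the error (1 / 2)^m is at most 1.\<close>
  have "2 ^ m \<le> B + 1" for m
  proof -
    have "\<bar>1\<bar> * Lp_norm p (trig_poly (K m) (b m)) \<le>
        Lp_norm p (trig_poly (K m) (\<lambda>\<kappa>. \<phi> (J m) (real_vec (\<kappa> + dyadic_point (J m))) *\<^sub>C b m \<kappa>)) + (1 / 2) ^ m"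
    proof (rule Lp_norm_trig_poly_perturb(2)[OF p])
      fix \<kappa>
      show "norm (\<phi> (J m) (real_vec (\<kappa> + dyadic_point (J m))) - of_real 1) \<le> \<delta> (J m) \<kappa>"
        using resolution_near_dyadic_point[OF \<phi> L lip, of "J m" "J m" \<kappa>] by (simp add: \<delta>_def)
    next
      have "(\<Sum>\<kappa>\<in>K m. \<delta> (J m) \<kappa> * norm (b m \<kappa>)) \<le> (\<Sum>\<kappa>\<in>K m. \<delta> (J m) \<kappa> * norm (a m \<kappa>))"
        by (intro sum_mono mult_left_mono b_le \<delta>0)
      then show "(\<Sum>\<kappa>\<in>K m. \<delta> (J m) \<kappa> * norm (b m \<kappa>)) \<le> (1 / 2) ^ m" using G(4)[of m] by linarith
    qed
    moreover have "2 ^ m \<le> Lp_norm p (trig_poly (K m) (b m))" using Ra_ge[of m] by (simp add: b_def[abs_def])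
    moreover have "(1 / 2 :: real) ^ m \<le> 1" by (intro power_le_one) auto
    moreover have "2 powr (s * real (J m)) * Lp_norm p (dyadic_block \<phi> (J m) g) =
        Lp_norm p (trig_poly (K m) (\<lambda>\<kappa>. \<phi> (J m) (real_vec (\<kappa> + dyadic_point (J m))) *\<^sub>C b m \<kappa>))"
    proof -
      have "J m \<le> J m + 1" by simp
      from block_g[OF this this] show ?thesis
        unfolding Lp_norm_scaleR[OF continuous_trig_poly p0] using weight[of "J m" m] by simp
    qed
    ultimately show ?thesis using B[of "J m"] by linarith
  qed
  moreover obtain m where "B + 1 < 2 ^ m" using real_arch_pow[of 2 "B + 1"] by auto
  ultimately show False by (meson not_le)
qed

theorem theorem5p7:
  fixes \<phi> :: "nat \<Rightarrow> 'n::{finite,linorder} rvec \<Rightarrow> complex"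
    and s p :: real and q :: ennreal
  assumes "resolution_of_unity \<phi>"
    and "1 < p"
    and "1 \<le> q"
  shows "(\<forall>M :: 'n zvec \<Rightarrow> 'e::complex_banach \<Rightarrow>\<^sub>L 'e.
            (\<forall>k. M k \<in> L_ops) \<and> bounded_coarse_variation M \<longrightarrow> besov_multiplier \<phi> s p q M)
         \<longleftrightarrow> UMD_space TYPE('n) TYPE('e)"
proof
  assume "\<forall>M :: 'n zvec \<Rightarrow> 'e \<Rightarrow>\<^sub>L 'e.
    (\<forall>k. M k \<in> L_ops) \<and> bounded_coarse_variation M \<longrightarrow> besov_multiplier \<phi> s p q M"
  \<comment> \<open>A single function of bounded variation already forces the UMD property.\<close>
  then have "besov_multiplier \<phi> s p q (translated_riesz :: 'n zvec \<Rightarrow> 'e \<Rightarrow>\<^sub>L 'e)"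
    using translated_riesz_L_ops translated_riesz_bounded_variation by blast
  then show "UMD_space TYPE('n) TYPE('e)" by (rule besov_multipliers_imp_UMD[OF assms])
next
  assume "UMD_space TYPE('n) TYPE('e)"
  then show "\<forall>M :: 'n zvec \<Rightarrow> 'e \<Rightarrow>\<^sub>L 'e.
    (\<forall>k. M k \<in> L_ops) \<and> bounded_coarse_variation M \<longrightarrow> besov_multiplier \<phi> s p q M"
    using UMD_imp_besov_multiplier[OF assms(1,2)] by blast
qed

end
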